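(* Let $\mathcal{K}$ be a Fraïssé class in a finite relational language $\mathcal{L}$ all of whose relation symbols have arity at most two, and suppose that the Fraïssé limit of $\mathcal{K}$ has $\mathrm{SDAP}^+$. Then the ordered expansion $\mathcal{K}^<$ of $\mathcal{K}$ has the Ramsey property.
   Context: The ordered expansion $\mathcal K^<$ is the class of all $(\mathcal L\cup\{<\})$-structures ($<$ a new binary symbol) in which $<$ is interpreted as a linear order and whose $\mathcal L$-reduct lies in $\mathcal K$. A class $\mathcal C$ of finite structures has the Ramsey property if for all $\mathbf A\le\mathbf B$ in $\mathcal C$ (i.e. $\mathbf A$ embeds in $\mathbf B$) and every $\ell\ge2$ there is $\mathbf C\in\mathcal C$ with $\mathbf B\le\mathbf C$ such that for every coloring of the copies of $\mathbf A$ in $\mathbf C$ with $\ell$ colors there is a copy $\mathbf B'$ of $\mathbf B$ in $\mathbf C$ all of whose copies of $\mathbf A$ have the same color. Standing conventions. $\mathcal L$ is a finite relational language containing at least one relation symbol of arity at least $2$. A Fraïssé class is a nonempty class $\mathcal K$ of finite $\mathcal L$-structures closed under isomorphism and substructures, with the joint embedding and amalgamation properties; its Fraïssé limit is the unique countable ultrahomogeneous structure with age $\mathcal K$. It is assumed that relations hold only of tuples of distinct elements, that each relation symbol holds of some tuple and fails of some tuple in the Fraïssé limit, and that if $\mathcal L$ has unary relation symbols then there are at least two of them and every element of every structure in $\mathcal K$ satisfies exactly one of them. Types are complete quantifier-free $1$-types in the variable $x$ over finite parameter sets; $\mathrm{tp}(v/\mathbf B)$ is the type of $v$ over $\mathbf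 B$, and for a type $\sigma$ over $\mathbf B\supseteq\mathbf A$, $\sigma\restriction\mathbf A$ is its restriction to parameters from $\mathbf A$. $\mathcal K$ has the disjoint amalgamation property (DAP) if amalgams can be chosen in which the images of the two structures meet exactly in the image of the common substructure. SDAP. $\mathcal K$ has SDAP if it has DAP and: whenever $\mathbf A,\mathbf C\in\mathcal K$ with $\mathbf A$ a substructure of $\mathbf C$ and $\mathrm C\setminus\mathrm A=\{v,w\}$, there exist $\mathbf A',\mathbf C'\in\mathcal K$, with $\mathbf A'$ containing a copy of $\mathbf A$ as a substructure and $\mathbf C'$ a disjoint amalgamation of $\mathbf A'$ and $\mathbf C$ over $\mathbf A$, such that, writing $v',w'$ for the two vertices of $\mathrm C'\setminus\mathrm A'$: for every $\mathbf B\in\mathcal K$ containing $\mathbf A'$ as a substructure, all $1$-types $\sigma,\tau$ over $\mathbf B$ with $\sigma\restriction\mathbf A'=\mathrm{tp}(v'/\mathbf A')$, $\tau\restriction\mathbf A'=\mathrm{tp}(w'/\mathbf A')$, and every $\mathbf D\in\mathcal K$ extending $\mathbf B$ by one vertex $v''$ with $\mathrm{tp}(v''/\mathbf B)=\sigma$, there is $\mathbf E\in\mathcal K$ extending $\mathbf D$ by one vertex $w''$ with $\mathrm{tp}(w''/\mathbf B)=\tau$ and $\mathbf E\restriction(\mathrm A\cup\{v'',w''\})\cong\mathbf C$. Coding trees. An enumerated Fraïssé limit $\mathbf K$ has universe $\omega$; $v_n$ denotes $n$ and $\mathbf K_n$ the substructure on $\{v_i:i<n\}$. The coding tree $\mathbb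 S=\mathbb S(\mathbf K)$ is the set of all types $\mathrm{tp}(v_i/\mathbf K_n)$, $n\le i<\omega$, ordered by inclusion; $\mathbb S(n)$ is the set of those over $\mathbf K_n$, and these have length $n+1$. The $n$-th coding node is $c_n=\mathrm{tp}(v_n/\mathbf K_n)$; it represents $v_n$. For $\ell\le|s|$, $s\restriction\ell$ is the restriction of $s$ to parameters in $\mathbf K_{\ell-1}$; for $1\le i<|s|$, $s(i)$ is the set of formulas of $s\restriction\mathbf K_i$ in which $v_{i-1}$ occurs. The meet $s\wedge t$ is $s\restriction m$ for the largest $m$ with $s\restriction m=t\restriction m$. $\Gamma=\mathbb S(0)$. With $\mathcal L^-$ the non-unary symbols of $\mathcal L$, the tree $\mathbb U=\mathbb U(\mathbf K)$ is defined like $\mathbb S$ using $\mathcal L^-$-types over the $\mathcal L^-$-reducts $\mathbf K^-_n$, its $n$-th coding node being the $\mathcal L^-$-type of $v_n$ over $\mathbf K^-_n$ together with the $\gamma\in\Gamma$ satisfied by $v_n$. All notions below are defined identically in $\mathbb S$ and $\mathbb U$. $\prec$ is the linear order on the tree lexicographic with respect to a fixed linear order of atomic and negated atomic formulas (negated ones first); thus $s\subsetneq t$ implies $s\prec t$, and for incomparable $s,t$ with $|s\wedge t|=n$, $s\prec t$ iff $s\restriction(n+1)\prec t\restriction(n+1)$. Subtrees and passing types. For a subset $A$, $c^A_0,c^A_1,\dots$ enumerate its coding nodes by increasing length, $N^A=\{i:c_i\in A\}$, $N^A_n$ is the set of indices of the first $n$ of them, $v^A_n$ is the vertex represented by $c^A_n$,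 and $\mathbf K\restriction A$ is the substructure of $\mathbf K$ on $\{v_i:i\in N^A\}$. $T$ is a subtree if it is closed under meets and $t\restriction\ell\in T$ whenever $t\in T$ and $\ell\le|t|$ is the length of a coding node of $T$ or of a meet of two incomparable nodes of $T$. For $|s|<|t|$, $t(|s|)$ is the passing type of $t$ at $s$. For a coding node $c_n$ with $|c_n|<|t|$, $t(c_n;A)$ is the set of formulas in $t(|c_n|)$ all of whose parameters lie in $\{v_i:i\in N^A_m\cup\{n\}\}$, $m$ least with $|c^A_m|\ge|c_n|$; $t(n;A)=t(c^A_n;A)$. If $|N^A\cap m|=|N^B\cap n|=p$, let $f$ be the increasing bijection $N^A_p\to N^B_p$ extended by $m\mapsto n$, and $f^*$ the map $v_i\mapsto v_{f(i)}$, $x\mapsto x$; then $s(c_m;A)\sim t(c_n;B)$ means: for every relation symbol $R$ of arity $k$ and every $k$-tuple $\bar z$ from $\{v_i:i\in N^A_p\cup\{m\}\}\cup\{x\}$ containing $x$, $R(\bar z)\in s(c_m;A)$ iff $R(f^*(\bar z))\in t(c_n;B)$. $s(n;A)\sim t(n;B)$ means $s(c^A_n;A)\sim t(c^B_n;B)$. Similarity. For meet-closed $S,T$, a bijection $f:S\to T$ is a similarity map if for all $s,t\in S$: $s\prec t$ iff $f(s)\prec f(t)$; $f(s\wedge t)=f(s)\wedge f(t)$; $|s|<|t|$ iff $|f(s)|<|f(t)|$; $s\subseteq t$ iff $f(s)\subseteq f(t)$; $f(c^S_n)=c^T_n$ and $v^S_n,v^T_n$ satisfy the same $\gamma\in\Gamma$;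 and $s(n;S)\sim f(s)(n;T)$ whenever $|c^S_n|<|s|$. $S\sim T$ if such a map exists. Diagonal coding trees. A subtree $T$ is diagonal if each level contains at most one splitting node, each splitting node has exactly two immediate successors, and no splitting node has the length of a coding node of $T$. Let $\ell^T_n=|c^T_n|$, $\widehat T=\{t\restriction n:t\in T,n\le|t|\}$, $t^+$ the immediate successor in $\widehat T$ of a non-splitting $t$, $T\restriction\ell$ the nodes of $\widehat T$ of length $\ell$, and $T{\restriction}{\le}\ell$ the nodes of $T$ of length $<\ell$ together with $T\restriction\ell$. A diagonal subtree $T$ of $\mathbb U$ (resp. $\mathbb S$) is a diagonal coding subtree if (1) $\mathbf K\restriction T\cong\mathbf K$; (2) for each $n$ the collection of $1$-types in $T\restriction(\ell^T_n+1)$ over $\mathbf K\restriction(T{\restriction}{\le}\ell^T_n)$ is in one-to-one correspondence with the collection of $1$-types in $\mathbb U(n+1)$ (resp. $\mathbb S(n+1)$); (3) if $m<n$ and $c^T_n\supseteq c^T_m$ then, with $A=T{\restriction}{\le}(\ell^T_m-1)$, $(c^T_n)^+(c^T_n;A)\sim(c^T_m)^+(c^T_m;A)$. A tree is perfect if it has no terminal nodes and every node has two incomparable extensions. $\mathcal K$ has the Diagonal Coding Tree Property if for every enumerated Fraïssé limit $\mathbf K$ there is a perfect diagonal coding subtree of $\mathbb S(\mathbf K)$ or of $\mathbb U(\mathbf K)$. Extension Property. Fix a diagonal coding subtree $\mathbf T$ and let $\mathcal T$ be the set of subtrees $T\subseteq\mathbf T$ with $T\sim\mathbf T$. Critical (splitting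 or coding) nodes of a diagonal tree $T$ have distinct lengths; enumerate them $d^T_0,d^T_1,\dots$ by length, let $T(m)$ be the nodes of $T$ of length $|d^T_m|$ and $r_k(T)=\bigcup_{m<k}T(m)$; for $A\subseteq T$, $r_k(A)$ is the first $k$ levels of the tree induced by the meet-closure of $A$. For finite $A$, $\max(A)$ is the set of its nodes of maximal length $\ell_A$ and $\max(A)^+$ the nodes of length $\ell_A+1$ in $T$ extending them. Finite $A,B$ are $+$-similar if $A\sim B$ via $f$ and either $\max(A)$ has a splitting node, in which case $\max(B)$ has one and $f$ maps one to the other, or $\max(A)$ has a coding node $c^A_n$ and $s^+(n;A)\sim f(s)^+(n;B)$ for all $s\in\max(A)$. $\mathbf K$ has the Extension Property if (1) or (2) holds. (1) Whenever $A$ is a finite or infinite subtree of some $T\in\mathcal T$, $k<\omega$, $\max(r_{k+1}(A))$ contains a splitting node $u$, and $B\subseteq T$ is a $+$-similarity copy of $r_k(A)$, letting $s$ be the node of $\max(B)^+$ which must be extended to a splitting node to obtain a $+$-similarity copy of $r_{k+1}(A)$: if $s^*\in T$ is a splitting node extending $s$, then the other nodes of $\max(B)^+$ can be extended to the length of $s^*$ so as to give a $+$-similarity copy of $r_{k+1}(A)$ which can be extended to a copy of $A$. (2) There are $2\le q<\omega$ and a function $\psi$ from the splitting nodes of $\mathbf T$ onto $q$ such that: (a) as in (1), but assuming also that the similarity map $f:r_k(A)\to B$ satisfies $\psi(t)=\psi(f(t))$ for splitting nodes $t$, and concluding that for every $s'\supseteq s$ in $T$ there is a splitting node $s^*\in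 T$ extending $s'$ with $\psi(s^* )=\psi(u)$, and for any such $s^*$ the other nodes of $\max(B)^+$ can be extended to the length of $s^*$ giving a $+$-similarity copy of $r_{k+1}(A)$ that extends to a copy of $A$; (b) $\mathcal L$ has a binary relation symbol and $\psi$ is determined by a partition $Q_0,\dots,Q_{q-1}$ of all pairs of partial $1$-types involving only binary relation symbols over a one-element structure, so that $\psi(s)=m$ iff whenever $c^{\mathbf T}_j,c^{\mathbf T}_k$ are coding nodes with $c^{\mathbf T}_j\wedge c^{\mathbf T}_k=s$, the pair of partial $1$-types of $v^{\mathbf T}_j,v^{\mathbf T}_k$ over $\mathbf K\restriction\{v_i\}$ is in $Q_m$. $\mathrm{SDAP}^+$: a Fraïssé structure $\mathbf K$ satisfies $\mathrm{SDAP}^+$ if its age has SDAP and the Diagonal Coding Tree Property, and $\mathbf K$ has the Extension Property. *)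

theory Defs
  imports Main "HOL-Library.Infinite_Set" "HOL-Library.Disjoint_Sets"
begin

section \<open>Relational structures\<close>

text \<open>A finite relational language is a finite type \<open>'r\<close> of relation symbols together with an
  arity function \<open>ar :: 'r \<Rightarrow> nat\<close>. Structures live on subsets of \<open>nat\<close>; every finite structure,
  and every countable one, has an isomorphic copy of this kind. The empty structure is allowed.\<close>

record 'r struct =
  univ :: "nat set"
  rels :: "'r \<Rightarrow> nat list set"

definition is_struct :: "('r \<Rightarrow> nat) \<Rightarrow> 'r struct \<Rightarrow> bool" where
  "is_struct ar A \<longleftrightarrow> (\<forall>R. \<forall>xs \<in> rels A R. length xs = ar R \<and> set xs \<subseteq> univ A)"

definition induced :: "'r struct \<Rightarrow> nat set \<Rightarrow> 'r struct" where
  "induced B X = \<lparr>univ = X, rels = (\<lambda>R. {xs \<in> rels B R. set xs \<subseteq> X})\<rparr>"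

definition substructure :: "'r struct \<Rightarrow> 'r struct \<Rightarrow> bool" where
  "substructure A B \<longleftrightarrow> univ A \<subseteq> univ B \<and> A = induced B (univ A)"

definition embedding :: "(nat \<Rightarrow> nat) \<Rightarrow> 'r struct \<Rightarrow> 'r struct \<Rightarrow> bool" where
  "embedding f A B \<longleftrightarrow> inj_on f (univ A) \<and> f ` univ A \<subseteq> univ B \<and>
     (\<forall>R xs. set xs \<subseteq> univ A \<longrightarrow> (xs \<in> rels A R \<longleftrightarrow> map f xs \<in> rels B R))"

definition embeds :: "'r struct \<Rightarrow> 'r struct \<Rightarrow> bool" where
  "embeds A B \<longleftrightarrow> (\<exists>f. embedding f A B)"

definition is_iso :: "(nat \<Rightarrow> nat) \<Rightarrow> 'r struct \<Rightarrow> 'r struct \<Rightarrow> bool" where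
  "is_iso f A B \<longleftrightarrow> embedding f A B \<and> f ` univ A = univ B"

definition isomorphic :: "'r struct \<Rightarrow> 'r struct \<Rightarrow> bool" where
  "isomorphic A B \<longleftrightarrow> (\<exists>f. is_iso f A B)"

definition copies :: "'r struct \<Rightarrow> 'r struct \<Rightarrow> 'r struct set" where
  "copies A B = {A'. substructure A' B \<and> isomorphic A A'}"

definition ramsey_property :: "'r struct set \<Rightarrow> bool" where
  "ramsey_property \<C> \<longleftrightarrow>
     (\<forall>A \<in> \<C>. \<forall>B \<in> \<C>. embeds A B \<longrightarrow> (\<forall>l \<ge> (2::nat).
        \<exists>C \<in> \<C>. embeds B C \<and>
          (\<forall>\<chi>. (\<forall>A' \<in> copies A C. \<chi> A' < l) \<longrightarrow>
             (\<exists>B' \<in> copies B C. \<exists>c. \<forall>A' \<in> copies A B'. \<chi> A' = c))))"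

text \<open>In the expanded language \<open>'r option\<close> the new binary symbol \<open><\<close> is \<open>None\<close>.\<close>

definition reduct :: "'r option struct \<Rightarrow> 'r struct" where
  "reduct A = \<lparr>univ = univ A, rels = (\<lambda>R. rels A (Some R))\<rparr>"

definition ordered_expansion :: "('r \<Rightarrow> nat) \<Rightarrow> 'r struct set \<Rightarrow> 'r option struct set" where
  "ordered_expansion ar \<K> =
     {A. is_struct (case_option 2 ar) A \<and> reduct A \<in> \<K> \<and>
         strict_linear_order_on (univ A) {(a, b). [a, b] \<in> rels A None}}"

section \<open>Fraisse classes and their limits\<close>

definition joint_embedding :: "'r struct set \<Rightarrow> bool" where
  "joint_embedding \<K> \<longleftrightarrow> (\<forall>A \<in> \<K>. \<forall>B \<in> \<K>. \<exists>C \<in> \<K>. embeds A C \<and> embeds B C)"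

definition amalgamation :: "'r struct set \<Rightarrow> bool" where
  "amalgamation \<K> \<longleftrightarrow>
     (\<forall>A \<in> \<K>. \<forall>B \<in> \<K>. \<forall>C \<in> \<K>. \<forall>e f. embedding e A B \<and> embedding f A C \<longrightarrow>
        (\<exists>D \<in> \<K>. \<exists>g h. embedding g B D \<and> embedding h C D \<and> (\<forall>a \<in> univ A. g (e a) = h (f a))))"

definition disjoint_amalgamation :: "'r struct set \<Rightarrow> bool" where
  "disjoint_amalgamation \<K> \<longleftrightarrow>
     (\<forall>A \<in> \<K>. \<forall>B \<in> \<K>. \<forall>C \<in> \<K>. \<forall>e f. embedding e A B \<and> embedding f A C \<longrightarrow>
        (\<exists>D \<in> \<K>. \<exists>g h. embedding g B D \<and> embedding h C D \<and> (\<forall>a \<in> univ A. g (e a) = h (f a)) \<and>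
            g ` univ B \<inter> h ` univ C = g ` e ` univ A))"

definition fraisse_class :: "('r \<Rightarrow> nat) \<Rightarrow> 'r struct set \<Rightarrow> bool" where
  "fraisse_class ar \<K> \<longleftrightarrow> \<K> \<noteq> {} \<and>
     (\<forall>A \<in> \<K>. is_struct ar A \<and> finite (univ A)) \<and>
     (\<forall>A \<in> \<K>. \<forall>B. is_struct ar B \<and> isomorphic A B \<longrightarrow> B \<in> \<K>) \<and>
     (\<forall>A \<in> \<K>. \<forall>B. substructure B A \<longrightarrow> B \<in> \<K>) \<and>
     joint_embedding \<K> \<and> amalgamation \<K>"

definition age :: "('r \<Rightarrow> nat) \<Rightarrow> 'r struct \<Rightarrow> 'r struct set" where
  "age ar M = {A. is_struct ar A \<and> finite (univ A) \<and> embeds A M}"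

definition ultrahomogeneous :: "'r struct \<Rightarrow> bool" where
  "ultrahomogeneous M \<longleftrightarrow>
     (\<forall>F G f. F \<subseteq> univ M \<and> G \<subseteq> univ M \<and> finite F \<and> is_iso f (induced M F) (induced M G) \<longrightarrow>
        (\<exists>h. is_iso h M M \<and> (\<forall>a \<in> F. h a = f a)))"

definition enumerated_fraisse_limit :: "('r \<Rightarrow> nat) \<Rightarrow> 'r struct set \<Rightarrow> 'r struct \<Rightarrow> bool" where
  "enumerated_fraisse_limit ar \<K> M \<longleftrightarrow>
     is_struct ar M \<and> univ M = UNIV \<and> ultrahomogeneous M \<and> age ar M = \<K>"

section \<open>Quantifier-free 1-types\<close>

text \<open>A type is represented by the set of those of its literals in which the variable occurs.
  Literals without the variable are determined by the parameter structure, and equalities are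
  omitted because only types of vertices outside the parameter set are considered.\<close>

datatype tm = Var | Par nat

datatype 'r lit = Pos (sym: 'r) (args: "tm list") | Neg (sym: 'r) (args: "tm list")

definition par :: "'r lit \<Rightarrow> nat set" where
  "par \<phi> = {i. Par i \<in> set (args \<phi>)}"

fun holds :: "'r struct \<Rightarrow> (tm \<Rightarrow> nat) \<Rightarrow> 'r lit \<Rightarrow> bool" where
  "holds A e (Pos R zs) \<longleftrightarrow> map e zs \<in> rels A R"
| "holds A e (Neg R zs) \<longleftrightarrow> map e zs \<notin> rels A R"

text \<open>In \<open>lits\<close> and \<open>tp\<close>, \<open>W\<close> is the set of relation symbols that are taken into account.\<close>

definition lits :: "('r \<Rightarrow> nat) \<Rightarrow> 'r set \<Rightarrow> nat set \<Rightarrow> 'r lit set" where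
  "lits ar W B = {\<phi>. sym \<phi> \<in> W \<and> length (args \<phi>) = ar (sym \<phi>) \<and> Var \<in> set (args \<phi>) \<and> par \<phi> \<subseteq> B}"

definition tp :: "('r \<Rightarrow> nat) \<Rightarrow> 'r set \<Rightarrow> 'r struct \<Rightarrow> nat \<Rightarrow> nat set \<Rightarrow> 'r lit set" where
  "tp ar W A v B = {\<phi> \<in> lits ar W B. holds A (case_tm v id) \<phi>}"

definition tp_restrict :: "'r lit set \<Rightarrow> nat set \<Rightarrow> 'r lit set" where
  "tp_restrict \<sigma> B = {\<phi> \<in> \<sigma>. par \<phi> \<subseteq> B}"

definition one_vertex_ext :: "'r struct \<Rightarrow> 'r struct \<Rightarrow> nat \<Rightarrow> bool" where
  "one_vertex_ext B D v \<longleftrightarrow> substructure B D \<and> v \<notin> univ B \<and> univ D = insert v (univ B)"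

text \<open>The 1-types over \<open>B\<close> are those realized by a new vertex in some member of the class.\<close>

definition types_over :: "('r \<Rightarrow> nat) \<Rightarrow> 'r struct set \<Rightarrow> 'r struct \<Rightarrow> 'r lit set set" where
  "types_over ar \<K> B = {tp ar UNIV G y (univ B) | G y. G \<in> \<K> \<and> one_vertex_ext B G y}"

text \<open>Below \<open>e\<close> embeds \<open>A\<close> as a copy into \<open>A'\<close>, and \<open>C'\<close> is a disjoint amalgamation of \<open>A'\<close> and
  \<open>C\<close> over \<open>A\<close> via \<open>g\<close>. The isomorphism between \<open>C\<close> and the substructure of \<open>E\<close> on (the copy of)
  \<open>A\<close> and \<open>v''\<close>, \<open>w''\<close> is the one over \<open>A\<close> sending \<open>v, w\<close> to \<open>v'', w''\<close>.\<close>

definition SDAP :: "('r \<Rightarrow> nat) \<Rightarrow> 'r struct set \<Rightarrow> bool" where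
  "SDAP ar \<K> \<longleftrightarrow> disjoint_amalgamation \<K> \<and>
     (\<forall>A \<in> \<K>. \<forall>C \<in> \<K>. \<forall>v w. substructure A C \<and> v \<noteq> w \<and> univ C - univ A = {v, w} \<longrightarrow>
       (\<exists>A' \<in> \<K>. \<exists>C' \<in> \<K>. \<exists>e g.
          embedding e A A' \<and> substructure A' C' \<and> embedding g C C' \<and>
          (\<forall>a \<in> univ A. g a = e a) \<and>
          univ A' \<inter> g ` univ C = e ` univ A \<and> univ C' = univ A' \<union> g ` univ C \<and>
          (\<forall>B \<in> \<K>. substructure A' B \<longrightarrow>
            (\<forall>\<sigma> \<in> types_over ar \<K> B. \<forall>\<tau> \<in> types_over ar \<K> B.
               tp_restrict \<sigma> (univ A') = tp ar UNIV C' (g v) (univ A') \<and>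
               tp_restrict \<tau> (univ A') = tp ar UNIV C' (g w) (univ A') \<longrightarrow>
               (\<forall>D \<in> \<K>. \<forall>v''. one_vertex_ext B D v'' \<and> tp ar UNIV D v'' (univ B) = \<sigma> \<longrightarrow>
                  (\<exists>E \<in> \<K>. \<exists>w''. one_vertex_ext D E w'' \<and> tp ar UNIV E w'' (univ B) = \<tau> \<and>
                     is_iso (e(v := v'', w := w'')) C
                       (induced E (e ` univ A \<union> {v'', w''}))))))))"

section \<open>Coding trees\<close>

text \<open>A node is a pair of its length and its set of literals. The tree \<open>\<S>\<close> is obtained below with
  \<open>W\<close> the set of all symbols and \<open>\<U>\<close> with \<open>W\<close> the set of non-unary symbols. Since each level
  has exactly one coding node, the unary type attached to a coding node of \<open>\<U>\<close> is a function of its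
  index and is read off from the structure (see \<open>same_unary\<close>).

  Restriction to length 0 gives a virtual root \<open>(0, {})\<close> which is never a node of the tree: if
  there are several unary types, \<open>\<S>\<close> is a forest. Closure under meets and preservation of meets
  are understood accordingly.\<close>

type_synonym 'r node = "nat \<times> 'r lit set"

abbreviation len :: "'r node \<Rightarrow> nat" where "len s \<equiv> fst s"

definition restr :: "'r node \<Rightarrow> nat \<Rightarrow> 'r node" where
  "restr s l = (l, if l = 0 then {} else tp_restrict (snd s) {..<l - 1})"

definition below :: "'r node \<Rightarrow> 'r node \<Rightarrow> bool"  (infix "\<sqsubseteq>" 50) where
  "s \<sqsubseteq> t \<longleftrightarrow> len s \<le> len t \<and> snd s \<subseteq> snd t"

definition incomparable :: "'r node \<Rightarrow> 'r node \<Rightarrow> bool" where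
  "incomparable s t \<longleftrightarrow> \<not> s \<sqsubseteq> t \<and> \<not> t \<sqsubseteq> s"

definition meet :: "'r node \<Rightarrow> 'r node \<Rightarrow> 'r node" where
  "meet s t = restr s (GREATEST m. m \<le> len s \<and> m \<le> len t \<and> restr s m = restr t m)"

definition entry :: "'r node \<Rightarrow> nat \<Rightarrow> 'r lit set" where
  "entry s i = {\<phi> \<in> snd s. par \<phi> \<subseteq> {..<i} \<and> i - 1 \<in> par \<phi>}"

text \<open>For two distinct finite sets of literals of the same size, listed increasingly, the
  lexicographically smaller one is the one containing the least element of the symmetric
  difference.\<close>

definition literal_order :: "('r lit \<times> 'r lit) set \<Rightarrow> bool" where
  "literal_order lo \<longleftrightarrow> strict_linear_order lo \<and> (\<forall>R zs R' zs'. (Neg R zs, Pos R' zs') \<in> lo)"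

definition lex_less :: "('r lit \<times> 'r lit) set \<Rightarrow> 'r lit set \<Rightarrow> 'r lit set \<Rightarrow> bool" where
  "lex_less lo \<sigma> \<tau> \<longleftrightarrow>
     (\<exists>\<phi> \<in> \<sigma> - \<tau>. \<forall>\<psi> \<in> (\<sigma> - \<tau>) \<union> (\<tau> - \<sigma>). \<psi> \<noteq> \<phi> \<longrightarrow> (\<phi>, \<psi>) \<in> lo)"

definition prec :: "('r lit \<times> 'r lit) set \<Rightarrow> 'r node \<Rightarrow> 'r node \<Rightarrow> bool" where
  "prec lo s t \<longleftrightarrow> (s \<sqsubseteq> t \<and> s \<noteq> t) \<or>
     (incomparable s t \<and>
      lex_less lo (snd (restr s (len (meet s t) + 1))) (snd (restr t (len (meet s t) + 1))))"

definition meet_closed :: "'r node set \<Rightarrow> bool" where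
  "meet_closed T \<longleftrightarrow> (\<forall>s \<in> T. \<forall>t \<in> T. len (meet s t) > 0 \<longrightarrow> meet s t \<in> T)"

definition meet_closure :: "'r node set \<Rightarrow> 'r node set" where
  "meet_closure A = \<Inter> {B. A \<subseteq> B \<and> meet_closed B}"

definition hat :: "'r node set \<Rightarrow> 'r node set" where
  "hat T = {restr t n | t n. t \<in> T \<and> 1 \<le> n \<and> n \<le> len t}"

definition imm_succ :: "'r node set \<Rightarrow> 'r node \<Rightarrow> 'r node set" where
  "imm_succ T s = {t \<in> hat T. s \<sqsubseteq> t \<and> len t = len s + 1}"

definition splitting :: "'r node set \<Rightarrow> 'r node \<Rightarrow> bool" where
  "splitting T s \<longleftrightarrow> s \<in> T \<and> (\<exists>a \<in> imm_succ T s. \<exists>b \<in> imm_succ T s. a \<noteq> b)"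

definition plus :: "'r node set \<Rightarrow> 'r node \<Rightarrow> 'r node" where
  "plus T t = the_elem (imm_succ T t)"

definition at_level :: "'r node set \<Rightarrow> nat \<Rightarrow> 'r node set" where
  "at_level T l = {t \<in> hat T. len t = l}"

definition up_to_level :: "'r node set \<Rightarrow> nat \<Rightarrow> 'r node set" where
  "up_to_level T l = {t \<in> T. len t < l} \<union> at_level T l"

definition perfect :: "'r node set \<Rightarrow> bool" where
  "perfect T \<longleftrightarrow> (\<forall>t \<in> T. (\<exists>u \<in> T. t \<sqsubseteq> u \<and> u \<noteq> t) \<and>
     (\<exists>u \<in> T. \<exists>w \<in> T. t \<sqsubseteq> u \<and> t \<sqsubseteq> w \<and> incomparable u w))"

definition max_nodes :: "'r node set \<Rightarrow> 'r node set" where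
  "max_nodes A = {t \<in> A. \<forall>s \<in> A. len s \<le> len t}"

definition induced_tree :: "'r node set \<Rightarrow> 'r node set" where
  "induced_tree A =
     {restr t (len s) | s t. s \<in> meet_closure A \<and> t \<in> meet_closure A \<and> len s \<le> len t}"

definition first_levels :: "nat \<Rightarrow> 'r node set \<Rightarrow> 'r node set" where
  "first_levels k A = {t \<in> induced_tree A. card {l \<in> len ` induced_tree A. l < len t} < k}"

definition max_succ :: "'r node set \<Rightarrow> 'r node set \<Rightarrow> 'r node set" where
  "max_succ T A = (\<Union>t \<in> max_nodes A. imm_succ T t)"

context
  fixes ar :: "'r \<Rightarrow> nat" and W :: "'r set" and M :: "'r struct"
begin

definition node :: "nat \<Rightarrow> nat \<Rightarrow> 'r node" where
  "node n i = (n + 1, tp ar W M i {..<n})"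

definition tree_level :: "nat \<Rightarrow> 'r node set" where
  "tree_level n = {node n i | i. n \<le> i}"

definition coding_tree :: "'r node set" where
  "coding_tree = (\<Union>n. tree_level n)"

definition coding_node :: "nat \<Rightarrow> 'r node" where
  "coding_node n = node n n"

definition coding_idx :: "'r node set \<Rightarrow> nat set" where
  "coding_idx A = {i. coding_node i \<in> A}"

text \<open>\<open>nth_idx A n\<close> is the index of the \<open>n\<close>-th coding node of \<open>A\<close>, if there is one.\<close>

definition has_nth :: "'r node set \<Rightarrow> nat \<Rightarrow> bool" where
  "has_nth A n \<longleftrightarrow> infinite (coding_idx A) \<or> n < card (coding_idx A)"

definition nth_idx :: "'r node set \<Rightarrow> nat \<Rightarrow> nat" where
  "nth_idx A n = enumerate (coding_idx A) n"

definition nth_coding :: "'r node set \<Rightarrow> nat \<Rightarrow> 'r node" where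
  "nth_coding A n = coding_node (nth_idx A n)"

definition same_unary :: "nat \<Rightarrow> nat \<Rightarrow> bool" where
  "same_unary i j \<longleftrightarrow> (\<forall>R. ar R = 1 \<longrightarrow> ([i] \<in> rels M R \<longleftrightarrow> [j] \<in> rels M R))"

text \<open>\<open>passing t n A\<close> is \<open>t(c\<^sub>n; A)\<close>. The first \<open>m\<close> indices of \<open>A\<close>, for \<open>m\<close> least such that the
  \<open>m\<close>-th coding node of \<open>A\<close> is at least as long as \<open>c\<^sub>n\<close>, are the indices of \<open>A\<close> below \<open>n\<close>; if
  there is no such \<open>m\<close>, these are all indices of \<open>A\<close>.\<close>

definition passing :: "'r node \<Rightarrow> nat \<Rightarrow> 'r node set \<Rightarrow> 'r lit set" where
  "passing t n A =
     {\<phi> \<in> entry t (len (coding_node n)). par \<phi> \<subseteq> (coding_idx A \<inter> {..<n}) \<union> {n}}"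

definition passing_sim ::
    "'r node \<Rightarrow> nat \<Rightarrow> 'r node set \<Rightarrow> 'r node \<Rightarrow> nat \<Rightarrow> 'r node set \<Rightarrow> bool" where
  "passing_sim s m A t n B \<longleftrightarrow>
     (\<exists>f. bij_betw f (coding_idx A \<inter> {..<m}) (coding_idx B \<inter> {..<n}) \<and>
          strict_mono_on (coding_idx A \<inter> {..<m}) f \<and> f m = n \<and>
          (\<forall>R zs. length zs = ar R \<and> Var \<in> set zs \<and>
                  set zs \<subseteq> insert Var (Par ` (coding_idx A \<inter> {..<m} \<union> {m})) \<longrightarrow>
             (Pos R zs \<in> passing s m A \<longleftrightarrow>
              Pos R (map (case_tm Var (\<lambda>i. Par (f i))) zs) \<in> passing t n B)))"

definition subtree :: "'r node set \<Rightarrow> bool" where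
  "subtree T \<longleftrightarrow> T \<subseteq> coding_tree \<and> meet_closed T \<and>
     (\<forall>t \<in> T. \<forall>l. 1 \<le> l \<and> l \<le> len t \<and>
        ((\<exists>i \<in> coding_idx T. l = len (coding_node i)) \<or>
         (\<exists>u \<in> T. \<exists>w \<in> T. incomparable u w \<and> l = len (meet u w))) \<longrightarrow> restr t l \<in> T)"

definition diagonal :: "'r node set \<Rightarrow> bool" where
  "diagonal T \<longleftrightarrow>
     (\<forall>s t. splitting T s \<and> splitting T t \<and> len s = len t \<longrightarrow> s = t) \<and>
     (\<forall>s. splitting T s \<longrightarrow> card (imm_succ T s) = 2) \<and>
     (\<forall>s. splitting T s \<longrightarrow> (\<forall>i \<in> coding_idx T. len s \<noteq> len (coding_node i)))"

definition diagonal_coding_subtree :: "'r node set \<Rightarrow> bool" where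
  "diagonal_coding_subtree T \<longleftrightarrow> subtree T \<and> diagonal T \<and>
     isomorphic (induced M (coding_idx T)) M \<and>
     (\<forall>n. \<exists>g. bij_betw g
        ((\<lambda>t. tp_restrict (snd t) (coding_idx (up_to_level T (len (nth_coding T n))))) `
           at_level T (len (nth_coding T n) + 1))
        (tree_level (n + 1))) \<and>
     (\<forall>m n. m < n \<and> nth_coding T m \<sqsubseteq> nth_coding T n \<longrightarrow>
        (let A = up_to_level T (len (nth_coding T m) - 1) in
           passing_sim (plus T (nth_coding T n)) (nth_idx T n) A
                       (plus T (nth_coding T m)) (nth_idx T m) A))"

text \<open>Partial 1-types in the binary symbols of \<open>v\<^sub>j\<close> over \<open>{v\<^sub>i}\<close>, with the parameter \<open>v\<^sub>i\<close> renamed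
  to \<open>0\<close> so that types over different one-element structures can be compared.\<close>

definition binary_type :: "nat \<Rightarrow> nat \<Rightarrow> 'r lit set" where
  "binary_type j i = {\<phi> \<in> lits ar {R. ar R = 2} {0}. holds M (case_tm j (\<lambda>_. i)) \<phi>}"

definition binary_types :: "'r lit set set" where
  "binary_types = {binary_type j i | i j. i \<noteq> j}"

text \<open>The vertex over which the binary types are taken is the \<open>v\<^sub>i\<close> with \<open>|c\<^sub>i| = |s|\<close>, which is the
  vertex at which extensions of the splitting node \<open>s\<close> first differ.\<close>

definition determined_by_binary_types :: "'r node set \<Rightarrow> nat \<Rightarrow> ('r node \<Rightarrow> nat) \<Rightarrow> bool" where
  "determined_by_binary_types \<T> q \<psi> \<longleftrightarrow> (\<exists>R. ar R = 2) \<and>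
     (\<exists>Q. (\<Union>m<q. Q m) = binary_types \<times> binary_types \<and> disjoint_family_on Q {..<q} \<and>
          (\<forall>m<q. Q m \<noteq> {}) \<and>
          (\<forall>s. splitting \<T> s \<longrightarrow> (\<forall>m<q. \<psi> s = m \<longleftrightarrow>
             (\<forall>j \<in> coding_idx \<T>. \<forall>k \<in> coding_idx \<T>. \<forall>i.
                meet (coding_node j) (coding_node k) = s \<and> len (coding_node i) = len s \<longrightarrow>
                (binary_type j i, binary_type k i) \<in> Q m))))"

context
  fixes lo :: "('r lit \<times> 'r lit) set"
begin

definition similarity_map :: "('r node \<Rightarrow> 'r node) \<Rightarrow> 'r node set \<Rightarrow> 'r node set \<Rightarrow> bool" where
  "similarity_map f S T \<longleftrightarrow> meet_closed S \<and> meet_closed T \<and> bij_betw f S T \<and>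
     (\<forall>s \<in> S. \<forall>t \<in> S.
        (prec lo s t \<longleftrightarrow> prec lo (f s) (f t)) \<and>
        (if len (meet s t) = 0 then meet s t else f (meet s t)) = meet (f s) (f t) \<and>
        (len s < len t \<longleftrightarrow> len (f s) < len (f t)) \<and>
        (s \<sqsubseteq> t \<longleftrightarrow> f s \<sqsubseteq> f t)) \<and>
     (\<forall>n. has_nth S n \<longleftrightarrow> has_nth T n) \<and>
     (\<forall>n. has_nth S n \<longrightarrow>
        f (nth_coding S n) = nth_coding T n \<and> same_unary (nth_idx S n) (nth_idx T n) \<and>
        (\<forall>s \<in> S. len (nth_coding S n) < len s \<longrightarrow>
           passing_sim s (nth_idx S n) S (f s) (nth_idx T n) T))"

definition similar :: "'r node set \<Rightarrow> 'r node set \<Rightarrow> bool" where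
  "similar S T \<longleftrightarrow> (\<exists>f. similarity_map f S T)"

definition plus_similarity_map ::
    "'r node set \<Rightarrow> ('r node \<Rightarrow> 'r node) \<Rightarrow> 'r node set \<Rightarrow> 'r node set \<Rightarrow> bool" where
  "plus_similarity_map T f A B \<longleftrightarrow> finite A \<and> finite B \<and> similarity_map f A B \<and>
     ((\<exists>t \<in> max_nodes A. splitting T t \<and> f t \<in> max_nodes B \<and> splitting T (f t)) \<or>
      (\<exists>n. has_nth A n \<and> nth_coding A n \<in> max_nodes A \<and>
           (\<forall>s \<in> max_nodes A.
              passing_sim (plus T s) (nth_idx A n) A (plus T (f s)) (nth_idx B n) B)))"

definition similar_subtrees :: "'r node set \<Rightarrow> 'r node set set" where
  "similar_subtrees \<T> = {T. subtree T \<and> T \<subseteq> \<T> \<and> similar T \<T>}"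

text \<open>The situation common to both clauses of the Extension Property: \<open>u\<close> is the splitting node in
  the \<open>(k+1)\<close>-st level of \<open>A\<close>, \<open>f\<close> maps the first \<open>k\<close> levels onto \<open>B\<close>, and \<open>s\<close> is the node of
  \<open>max(B)\<^sup>+\<close> that has to be extended to a splitting node: it lies above \<open>f\<close> of the node of
  \<open>max(r\<^sub>k(A))\<close> below \<open>u\<close>, and to the left or to the right according to the position of \<open>u\<close> in case
  that node splits in \<open>T\<close>.\<close>

definition extension_situation ::
    "'r node set \<Rightarrow> 'r node set \<Rightarrow> nat \<Rightarrow> 'r node \<Rightarrow> 'r node set \<Rightarrow> ('r node \<Rightarrow> 'r node) \<Rightarrow>
     'r node \<Rightarrow> bool" where
  "extension_situation T A k u B f s \<longleftrightarrow>
     subtree A \<and> A \<subseteq> T \<and>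
     u \<in> max_nodes (first_levels (k + 1) A) \<and> u \<notin> first_levels k A \<and> splitting T u \<and>
     B \<subseteq> T \<and> plus_similarity_map T f (first_levels k A) B \<and>
     s \<in> max_succ T B \<and>
     (\<exists>p \<in> max_nodes (first_levels k A). p \<sqsubseteq> u \<and> f p \<sqsubseteq> s \<and>
        card {x \<in> imm_succ T p. prec lo x (restr u (len p + 1))} =
        card {y \<in> imm_succ T (f p). prec lo y s})"

definition extension_conclusion ::
    "'r node set \<Rightarrow> 'r node set \<Rightarrow> nat \<Rightarrow> 'r node \<Rightarrow> 'r node set \<Rightarrow> ('r node \<Rightarrow> 'r node) \<Rightarrow>
     'r node \<Rightarrow> bool" where
  "extension_conclusion T A k u B f s' \<longleftrightarrow>
     (\<exists>B' g. B \<subseteq> B' \<and> B' \<subseteq> T \<and> (\<forall>y \<in> B' - B. len y = len s') \<and>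
        plus_similarity_map T g (first_levels (k + 1) A) B' \<and>
        (\<forall>x \<in> first_levels k A. g x = f x) \<and> g u = s' \<and>
        (\<exists>A' h. A' \<subseteq> T \<and> similarity_map h A A' \<and>
           (\<forall>x \<in> A \<inter> first_levels (k + 1) A. h x = g x)))"

definition extension_property_1 :: "'r node set \<Rightarrow> bool" where
  "extension_property_1 \<T> \<longleftrightarrow>
     (\<forall>T \<in> similar_subtrees \<T>. \<forall>A k u B f s.
        extension_situation T A k u B f s \<longrightarrow>
        (\<forall>s'. splitting T s' \<and> s \<sqsubseteq> s' \<longrightarrow> extension_conclusion T A k u B f s'))"

definition extension_property_2 :: "'r node set \<Rightarrow> bool" where
  "extension_property_2 \<T> \<longleftrightarrow>
     (\<exists>q \<psi>. 2 \<le> q \<and> \<psi> ` {s. splitting \<T> s} = {..<q} \<and>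
        (\<forall>T \<in> similar_subtrees \<T>. \<forall>A k u B f s.
           extension_situation T A k u B f s \<and>
           (\<forall>t \<in> first_levels k A.
              splitting (first_levels k A) t \<or> (t \<in> max_nodes (first_levels k A) \<and> splitting T t) \<longrightarrow>
              \<psi> (f t) = \<psi> t) \<longrightarrow>
           (\<forall>r \<in> T. s \<sqsubseteq> r \<longrightarrow> (\<exists>s'. splitting T s' \<and> r \<sqsubseteq> s' \<and> \<psi> s' = \<psi> u)) \<and>
           (\<forall>s'. splitting T s' \<and> s \<sqsubseteq> s' \<and> \<psi> s' = \<psi> u \<longrightarrow> extension_conclusion T A k u B f s')) \<and>
        determined_by_binary_types \<T> q \<psi>)"

end

end

text \<open>The two choices of symbols that give the trees \<open>\<S>\<close> and \<open>\<U>\<close>.\<close>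

definition tree_symbols :: "('r \<Rightarrow> nat) \<Rightarrow> 'r set set" where
  "tree_symbols ar = {UNIV, {R. ar R \<noteq> 1}}"

definition diagonal_coding_tree_property :: "('r \<Rightarrow> nat) \<Rightarrow> 'r struct set \<Rightarrow> bool" where
  "diagonal_coding_tree_property ar \<K> \<longleftrightarrow>
     (\<forall>M. enumerated_fraisse_limit ar \<K> M \<longrightarrow>
        (\<exists>W \<in> tree_symbols ar. \<exists>T. perfect T \<and> diagonal_coding_subtree ar W M T))"

text \<open>The diagonal coding subtree with respect to which the Extension Property is formulated is
  a perfect one, as provided by the Diagonal Coding Tree Property.\<close>

definition extension_property ::
    "('r \<Rightarrow> nat) \<Rightarrow> ('r lit \<times> 'r lit) set \<Rightarrow> 'r struct \<Rightarrow> bool" where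
  "extension_property ar lo M \<longleftrightarrow>
     (\<exists>W \<in> tree_symbols ar. \<exists>\<T>. perfect \<T> \<and> diagonal_coding_subtree ar W M \<T> \<and>
        (extension_property_1 ar W M lo \<T> \<or> extension_property_2 ar W M lo \<T>))"

definition SDAP_plus :: "('r \<Rightarrow> nat) \<Rightarrow> ('r lit \<times> 'r lit) set \<Rightarrow> 'r struct \<Rightarrow> bool" where
  "SDAP_plus ar lo M \<longleftrightarrow> SDAP ar (age ar M) \<and> diagonal_coding_tree_property ar (age ar M) \<and>
     extension_property ar lo M"

end

theory Submission
  imports Defs "HOL-Library.Ramsey" "HOL-Library.Countable"
begin

text \<open>
  Call two types of pairs congruent if in every finite set of vertices a pair of the one type can be
  given the other type without changing anything else. SDAP says that the congruence class of a pair
  is decided by the types of its two vertices over suitable further vertices. Realise a finite set in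
  the diagonal coding tree above nodes that decide all its pairs. The Extension Property copies
  coding nodes into cones of the tree, so the class of a pair depends only on the unary types, on the
  label of the meet and on the side of the split. Among three vertices of one unary type \<open>u\<close>, two
  split last, and all vertices of a given unary type that separate these two do so in the same way.
  The Diagonal Coding Tree Property, for an enumeration starting with a vertex of unary type \<open>u\<close>,
  provides a vertex with a constant type over copies of all finite sets of unary type \<open>u\<close>, because
  the coding node \<open>c\<^sub>0\<close> does not split. Hence for each pair of unary types there are at most two
  classes. Where there are two, they define linear orders on blocks of unary types; a finite linearly
  ordered set whose pairs are realisable and respect these orders embeds into the Fraisse limit, since
  its vertices can be added one at a time from below. Thus the members of the ordered expansion are
  the structures with two linear orders and freely chosen edge types from admissible sets, and the
  partite construction applies to these.
\<close>

section \<open>Changing the type of a pair\<close>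

text \<open>The Extension Property copies only above a splitting node that is copied already, and it
  sees a pair of coding nodes only through the label and the side of their split. Nothing bounds the
  number of labels, so it does not by itself bound the number of classes. Three vertices rather than
  two are used because the earlier split provides the splitting node below the later one that
  copying needs. If two vertices of one unary type separated the pair by different values, four
  configurations over one triple would be realisable that no tree can contain together. The bound
  two follows since a separating vertex shows only two classes, and the constant type tells its
  lower vertices from its upper ones. Hence such a vertex behaves like a point in a cut of a linear
  order, and comparing cuts orders a whole block. These orders are determined by the pair types,
  whereas \<open><\<close> is arbitrary; copies must therefore be controlled in two unrelated orders
  at once, which is the reason for the grid and for the product form of Ramsey's theorem.\<close>

locale homog =
  fixes un :: "nat \<Rightarrow> 'u" and bn :: "nat \<Rightarrow> nat \<Rightarrow> 'b"
begin

definition q :: "nat \<Rightarrow> nat \<Rightarrow> 'u \<times> 'u \<times> 'b" where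
  "q x y = (un x, un y, bn x y)"

text \<open>Partial isomorphisms: with arities one and two, the unary types and the types of pairs
  of distinct vertices determine the induced substructure.\<close>

definition pe :: "(nat \<Rightarrow> nat) \<Rightarrow> nat set \<Rightarrow> bool" where
  "pe \<phi> F \<longleftrightarrow> inj_on \<phi> F \<and> (\<forall>x \<in> F. un (\<phi> x) = un x) \<and>
     (\<forall>x \<in> F. \<forall>y \<in> F. x \<noteq> y \<longrightarrow> bn (\<phi> x) (\<phi> y) = bn x y)"

definition same :: "nat \<Rightarrow> nat \<Rightarrow> nat set \<Rightarrow> bool" where
  "same p x E \<longleftrightarrow> un p = un x \<and> (\<forall>e \<in> E. bn p e = bn x e)"

definition change_map :: "(nat \<Rightarrow> nat) \<Rightarrow> nat set \<Rightarrow> nat \<Rightarrow> nat \<Rightarrow> 'u \<times> 'u \<times> 'b \<Rightarrow> bool" where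
  "change_map \<phi> F x y T \<longleftrightarrow> inj_on \<phi> F \<and> (\<forall>a \<in> F. un (\<phi> a) = un a) \<and>
     (\<forall>a \<in> F. \<forall>b \<in> F. a \<noteq> b \<longrightarrow> {a, b} \<noteq> {x, y} \<longrightarrow> bn (\<phi> a) (\<phi> b) = bn a b) \<and> q (\<phi> x) (\<phi> y) = T"

definition changed :: "nat set \<Rightarrow> nat \<Rightarrow> nat \<Rightarrow> 'u \<times> 'u \<times> 'b \<Rightarrow> bool" where
  "changed F x y T \<longleftrightarrow> (\<exists>\<phi>. change_map \<phi> F x y T)"

definition changeable :: "'u \<times> 'u \<times> 'b \<Rightarrow> 'u \<times> 'u \<times> 'b \<Rightarrow> bool" where
  "changeable T T' \<longleftrightarrow> fst T = fst T' \<and> fst (snd T) = fst (snd T') \<and>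
     (\<forall>F x y. finite F \<longrightarrow> x \<in> F \<longrightarrow> y \<in> F \<longrightarrow> x \<noteq> y \<longrightarrow> q x y = T \<longrightarrow> changed F x y T')"

definition cong :: "'u \<times> 'u \<times> 'b \<Rightarrow> 'u \<times> 'u \<times> 'b \<Rightarrow> bool"  (infix "\<cong>" 50) where
  "T \<cong> T' \<longleftrightarrow> changeable T T' \<and> changeable T' T"

text \<open>What SDAP supplies for a pair \<open>v, w\<close>: having the right types over
  \<open>A\<close> is enough to permit the change to \<open>T\<close>, whatever else belongs to
  \<open>F\<close>.\<close>

definition frees :: "nat set \<Rightarrow> nat \<Rightarrow> nat \<Rightarrow> 'u \<times> 'u \<times> 'b \<Rightarrow> bool" where
  "frees A v w T \<longleftrightarrow> (\<forall>F p r. finite F \<longrightarrow> A \<subseteq> F \<longrightarrow> p \<in> F - A \<longrightarrow> r \<in> F - A \<longrightarrow> p \<noteq> r \<longrightarrow>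
     same p v A \<longrightarrow> same r w A \<longrightarrow> changed F p r T)"

definition decides :: "nat set \<Rightarrow> nat \<Rightarrow> nat \<Rightarrow> bool" where
  "decides E x y \<longleftrightarrow> (\<forall>p r. p \<noteq> r \<longrightarrow> p \<notin> E \<longrightarrow> r \<notin> E \<longrightarrow> same p x E \<longrightarrow> same r y E \<longrightarrow> q p r \<cong> q x y)"

lemma freesD:
  "frees A v w T \<Longrightarrow> finite F \<Longrightarrow> A \<subseteq> F \<Longrightarrow> p \<in> F \<Longrightarrow> p \<notin> A \<Longrightarrow> r \<in> F \<Longrightarrow> r \<notin> A \<Longrightarrow> p \<noteq> r \<Longrightarrow>
    same p v A \<Longrightarrow> same r w A \<Longrightarrow> changed F p r T"
  by (simp add: frees_def)

lemma pe_id: "pe id F"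
  by (auto simp: pe_def)

lemma pe_subset: "pe \<phi> F \<Longrightarrow> F' \<subseteq> F \<Longrightarrow> pe \<phi> F'"
  unfolding pe_def by (meson inj_on_subset subsetD)

lemma pe_comp: "pe \<phi> F \<Longrightarrow> pe \<psi> (\<phi> ` F) \<Longrightarrow> pe (\<psi> \<circ> \<phi>) F"
  unfolding pe_def by (auto intro: comp_inj_on simp: inj_on_eq_iff)

lemma pe_cong: "pe \<phi> F \<Longrightarrow> (\<And>x. x \<in> F \<Longrightarrow> \<psi> x = \<phi> x) \<Longrightarrow> pe \<psi> F"
  unfolding pe_def by (simp add: inj_on_def)

lemma pe_q: "pe \<phi> F \<Longrightarrow> x \<in> F \<Longrightarrow> y \<in> F \<Longrightarrow> x \<noteq> y \<Longrightarrow> q (\<phi> x) (\<phi> y) = q x y"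
  by (simp add: pe_def q_def)

lemma pe_inj: "pe \<phi> F \<Longrightarrow> inj_on \<phi> F"
  by (simp add: pe_def)

lemma pe_bn: "pe \<phi> F \<Longrightarrow> x \<in> F \<Longrightarrow> y \<in> F \<Longrightarrow> x \<noteq> y \<Longrightarrow> bn (\<phi> x) (\<phi> y) = bn x y"
  by (simp add: pe_def)

lemma pe_un: "pe \<phi> F \<Longrightarrow> x \<in> F \<Longrightarrow> un (\<phi> x) = un x"
  by (simp add: pe_def)

lemma pe_inv: "pe \<phi> F \<Longrightarrow> pe (the_inv_into F \<phi>) (\<phi> ` F)"
  unfolding pe_def by (auto simp: the_inv_into_f_f intro: inj_on_the_inv_into) metis

lemma change_mapD:
  assumes "change_map \<phi> F x y T"
  shows "inj_on \<phi> F" "a \<in> F \<Longrightarrow> un (\<phi> a) = un a" "q (\<phi> x) (\<phi> y) = T"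
    "a \<in> F \<Longrightarrow> b \<in> F \<Longrightarrow> a \<noteq> b \<Longrightarrow> {a, b} \<noteq> {x, y} \<Longrightarrow> bn (\<phi> a) (\<phi> b) = bn a b"
  using assms by (auto simp: change_map_def)

lemma changed_mono:
  assumes "changed F x y T" "F' \<subseteq> F"
  shows "changed F' x y T"
proof -
  obtain \<phi> where "change_map \<phi> F x y T" using assms(1) by (auto simp: changed_def)
  then have "change_map \<phi> F' x y T"
    using assms(2) by (auto simp: change_map_def intro: inj_on_subset) blast+
  then show ?thesis by (auto simp: changed_def)
qed

lemma change_map_comp:
  assumes \<phi>: "change_map \<phi> (\<psi> ` F) (\<psi> x) (\<psi> y) T" and inj: "inj_on \<psi> F" and un: "\<And>a. a \<in> F \<Longrightarrow> un (\<psi> a) = un a"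
    and bn: "\<And>a b. a \<in> F \<Longrightarrow> b \<in> F \<Longrightarrow> a \<noteq> b \<Longrightarrow> {a, b} \<noteq> {x, y} \<Longrightarrow> bn (\<psi> a) (\<psi> b) = bn a b"
    and xy: "x \<in> F" "y \<in> F"
  shows "change_map (\<phi> \<circ> \<psi>) F x y T"
proof -
  have "bn (\<phi> (\<psi> a)) (\<phi> (\<psi> b)) = bn a b" if ab: "a \<in> F" "b \<in> F" "a \<noteq> b" "{a, b} \<noteq> {x, y}" for a b
  proof -
    have "\<psi> a \<noteq> \<psi> b" "{\<psi> a, \<psi> b} \<noteq> {\<psi> x, \<psi> y}"
      using ab xy inj by (auto simp: doubleton_eq_iff inj_on_eq_iff)
    then show ?thesis using change_mapD(4)[OF \<phi>, of "\<psi> a" "\<psi> b"] bn ab by simp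
  qed
  then show ?thesis
    using change_mapD[OF \<phi>] inj un by (auto simp: change_map_def intro: comp_inj_on)
qed

lemma changed_pe:
  assumes \<psi>: "pe \<psi> F" and ch: "changed (\<psi> ` F) (\<psi> x) (\<psi> y) T" and xy: "x \<in> F" "y \<in> F"
  shows "changed F x y T"
proof -
  obtain \<phi> where "change_map \<phi> (\<psi> ` F) (\<psi> x) (\<psi> y) T" using ch by (auto simp: changed_def)
  then have "change_map (\<phi> \<circ> \<psi>) F x y T"
    using \<psi> xy by (intro change_map_comp) (auto simp: pe_def)
  then show ?thesis by (auto simp: changed_def)
qed

lemma cong_refl: "T \<cong> T"
proof -
  have "change_map id F x y (q x y)" for F x y by (simp add: change_map_def)
  then have "changed F x y (q x y)" for F x y unfolding changed_def by blast
  then show ?thesis unfolding cong_def changeable_def by blast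
qed

lemma cong_sym: "T \<cong> T' \<Longrightarrow> T' \<cong> T"
  by (simp add: cong_def)

lemma changeableD:
  "changeable T T' \<Longrightarrow> finite F \<Longrightarrow> x \<in> F \<Longrightarrow> y \<in> F \<Longrightarrow> x \<noteq> y \<Longrightarrow> q x y = T \<Longrightarrow> changed F x y T'"
  by (simp add: changeable_def)

lemma changeableI:
  assumes "fst T = fst T'" "fst (snd T) = fst (snd T')"
    "\<And>F x y. finite F \<Longrightarrow> x \<in> F \<Longrightarrow> y \<in> F \<Longrightarrow> x \<noteq> y \<Longrightarrow> q x y = T \<Longrightarrow> changed F x y T'"
  shows "changeable T T'"
  using assms unfolding changeable_def by blast

lemma changeable_trans:
  assumes "changeable T T'" "changeable T' T''"
  shows "changeable T T''"
proof -
  have "changed F x y T''" if F: "finite F" "x \<in> F" "y \<in> F" "x \<noteq> y" "q x y = T" for F x y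
  proof -
    obtain \<phi> where \<phi>: "change_map \<phi> F x y T'"
      using changeableD[OF assms(1) F] by (auto simp: changed_def)
    note \<phi>D = change_mapD[OF \<phi>]
    have "\<phi> x \<noteq> \<phi> y" using \<phi>D(1) F by (auto simp: inj_on_eq_iff)
    then have "changed (\<phi> ` F) (\<phi> x) (\<phi> y) T''"
      using F \<phi>D(3) by (intro changeableD[OF assms(2)]) auto
    then obtain \<psi> where "change_map \<psi> (\<phi> ` F) (\<phi> x) (\<phi> y) T''"
      by (auto simp: changed_def)
    then have "change_map (\<psi> \<circ> \<phi>) F x y T''"
      using \<phi>D F by (intro change_map_comp) auto
    then show ?thesis by (auto simp: changed_def)
  qed
  then show ?thesis using assms by (auto simp: changeable_def)
qed

lemma cong_trans: "T \<cong> T' \<Longrightarrow> T' \<cong> T'' \<Longrightarrow> T \<cong> T''"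
  unfolding cong_def using changeable_trans by blast

lemma changeable_un:
  assumes "changeable (q a b) (q c d)"
  shows "un a = un c" "un b = un d"
proof -
  have "fst (q a b) = fst (q c d) \<and> fst (snd (q a b)) = fst (snd (q c d))"
    using assms unfolding changeable_def by blast
  then show "un a = un c" "un b = un d" by (simp_all add: q_def)
qed

lemma cong_un: "q a b \<cong> q c d \<Longrightarrow> un a = un c \<and> un b = un d"
  unfolding cong_def using changeable_un by blast

lemma change_pair:
  assumes "q x y \<cong> q c d" "finite F" "x \<in> F" "y \<in> F" "x \<noteq> y"
  obtains \<phi> where "change_map \<phi> F x y (q c d)"
  using assms changeableD[of "q x y" "q c d" F x y] by (auto simp: cong_def changed_def)

lemma change_map_q:
  assumes "change_map \<phi> F x y T" "a \<in> F" "b \<in> F" "a \<noteq> b" "{a, b} \<noteq> {x, y}"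
  shows "q (\<phi> a) (\<phi> b) = q a b"
  using change_mapD[OF assms(1)] assms(2-) by (simp add: q_def)

end

text \<open>\<open>ext1\<close> is one-point extension of partial isomorphisms. Avoiding an
  arbitrary finite set \<open>G\<close> is the contribution of disjoint amalgamation.\<close>

locale homog_ext = homog un bn for un :: "nat \<Rightarrow> 'u" and bn :: "nat \<Rightarrow> nat \<Rightarrow> 'b" +
  assumes bn_swap: "bn x y = bn x' y' \<Longrightarrow> bn y x = bn y' x'"
    and ext1: "finite F \<Longrightarrow> finite G \<Longrightarrow> pe \<phi> F \<Longrightarrow> y \<notin> F \<Longrightarrow>
      \<exists>y'. y' \<notin> G \<and> pe (\<phi>(y := y')) (insert y F)"
begin

lemma q_swap: "q x y = q x' y' \<Longrightarrow> q y x = q y' x'"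
  using bn_swap[of x y x' y'] by (simp add: q_def)

lemma extend:
  assumes "finite F" "finite Y" "finite G" "pe \<phi> F"
  shows "\<exists>\<phi>'. pe \<phi>' (F \<union> Y) \<and> (\<forall>x \<in> F. \<phi>' x = \<phi> x) \<and> (\<forall>y \<in> Y - F. \<phi>' y \<notin> G)"
  using assms(2)
proof (induction Y rule: finite_induct)
  case empty
  then show ?case using assms(4) by (auto intro!: exI[of _ \<phi>])
next
  case (insert y Y)
  then obtain \<phi>' where \<phi>': "pe \<phi>' (F \<union> Y)" "\<forall>x \<in> F. \<phi>' x = \<phi> x" "\<forall>y \<in> Y - F. \<phi>' y \<notin> G" by blast
  show ?case
  proof (cases "y \<in> F")
    case True
    then show ?thesis using \<phi>' by (intro exI[of _ \<phi>']) (auto simp: insert_absorb)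
  next
    case False
    obtain y' where y': "y' \<notin> G" "pe (\<phi>'(y := y')) (insert y (F \<union> Y))"
      using ext1[of "F \<union> Y" G \<phi>' y] assms insert False \<phi>' by auto
    from y'(2) have "pe (\<phi>'(y := y')) (F \<union> insert y Y)" by simp
    moreover have "\<forall>x \<in> F. (\<phi>'(y := y')) x = \<phi> x" using \<phi>'(2) False by auto
    moreover have "\<forall>x \<in> insert y Y - F. (\<phi>'(y := y')) x \<notin> G" using \<phi>'(3) y'(1) by auto
    ultimately show ?thesis by blast
  qed
qed

lemma pe_pair:
  assumes "x \<noteq> y" "v \<noteq> w" "q v w = q x y"
  shows "pe ((\<lambda>_. y)(v := x)) {v, w}"
proof -
  have "bn w v = bn y x" using q_swap[OF assms(3)] by (simp add: q_def)
  then show ?thesis using assms by (simp add: pe_def q_def inj_on_def)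
qed

text \<open>Homogeneity extends the inverse of \<open>\<phi>\<close> to any finite set around the
  image of \<open>A\<close>; there the freedom of \<open>A\<close> applies, and the change is pulled
  back by \<open>changed_pe\<close>.\<close>

lemma frees_transfer:
  assumes fr: "frees A v w T" and A: "finite A" and \<phi>: "pe \<phi> A"
    and v': "un v' = un v" "\<And>a. a \<in> A \<Longrightarrow> bn v' (\<phi> a) = bn v a"
    and w': "un w' = un w" "\<And>a. a \<in> A \<Longrightarrow> bn w' (\<phi> a) = bn w a"
  shows "frees (\<phi> ` A) v' w' T"
  unfolding frees_def
proof (intro allI impI)
  fix F p r
  assume F: "finite F" "\<phi> ` A \<subseteq> F" "p \<in> F - \<phi> ` A" "r \<in> F - \<phi> ` A" "p \<noteq> r"
    "same p v' (\<phi> ` A)" "same r w' (\<phi> ` A)"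
  let ?\<psi> = "the_inv_into A \<phi>"
  have fi: "finite (\<phi> ` A)" using A by simp
  have "\<exists>\<psi>. pe \<psi> (\<phi> ` A \<union> F) \<and> (\<forall>x \<in> \<phi> ` A. \<psi> x = ?\<psi> x) \<and> (\<forall>y \<in> F - \<phi> ` A. \<psi> y \<notin> {})"
    by (rule extend[OF fi F(1) finite.emptyI pe_inv[OF \<phi>]])
  then obtain \<psi> where \<psi>: "pe \<psi> (\<phi> ` A \<union> F)" "\<forall>x \<in> \<phi> ` A. \<psi> x = ?\<psi> x" by blast
  have pF: "pe \<psi> F" using \<psi>(1) by (rule pe_subset) auto
  note inj = pe_inj[OF pF] pe_inj[OF \<phi>]
  have \<psi>\<phi>: "\<psi> (\<phi> a) = a" if "a \<in> A" for a
  proof -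
    have "\<psi> (\<phi> a) = the_inv_into A \<phi> (\<phi> a)" by (rule bspec[OF \<psi>(2) imageI[OF that]])
    then show ?thesis using the_inv_into_f_f[OF inj(2) that] by simp
  qed
  have AF: "A \<subseteq> \<psi> ` F"
  proof
    fix a assume a: "a \<in> A"
    then have "\<phi> a \<in> F" using F(2) by blast
    then have "\<psi> (\<phi> a) \<in> \<psi> ` F" by (rule imageI)
    then show "a \<in> \<psi> ` F" using \<psi>\<phi>[OF a] by simp
  qed
  have out: "\<psi> z \<notin> A" if z: "z \<in> F - \<phi> ` A" for z
  proof
    assume a: "\<psi> z \<in> A"
    then have "\<psi> (\<phi> (\<psi> z)) = \<psi> z" by (rule \<psi>\<phi>)
    moreover have "\<phi> (\<psi> z) \<in> F" "z \<in> F" using F(2) a z by auto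
    ultimately have "\<phi> (\<psi> z) = z" using inj(1) by (rule inj_onD[rotated])
    then have "z \<in> \<phi> ` A" using a by (metis imageI)
    then show False using z by simp
  qed
  have bnz: "bn (\<psi> z) a = bn z (\<phi> a)" if z: "z \<in> F - \<phi> ` A" "a \<in> A" for z a
  proof -
    have "z \<noteq> \<phi> a" "\<phi> a \<in> F" using z F(2) by auto
    then have "bn (\<psi> z) (\<psi> (\<phi> a)) = bn z (\<phi> a)" using z by (intro pe_bn[OF pF]) auto
    then show ?thesis using \<psi>\<phi>[OF z(2)] by simp
  qed
  have "same (\<psi> p) v A"
    unfolding same_def using F(3,6) v' bnz[OF F(3)] pe_un[OF pF, of p] by (simp add: same_def)
  moreover have "same (\<psi> r) w A"
    unfolding same_def using F(4,7) w' bnz[OF F(4)] pe_un[OF pF, of r] by (simp add: same_def)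
  moreover have "\<psi> p \<noteq> \<psi> r" using inj(1) F by (auto simp: inj_on_eq_iff)
  ultimately have "changed (\<psi> ` F) (\<psi> p) (\<psi> r) T"
    using F(1,3,4) out[OF F(3)] out[OF F(4)] by (intro freesD[OF fr _ AF]) auto
  then show "changed F p r T" using F(3,4) by (blast intro: changed_pe[OF pF])
qed

lemma frees_same: "frees A v w T \<Longrightarrow> same p v A \<Longrightarrow> same r w A \<Longrightarrow> frees A p r T"
  unfolding frees_def same_def by simp

end

text \<open>\<open>free_pair\<close> is SDAP for a two-element structure over the empty one,
  expressed inside the limit.\<close>

locale homog_sdap = homog_ext un bn for un :: "nat \<Rightarrow> 'u" and bn :: "nat \<Rightarrow> nat \<Rightarrow> 'b" +
  assumes free_pair: "x \<noteq> y \<Longrightarrow> \<exists>A v w. finite A \<and> v \<notin> A \<and> w \<notin> A \<and> v \<noteq> w \<and> q v w = q x y \<and> frees A v w (q x y)"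
begin

text \<open>Homogeneity moves the pair \<open>v, w\<close> of \<open>free_pair\<close> onto
  \<open>x, y\<close>; the image of the freeing set can be kept away from \<open>G\<close>.\<close>

lemma free_at:
  assumes "x \<noteq> y" "finite G"
  obtains A where "finite A" "x \<notin> A" "y \<notin> A" "A \<inter> G = {}" "frees A x y (q x y)"
proof -
  obtain A v w where A: "finite A" "v \<notin> A" "w \<notin> A" "v \<noteq> w" "q v w = q x y" "frees A v w (q x y)"
    using free_pair[OF assms(1)] by blast
  obtain \<phi> where \<phi>: "pe \<phi> ({v, w} \<union> A)" "\<phi> v = x" "\<phi> w = y" "\<forall>a \<in> A - {v, w}. \<phi> a \<notin> G"
    using extend[OF _ A(1) assms(2) pe_pair[OF assms(1) A(4,5)]] A(4) by auto
  have "frees (\<phi> ` A) x y (q x y)"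
  proof (rule frees_transfer[OF A(6,1)])
    show "pe \<phi> A" using \<phi>(1) by (rule pe_subset) auto
    show "un x = un v" "un y = un w" using A(5) by (auto simp: q_def)
    show "bn x (\<phi> a) = bn v a" "bn y (\<phi> a) = bn w a" if "a \<in> A" for a
      using pe_bn[OF \<phi>(1), of v a] pe_bn[OF \<phi>(1), of w a] \<phi>(2,3) that A(2,3) by fastforce+
  qed
  moreover have "x \<notin> \<phi> ` A" "y \<notin> \<phi> ` A"
  proof -
    have "inj_on \<phi> ({v, w} \<union> A)" using \<phi>(1) by (simp add: pe_def)
    then show "x \<notin> \<phi> ` A" "y \<notin> \<phi> ` A" using A \<phi>(2,3) by (auto simp: inj_on_def)
  qed
  ultimately show ?thesis using that[of "\<phi> ` A"] A \<phi>(4) by auto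
qed

text \<open>A finite set with a pair of type \<open>q x y\<close> can be moved so that this pair
  becomes \<open>x, y\<close>. Joining \<open>A\<close> to the moved set makes the freedom of
  \<open>A\<close> applicable, and \<open>A\<close> is dropped afterwards.\<close>

lemma frees_changeable:
  assumes A: "finite A" "x \<notin> A" "y \<notin> A" "x \<noteq> y" "frees A x y T" and T: "fst T = un x" "fst (snd T) = un y"
  shows "changeable (q x y) T"
proof -
  have "changed F p r T" if F: "finite F" "p \<in> F" "r \<in> F" "p \<noteq> r" "q p r = q x y" for F p r
  proof -
    obtain \<psi> where \<psi>: "pe \<psi> ({p, r} \<union> F)" "\<psi> p = x" "\<psi> r = y" "\<forall>a \<in> F - {p, r}. \<psi> a \<notin> A"
      using extend[OF _ F(1) A(1) pe_pair[OF A(4) F(4,5)]] F(4) by auto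
    have pF: "pe \<psi> F" using \<psi>(1) by (rule pe_subset) auto
    have "x \<in> \<psi> ` F" "y \<in> \<psi> ` F" using \<psi> F by auto
    then have "changed (\<psi> ` F \<union> A) x y T"
      using A(1-4) F(1) by (intro freesD[OF A(5)]) (auto simp: same_def)
    then have "changed (\<psi> ` F) (\<psi> p) (\<psi> r) T" using \<psi> by (auto intro: changed_mono)
    then show ?thesis using F(2,3) by (rule changed_pe[OF pF])
  qed
  then show ?thesis using T by (intro changeableI) (simp_all add: q_def)
qed

text \<open>The freedom of \<open>A\<close> lets \<open>p, r\<close> be changed to the type of
  \<open>x, y\<close>. For the way back, carry along a set \<open>B\<close> that frees
  \<open>p, r\<close> for their own old type: the change touches a single pair, so the changed
  vertices still have the old types over the image of \<open>B\<close>, which then frees them for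
  the old type.\<close>

lemma frees_decides:
  assumes A: "finite A" "x \<notin> A" "y \<notin> A" "x \<noteq> y" "frees A x y (q x y)"
  shows "decides A x y"
  unfolding decides_def
proof (intro allI impI)
  fix p r assume p: "p \<noteq> r" "p \<notin> A" "r \<notin> A" "same p x A" "same r y A"
  have un: "un p = un x" "un r = un y" using p by (auto simp: same_def)
  have 1: "changeable (q p r) (q x y)"
    using A p un by (intro frees_changeable[of A] frees_same[OF A(5)]) (auto simp: q_def)
  obtain B where B: "finite B" "p \<notin> B" "r \<notin> B" "B \<inter> A = {}" "frees B p r (q p r)"
    using free_at[OF p(1) A(1)] by blast
  let ?F = "insert p (insert r (A \<union> B))"
  have "changed ?F p r (q x y)"
    using p A(1) B(1) by (intro freesD[OF A(5)]) auto
  then obtain \<phi> where "change_map \<phi> ?F p r (q x y)"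
    by (auto simp: changed_def)
  note \<phi> = change_mapD[OF this]
  have "frees (\<phi> ` B) (\<phi> p) (\<phi> r) (q p r)"
  proof (rule frees_transfer[OF B(5,1)])
    have "{a, b} \<noteq> {p, r}" if "a \<in> B" for a b
      using that B(2,3) by (auto simp: doubleton_eq_iff)
    then show "pe \<phi> B"
      unfolding pe_def using \<phi>(2,4) by (intro conjI ballI impI inj_on_subset[OF \<phi>(1)]) auto
    show "un (\<phi> p) = un p" "un (\<phi> r) = un r" using \<phi>(2) by auto
    show "bn (\<phi> p) (\<phi> a) = bn p a" "bn (\<phi> r) (\<phi> a) = bn r a" if "a \<in> B" for a
    proof -
      have "p \<noteq> a" "r \<noteq> a" using that B by auto
      then show "bn (\<phi> p) (\<phi> a) = bn p a" "bn (\<phi> r) (\<phi> a) = bn r a"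
        using \<phi>(4)[of p a] \<phi>(4)[of r a] that p(1) by (auto simp: doubleton_eq_iff)
    qed
  qed
  moreover have "\<phi> p \<notin> \<phi> ` B" "\<phi> r \<notin> \<phi> ` B" "\<phi> p \<noteq> \<phi> r"
    using \<phi>(1) B(2,3) p(1) by (auto simp: inj_on_def)
  ultimately have "changeable (q (\<phi> p) (\<phi> r)) (q p r)"
    using B(1) \<phi>(2) by (intro frees_changeable[of "\<phi> ` B"]) (auto simp: q_def)
  then show "q p r \<cong> q x y" using 1 \<phi>(3) by (simp add: cong_def)
qed

lemma decide_pair:
  assumes "x \<noteq> y" "finite G"
  obtains E where "finite E" "E \<inter> G = {}" "decides E x y"
proof -
  obtain A where A: "finite A" "x \<notin> A" "y \<notin> A" "A \<inter> G = {}" "frees A x y (q x y)"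
    using free_at[OF assms] by blast
  show ?thesis
    by (rule that[OF A(1,4) frees_decides[OF A(1-3) assms(1) A(5)]])
qed

lemma cong_swap:
  assumes "q x y \<cong> q a b" "x \<noteq> y" "a \<noteq> b"
  shows "q y x \<cong> q b a"
proof -
  have *: "changeable (q y x) (q b a)" if c: "changeable (q x y) (q a b)" "x \<noteq> y" "a \<noteq> b" for x y a b
  proof -
    have "changed F r p (q b a)" if F: "finite F" "p \<in> F" "r \<in> F" "p \<noteq> r" "q r p = q y x" for F p r
    proof -
      have "q p r = q x y" using q_swap[OF F(5)] .
      then have "changed F p r (q a b)" using c F by (auto simp: changeable_def)
      then obtain \<phi> where "change_map \<phi> F p r (q a b)" by (auto simp: changed_def)
      then have "change_map \<phi> F r p (q b a)"
        using q_swap[of "\<phi> p" "\<phi> r" a b] by (simp add: change_map_def insert_commute)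
      then show ?thesis by (auto simp: changed_def)
    qed
    then show ?thesis using changeable_un[OF c(1)] by (intro changeableI) (simp_all add: q_def)
  qed
  show ?thesis using assms * unfolding cong_def by blast
qed

end

section \<open>Fraisse limits with SDAP\<close>

definition unS :: "('r \<Rightarrow> nat) \<Rightarrow> 'r struct \<Rightarrow> nat \<Rightarrow> 'r set" where
  "unS ar A x = {R. ar R = 1 \<and> [x] \<in> rels A R}"

text \<open>Both directions are recorded, so that the type of a pair determines the type of the
  reversed pair.\<close>

definition bnS :: "('r \<Rightarrow> nat) \<Rightarrow> 'r struct \<Rightarrow> nat \<Rightarrow> nat \<Rightarrow> 'r set \<times> 'r set" where
  "bnS ar A x y = ({R. ar R = 2 \<and> [x, y] \<in> rels A R}, {R. ar R = 2 \<and> [y, x] \<in> rels A R})"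

definition proper :: "('r \<Rightarrow> nat) \<Rightarrow> 'r struct \<Rightarrow> bool" where
  "proper ar A \<longleftrightarrow> is_struct ar A \<and> (\<forall>R. \<forall>xs \<in> rels A R. distinct xs)"

lemma length_1_or_2:
  assumes "length xs = (n::nat)" "n \<in> {1, 2}"
  obtains a where "xs = [a]" "n = 1" | a b where "xs = [a, b]" "n = 2"
  using assms by (auto simp: length_Suc_conv numeral_2_eq_2)

lemma embeddingI:
  assumes ar: "\<And>R. ar R \<in> {1, 2}" and A: "proper ar A" and B: "proper ar B"
    and f: "inj_on f (univ A)" "f ` univ A \<subseteq> univ B"
    and un: "\<And>a. a \<in> univ A \<Longrightarrow> unS ar B (f a) = unS ar A a"
    and bn: "\<And>a b. a \<in> univ A \<Longrightarrow> b \<in> univ A \<Longrightarrow> a \<noteq> b \<Longrightarrow> bnS ar B (f a) (f b) = bnS ar A a b"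
  shows "embedding f A B"
proof -
  have "xs \<in> rels A R \<longleftrightarrow> map f xs \<in> rels B R" if xs: "set xs \<subseteq> univ A" for R xs
  proof (cases "length xs = ar R")
    case False
    then have "length xs \<noteq> ar R" "length (map f xs) \<noteq> ar R" by auto
    then have "xs \<notin> rels A R" "map f xs \<notin> rels B R"
      using A B unfolding proper_def is_struct_def by blast+
    then show ?thesis by simp
  next
    case True
    consider (1) a where "xs = [a]" "ar R = 1" | (2) a b where "xs = [a, b]" "ar R = 2"
      using length_1_or_2[OF True ar[of R]] by metis
    then show ?thesis
    proof cases
      case (1 a)
      then have "R \<in> unS ar B (f a) \<longleftrightarrow> R \<in> unS ar A a" using un xs by simp
      then show ?thesis using 1 by (simp add: unS_def)
    next
      case (2 a b)
      show ?thesis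
      proof (cases "a = b")
        case True
        then have "\<not> distinct xs" "\<not> distinct (map f xs)" using 2 by auto
        then have "xs \<notin> rels A R" "map f xs \<notin> rels B R"
          using A B unfolding proper_def by blast+
        then show ?thesis by simp
      next
        case False
        then have "bnS ar B (f a) (f b) = bnS ar A a b" using bn 2 xs by simp
        then have "R \<in> fst (bnS ar B (f a) (f b)) \<longleftrightarrow> R \<in> fst (bnS ar A a b)" by simp
        then show ?thesis using 2 by (simp add: bnS_def)
      qed
    qed
  qed
  then show ?thesis using f by (auto simp: embedding_def)
qed

lemma embedding_unS:
  assumes "embedding f A B" "a \<in> univ A"
  shows "unS ar B (f a) = unS ar A a"
proof -
  have "[a] \<in> rels A R \<longleftrightarrow> map f [a] \<in> rels B R" for R
    using assms unfolding embedding_def by (metis empty_set empty_subsetI insert_subset list.simps(15))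
  then show ?thesis by (simp add: unS_def)
qed

lemma embedding_bnS:
  assumes "embedding f A B" "a \<in> univ A" "b \<in> univ A"
  shows "bnS ar B (f a) (f b) = bnS ar A a b"
proof -
  have "xs \<in> rels A R \<longleftrightarrow> map f xs \<in> rels B R" if "set xs \<subseteq> univ A" for R xs
    using assms that unfolding embedding_def by blast
  from this[of "[a, b]"] this[of "[b, a]"] assms show ?thesis by (simp add: bnS_def)
qed

lemma embedding_comp: "embedding f A B \<Longrightarrow> embedding g B C \<Longrightarrow> embedding (g \<circ> f) A C"
proof -
  assume fg: "embedding f A B" "embedding g B C"
  have "xs \<in> rels A R \<longleftrightarrow> map (g \<circ> f) xs \<in> rels C R" if xs: "set xs \<subseteq> univ A" for R xs
  proof -
    have "set (map f xs) \<subseteq> univ B" using fg(1) xs by (auto simp: embedding_def)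
    then show ?thesis using fg xs unfolding embedding_def by (metis map_map)
  qed
  moreover have "inj_on (g \<circ> f) (univ A)"
    using fg unfolding embedding_def by (meson comp_inj_on inj_on_subset)
  ultimately show ?thesis using fg unfolding embedding_def by (auto simp: image_subset_iff)
qed

lemma induced_simps [simp]: "univ (induced A X) = X"
  "rels (induced A X) R = {xs \<in> rels A R. set xs \<subseteq> X}"
  by (simp_all add: induced_def)

lemma unS_induced [simp]: "x \<in> X \<Longrightarrow> unS ar (induced A X) x = unS ar A x"
  by (simp add: unS_def)

lemma bnS_induced [simp]: "x \<in> X \<Longrightarrow> y \<in> X \<Longrightarrow> bnS ar (induced A X) x y = bnS ar A x y"
  by (simp add: bnS_def)

lemma proper_induced: "proper ar A \<Longrightarrow> proper ar (induced A X)"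
  by (auto simp: proper_def is_struct_def)

lemma struct_eqI:
  fixes A B :: "'r struct"
  assumes "univ A = univ B" "\<And>R. rels A R = rels B R"
  shows "A = B"
  using assms by (cases A; cases B) (auto simp: fun_eq_iff)

lemma embedding_induced_id: "X \<subseteq> univ B \<Longrightarrow> embedding id (induced B X) B"
  by (auto simp: embedding_def)

lemma substructure_embedding: "substructure A B \<Longrightarrow> embedding id A B"
  unfolding substructure_def by (metis embedding_induced_id)

text \<open>A copy with a prescribed universe. It serves to relabel finite parts of the limit, to
  permute the enumeration, and to build the final structure from an embedding into the
  limit.\<close>

definition pull :: "(nat \<Rightarrow> nat) \<Rightarrow> 'r struct \<Rightarrow> nat set \<Rightarrow> 'r struct" where
  "pull \<kappa> A S = \<lparr>univ = S, rels = (\<lambda>R. {xs. set xs \<subseteq> S \<and> map \<kappa> xs \<in> rels A R})\<rparr>"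

lemma pull_simps [simp]: "univ (pull \<kappa> A S) = S"
  "xs \<in> rels (pull \<kappa> A S) R \<longleftrightarrow> set xs \<subseteq> S \<and> map \<kappa> xs \<in> rels A R"
  by (simp_all add: pull_def)

lemma embedding_pull: "inj_on \<kappa> S \<Longrightarrow> \<kappa> ` S \<subseteq> univ A \<Longrightarrow> embedding \<kappa> (pull \<kappa> A S) A"
  by (auto simp: embedding_def)

lemma is_struct_pull:
  assumes "is_struct ar A"
  shows "is_struct ar (pull \<kappa> A S)"
proof -
  have "length xs = ar R" if "map \<kappa> xs \<in> rels A R" for R xs
    using assms that unfolding is_struct_def by (metis length_map)
  then show ?thesis by (auto simp: is_struct_def)
qed

locale fraisse_limit =
  fixes ar :: "'r::finite \<Rightarrow> nat" and \<K> :: "'r struct set" and M :: "'r struct"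
  assumes ar: "\<And>R. ar R \<in> {1, 2}"
    and limit: "enumerated_fraisse_limit ar \<K> M"
    and dap: "disjoint_amalgamation \<K>"
    and distinct_tuples: "\<And>A R xs. A \<in> \<K> \<Longrightarrow> xs \<in> rels A R \<Longrightarrow> distinct xs"
begin

abbreviation "un \<equiv> unS ar M"
abbreviation "bn \<equiv> bnS ar M"

sublocale homog un bn .

lemma univ_M [simp]: "univ M = UNIV"
  using limit by (simp add: enumerated_fraisse_limit_def)

lemma K_iff: "A \<in> \<K> \<longleftrightarrow> is_struct ar A \<and> finite (univ A) \<and> embeds A M"
  using limit by (auto simp: enumerated_fraisse_limit_def age_def)

lemma struct_M: "is_struct ar M"
  using limit by (simp add: enumerated_fraisse_limit_def)

lemma induced_K: "finite F \<Longrightarrow> induced M F \<in> \<K>"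
  using struct_M embedding_induced_id[of F M] by (auto simp: K_iff embeds_def is_struct_def)

lemma pull_K: "finite S \<Longrightarrow> inj_on \<kappa> S \<Longrightarrow> pull \<kappa> M S \<in> \<K>"
  using is_struct_pull[OF struct_M] embedding_pull[of \<kappa> S M] by (auto simp: K_iff embeds_def)

lemma proper_M: "proper ar M"
proof -
  have "distinct xs" if "xs \<in> rels M R" for R xs
    using distinct_tuples[OF induced_K[of "set xs"], of xs R] that by simp
  then show ?thesis using struct_M by (auto simp: proper_def)
qed

lemma proper_K: "A \<in> \<K> \<Longrightarrow> proper ar A"
  using distinct_tuples K_iff by (auto simp: proper_def)

lemma embedding_pe: "embedding f A M \<Longrightarrow> A = induced M X \<Longrightarrow> pe f X"
  using embedding_unS[of f A M _ ar] embedding_bnS[of f A M _ _ ar]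
  by (auto simp: pe_def embedding_def)

lemma pe_embedding:
  assumes "pe f X" "f ` X \<subseteq> Y"
  shows "embedding f (induced M X) (induced M Y)"
  using assms by (intro embeddingI[OF ar proper_induced[OF proper_M] proper_induced[OF proper_M]])
    (auto simp: pe_def image_subset_iff)

text \<open>Amalgamating \<open>F\<close> with \<open>y\<close> added and the image of
  \<open>F\<close> with \<open>G\<close> added, disjointly over \<open>F\<close>, makes the new
  vertex avoid \<open>G\<close>. After embedding the amalgam into the limit, ultrahomogeneity moves
  the second part back to its original place.\<close>

lemma homogeneous_extension:
  assumes F: "finite F" and G: "finite G" and \<phi>: "pe \<phi> F" and y: "y \<notin> F"
  shows "\<exists>y'. y' \<notin> G \<and> pe (\<phi>(y := y')) (insert y F)"
proof -
  let ?A = "induced M F" and ?B = "induced M (insert y F)" and ?C = "induced M (\<phi> ` F \<union> G)"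
  have "embedding id ?A ?B" by (rule pe_embedding[OF pe_id]) auto
  moreover have "embedding \<phi> ?A ?C" by (rule pe_embedding[OF \<phi>]) auto
  moreover have "?A \<in> \<K>" "?B \<in> \<K>" "?C \<in> \<K>" using F G by (auto intro: induced_K)
  ultimately obtain D g h where D: "D \<in> \<K>" "embedding g ?B D" "embedding h ?C D"
    "\<And>a. a \<in> univ ?A \<Longrightarrow> g (id a) = h (\<phi> a)" "g ` univ ?B \<inter> h ` univ ?C = g ` id ` univ ?A"
    using dap unfolding disjoint_amalgamation_def by metis
  obtain m where m: "embedding m D M" using D(1) by (auto simp: K_iff embeds_def)
  let ?X = "\<phi> ` F \<union> G"
  have mh: "pe (m \<circ> h) ?X" using embedding_pe[OF embedding_comp[OF D(3) m]] by simp
  have mg: "pe (m \<circ> g) (insert y F)" using embedding_pe[OF embedding_comp[OF D(2) m]] by simp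
  let ?w = "the_inv_into ?X (m \<circ> h)"
  have w_img: "?w ` ((m \<circ> h) ` ?X) = ?X" using the_inv_into_onto[OF pe_inj[OF mh]] .
  have "is_iso ?w (induced M ((m \<circ> h) ` ?X)) (induced M ?X)"
    unfolding is_iso_def using pe_embedding[OF pe_inv[OF mh] eq_refl[OF w_img]] w_img by simp
  moreover have "finite ((m \<circ> h) ` ?X)" using F G by simp
  ultimately obtain H where H: "is_iso H M M" "\<And>a. a \<in> (m \<circ> h) ` ?X \<Longrightarrow> H a = ?w a"
    using limit unfolding enumerated_fraisse_limit_def ultrahomogeneous_def
    by (metis (no_types, lifting) subset_UNIV univ_M)
  have Hid: "H (m (h x)) = x" if "x \<in> ?X" for x
    using H(2)[of "m (h x)"] the_inv_into_f_f[OF pe_inj[OF mh] that] that by simp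
  have H_emb: "embedding H M M" "inj H" using H(1) by (auto simp: is_iso_def embedding_def)
  have m_inj: "inj_on m (univ D)" using m by (simp add: embedding_def)
  have gD: "g ` insert y F \<subseteq> univ D" "h ` ?X \<subseteq> univ D" "inj_on g (insert y F)"
    using D(2,3) by (auto simp: embedding_def)
  have "H (m (g y)) \<notin> G"
  proof
    assume G: "H (m (g y)) \<in> G"
    then have "H (m (h (H (m (g y))))) = H (m (g y))" using Hid by blast
    then have "m (h (H (m (g y)))) = m (g y)" using H_emb(2) by (simp add: inj_eq)
    then have "h (H (m (g y))) = g y" using m_inj gD G by (auto simp: inj_on_eq_iff)
    then have "g y \<in> g ` univ ?B \<inter> h ` univ ?C" using G by (metis IntI UnI2 imageI induced_simps(1) insertI1)
    then have "g y \<in> g ` id ` univ ?A" unfolding D(5) .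
    then have "g y \<in> g ` F" by simp
    then show False using gD(3) y by (auto simp: inj_on_def)
  qed
  moreover have "pe (\<phi>(y := H (m (g y)))) (insert y F)"
  proof (rule pe_cong)
    have "pe H ((m \<circ> g) ` insert y F)"
      using embedding_comp[OF embedding_induced_id H_emb(1), of "(m \<circ> g) ` insert y F"] embedding_pe by simp
    then show "pe (H \<circ> (m \<circ> g)) (insert y F)" by (rule pe_comp[OF mg])
    show "(\<phi>(y := H (m (g y)))) x = (H \<circ> (m \<circ> g)) x" if "x \<in> insert y F" for x
      using that D(4)[of x] Hid[of "\<phi> x"] by auto
  qed
  ultimately show ?thesis by blast
qed

sublocale homog_ext un bn
proof
  show "bn y x = bn y' x'" if "bn x y = bn x' y'" for x y x' y'
    using that by (simp add: bnS_def)
qed (rule homogeneous_extension)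

lemma same_tuple:
  assumes "same p v A" "length zs = ar R" "Var \<in> set zs" "\<And>i. Par i \<in> set zs \<Longrightarrow> f i \<in> A"
  shows "map (case_tm p f) zs \<in> rels M R \<longleftrightarrow> map (case_tm v f) zs \<in> rels M R"
proof -
  consider (1) a where "zs = [a]" "ar R = 1" | (2) a b where "zs = [a, b]" "ar R = 2"
    using length_1_or_2[OF assms(2) ar[of R]] by metis
  then show ?thesis
  proof cases
  case (1 a)
  have "R \<in> un p \<longleftrightarrow> R \<in> un v" using assms(1) by (simp add: same_def)
  then show ?thesis using 1 assms(3) by (simp add: unS_def)
next
  case (2 a b)
  have "distinct [z, z]" if "[z, z] \<in> rels M R" for z
    using proper_M that unfolding proper_def by blast
  then have nd: "[z, z] \<notin> rels M R" for z by auto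
  show ?thesis
  proof (cases a; cases b)
    fix i assume ab: "a = Var" "b = Par i"
    then have "bn p (f i) = bn v (f i)" using assms(1,4) 2 by (simp add: same_def)
    then have "R \<in> fst (bn p (f i)) \<longleftrightarrow> R \<in> fst (bn v (f i))" by simp
    then show ?thesis using ab 2 by (simp add: bnS_def)
  next
    fix i assume ab: "a = Par i" "b = Var"
    then have "bn p (f i) = bn v (f i)" using assms(1,4) 2 by (simp add: same_def)
    then have "R \<in> snd (bn p (f i)) \<longleftrightarrow> R \<in> snd (bn v (f i))" by simp
    then show ?thesis using ab 2 by (simp add: bnS_def)
  qed (use assms(3) 2 nd in auto)
  qed
qed

end

locale fraisse_sdap = fraisse_limit ar \<K> M for ar :: "'r::finite \<Rightarrow> nat" and \<K> and M +
  assumes sdap: "SDAP ar \<K>"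
begin

lemma sdapE:
  assumes "A \<in> \<K>" "C \<in> \<K>" "substructure A C \<and> v \<noteq> w \<and> univ C - univ A = {v, w}"
  obtains A' C' e g where "A' \<in> \<K>" "C' \<in> \<K>" "substructure A' C'" "embedding g C C'"
    "univ A' \<inter> g ` univ C = e ` univ A"
    "\<And>B \<sigma> \<tau> D v''. B \<in> \<K> \<Longrightarrow> substructure A' B \<Longrightarrow> \<sigma> \<in> types_over ar \<K> B \<Longrightarrow> \<tau> \<in> types_over ar \<K> B \<Longrightarrow>
       tp_restrict \<sigma> (univ A') = tp ar UNIV C' (g v) (univ A') \<Longrightarrow>
       tp_restrict \<tau> (univ A') = tp ar UNIV C' (g w) (univ A') \<Longrightarrow> D \<in> \<K> \<Longrightarrow>
       one_vertex_ext B D v'' \<Longrightarrow> tp ar UNIV D v'' (univ B) = \<sigma> \<Longrightarrow>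
       \<exists>E \<in> \<K>. \<exists>w''. one_vertex_ext D E w'' \<and> tp ar UNIV E w'' (univ B) = \<tau> \<and>
          is_iso (e(v := v'', w := w'')) C (induced E (e ` univ A \<union> {v'', w''}))"
proof -
  have "\<forall>A \<in> \<K>. \<forall>C \<in> \<K>. \<forall>v w. substructure A C \<and> v \<noteq> w \<and> univ C - univ A = {v, w} \<longrightarrow>
       (\<exists>A' \<in> \<K>. \<exists>C' \<in> \<K>. \<exists>e g.
          embedding e A A' \<and> substructure A' C' \<and> embedding g C C' \<and>
          (\<forall>a \<in> univ A. g a = e a) \<and>
          univ A' \<inter> g ` univ C = e ` univ A \<and> univ C' = univ A' \<union> g ` univ C \<and>
          (\<forall>B \<in> \<K>. substructure A' B \<longrightarrow>
            (\<forall>\<sigma> \<in> types_over ar \<K> B. \<forall>\<tau> \<in> types_over ar \<K> B.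
               tp_restrict \<sigma> (univ A') = tp ar UNIV C' (g v) (univ A') \<and>
               tp_restrict \<tau> (univ A') = tp ar UNIV C' (g w) (univ A') \<longrightarrow>
               (\<forall>D \<in> \<K>. \<forall>v''. one_vertex_ext B D v'' \<and> tp ar UNIV D v'' (univ B) = \<sigma> \<longrightarrow>
                  (\<exists>E \<in> \<K>. \<exists>w''. one_vertex_ext D E w'' \<and> tp ar UNIV E w'' (univ B) = \<tau> \<and>
                     is_iso (e(v := v'', w := w'')) C
                       (induced E (e ` univ A \<union> {v'', w''})))))))"
    using sdap unfolding SDAP_def by (rule conjunct2)
  note this[rule_format, OF assms]
  then show ?thesis
    apply (elim bexE exE conjE)
    subgoal premises prems for A' C' e g
      by (rule that[OF prems(1,2,4,5,7)]) (rule prems(9)[rule_format]; simp)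
    done
qed

text \<open>SDAP is applied to the pair over the empty structure. It speaks of members of the class
  that literally contain \<open>A'\<close>, whereas the finite sets in question live in the limit;
  the work consists in relabelling them.\<close>

lemma sdap_free_pair:
  assumes xy: "x \<noteq> y"
  shows "\<exists>A v w. finite A \<and> v \<notin> A \<and> w \<notin> A \<and> v \<noteq> w \<and> q v w = q x y \<and> frees A v w (q x y)"
proof -
  let ?C = "induced M {x, y}" and ?A = "induced M {}"
  have AC: "?A \<in> \<K>" "?C \<in> \<K>" by (auto intro: induced_K)
  have sub: "substructure ?A ?C \<and> x \<noteq> y \<and> univ ?C - univ ?A = {x, y}"
    using xy by (auto simp: substructure_def intro!: struct_eqI)
  obtain A' C' e g where A': "A' \<in> \<K>" "C' \<in> \<K>" "substructure A' C'" "embedding g ?C C'"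
    and disj: "univ A' \<inter> g ` univ ?C = e ` univ ?A"
    and main: "\<And>B \<sigma> \<tau> D v''. B \<in> \<K> \<Longrightarrow> substructure A' B \<Longrightarrow> \<sigma> \<in> types_over ar \<K> B \<Longrightarrow> \<tau> \<in> types_over ar \<K> B \<Longrightarrow>
       tp_restrict \<sigma> (univ A') = tp ar UNIV C' (g x) (univ A') \<Longrightarrow>
       tp_restrict \<tau> (univ A') = tp ar UNIV C' (g y) (univ A') \<Longrightarrow> D \<in> \<K> \<Longrightarrow>
       one_vertex_ext B D v'' \<Longrightarrow> tp ar UNIV D v'' (univ B) = \<sigma> \<Longrightarrow>
       \<exists>E \<in> \<K>. \<exists>w''. one_vertex_ext D E w'' \<and> tp ar UNIV E w'' (univ B) = \<tau> \<and>
          is_iso (e(x := v'', y := w'')) ?C (induced E (e ` univ ?A \<union> {v'', w''}))"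
    by (rule sdapE[OF AC sub], rule that)
  obtain j where j: "embedding j C' M" using A'(2) by (auto simp: K_iff embeds_def)
  define A where "A = j ` univ A'"
  define v where "v = j (g x)"
  define w where "w = j (g y)"
  have A'C': "univ A' \<subseteq> univ C'" "A' = induced C' (univ A')" using A'(3) unfolding substructure_def by auto
  have gC: "g x \<in> univ C'" "g y \<in> univ C'" "g x \<notin> univ A'" "g y \<notin> univ A'"
    using A'(4) disj by (auto simp: embedding_def)
  have j_inj: "inj_on j (univ C')" using j by (simp add: embedding_def)
  have jg: "embedding (j \<circ> g) ?C M" by (rule embedding_comp[OF A'(4) j])
  have "pe (j \<circ> g) {x, y}" using embedding_pe[OF jg] by simp
  then have qvw: "q v w = q x y" using pe_q[of "j \<circ> g" "{x, y}" x y] xy by (simp add: v_def w_def)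
  have "v \<notin> A" "w \<notin> A" using gC A'C'(1) j_inj unfolding A_def v_def w_def
    by (auto simp: inj_on_def)
  have "g x \<noteq> g y" using A'(4) xy by (auto simp: embedding_def inj_on_def)
  then have "v \<noteq> w" using gC j_inj unfolding v_def w_def by (metis inj_onD)
  have finA': "finite (univ A')" using A'(1) by (simp add: K_iff)
  then have "finite A" by (simp add: A_def)
  have "frees A v w (q x y)"
    unfolding frees_def
  proof (intro allI impI)
    fix F p r assume F: "finite F" "A \<subseteq> F" "p \<in> F - A" "r \<in> F - A" "p \<noteq> r" "same p v A" "same r w A"
    \<comment> \<open>\<open>\<iota>\<close> sends \<open>A\<close> back onto the universe of
      \<open>A'\<close> and shifts every other vertex by \<open>N\<close>, beyond all elements of
      \<open>A'\<close>. Thus it is injective, and the relabelled structure contains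
      \<open>A'\<close> itself.\<close>
    define N where "N = Suc (Max (insert 0 (univ A')))"
    define \<iota> where "\<iota> z = (if z \<in> A then the_inv_into (univ A') j z else N + z)" for z
    have jA: "inj_on j (univ A')" using j_inj A'C'(1) by (rule inj_on_subset)
    have \<iota>j: "\<iota> (j a) = a" if "a \<in> univ A'" for a
      using that the_inv_into_f_f[OF jA that] by (simp add: \<iota>_def A_def)
    have N: "a < N" if "a \<in> univ A'" for a
      unfolding N_def less_Suc_eq_le using finA' that by (intro Max_ge) auto
    have \<iota>_A: "\<iota> z < N" if "z \<in> A" for z using that \<iota>j N by (auto simp: A_def)
    have \<iota>_out: "\<iota> z = N + z" if "z \<notin> A" for z using that by (simp add: \<iota>_def)
    have inj\<iota>: "inj \<iota>"
    proof (rule injI)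
      fix a b assume ab: "\<iota> a = \<iota> b"
      show "a = b"
      proof (cases "a \<in> A \<and> b \<in> A")
        case True
        then obtain a' b' where "a' \<in> univ A'" "b' \<in> univ A'" "a = j a'" "b = j b'" by (auto simp: A_def)
        then show ?thesis using ab \<iota>j[of a'] \<iota>j[of b'] by metis
      next
        case False
        then have "a \<notin> A \<or> b \<notin> A" by blast
        moreover have "a \<notin> A \<longrightarrow> b \<notin> A" "b \<notin> A \<longrightarrow> a \<notin> A"
          using ab \<iota>_A[of a] \<iota>_A[of b] \<iota>_out[of a] \<iota>_out[of b] by fastforce+
        ultimately have "N + a = N + b" using ab \<iota>_out[of a] \<iota>_out[of b] by metis
        then show ?thesis by simp
      qed
    qed
    define \<kappa> where "\<kappa> = the_inv \<iota>"
    have \<kappa>[simp]: "\<kappa> (\<iota> z) = z" for z using inj\<iota> by (simp add: \<kappa>_def the_inv_f_f)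
    have \<kappa>_inj: "inj_on \<kappa> (\<iota> ` X)" for X by (auto simp: inj_on_def)
    define P where "P X = pull \<kappa> M (\<iota> ` X)" for X
    have PK: "P X \<in> \<K>" if "finite X" for X unfolding P_def using that \<kappa>_inj by (intro pull_K) auto
    have map_in: "map \<kappa> zs \<in> rels M R \<longleftrightarrow> zs \<in> rels (P X) R" if "set zs \<subseteq> \<iota> ` X" for zs R X
      using that by (simp add: P_def)
    have PP: "substructure (P X) (P Y)" if "X \<subseteq> Y" for X Y
    proof -
      have "\<iota> ` X \<subseteq> \<iota> ` Y" using that by (rule image_mono)
      then have "rels (P X) R = rels (induced (P Y) (univ (P X))) R" for R
        unfolding P_def by fastforce
      then show ?thesis using that unfolding substructure_def by (auto simp: P_def intro!: struct_eqI)
    qed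
    \<comment> \<open>Both vertices of the pair are removed. \<open>p\<close> returns as the given
      one-vertex extension, while SDAP supplies a new vertex in the role of
      \<open>r\<close>.\<close>
    define B0 where "B0 = F - {p, r}"
    have AB0: "A \<subseteq> B0" using F by (auto simp: B0_def)
    have \<iota>_notin: "\<iota> z \<notin> \<iota> ` X" if "z \<notin> X" for z X using that inj\<iota> by (auto simp: inj_def)
    have ext1: "one_vertex_ext (P B0) (P (insert z B0)) (\<iota> z)" if "z \<notin> B0" for z
      using PP[of B0 "insert z B0"] \<iota>_notin[OF that] by (auto simp: one_vertex_ext_def P_def)
    have uA': "univ A' \<subseteq> \<iota> ` B0"
    proof
      fix a assume a: "a \<in> univ A'"
      then have "j a \<in> B0" using AB0 by (auto simp: A_def)
      then show "a \<in> \<iota> ` B0" using \<iota>j[OF a] by (metis imageI)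
    qed
    have \<kappa>j: "\<kappa> a = j a" if "a \<in> univ A'" for a using \<iota>j[OF that] \<kappa>[of "j a"] by simp
    have subA': "substructure A' (P B0)"
    proof -
      have "xs \<in> rels A' R \<longleftrightarrow> xs \<in> rels (induced (P B0) (univ A')) R" for xs R
      proof (cases "set xs \<subseteq> univ A'")
        case True
        have "xs \<in> rels A' R \<longleftrightarrow> xs \<in> rels C' R" using A'C'(2) True by (metis (no_types, lifting) induced_simps(2) mem_Collect_eq)
        also have "\<dots> \<longleftrightarrow> map j xs \<in> rels M R" using j True A'C'(1) unfolding embedding_def by blast
        also have "map j xs = map \<kappa> xs" using True \<kappa>j by auto
        finally show ?thesis using True uA' by (auto simp: P_def)
      next
        case False
        then show ?thesis using A'(1) by (auto simp: K_iff is_struct_def)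
      qed
      then have "A' = induced (P B0) (univ A')" by (intro struct_eqI) auto
      then show ?thesis using uA' unfolding substructure_def by (simp add: P_def)
    qed
    have tuple: "map (case_tm (\<iota> z) id) zs \<in> rels (P (insert z B0)) R \<longleftrightarrow> map (case_tm z \<kappa>) zs \<in> rels M R"
      if "\<And>i. Par i \<in> set zs \<Longrightarrow> i \<in> \<iota> ` B0" for z zs R
    proof -
      have S: "set (map (case_tm (\<iota> z) id) zs) \<subseteq> \<iota> ` insert z B0"
        using that by (auto split: tm.splits)
      have E: "map \<kappa> (map (case_tm (\<iota> z) id) zs) = map (case_tm z \<kappa>) zs"
        by (auto split: tm.splits)
      show ?thesis using map_in[OF S, of R] unfolding E by blast
    qed
    have rtp: "tp_restrict (tp ar UNIV (P (insert z B0)) (\<iota> z) (\<iota> ` B0)) (univ A') = tp ar UNIV C' c (univ A')"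
      if z: "same z (j c) A" "c \<in> univ C'" for z c
    proof -
      have "holds (P (insert z B0)) (case_tm (\<iota> z) id) \<phi> \<longleftrightarrow> holds C' (case_tm c id) \<phi>"
        if \<phi>: "\<phi> \<in> lits ar UNIV (univ A')" for \<phi>
      proof -
        let ?R = "sym \<phi>" and ?zs = "args \<phi>"
        have zs: "length ?zs = ar ?R" "Var \<in> set ?zs" "\<And>i. Par i \<in> set ?zs \<Longrightarrow> i \<in> univ A'"
          using \<phi> by (auto simp: lits_def par_def)
        have "map (case_tm (\<iota> z) id) ?zs \<in> rels (P (insert z B0)) ?R \<longleftrightarrow> map (case_tm z \<kappa>) ?zs \<in> rels M ?R"
          using zs(3) uA' by (intro tuple) auto
        also have "map (case_tm z \<kappa>) ?zs = map (case_tm z j) ?zs"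
          using zs(3) \<kappa>j by (auto split: tm.splits)
        also have "map (case_tm z j) ?zs \<in> rels M ?R \<longleftrightarrow> map (case_tm (j c) j) ?zs \<in> rels M ?R"
          using zs by (intro same_tuple[OF z(1)]) (auto simp: A_def)
        also have "map (case_tm (j c) j) ?zs = map j (map (case_tm c id) ?zs)"
          by (auto split: tm.splits)
        also have "map j (map (case_tm c id) ?zs) \<in> rels M ?R \<longleftrightarrow> map (case_tm c id) ?zs \<in> rels C' ?R"
        proof -
          have "set (map (case_tm c id) ?zs) \<subseteq> univ C'"
            using zs(3) A'C'(1) z(2) by (fastforce split: tm.splits)
          then show ?thesis using j unfolding embedding_def by blast
        qed
        finally show ?thesis by (cases \<phi>) auto
      qed
      moreover have "lits ar UNIV (univ A') \<subseteq> lits ar UNIV (\<iota> ` B0)" using uA' by (auto simp: lits_def)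
      ultimately show ?thesis
        unfolding tp_restrict_def tp_def lits_def by blast
    qed
    have pr: "p \<notin> B0" "r \<notin> B0" "finite B0" using F(1) by (auto simp: B0_def)
    have ty: "tp ar UNIV (P (insert z B0)) (\<iota> z) (univ (P B0)) \<in> types_over ar \<K> (P B0)" if "z \<notin> B0" for z
      unfolding types_over_def using ext1[OF that] PK[of "insert z B0"] pr(3) by blast
    have uP: "univ (P B0) = \<iota> ` B0" by (simp add: P_def)
    have t1: "tp_restrict (tp ar UNIV (P (insert p B0)) (\<iota> p) (univ (P B0))) (univ A') = tp ar UNIV C' (g x) (univ A')"
      unfolding uP using F(6) gC(1) by (intro rtp) (simp_all add: v_def)
    have t2: "tp_restrict (tp ar UNIV (P (insert r B0)) (\<iota> r) (univ (P B0))) (univ A') = tp ar UNIV C' (g y) (univ A')"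
      unfolding uP using F(7) gC(2) by (intro rtp) (simp_all add: w_def)
    have PKp: "P (insert p B0) \<in> \<K>" using pr(3) by (intro PK) simp
    obtain E w'' where E: "E \<in> \<K>" "one_vertex_ext (P (insert p B0)) E w''"
      "tp ar UNIV E w'' (univ (P B0)) = tp ar UNIV (P (insert r B0)) (\<iota> r) (univ (P B0))"
      "is_iso (e(x := \<iota> p, y := w'')) ?C (induced E (e ` univ ?A \<union> {\<iota> p, w''}))"
      using main[OF PK[OF pr(3)] subA' ty[OF pr(1)] ty[OF pr(2)] t1 t2 PKp ext1[OF pr(1)] refl] by blast
    obtain m where m: "embedding m E M" using E(1) by (auto simp: K_iff embeds_def)
    have uE: "w'' \<notin> \<iota> ` insert p B0" "univ E = insert w'' (\<iota> ` insert p B0)" "substructure (P (insert p B0)) E"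
      using E(2) by (auto simp: one_vertex_ext_def P_def)
    \<comment> \<open>All vertices but \<open>r\<close> return through an embedding of
      \<open>E\<close> into the limit, and \<open>r\<close> goes to the new vertex. Over
      \<open>B0\<close> the new vertex has the type of \<open>r\<close>, so only the pair
      \<open>p, r\<close> has changed.\<close>
    define \<theta> where "\<theta> z = (if z = r then m w'' else m (\<iota> z))" for z
    have Fr: "F - {r} = insert p B0" "F = insert r (insert p B0)" using F(3-5) by (auto simp: B0_def)
    have "embedding (m \<circ> id) (P (insert p B0)) M" by (rule embedding_comp[OF substructure_embedding[OF uE(3)] m])
    moreover have "embedding \<iota> (induced M (insert p B0)) (P (insert p B0))"
    proof -
      have "map \<kappa> (map \<iota> xs) = xs" for xs by (simp add: map_idI)
      then show ?thesis using inj\<iota> by (auto simp: embedding_def P_def inj_on_def inj_def)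
    qed
    ultimately have "embedding (m \<circ> id \<circ> \<iota>) (induced M (insert p B0)) M"
      by (rule embedding_comp[rotated])
    then have "pe (m \<circ> id \<circ> \<iota>) (insert p B0)" using embedding_pe by blast
    then have pe\<theta>: "pe \<theta> (insert p B0)"
      by (rule pe_cong) (use pr(2) F(5) in \<open>auto simp: \<theta>_def\<close>)
    have m_inj: "inj_on m (univ E)" using m by (simp add: embedding_def)
    have rB: "map (case_tm (m w'') (m)) zs \<in> rels M R \<longleftrightarrow> map (case_tm r \<kappa>) zs \<in> rels M R"
      if zs: "length zs = ar R" "Var \<in> set zs" "\<And>i. Par i \<in> set zs \<Longrightarrow> i \<in> \<iota> ` B0" for zs R
    proof -
      have "Pos R zs \<in> lits ar UNIV (\<iota> ` B0)" using zs by (auto simp: lits_def par_def)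
      then have "holds E (case_tm w'' id) (Pos R zs) \<longleftrightarrow> holds (P (insert r B0)) (case_tm (\<iota> r) id) (Pos R zs)"
        using E(3) unfolding uP tp_def by blast
      then have 1: "map (case_tm w'' id) zs \<in> rels E R \<longleftrightarrow> map (case_tm (\<iota> r) id) zs \<in> rels (P (insert r B0)) R"
        by simp
      have "set (map (case_tm w'' id) zs) \<subseteq> univ E"
        using zs(3) uE(2) by (fastforce split: tm.splits)
      then have 2: "map (case_tm w'' id) zs \<in> rels E R \<longleftrightarrow> map m (map (case_tm w'' id) zs) \<in> rels M R"
        using m unfolding embedding_def by blast
      have 3: "map m (map (case_tm w'' id) zs) = map (case_tm (m w'') m) zs"
        by (auto split: tm.splits)
      show ?thesis using tuple[of zs r R] zs(3) 1 2 unfolding 3 by blast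
    qed
    have un_r: "un (\<theta> r) = un r"
    proof -
      have "[m w''] \<in> rels M R \<longleftrightarrow> [r] \<in> rels M R" if "ar R = 1" for R
        using rB[of "[Var]" R] that by simp
      then show ?thesis by (auto simp: unS_def \<theta>_def)
    qed
    have bn_r: "bn (\<theta> r) (\<theta> b) = bn r b" if b: "b \<in> B0" for b
    proof -
      have "b \<noteq> r" using b pr by auto
      moreover have "[m w'', m (\<iota> b)] \<in> rels M R \<longleftrightarrow> [r, b] \<in> rels M R"
        "[m (\<iota> b), m w''] \<in> rels M R \<longleftrightarrow> [b, r] \<in> rels M R" if "ar R = 2" for R
        using rB[of "[Var, Par (\<iota> b)]" R] rB[of "[Par (\<iota> b), Var]" R] that b by auto
      ultimately show ?thesis by (auto simp: bnS_def \<theta>_def)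
    qed
    have "q (\<theta> p) (\<theta> r) = q x y"
    proof -
      have "embedding (e(x := \<iota> p, y := w'')) ?C (induced E {\<iota> p, w''})"
        using E(4) by (simp add: is_iso_def)
      moreover have "embedding id (induced E {\<iota> p, w''}) E"
        using uE(2) by (intro embedding_induced_id) auto
      ultimately have "embedding (m \<circ> (id \<circ> e(x := \<iota> p, y := w''))) ?C M"
        by (intro embedding_comp[OF embedding_comp m])
      then have "pe (m \<circ> (id \<circ> e(x := \<iota> p, y := w''))) {x, y}" using embedding_pe by blast
      from pe_q[OF this, of x y] show ?thesis using xy F(5) by (simp add: \<theta>_def)
    qed
    moreover have "inj_on \<theta> F"
    proof -
      have "m w'' \<noteq> m (\<iota> z)" if "z \<in> insert p B0" for z
      proof
        assume "m w'' = m (\<iota> z)"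
        moreover have "w'' \<in> univ E" "\<iota> z \<in> univ E" using uE(2) that by auto
        ultimately have "w'' = \<iota> z" by (rule inj_onD[OF m_inj])
        then show False using uE(1) that by blast
      qed
      moreover have "\<theta> z = m (\<iota> z)" if "z \<in> insert p B0" for z
        using that pr(2) F(5) by (auto simp: \<theta>_def)
      ultimately have "\<theta> r \<notin> \<theta> ` insert p B0" by (force simp: \<theta>_def)
      then show ?thesis
        unfolding Fr(2) using pe_inj[OF pe\<theta>] by (subst inj_on_insert) auto
    qed
    moreover have "bn (\<theta> a) (\<theta> b) = bn a b" if ab: "a \<in> F" "b \<in> F" "a \<noteq> b" "{a, b} \<noteq> {p, r}" for a b
    proof (cases "a = r \<or> b = r")
      case False
      then show ?thesis using ab Fr pe_bn[OF pe\<theta>] by auto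
    next
      case True
      then consider "a = r" "b \<in> B0" | "b = r" "a \<in> B0" using ab by (auto simp: B0_def doubleton_eq_iff)
      then show ?thesis
      proof cases
        case 1
        then show ?thesis using bn_r by simp
      next
        case 2
        then show ?thesis using bn_swap[OF bn_r[OF 2(2)]] by simp
      qed
    qed
    moreover have "un (\<theta> a) = un a" if "a \<in> F" for a
      using that Fr un_r pe_un[OF pe\<theta>] by (cases "a = r") auto
    ultimately have "change_map \<theta> F p r (q x y)" by (auto simp: change_map_def)
    then show "changed F p r (q x y)" by (auto simp: changed_def)
  qed
  then show ?thesis
    using \<open>finite A\<close> \<open>v \<notin> A\<close> \<open>w \<notin> A\<close> \<open>v \<noteq> w\<close> qvw by blast
qed

sublocale homog_sdap un bn
  by unfold_locales (rule sdap_free_pair)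

end

section \<open>Coding trees\<close>

lemma restr_restr: "m \<le> l \<Longrightarrow> restr (restr t l) m = restr t m"
  by (auto simp: restr_def tp_restrict_def)

lemma len_restr [simp]: "len (restr t l) = l"
  by (simp add: restr_def)

lemma restr_0: "restr t 0 = (0, {})"
  by (simp add: restr_def)

lemma finite_lits:
  fixes ar :: "'r::finite \<Rightarrow> nat"
  assumes "finite B"
  shows "finite (lits ar W B)"
proof -
  define L where "L R = {zs. set zs \<subseteq> insert Var (Par ` B) \<and> length zs = ar R}" for R
  have "finite (L R)" for R unfolding L_def using assms by (intro finite_lists_length_eq) auto
  then have fin: "finite (\<Union>R. Pos R ` L R \<union> Neg R ` L R)" by auto
  have "\<phi> \<in> (\<Union>R. Pos R ` L R \<union> Neg R ` L R)" if \<phi>: "\<phi> \<in> lits ar W B" for \<phi>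
  proof -
    have "z \<in> insert Var (Par ` B)" if z: "z \<in> set (args \<phi>)" for z
    proof (cases z)
      case (Par i)
      then show ?thesis using z \<phi> by (auto simp: lits_def par_def)
    qed simp
    then have "args \<phi> \<in> L (sym \<phi>)" using \<phi> by (auto simp: L_def lits_def)
    then show ?thesis by (cases \<phi>) auto
  qed
  then show ?thesis using fin by (meson finite_subset subsetI)
qed

text \<open>The least element of the finite symmetric difference exists and lies in exactly one of
  the two sets.\<close>

lemma lex_less_total:
  assumes lo: "literal_order lo" and fin: "finite \<sigma>" "finite \<tau>" and ne: "\<sigma> \<noteq> \<tau>"
  shows "lex_less lo \<sigma> \<tau> \<longleftrightarrow> \<not> lex_less lo \<tau> \<sigma>"
proof -
  have tr: "trans lo" and irr: "irrefl lo" and tot: "total lo"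
    using lo by (auto simp: literal_order_def strict_linear_order_on_def)
  let ?D = "(\<sigma> - \<tau>) \<union> (\<tau> - \<sigma>)"
  have least: "\<exists>m\<in>D. \<forall>x\<in>D. x \<noteq> m \<longrightarrow> (m, x) \<in> lo" if "finite D" "D \<noteq> {}" for D
    using that
  proof (induction D rule: finite_ne_induct)
    case (singleton x)
    then show ?case by simp
  next
    case (insert x D)
    then obtain m where m: "m \<in> D" "\<forall>y\<in>D. y \<noteq> m \<longrightarrow> (m, y) \<in> lo" by blast
    have "x \<noteq> m" using insert m by auto
    then consider "(x, m) \<in> lo" | "(m, x) \<in> lo" using tot by (auto simp: total_on_def)
    then show ?case
    proof cases
      case 1
      then have "\<forall>y\<in>insert x D. y \<noteq> x \<longrightarrow> (x, y) \<in> lo" using m tr by (metis insertE transD)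
      then show ?thesis by blast
    next
      case 2
      then show ?thesis using m by blast
    qed
  qed
  have "?D \<noteq> {}" "finite ?D" using ne fin by auto
  from least[OF this(2,1)] obtain m where m: "m \<in> ?D" "\<forall>x\<in>?D. x \<noteq> m \<longrightarrow> (m, x) \<in> lo" by blast
  have asym: "(a, b) \<in> lo \<Longrightarrow> (b, a) \<notin> lo" for a b
    using tr irr by (meson irreflD transD)
  have uniq: "m' = m" if "m' \<in> ?D" "\<forall>x\<in>?D. x \<noteq> m' \<longrightarrow> (m', x) \<in> lo" for m'
    using m that asym by metis
  have 1: "lex_less lo \<sigma> \<tau> \<longleftrightarrow> m \<in> \<sigma> - \<tau>"
    unfolding lex_less_def using m uniq by (metis UnI1)
  have 2: "lex_less lo \<tau> \<sigma> \<longleftrightarrow> m \<in> \<tau> - \<sigma>"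
    unfolding lex_less_def using m uniq by (metis UnI2 sup_commute)
  show ?thesis using 1 2 m(1) by blast
qed

locale coding_tree_of = fraisse_limit ar \<K> M for ar :: "'r::finite \<Rightarrow> nat" and \<K> and M +
  fixes W :: "'r set" and lo :: "('r lit \<times> 'r lit) set"
  assumes W: "W \<in> tree_symbols ar" and lo: "literal_order lo"
begin

abbreviation "nd \<equiv> node ar W M"
abbreviation "cn \<equiv> coding_node ar W M"
abbreviation "CT \<equiv> coding_tree ar W M"
abbreviation "cidx \<equiv> coding_idx ar W M"
abbreviation "ml s t \<equiv> len (meet s t)"

definition "uW i = un i \<inter> W"

text \<open>Equality of the types of \<open>i\<close> and \<open>j\<close> over the first
  \<open>n\<close> vertices, as far as the tree records them. In the tree without unary symbols
  \<open>uW\<close> is always empty.\<close>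

definition agree :: "nat \<Rightarrow> nat \<Rightarrow> nat \<Rightarrow> bool" where
  "agree n i j \<longleftrightarrow> uW i = uW j \<and> (\<forall>k<n. bn i k = bn j k)"

lemma binary_W: "ar R = 2 \<Longrightarrow> R \<in> W"
  using W by (auto simp: tree_symbols_def)

lemma nd_subset:
  assumes "m \<le> n" "n \<le> j"
  shows "snd (nd m i) \<subseteq> snd (nd n j) \<longleftrightarrow> agree m i j"
proof
  assume sub: "snd (nd m i) \<subseteq> snd (nd n j)"
  have iff: "map (case_tm i id) zs \<in> rels M R \<longleftrightarrow> map (case_tm j id) zs \<in> rels M R"
    if "R \<in> W" "length zs = ar R" "Var \<in> set zs" "\<And>k. Par k \<in> set zs \<Longrightarrow> k < m" for R zs
  proof -
    have "Pos R zs \<in> lits ar W {..<m}" "Neg R zs \<in> lits ar W {..<m}"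
      using that by (auto simp: lits_def par_def)
    then have "map (case_tm i id) zs \<in> rels M R \<Longrightarrow> Pos R zs \<in> snd (nd n j)"
      "map (case_tm i id) zs \<notin> rels M R \<Longrightarrow> Neg R zs \<in> snd (nd n j)"
      using sub by (auto simp: node_def tp_def)
    then show ?thesis by (auto simp: node_def tp_def)
  qed
  have "uW i = uW j" using iff[of _ "[Var]"] by (auto simp: uW_def unS_def)
  moreover have "bn i k = bn j k" if "k < m" for k
    using iff[of _ "[Var, Par k]"] iff[of _ "[Par k, Var]"] that binary_W by (auto simp: bnS_def)
  ultimately show "agree m i j" by (simp add: agree_def)
next
  assume ag: "agree m i j"
  have "holds M (case_tm i id) \<phi> \<longleftrightarrow> holds M (case_tm j id) \<phi>" if \<phi>: "\<phi> \<in> lits ar W {..<m}" for \<phi>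
  proof -
    let ?R = "sym \<phi>" and ?zs = "args \<phi>"
    have zs: "?R \<in> W" "length ?zs = ar ?R" "Var \<in> set ?zs" "\<And>k. Par k \<in> set ?zs \<Longrightarrow> k < m"
      using \<phi> by (auto simp: lits_def par_def)
    have "map (case_tm i id) ?zs \<in> rels M ?R \<longleftrightarrow> map (case_tm j id) ?zs \<in> rels M ?R"
    proof -
      consider (1) a where "?zs = [a]" "ar ?R = 1" | (2) a b where "?zs = [a, b]" "ar ?R = 2"
        using length_1_or_2[OF zs(2) ar[of ?R]] by metis
      then show ?thesis
      proof cases
        case (1 a)
        have "?R \<in> uW i \<longleftrightarrow> ?R \<in> uW j" using ag by (simp add: agree_def)
        then show ?thesis using 1 zs by (simp add: uW_def unS_def)
      next
        case (2 a b)
        have "distinct [z, z]" if "[z, z] \<in> rels M ?R" for z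
          using proper_M that unfolding proper_def by blast
        then have nd: "[z, z] \<notin> rels M ?R" for z by auto
        have b: "?R \<in> fst (bn i k) \<longleftrightarrow> ?R \<in> fst (bn j k)" "?R \<in> snd (bn i k) \<longleftrightarrow> ?R \<in> snd (bn j k)" if "k < m" for k
          using ag that by (simp_all add: agree_def)
        show ?thesis
        proof (cases a; cases b)
          fix k assume ab: "a = Var" "b = Par k"
          then show ?thesis using 2 zs(4)[of k] b(1)[of k] by (simp add: bnS_def)
        next
          fix k assume ab: "a = Par k" "b = Var"
          then show ?thesis using 2 zs(4)[of k] b(2)[of k] by (simp add: bnS_def)
        qed (use zs(3) 2 nd in auto)
      qed
    qed
    then show ?thesis by (cases \<phi>) auto
  qed
  moreover have "lits ar W {..<m} \<subseteq> lits ar W {..<n}" using assms(1) by (auto simp: lits_def)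
  ultimately show "snd (nd m i) \<subseteq> snd (nd n j)" by (auto simp: node_def tp_def)
qed

lemma agree_sym: "agree n i j \<Longrightarrow> agree n j i"
  by (simp add: agree_def)

lemma nd_eq_iff: "n \<le> i \<Longrightarrow> n \<le> j \<Longrightarrow> nd n i = nd n j \<longleftrightarrow> agree n i j"
  using nd_subset[of n n j i] nd_subset[of n n i j] agree_sym[of n i j]
  by (auto simp: node_def)

lemma len_nd [simp]: "len (nd n i) = n + 1"
  by (simp add: node_def)

lemma len_cn [simp]: "len (cn i) = i + 1"
  by (simp add: coding_node_def)

lemma restr_nd: "1 \<le> l \<Longrightarrow> l \<le> n + 1 \<Longrightarrow> restr (nd n i) l = nd (l - 1) i"
  by (auto simp: restr_def node_def tp_restrict_def tp_def lits_def)

lemma CT_E: "t \<in> CT \<Longrightarrow> (\<And>n i. t = nd n i \<Longrightarrow> n \<le> i \<Longrightarrow> P) \<Longrightarrow> P"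
  by (auto simp: coding_tree_def tree_level_def)

lemma nd_CT: "n \<le> i \<Longrightarrow> nd n i \<in> CT"
  by (auto simp: coding_tree_def tree_level_def)

lemma cn_CT: "cn i \<in> CT"
  by (simp add: coding_node_def nd_CT)

lemma CT_len: "t \<in> CT \<Longrightarrow> 1 \<le> len t"
  by (auto elim: CT_E)

lemma restr_len: "t \<in> CT \<Longrightarrow> restr t (len t) = t"
  by (erule CT_E) (simp add: restr_nd)

lemma restr_CT: "t \<in> CT \<Longrightarrow> 1 \<le> l \<Longrightarrow> l \<le> len t \<Longrightarrow> restr t l \<in> CT"
  by (erule CT_E) (auto simp: restr_nd intro!: nd_CT)

lemma below_iff: "s \<in> CT \<Longrightarrow> t \<in> CT \<Longrightarrow> s \<sqsubseteq> t \<longleftrightarrow> len s \<le> len t \<and> restr t (len s) = s"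
proof (elim CT_E)
  fix m i n j assume *: "s = nd m i" "m \<le> i" "t = nd n j" "n \<le> j"
  show ?thesis
  proof (cases "m \<le> n")
    case True
    then show ?thesis
      using * nd_subset[of m n j i] nd_eq_iff[of m j i] agree_sym
      by (auto simp: below_def restr_nd)
  qed (use * in \<open>auto simp: below_def\<close>)
qed

lemma restr_below: "t \<in> CT \<Longrightarrow> 1 \<le> l \<Longrightarrow> l \<le> len t \<Longrightarrow> restr t l \<sqsubseteq> t"
  by (simp add: below_iff restr_CT)

lemma below_restr: "s \<in> CT \<Longrightarrow> t \<in> CT \<Longrightarrow> s \<sqsubseteq> t \<Longrightarrow> l \<le> len s \<Longrightarrow> restr t l = restr s l"
  by (metis below_iff restr_restr)

lemma below_trans: "s \<sqsubseteq> t \<Longrightarrow> t \<sqsubseteq> u \<Longrightarrow> s \<sqsubseteq> u"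
  by (auto simp: below_def)

lemma below_len: "s \<sqsubseteq> t \<Longrightarrow> len s \<le> len t"
  by (simp add: below_def)

lemma below_refl [simp]: "s \<sqsubseteq> s"
  by (simp add: below_def)

lemma below_antisym: "s \<in> CT \<Longrightarrow> t \<in> CT \<Longrightarrow> s \<sqsubseteq> t \<Longrightarrow> len s = len t \<Longrightarrow> s = t"
  by (metis below_iff restr_len)

lemma below_linear:
  assumes "a \<in> CT" "b \<in> CT" "t \<in> CT" "a \<sqsubseteq> t" "b \<sqsubseteq> t" "len a \<le> len b"
  shows "a \<sqsubseteq> b"
  using assms below_restr[of b t "len a"] by (simp add: below_iff)

lemma meet_aux:
  "ml s t \<le> len s \<and> ml s t \<le> len t \<and> restr s (ml s t) = restr t (ml s t)"
  "m \<le> len s \<Longrightarrow> m \<le> len t \<Longrightarrow> restr s m = restr t m \<Longrightarrow> m \<le> ml s t"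
proof -
  let ?P = "\<lambda>m. m \<le> len s \<and> m \<le> len t \<and> restr s m = restr t m"
  have ml: "ml s t = Greatest ?P" by (simp add: meet_def)
  have 0: "?P 0" by (simp add: restr_0)
  have b: "\<forall>m. ?P m \<longrightarrow> m \<le> len s" by blast
  show "ml s t \<le> len s \<and> ml s t \<le> len t \<and> restr s (ml s t) = restr t (ml s t)"
    unfolding ml by (rule GreatestI_nat[of ?P, OF 0]) blast
  show "m \<le> len s \<Longrightarrow> m \<le> len t \<Longrightarrow> restr s m = restr t m \<Longrightarrow> m \<le> ml s t"
    unfolding ml by (rule Greatest_le_nat[of ?P]) blast+
qed

lemma ml_le: "ml s t \<le> len s" "ml s t \<le> len t"
  using meet_aux(1) by blast+

lemma meet_restr: "meet s t = restr s (ml s t)" "meet s t = restr t (ml s t)"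
proof -
  show "meet s t = restr s (ml s t)" by (simp add: meet_def)
  then show "meet s t = restr t (ml s t)" using meet_aux(1)[of s t] by simp
qed

lemma restr_eq_iff: "m \<le> len s \<Longrightarrow> m \<le> len t \<Longrightarrow> restr s m = restr t m \<longleftrightarrow> m \<le> ml s t"
proof -
  assume m: "m \<le> len s" "m \<le> len t"
  have "restr s m = restr t m" if "m \<le> ml s t"
  proof -
    have "restr s m = restr (restr s (ml s t)) m" "restr t m = restr (restr t (ml s t)) m"
      using that by (simp_all add: restr_restr)
    then show ?thesis using meet_aux(1)[of s t] by simp
  qed
  then show ?thesis using meet_aux(2)[OF m] by blast
qed

lemma ml_commute: "ml s t = ml t s"
proof (rule antisym)
  show "ml s t \<le> ml t s"
    using meet_aux(1)[of s t] by (intro meet_aux(2)[of _ t s]) simp_all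
  show "ml t s \<le> ml s t"
    using meet_aux(1)[of t s] by (intro meet_aux(2)[of _ s t]) simp_all
qed

lemma meet_commute: "meet s t = meet t s"
  using meet_restr(1)[of s t] meet_restr(2)[of t s] ml_commute[of s t] by simp

lemma incomparable_iff: "s \<in> CT \<Longrightarrow> t \<in> CT \<Longrightarrow> incomparable s t \<longleftrightarrow> ml s t < len s \<and> ml s t < len t"
proof -
  assume st: "s \<in> CT" "t \<in> CT"
  have "s \<sqsubseteq> t \<longleftrightarrow> ml s t = len s"
    using st restr_eq_iff[of "len s" s t] ml_le[of s t] by (auto simp: below_iff restr_len)
  moreover have "t \<sqsubseteq> s \<longleftrightarrow> ml s t = len t"
    using st restr_eq_iff[of "len t" s t] ml_le[of s t] by (auto simp: below_iff restr_len)
  ultimately show ?thesis using ml_le[of s t] by (auto simp: incomparable_def)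
qed

lemma ml_restr: "l \<le> len s \<Longrightarrow> k \<le> len t \<Longrightarrow> ml (restr s l) (restr t k) = min (min l k) (ml s t)"
proof (rule antisym)
  assume lk: "l \<le> len s" "k \<le> len t"
  let ?m = "ml (restr s l) (restr t k)"
  have 1: "?m \<le> l" "?m \<le> k" using ml_le[of "restr s l" "restr t k"] by simp_all
  then have "restr s ?m = restr t ?m"
    using meet_aux(1)[of "restr s l" "restr t k"] by (simp add: restr_restr)
  then show "?m \<le> min (min l k) (ml s t)" using 1 lk restr_eq_iff[of ?m s t] by simp
  let ?n = "min (min l k) (ml s t)"
  have "restr s ?n = restr t ?n" using lk by (subst restr_eq_iff) auto
  then show "?n \<le> ?m" by (intro meet_aux(2)) (simp_all add: restr_restr)
qed

text \<open>Incomparable nodes have split already, so no extension can move their meet. For the same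
  reason their order persists in \<open>prec_above\<close>.\<close>

lemma meet_above:
  assumes "s \<in> CT" "t \<in> CT" "s' \<in> CT" "t' \<in> CT" "s \<sqsubseteq> s'" "t \<sqsubseteq> t'" "incomparable s t"
  shows "meet s' t' = meet s t" "incomparable s' t'"
proof -
  have r: "restr s' (len s) = s" "restr t' (len t) = t" "len s \<le> len s'" "len t \<le> len t'"
    using assms by (auto simp: below_iff)
  have lt: "ml s t < len s" "ml s t < len t" using assms incomparable_iff by auto
  have "ml s t = min (min (len s) (len t)) (ml s' t')"
    using ml_restr[of "len s" s' "len t" t'] r by simp
  then have eq: "ml s' t' = ml s t" using lt by auto
  then show "meet s' t' = meet s t"
    using meet_restr(1)[of s' t'] meet_restr(1)[of s t] r(1) lt(1) restr_restr[of "ml s t" "len s" s'] by simp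
  show "incomparable s' t'" using eq lt r assms incomparable_iff by auto
qed

lemma meet_below: "s \<in> CT \<Longrightarrow> t \<in> CT \<Longrightarrow> 0 < ml s t \<Longrightarrow> meet s t \<in> CT \<and> meet s t \<sqsubseteq> s \<and> meet s t \<sqsubseteq> t"
  using restr_CT[of s "ml s t"] restr_below[of s "ml s t"] restr_below[of t "ml s t"] ml_le[of s t]
    meet_restr[of s t] by (metis One_nat_def Suc_leI)

lemma finite_node: "t \<in> CT \<Longrightarrow> finite (snd t)"
  by (erule CT_E) (auto simp: node_def tp_def intro: finite_subset[OF _ finite_lits[of "{..<_}"]])

abbreviation "pr \<equiv> prec lo"

lemma prec_incomparable: "s \<in> CT \<Longrightarrow> t \<in> CT \<Longrightarrow> incomparable s t \<Longrightarrow>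
    pr s t \<longleftrightarrow> lex_less lo (snd (restr s (ml s t + 1))) (snd (restr t (ml s t + 1)))"
  by (auto simp: prec_def incomparable_def)

lemma prec_asym:
  assumes "s \<in> CT" "t \<in> CT" "incomparable s t"
  shows "pr t s \<longleftrightarrow> \<not> pr s t"
proof -
  have lt: "ml s t < len s" "ml s t < len t" using assms incomparable_iff by auto
  have "restr s (ml s t + 1) \<noteq> restr t (ml s t + 1)"
    using lt restr_eq_iff[of "ml s t + 1" s t] by simp
  then have "snd (restr s (ml s t + 1)) \<noteq> snd (restr t (ml s t + 1))"
    by (metis len_restr prod.collapse)
  moreover have "finite (snd (restr s (ml s t + 1)))" "finite (snd (restr t (ml s t + 1)))"
    using lt assms by (auto intro!: finite_node restr_CT)
  moreover have "incomparable t s" using assms(3) by (auto simp: incomparable_def)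
  ultimately show ?thesis
    using lex_less_total[OF lo] assms prec_incomparable[of s t] prec_incomparable[of t s] ml_commute[of t s]
    by metis
qed

lemma prec_above:
  assumes "s \<in> CT" "t \<in> CT" "s' \<in> CT" "t' \<in> CT" "s \<sqsubseteq> s'" "t \<sqsubseteq> t'" "incomparable s t"
  shows "pr s' t' \<longleftrightarrow> pr s t"
proof -
  note ma = meet_above[OF assms]
  have "ml s t < len s" "ml s t < len t" using assms incomparable_iff by auto
  then have "restr s' (ml s t + 1) = restr s (ml s t + 1)" "restr t' (ml s t + 1) = restr t (ml s t + 1)"
    using below_restr[OF assms(1,3,5)] below_restr[OF assms(2,4,6)] by auto
  then show ?thesis using prec_incomparable assms ma by simp
qed

lemma cn_agree: "k \<le> i \<Longrightarrow> k \<le> j \<Longrightarrow> restr (cn i) (k + 1) = restr (cn j) (k + 1) \<longleftrightarrow> agree k i j"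
  by (simp add: coding_node_def restr_nd nd_eq_iff)

end

locale diagonal_tree = coding_tree_of ar \<K> M W lo for ar :: "'r::finite \<Rightarrow> nat" and \<K> and M and W and lo +
  fixes T :: "'r node set"
  assumes sub: "subtree ar W M T" and diag: "diagonal ar W M T" and perf: "perfect T"
    and iso: "isomorphic (induced M (coding_idx ar W M T)) M"
begin

abbreviation "spl \<equiv> splitting T"
abbreviation "N \<equiv> cidx T"

lemma T_CT: "t \<in> T \<Longrightarrow> t \<in> CT"
  using sub by (auto simp: subtree_def)

lemma N_iff: "i \<in> N \<longleftrightarrow> cn i \<in> T"
  by (simp add: coding_idx_def)

lemma meet_T: "s \<in> T \<Longrightarrow> t \<in> T \<Longrightarrow> 0 < ml s t \<Longrightarrow> meet s t \<in> T"
  using sub by (auto simp: subtree_def meet_closed_def)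

lemma hatI: "t \<in> T \<Longrightarrow> 1 \<le> n \<Longrightarrow> n \<le> len t \<Longrightarrow> restr t n \<in> hat T"
  unfolding hat_def by blast

lemma spl_T: "spl b \<Longrightarrow> b \<in> T"
  by (simp add: splitting_def)

lemma spl_CT: "spl b \<Longrightarrow> b \<in> CT"
  using spl_T T_CT by blast

lemma succ_mem: "t \<in> T \<Longrightarrow> b \<in> CT \<Longrightarrow> b \<sqsubseteq> t \<Longrightarrow> len b < len t \<Longrightarrow> restr t (len b + 1) \<in> imm_succ T b"
  using T_CT[of t] restr_CT[of t "len b + 1"] by (auto simp: imm_succ_def below_iff restr_restr intro: hatI)

lemma succE:
  assumes "a \<in> imm_succ T b" "b \<in> CT"
  obtains t where "t \<in> T" "b \<sqsubseteq> t" "len b < len t" "a = restr t (len b + 1)" "a \<in> CT"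
proof -
  obtain t n where t: "t \<in> T" "1 \<le> n" "n \<le> len t" "a = restr t n" "b \<sqsubseteq> a" "len a = len b + 1"
    using assms by (auto simp: imm_succ_def hat_def)
  then have "a \<in> CT" "n = len b + 1" using T_CT restr_CT by auto
  moreover have "b \<sqsubseteq> t" using t T_CT by (meson below_trans restr_below)
  ultimately show ?thesis using that t by auto
qed

lemma meet_spl:
  assumes "u \<in> T" "w \<in> T" "incomparable u w" "0 < ml u w"
  shows "spl (meet u w)"
proof -
  let ?m = "meet u w"
  have CT: "u \<in> CT" "w \<in> CT" using assms T_CT by auto
  have lt: "ml u w < len u" "ml u w < len w" using assms CT incomparable_iff by auto
  have "?m \<in> T" using meet_T assms by blast
  moreover have "?m \<sqsubseteq> u" "?m \<sqsubseteq> w" using meet_below CT assms(4) by auto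
  then have "restr u (ml u w + 1) \<in> imm_succ T ?m" "restr w (ml u w + 1) \<in> imm_succ T ?m"
    using succ_mem lt assms \<open>?m \<in> T\<close> T_CT by auto
  moreover have "restr u (ml u w + 1) \<noteq> restr w (ml u w + 1)"
    using restr_eq_iff[of "ml u w + 1" u w] lt by simp
  ultimately show ?thesis by (auto simp: splitting_def)
qed

lemma splE:
  assumes "spl b"
  obtains t1 t2 where "t1 \<in> T" "t2 \<in> T" "b \<sqsubseteq> t1" "b \<sqsubseteq> t2" "incomparable t1 t2" "meet t1 t2 = b"
    "imm_succ T b = {restr t1 (len b + 1), restr t2 (len b + 1)}"
    "restr t1 (len b + 1) \<noteq> restr t2 (len b + 1)" "len b < len t1" "len b < len t2"
proof -
  have b: "b \<in> CT" using assms spl_CT by blast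
  obtain x y where xy: "x \<in> imm_succ T b" "y \<in> imm_succ T b" "x \<noteq> y" using assms by (auto simp: splitting_def)
  obtain t1 where t1: "t1 \<in> T" "b \<sqsubseteq> t1" "len b < len t1" "x = restr t1 (len b + 1)" using succE[OF xy(1) b] by blast
  obtain t2 where t2: "t2 \<in> T" "b \<sqsubseteq> t2" "len b < len t2" "y = restr t2 (len b + 1)" using succE[OF xy(2) b] by blast
  have CT: "t1 \<in> CT" "t2 \<in> CT" using t1 t2 T_CT by auto
  have "len b \<le> ml t1 t2" using restr_eq_iff[of "len b" t1 t2] t1 t2 CT b by (auto simp: below_iff)
  moreover have "ml t1 t2 < len b + 1" using restr_eq_iff[of "len b + 1" t1 t2] xy(3) t1 t2 by auto
  ultimately have ml: "ml t1 t2 = len b" by simp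
  have "card (imm_succ T b) = 2" using diag assms unfolding diagonal_def by blast
  then have "finite (imm_succ T b)" by (metis card.infinite zero_neq_numeral)
  then have "imm_succ T b = {x, y}"
    using xy \<open>card (imm_succ T b) = 2\<close> card_subset_eq[of "imm_succ T b" "{x, y}"] by auto
  moreover have "meet t1 t2 = b" using meet_restr(1)[of t1 t2] ml t1 CT b by (auto simp: below_iff)
  moreover have "incomparable t1 t2" using incomparable_iff CT ml t1 t2 by auto
  ultimately show ?thesis using that t1 t2 xy by auto
qed

lemma spl_level: "spl b \<Longrightarrow> t \<in> T \<Longrightarrow> len b \<le> len t \<Longrightarrow> restr t (len b) \<in> T"
proof -
  assume b: "spl b" and t: "t \<in> T" "len b \<le> len t"
  obtain t1 t2 where "t1 \<in> T" "t2 \<in> T" "incomparable t1 t2" "meet t1 t2 = b" using splE[OF b] by blast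
  then have "\<exists>u \<in> T. \<exists>w \<in> T. incomparable u w \<and> len b = len (meet u w)" by metis
  moreover have "1 \<le> len b" using b spl_CT CT_len by blast
  ultimately show ?thesis using sub t unfolding subtree_def by blast
qed

lemma coding_level: "i \<in> N \<Longrightarrow> t \<in> T \<Longrightarrow> i + 1 \<le> len t \<Longrightarrow> restr t (i + 1) \<in> T"
  using sub unfolding subtree_def by (metis le_add2 len_cn)

lemma spl_not_coding: "spl b \<Longrightarrow> i \<in> N \<Longrightarrow> len b \<noteq> i + 1"
  using diag unfolding diagonal_def by (metis len_cn)

lemma spl_unique: "spl b \<Longrightarrow> spl b' \<Longrightarrow> len b = len b' \<Longrightarrow> b = b'"
  using diag unfolding diagonal_def by blast

lemma succ_cases:
  assumes "spl b" "t1 \<in> T" "t2 \<in> T" "t3 \<in> T" "b \<sqsubseteq> t1" "b \<sqsubseteq> t2" "b \<sqsubseteq> t3" "len b < len t1" "len b < len t2" "len b < len t3"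
  shows "restr t1 (len b + 1) = restr t2 (len b + 1) \<or> restr t1 (len b + 1) = restr t3 (len b + 1) \<or>
    restr t2 (len b + 1) = restr t3 (len b + 1)"
proof -
  have b: "b \<in> CT" using assms spl_CT by blast
  obtain x y where "imm_succ T b = {x, y}" using splE[OF assms(1)] by metis
  moreover have "restr t1 (len b + 1) \<in> imm_succ T b" "restr t2 (len b + 1) \<in> imm_succ T b" "restr t3 (len b + 1) \<in> imm_succ T b"
    using succ_mem assms b by auto
  ultimately show ?thesis by auto
qed

lemma split_above:
  assumes "t \<in> T"
  obtains u w where "u \<in> T" "w \<in> T" "t \<sqsubseteq> u" "t \<sqsubseteq> w" "incomparable u w" "spl (meet u w)" "t \<sqsubseteq> meet u w"
proof -
  obtain u w where uw: "u \<in> T" "w \<in> T" "t \<sqsubseteq> u" "t \<sqsubseteq> w" "incomparable u w"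
    using perf assms by (auto simp: perfect_def)
  have CT: "u \<in> CT" "w \<in> CT" "t \<in> CT" using uw assms T_CT by auto
  have "len t \<le> ml u w" using restr_eq_iff[of "len t" u w] uw CT by (auto simp: below_iff)
  then have pos: "0 < ml u w" using CT_len[OF CT(3)] by simp
  have "t \<sqsubseteq> meet u w"
    using CT below_linear[of t "meet u w" u] meet_below[OF CT(1,2) pos] uw \<open>len t \<le> ml u w\<close> by auto
  then show ?thesis using that uw meet_spl[OF uw(1,2,5) pos] by blast
qed

lemma long_above:
  assumes "t \<in> T"
  shows "\<exists>t' \<in> T. t \<sqsubseteq> t' \<and> n \<le> len t'"
proof (induction n)
  case 0
  then show ?case using assms by (intro bexI[of _ t]) simp_all
next
  case (Suc n)
  then obtain t' where t': "t' \<in> T" "t \<sqsubseteq> t'" "n \<le> len t'" by blast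
  obtain u where u: "u \<in> T" "t' \<sqsubseteq> u" "u \<noteq> t'" using perf t'(1) by (auto simp: perfect_def)
  then have "len t' < len u" using below_antisym T_CT t'(1) below_len by (metis order_less_le)
  then show ?case using u t' below_trans[OF t'(2) u(2)] by (intro bexI[of _ u]) simp_all
qed

lemma finite_level: "finite {restr t l | t. t \<in> T \<and> l \<le> len t}"
proof -
  have "restr t l \<in> {l} \<times> Pow (lits ar W {..<l})" if "t \<in> T" "l \<le> len t" for t
    using T_CT[OF that(1)] that(2) by (auto elim!: CT_E simp: restr_def node_def tp_restrict_def tp_def lits_def)
  then have "{restr t l | t. t \<in> T \<and> l \<le> len t} \<subseteq> {l} \<times> Pow (lits ar W {..<l})" by blast
  then show ?thesis using finite_lits[of "{..<l}"] by (meson finite_Pow_iff finite_SigmaI finite.emptyI finite.insertI finite_lessThan finite_subset)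
qed

text \<open>Only finitely many nodes occur at length \<open>l\<close>; above each take a shortest
  splitting node. A long node over the same restriction must pass through it, since otherwise its
  meet with that splitting node would be a shorter one.\<close>

lemma path1:
  assumes l: "0 < l"
  shows "\<exists>L. \<forall>t \<in> T. L \<le> len t \<longrightarrow> (\<exists>b. spl b \<and> b \<sqsubseteq> t \<and> l \<le> len b \<and> len b < L)"
proof -
  let ?X = "{restr t l | t. t \<in> T \<and> l \<le> len t}"
  have ex: "\<exists>b. spl b \<and> l \<le> len b \<and> restr b l = x" if x: "x \<in> ?X" for x
  proof -
    obtain t where t: "t \<in> T" "l \<le> len t" "x = restr t l" using x by blast
    obtain b where b: "spl b" "t \<sqsubseteq> b" using split_above[OF t(1)] by blast
    then have "restr b l = x" using t below_restr[OF T_CT[OF t(1)] spl_CT[OF b(1)] b(2)] by simp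
    then show ?thesis using b t(2) below_len[OF b(2)] by (intro exI[of _ b]) simp
  qed
  define m where "m x = (LEAST k. \<exists>b. spl b \<and> l \<le> len b \<and> restr b l = x \<and> len b = k)" for x
  have m: "\<exists>b. spl b \<and> l \<le> len b \<and> restr b l = x \<and> len b = m x" if "x \<in> ?X" for x
    unfolding m_def by (rule LeastI_ex) (use ex[OF that] in blast)
  have m_le: "m (restr b l) \<le> len b" if "spl b" "l \<le> len b" for b
    unfolding m_def by (rule Least_le) (use that in blast)
  define L where "L = Suc (Max (insert l (m ` ?X)))"
  have mL: "m x < L" if "x \<in> ?X" for x
    unfolding L_def less_Suc_eq_le using that finite_level by (intro Max_ge) auto
  have "l \<le> Max (insert l (m ` ?X))" using finite_level by (intro Max_ge) auto
  then have lL: "l < L" by (simp add: L_def)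
  have "\<exists>b. spl b \<and> b \<sqsubseteq> t \<and> l \<le> len b \<and> len b < L" if t: "t \<in> T" "L \<le> len t" for t
  proof -
    have lt: "l \<le> len t" using t lL by simp
    then have X: "restr t l \<in> ?X" using t by blast
    obtain b where b: "spl b" "l \<le> len b" "restr b l = restr t l" "len b = m (restr t l)" using m[OF X] by blast
    have CT: "b \<in> CT" "t \<in> CT" using b t T_CT spl_CT by auto
    have bL: "len b < L" using mL[OF X] b by simp
    have "b \<sqsubseteq> t"
    proof (rule ccontr)
      assume nb: "\<not> b \<sqsubseteq> t"
      have "\<not> t \<sqsubseteq> b" using bL t(2) below_len by fastforce
      then have inc: "incomparable t b" using nb by (simp add: incomparable_def)
      have "l \<le> ml t b" using restr_eq_iff[of l t b] lt b by simp
      then have False: "0 < ml t b" using l by simp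
      show False
      proof -
        have lt2: "ml t b < len b" using inc CT incomparable_iff by simp
        have s: "spl (meet t b)" using meet_spl[OF t(1) spl_T[OF b(1)] inc False] .
        moreover have "restr (meet t b) l = restr t l"
          using meet_restr(1)[of t b] \<open>l \<le> ml t b\<close> restr_restr by metis
        ultimately have "m (restr t l) \<le> ml t b" using m_le[OF s] \<open>l \<le> ml t b\<close> by simp
        then show False using b(4) lt2 by simp
      qed
    qed
    then show ?thesis using b bL by blast
  qed
  then show ?thesis by blast
qed

end

section \<open>Extension of copies\<close>

context diagonal_tree
begin

text \<open>The side of \<open>s\<close> at the splitting node \<open>b\<close>, measured by the
  same count as in \<open>extension_situation\<close>.\<close>

definition position :: "'r node \<Rightarrow> 'r node \<Rightarrow> nat" where
  "position b s = card {x \<in> imm_succ T b. pr x s}"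

text \<open>Both clauses of the Extension Property imply this for a suitable \<open>\<psi>\<close>, which is constant in
  the case of the first clause.\<close>

definition extends_copies :: "('r node \<Rightarrow> nat) \<Rightarrow> bool" where
  "extends_copies \<psi> \<longleftrightarrow> (\<forall>A k u B f s.
     extension_situation ar W M lo T A k u B f s \<and>
     (\<forall>t \<in> first_levels k A.
        splitting (first_levels k A) t \<or> (t \<in> max_nodes (first_levels k A) \<and> spl t) \<longrightarrow> \<psi> (f t) = \<psi> t) \<longrightarrow>
     (\<forall>r \<in> T. s \<sqsubseteq> r \<longrightarrow> (\<exists>s'. spl s' \<and> r \<sqsubseteq> s' \<and> \<psi> s' = \<psi> u)) \<and>
     (\<forall>s'. spl s' \<and> s \<sqsubseteq> s' \<and> \<psi> s' = \<psi> u \<longrightarrow> extension_conclusion ar W M lo T A k u B f s'))"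

lemma passing_sim_refl: "passing_sim ar W M s n A s n A"
  unfolding passing_sim_def
proof (intro exI[of _ id] conjI allI impI)
  fix R zs
  have "case_tm Var (\<lambda>i. Par (id i)) = id" by (auto simp: fun_eq_iff split: tm.splits)
  then show "Pos R zs \<in> passing ar W M s n A \<longleftrightarrow>
      Pos R (map (case_tm Var (\<lambda>i. Par (id i))) zs) \<in> passing ar W M s n A" by simp
qed (auto simp: strict_mono_on_def)

lemma similarity_map_id: "meet_closed A \<Longrightarrow> similarity_map ar W M lo id A A"
  by (auto simp: similarity_map_def passing_sim_refl same_unary_def)

lemma T_similar: "T \<in> similar_subtrees ar W M lo T"
proof -
  have "meet_closed T" using sub by (auto simp: subtree_def)
  then have "similar ar W M lo T T" unfolding similar_def using similarity_map_id by blast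
  then show ?thesis using sub by (simp add: similar_subtrees_def)
qed

lemma extends_copies:
  assumes "extension_property_1 ar W M lo T \<or> extension_property_2 ar W M lo T"
  shows "\<exists>\<psi>. extends_copies \<psi>"
  using assms
proof
  assume e1: "extension_property_1 ar W M lo T"
  have "extends_copies (\<lambda>_. 0)"
    unfolding extends_copies_def
  proof (intro allI impI conjI)
    fix A k u B f s
    assume sit: "extension_situation ar W M lo T A k u B f s \<and>
      (\<forall>t \<in> first_levels k A. splitting (first_levels k A) t \<or> (t \<in> max_nodes (first_levels k A) \<and> spl t) \<longrightarrow> (0::nat) = 0)"
    show "\<forall>r \<in> T. s \<sqsubseteq> r \<longrightarrow> (\<exists>s'. spl s' \<and> r \<sqsubseteq> s' \<and> (0::nat) = 0)"
      using split_above by metis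
    show "extension_conclusion ar W M lo T A k u B f s'" if "spl s' \<and> s \<sqsubseteq> s' \<and> (0::nat) = 0" for s'
      using e1 T_similar sit that unfolding extension_property_1_def by blast
  qed
  then show ?thesis by blast
next
  assume "extension_property_2 ar W M lo T"
  then show ?thesis
    unfolding extension_property_2_def
  proof (elim exE conjE)
    fix q :: nat and \<psi> :: "'r node \<Rightarrow> nat"
    assume "2 \<le> q" "\<psi> ` {s. spl s} = {..<q}" and \<psi>: "\<forall>T' \<in> similar_subtrees ar W M lo T. \<forall>A k u B f s.
           extension_situation ar W M lo T' A k u B f s \<and>
           (\<forall>t \<in> first_levels k A.
              splitting (first_levels k A) t \<or> (t \<in> max_nodes (first_levels k A) \<and> splitting T' t) \<longrightarrow>
              \<psi> (f t) = \<psi> t) \<longrightarrow>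
           (\<forall>r \<in> T'. s \<sqsubseteq> r \<longrightarrow> (\<exists>s'. splitting T' s' \<and> r \<sqsubseteq> s' \<and> \<psi> s' = \<psi> u)) \<and>
           (\<forall>s'. splitting T' s' \<and> s \<sqsubseteq> s' \<and> \<psi> s' = \<psi> u \<longrightarrow> extension_conclusion ar W M lo T' A k u B f s')"
    have "extends_copies \<psi>"
      unfolding extends_copies_def using bspec[OF \<psi> T_similar] .
    then show ?thesis by blast
  qed
qed

text \<open>Restrictions of nodes of \<open>T\<close> to these lengths lie in \<open>T\<close>
  again. Subtrees to be copied are therefore generated at such lengths only.\<close>

definition levels :: "nat set" where
  "levels = len ` {b. spl b} \<union> Suc ` N"

definition generated :: "'r node set \<Rightarrow> nat set \<Rightarrow> 'r node set" where
  "generated C Ls = {restr c l | c l. c \<in> C \<and> l \<in> Ls \<and> l \<le> len c}"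

lemma generatedI: "c \<in> C \<Longrightarrow> l \<in> Ls \<Longrightarrow> l \<le> len c \<Longrightarrow> restr c l \<in> generated C Ls"
  unfolding generated_def by blast

lemma generatedE:
  assumes "t \<in> generated C Ls"
  obtains c l where "c \<in> C" "l \<in> Ls" "l \<le> len c" "t = restr c l"
  using assms unfolding generated_def by blast

end

section \<open>Finite subtrees generated by finitely many nodes and lengths\<close>

locale generators = diagonal_tree ar \<K> M W lo T for ar :: "'r::finite \<Rightarrow> nat" and \<K> and M and W and lo and T +
  fixes C :: "'r node set" and Ls :: "nat set"
  assumes C: "C \<subseteq> T" "finite C" and Ls: "Ls \<subseteq> levels" "finite Ls"
    and Ls_len: "\<And>l. l \<in> Ls \<Longrightarrow> \<exists>c \<in> C. l \<le> len c"
    and Ls_meet: "\<And>c c'. c \<in> C \<Longrightarrow> c' \<in> C \<Longrightarrow> 0 < ml c c' \<Longrightarrow> c \<noteq> c' \<Longrightarrow> ml c c' \<in> Ls"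
begin

abbreviation "A \<equiv> generated C Ls"

lemma restr_T: "c \<in> C \<Longrightarrow> l \<in> Ls \<Longrightarrow> l \<le> len c \<Longrightarrow> restr c l \<in> T"
proof -
  assume c: "c \<in> C" and l: "l \<in> Ls" "l \<le> len c"
  have cT: "c \<in> T" using c C(1) by blast
  from l(1) consider b where "spl b" "l = len b" | i where "l = Suc i" "i \<in> N" using Ls(1) unfolding levels_def by blast
  then show ?thesis
  proof cases
    case 1
    then show ?thesis using spl_level[OF 1(1) cT] l by simp
  next
    case 2
    then show ?thesis using coding_level[OF 2(2) cT] l by simp
  qed
qed

lemma A_T: "A \<subseteq> T"
  using generatedE restr_T by (metis subsetI)

lemma A_len: "t \<in> A \<Longrightarrow> len t \<in> Ls"
  by (erule generatedE) simp

lemma len_A: "l \<in> Ls \<Longrightarrow> \<exists>t \<in> A. len t = l"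
  using Ls_len generatedI by (metis len_restr)

lemma A_restr: "t \<in> A \<Longrightarrow> l \<in> Ls \<Longrightarrow> l \<le> len t \<Longrightarrow> restr t l \<in> A"
  by (erule generatedE) (simp add: restr_restr generatedI)

lemma finite_A: "finite A"
proof -
  have "A \<subseteq> (\<lambda>(c, l). restr c l) ` (C \<times> Ls)" unfolding generated_def by auto
  then show ?thesis using C(2) Ls(2) by (meson finite_SigmaI finite_imageI finite_subset)
qed

lemma meet_closed_le: "meet_closed {t \<in> A. len t \<le> l0}"
  unfolding meet_closed_def
proof (intro ballI impI)
  fix s t assume st: "s \<in> {t \<in> A. len t \<le> l0}" "t \<in> {t \<in> A. len t \<le> l0}" "0 < ml s t"
  obtain c l where c: "c \<in> C" "l \<in> Ls" "l \<le> len c" "s = restr c l" using st generatedE by blast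
  obtain c' l' where c': "c' \<in> C" "l' \<in> Ls" "l' \<le> len c'" "t = restr c' l'" using st generatedE by blast
  have m: "ml s t = min (min l l') (ml c c')" using ml_restr[OF c(3) c'(3)] c(4) c'(4) by simp
  have "ml s t \<in> Ls"
  proof (cases "c = c'")
    case True
    have "ml c c = len c" using meet_aux(2)[of "len c" c c] ml_le[of c c] by simp
    then show ?thesis using True m c c' by (auto simp: min_def)
  next
    case False
    then show ?thesis using m st(3) Ls_meet[OF c(1) c'(1)] c c' by (auto simp: min_def split: if_splits)
  qed
  moreover have "meet s t = restr s (ml s t)" "ml s t \<le> len s" by (rule meet_restr(1), rule ml_le(1))
  ultimately have "restr s (ml s t) \<in> A" using A_restr[of s "ml s t"] st by simp
  then have "meet s t \<in> A" using meet_restr(1)[of s t] by metis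
  moreover have "ml s t \<le> l0" using \<open>ml s t \<le> len s\<close> st by simp
  ultimately show "meet s t \<in> {t \<in> A. len t \<le> l0}" by simp
qed

lemma meet_closed_A: "meet_closed A"
proof -
  have "{t \<in> A. len t \<le> Max (insert 0 Ls)} = A"
    using A_len Ls(2) by auto
  then show ?thesis using meet_closed_le[of "Max (insert 0 Ls)"] by simp
qed

lemma subtree_A: "subtree ar W M A"
  unfolding subtree_def
proof (intro conjI ballI allI impI)
  show "A \<subseteq> CT" using A_T T_CT by blast
  show "meet_closed A" by (rule meet_closed_A)
  fix t l assume t: "t \<in> A" and l: "1 \<le> l \<and> l \<le> len t \<and> ((\<exists>i \<in> cidx A. l = len (cn i)) \<or>
         (\<exists>u \<in> A. \<exists>w \<in> A. incomparable u w \<and> l = ml u w))"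
  have "l \<in> Ls"
    using l A_len meet_closed_A unfolding coding_idx_def meet_closed_def
    by (metis (mono_tags, lifting) less_le_trans mem_Collect_eq zero_less_one)
  then show "restr t l \<in> A" using A_restr t l by blast
qed

lemma induced_tree_A: "induced_tree A = A"
proof -
  have mc: "meet_closure A = A" unfolding meet_closure_def using meet_closed_A by blast
  have "restr t (len s) \<in> A" if "s \<in> A" "t \<in> A" "len s \<le> len t" for s t
    using that A_restr A_len by blast
  moreover have "t = restr t (len t)" if "t \<in> A" for t using that A_T T_CT restr_len by (metis subsetD)
  ultimately show ?thesis unfolding induced_tree_def mc by (smt (verit) Collect_mem_eq Collect_mono_iff mem_Collect_eq order_refl subset_antisym)
qed

lemma len_image_A: "len ` A = Ls"
proof
  show "len ` A \<subseteq> Ls" using A_len by blast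
  show "Ls \<subseteq> len ` A" using len_A by (metis image_eqI subsetI)
qed

lemma card_below_mono:
  assumes "l \<in> Ls" "l' \<in> Ls"
  shows "card {k \<in> Ls. k < l} < card {k \<in> Ls. k < l'} \<longleftrightarrow> l < l'"
proof
  assume "l < l'"
  then have "{k \<in> Ls. k < l} \<subset> {k \<in> Ls. k < l'}" using assms by auto
  then show "card {k \<in> Ls. k < l} < card {k \<in> Ls. k < l'}" using Ls(2) by (simp add: psubset_card_mono)
next
  assume c: "card {k \<in> Ls. k < l} < card {k \<in> Ls. k < l'}"
  show "l < l'"
  proof (rule ccontr)
    assume "\<not> l < l'"
    then have "{k \<in> Ls. k < l'} \<subseteq> {k \<in> Ls. k < l}" by auto
    then show False using c card_mono[of "{k \<in> Ls. k < l}" "{k \<in> Ls. k < l'}"] Ls(2) by simp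
  qed
qed

text \<open>\<open>first_levels\<close> counts levels. The lengths in the generated tree are exactly
  the elements of \<open>Ls\<close>, so the index of a level is the number of smaller elements of
  \<open>Ls\<close>.\<close>

lemma first_levels_A:
  assumes "l \<in> Ls"
  shows "first_levels (card {k \<in> Ls. k < l}) A = {t \<in> A. len t < l}"
    "first_levels (card {k \<in> Ls. k < l} + 1) A = {t \<in> A. len t \<le> l}"
proof -
  have *: "{t \<in> A. card {k \<in> Ls. k < len t} < card {k \<in> Ls. k < l}} = {t \<in> A. len t < l}"
    "{t \<in> A. card {k \<in> Ls. k < len t} < card {k \<in> Ls. k < l} + 1} = {t \<in> A. len t \<le> l}"
  proof -
    have "card {k \<in> Ls. k < len t} < card {k \<in> Ls. k < l} \<longleftrightarrow> len t < l" if "t \<in> A" for t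
      using card_below_mono[of "len t" l] A_len[OF that] assms by blast
    then show "{t \<in> A. card {k \<in> Ls. k < len t} < card {k \<in> Ls. k < l}} = {t \<in> A. len t < l}" by blast
    have "card {k \<in> Ls. k < len t} < card {k \<in> Ls. k < l} + 1 \<longleftrightarrow> len t \<le> l" if "t \<in> A" for t
      using card_below_mono[of l "len t"] A_len[OF that] assms by linarith
    then show "{t \<in> A. card {k \<in> Ls. k < len t} < card {k \<in> Ls. k < l} + 1} = {t \<in> A. len t \<le> l}" by blast
  qed
  show "first_levels (card {k \<in> Ls. k < l}) A = {t \<in> A. len t < l}"
    "first_levels (card {k \<in> Ls. k < l} + 1) A = {t \<in> A. len t \<le> l}"
    unfolding first_levels_def induced_tree_A len_image_A * by (rule refl)+
qed

text \<open>The form in which the Extension Property is used. The last level already copied contains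
  a splitting node \<open>p\<close>: in this case \<open>+\<close>-similarity asks for no passing
  types beyond those of the similarity map, and it suffices that \<open>f p\<close> splits as
  well.\<close>

lemma extend_copy:
  assumes \<psi>: "extends_copies \<psi>"
    and l: "l0 \<in> Ls" "l1 \<in> Ls" "l0 < l1" "\<And>l. l \<in> Ls \<Longrightarrow> l < l1 \<Longrightarrow> l \<le> l0"
    and p: "p \<in> A" "spl p" "len p = l0" and u: "u \<in> A" "spl u" "len u = l1" "p \<sqsubseteq> u"
    and A0: "A0 = {t \<in> A. len t \<le> l0}"
    and f: "similarity_map ar W M lo f A0 B" "B \<subseteq> T" "spl (f p)"
    and lab: "\<And>t. t \<in> A0 \<Longrightarrow> splitting A0 t \<or> t = p \<Longrightarrow> \<psi> (f t) = \<psi> t"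
    and s: "s \<in> imm_succ T (f p)" "position p (restr u (len p + 1)) = position (f p) s"
  shows "\<And>r. r \<in> T \<Longrightarrow> s \<sqsubseteq> r \<Longrightarrow> \<exists>s'. spl s' \<and> r \<sqsubseteq> s' \<and> \<psi> s' = \<psi> u"
    "\<And>s'. spl s' \<Longrightarrow> s \<sqsubseteq> s' \<Longrightarrow> \<psi> s' = \<psi> u \<Longrightarrow>
       \<exists>A' h. A' \<subseteq> T \<and> similarity_map ar W M lo h A A' \<and> (\<forall>t \<in> A0. h t = f t) \<and> h u = s'"
proof -
  define k where "k = card {k \<in> Ls. k < l1}"
  have k: "first_levels k A = A0"
  proof -
    have "{t \<in> A. len t < l1} = A0" unfolding A0 using A_len l by fastforce
    then show ?thesis using first_levels_A(1)[OF l(2)] by (simp add: k_def)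
  qed
  have k1: "first_levels (k + 1) A = {t \<in> A. len t \<le> l1}"
    using first_levels_A(2)[OF l(2)] by (simp add: k_def)
  have finA0: "finite A0" unfolding A0 using finite_A by simp
  have bij: "bij_betw f A0 B" using f(1) by (simp add: similarity_map_def)
  have flen: "len (f t) \<le> len (f p)" if "t \<in> A0" for t
    using that f(1) p unfolding similarity_map_def A0 by (metis (no_types, lifting) leD leI mem_Collect_eq order_refl)
  have pA0: "p \<in> A0" using p A0 by simp
  have p_max: "p \<in> max_nodes A0" using p unfolding max_nodes_def A0 by auto
  have fp_max: "f p \<in> max_nodes B" unfolding max_nodes_def using flen bij pA0 by (auto simp: bij_betw_def)
  \<comment> \<open>Splitting nodes have distinct lengths, so the label condition on the top level
    concerns \<open>p\<close> alone.\<close>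
  have max_eq: "t = p" if "t \<in> max_nodes A0" "spl t" for t
  proof -
    have "len t = len p" using that(1) p_max unfolding max_nodes_def by (metis (no_types, lifting) le_antisym mem_Collect_eq)
    then show ?thesis using spl_unique that p by blast
  qed
  have "finite B" using bij finA0 bij_betw_finite by blast
  then have ps: "plus_similarity_map ar W M lo T f A0 B"
    unfolding plus_similarity_map_def using finA0 f p p_max fp_max by blast
  have "s \<in> max_succ T B" using s(1) fp_max unfolding max_succ_def by blast
  moreover have "u \<in> max_nodes {t \<in> A. len t \<le> l1}" using u unfolding max_nodes_def by auto
  moreover have "u \<notin> A0" using u l unfolding A0 by auto
  moreover have "f p \<sqsubseteq> s" using s(1) unfolding imm_succ_def by blast
  ultimately have sit: "extension_situation ar W M lo T A k u B f s"
    unfolding extension_situation_def k k1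
    using subtree_A A_T u(2,4) f(2) ps p_max s(2) unfolding position_def by blast
  have lab': "\<forall>t \<in> first_levels k A. splitting (first_levels k A) t \<or> (t \<in> max_nodes (first_levels k A) \<and> spl t) \<longrightarrow> \<psi> (f t) = \<psi> t"
    unfolding k using lab max_eq by blast
  have E: "(\<forall>r \<in> T. s \<sqsubseteq> r \<longrightarrow> (\<exists>s'. spl s' \<and> r \<sqsubseteq> s' \<and> \<psi> s' = \<psi> u)) \<and>
     (\<forall>s'. spl s' \<and> s \<sqsubseteq> s' \<and> \<psi> s' = \<psi> u \<longrightarrow> extension_conclusion ar W M lo T A k u B f s')"
    using \<psi> sit lab' unfolding extends_copies_def by blast
  show "\<exists>s'. spl s' \<and> r \<sqsubseteq> s' \<and> \<psi> s' = \<psi> u" if "r \<in> T" "s \<sqsubseteq> r" for r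
    using E that by blast
  show "\<exists>A' h. A' \<subseteq> T \<and> similarity_map ar W M lo h A A' \<and> (\<forall>t \<in> A0. h t = f t) \<and> h u = s'"
    if s': "spl s'" "s \<sqsubseteq> s'" "\<psi> s' = \<psi> u" for s'
  proof -
    have "extension_conclusion ar W M lo T A k u B f s'" using E s' by blast
    then obtain B' g A' h where g: "\<forall>x \<in> A0. g x = f x" "g u = s'" "A' \<subseteq> T" "similarity_map ar W M lo h A A'"
      "\<forall>x \<in> A \<inter> {t \<in> A. len t \<le> l1}. h x = g x"
      unfolding extension_conclusion_def k k1 by blast
    have "h t = f t" if t: "t \<in> A0" for t
    proof -
      have "t \<in> A \<inter> {t \<in> A. len t \<le> l1}" using t l unfolding A0 by simp
      then have "h t = g t" using g(5) by blast
      then show ?thesis using g(1) t by simp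
    qed
    moreover have "h u = s'" using g(2,5) u by auto
    ultimately show ?thesis using g(3,4) by blast
  qed
qed

end

context diagonal_tree
begin

text \<open>A splitting node has exactly two successors, which are incomparable and hence ordered by
  \<open>prec\<close>; the positions 0 and 1 both occur at every splitting node.\<close>

lemma position_cases:
  assumes "spl b" "spl b'" "s \<in> imm_succ T b"
  shows "\<exists>s' \<in> imm_succ T b'. position b s = position b' s'"
proof -
  have pos: "\<exists>x y. imm_succ T c = {x, y} \<and> x \<noteq> y \<and> position c x = 0 \<and> position c y = 1" if c: "spl c" for c
  proof -
    obtain t1 t2 where t: "t1 \<in> T" "t2 \<in> T" "meet t1 t2 = c" "len c < len t1" "len c < len t2"
      "imm_succ T c = {restr t1 (len c + 1), restr t2 (len c + 1)}" "restr t1 (len c + 1) \<noteq> restr t2 (len c + 1)"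
      using splE[OF c] by metis
    define x where "x = restr t1 (len c + 1)"
    define y where "y = restr t2 (len c + 1)"
    have CT: "x \<in> CT" "y \<in> CT" using t T_CT restr_CT by (auto simp: x_def y_def)
    have "ml x y = len c" using t ml_restr[of "len c + 1" t1 "len c + 1" t2] by (simp add: x_def y_def)
    then have inc: "incomparable x y" using incomparable_iff CT by (simp add: x_def y_def)
    have irr: "\<not> pr z z" for z by (simp add: prec_def incomparable_def)
    have as: "pr y x \<longleftrightarrow> \<not> pr x y" using prec_asym CT inc by blast
    have S: "imm_succ T c = {x, y}" "x \<noteq> y" using t by (auto simp: x_def y_def)
    show ?thesis
    proof (cases "pr x y")
      case True
      then have *: "{z \<in> imm_succ T c. pr z x} = {}" "{z \<in> imm_succ T c. pr z y} = {x}"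
        using S irr as by auto
      have "position c x = 0" "position c y = 1" unfolding position_def * by simp_all
      then show ?thesis using S by metis
    next
      case False
      then have *: "{z \<in> imm_succ T c. pr z y} = {}" "{z \<in> imm_succ T c. pr z x} = {y}"
        using S irr as by auto
      have "position c y = 0" "position c x = 1" unfolding position_def * by simp_all
      moreover have "imm_succ T c = {y, x}" using S(1) by blast
      ultimately show ?thesis using S(2) by metis
    qed
  qed
  obtain x y where 1: "imm_succ T b = {x, y}" "position b x = 0" "position b y = 1" using pos[OF assms(1)] by blast
  obtain x' y' where 2: "imm_succ T b' = {x', y'}" "position b' x' = 0" "position b' y' = 1" using pos[OF assms(2)] by blast
  show ?thesis using assms(3) 1 2 by auto
qed

text \<open>For binary symbols the passing type of \<open>cn j\<close> at the earlier
  \<open>cn i\<close> is the type of \<open>j\<close> over \<open>i\<close>, and similarity maps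
  preserve passing types and the order of lengths.\<close>

lemma sim_coding:
  assumes sim: "similarity_map ar W M lo h S S'" and i: "i \<in> cidx S" and S: "S \<subseteq> CT" "S' \<subseteq> CT"
  obtains i' where "i' \<in> cidx S'" "h (cn i) = cn i'" "un i' = un i"
    "\<And>j j'. j \<in> cidx S \<Longrightarrow> i < j \<Longrightarrow> h (cn j) = cn j' \<Longrightarrow> bn j' i' = bn j i"
proof -
  obtain n where n: "has_nth ar W M S n" "nth_idx ar W M S n = i"
  proof (cases "finite (cidx S)")
    case True
    then show ?thesis using finite_enumerate_Ex[OF True i] that by (auto simp: has_nth_def nth_idx_def)
  next
    case False
    then show ?thesis using enumerate_Ex[OF False i] that by (auto simp: has_nth_def nth_idx_def)
  qed
  define i' where "i' = nth_idx ar W M S' n"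
  have sm: "has_nth ar W M S' n" "h (cn i) = cn i'" "same_unary ar M i i'"
    "\<And>s. s \<in> S \<Longrightarrow> len (cn i) < len s \<Longrightarrow> passing_sim ar W M s i S (h s) i' S'"
    using sim n unfolding similarity_map_def nth_coding_def i'_def by blast+
  have "i' \<in> cidx S'"
    using sm(1) unfolding has_nth_def i'_def nth_idx_def
    by (metis enumerate_in_set finite_enumerate_in_set)
  moreover have "un i' = un i" using sm(3) by (auto simp: same_unary_def unS_def)
  moreover have "bn j' i' = bn j i" if j: "j \<in> cidx S" "i < j" "h (cn j) = cn j'" for j j'
  proof -
    have "cn j \<in> S" using j(1) by (simp add: coding_idx_def)
    then obtain f where f: "f i = i'" "\<And>R zs. length zs = ar R \<Longrightarrow> Var \<in> set zs \<Longrightarrow>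
          set zs \<subseteq> insert Var (Par ` (cidx S \<inter> {..<i} \<union> {i})) \<Longrightarrow>
          (Pos R zs \<in> passing ar W M (cn j) i S \<longleftrightarrow>
              Pos R (map (case_tm Var (\<lambda>i. Par (f i))) zs) \<in> passing ar W M (cn j') i' S')"
      using sm(4)[of "cn j"] j unfolding passing_sim_def by auto
    have "i' < j'"
    proof -
      have "cn i \<in> S" using i by (simp add: coding_idx_def)
      then have "len (h (cn i)) < len (h (cn j))"
        using sim \<open>cn j \<in> S\<close> j(2) unfolding similarity_map_def by (metis add_less_cancel_right len_cn)
      then show ?thesis using sm(2) j(3) by simp
    qed
    have pass: "Pos R zs \<in> passing ar W M (cn b) a X \<longleftrightarrow> map (case_tm b id) zs \<in> rels M R"
      if "ar R = 2" "zs = [Var, Par a] \<or> zs = [Par a, Var]" "a < b" for R zs a b X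
      using that binary_W[OF that(1)]
      by (auto simp: passing_def entry_def coding_node_def node_def tp_def lits_def par_def)
    have "[j, i] \<in> rels M R \<longleftrightarrow> [j', i'] \<in> rels M R" "[i, j] \<in> rels M R \<longleftrightarrow> [i', j'] \<in> rels M R" if "ar R = 2" for R
      using f(2)[of "[Var, Par i]" R] f(2)[of "[Par i, Var]" R] f(1) that
        pass[OF that, of "[Var, Par i]" i j S] pass[OF that, of "[Par i, Var]" i j S] j(2)
        pass[OF that, of "[Var, Par i']" i' j' S'] pass[OF that, of "[Par i', Var]" i' j' S'] \<open>i' < j'\<close>
      by simp_all
    then show ?thesis by (auto simp: bnS_def)
  qed
  ultimately show ?thesis using that sm(2) by blast
qed

end

section \<open>Realising pairs in the coding tree\<close>

context coding_tree_of
begin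

text \<open>A node of length \<open>n + 1\<close> is a type over the vertices below
  \<open>n\<close>, which explains the strict bound on \<open>k\<close>.\<close>

lemma bn_below:
  assumes "b \<in> CT" "b \<sqsubseteq> cn i" "b \<sqsubseteq> cn j" "k + 1 < len b"
  shows "bn i k = bn j k"
proof -
  define n where "n = len b - 1"
  have n: "len b = n + 1" "k < n" using assms(4) by (auto simp: n_def)
  have "restr (cn i) (n + 1) = restr (cn j) (n + 1)" "n \<le> i" "n \<le> j"
    using assms cn_CT n(1) by (auto simp: below_iff)
  then have "agree n i j" using cn_agree by blast
  then show ?thesis using n(2) by (simp add: agree_def)
qed

end

context diagonal_tree
begin

text \<open>The vertices represented in \<open>T\<close> induce a copy of the whole limit.
  Extensions are made in the limit and carried into \<open>N\<close> by the isomorphism.\<close>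

lemma extend_N:
  assumes fin: "finite F" "finite Y" "finite G" and \<phi>: "pe \<phi> F" "\<phi> ` F \<subseteq> N"
  shows "\<exists>\<phi>'. pe \<phi>' (F \<union> Y) \<and> (\<forall>x \<in> F. \<phi>' x = \<phi> x) \<and> \<phi>' ` (F \<union> Y) \<subseteq> N \<and> (\<forall>y \<in> Y - F. \<phi>' y \<notin> G)"
proof -
  obtain \<kappa> where \<kappa>: "embedding \<kappa> (induced M N) M" "\<kappa> ` N = UNIV"
    using iso by (auto simp: isomorphic_def is_iso_def)
  have pk: "pe \<kappa> N" using embedding_pe[OF \<kappa>(1) refl] .
  have "pe (\<kappa> \<circ> \<phi>) F" using pe_comp[OF \<phi>(1)] pe_subset[OF pk \<phi>(2)] by blast
  from extend[OF fin(1,2) finite_imageI[OF fin(3), of \<kappa>] this]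
  obtain \<phi>1 where \<phi>1: "pe \<phi>1 (F \<union> Y)" "\<forall>x \<in> F. \<phi>1 x = (\<kappa> \<circ> \<phi>) x" "\<forall>y \<in> Y - F. \<phi>1 y \<notin> \<kappa> ` G" by blast
  let ?i = "the_inv_into N \<kappa>"
  have pi: "pe ?i UNIV" using pe_inv[OF pk] \<kappa>(2) by simp
  have iN: "?i x \<in> N" "\<kappa> (?i x) = x" for x
    using the_inv_into_into[OF pe_inj[OF pk], of x N] f_the_inv_into_f[OF pe_inj[OF pk], of x] \<kappa>(2) by auto
  have "pe (?i \<circ> \<phi>1) (F \<union> Y)" by (rule pe_comp[OF \<phi>1(1) pe_subset[OF pi]]) simp
  moreover have "(?i \<circ> \<phi>1) x = \<phi> x" if "x \<in> F" for x
    using \<phi>1(2) that \<phi>(2) the_inv_into_f_f[OF pe_inj[OF pk], of "\<phi> x"] by auto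
  moreover have "(?i \<circ> \<phi>1) ` (F \<union> Y) \<subseteq> N" using iN by auto
  moreover have "(?i \<circ> \<phi>1) y \<notin> G" if "y \<in> Y - F" for y
    using \<phi>1(3) that iN(2)[of "\<phi>1 y"] by (metis comp_apply imageI)
  ultimately show ?thesis by blast
qed

end

section \<open>Copying coding nodes and pairs of coding nodes into prescribed cones\<close>

locale copying_tree = diagonal_tree ar \<K> M W lo T + fraisse_sdap ar \<K> M
  for ar :: "'r::finite \<Rightarrow> nat" and \<K> and M and W and lo and T +
  fixes \<psi> :: "'r node \<Rightarrow> nat"
  assumes copies: "extends_copies \<psi>"
begin

notation cong (infix "\<cong>" 50)

text \<open>The starting point for copying: for nodes above \<open>e\<close>, the subtree to be
  copied may begin with the splitting node \<open>a\<close>, which is mapped to itself, and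
  \<open>e\<close> is the successor of \<open>a\<close> to be extended.\<close>

definition cone :: "'r node \<Rightarrow> 'r node \<Rightarrow> bool" where
  "cone a e \<longleftrightarrow> spl a \<and> e \<in> CT \<and> a \<sqsubseteq> e \<and> len e = len a + 1"

lemma cone_above:
  assumes "cone a e" "w \<in> CT" "e \<sqsubseteq> w"
  shows "a \<sqsubseteq> w" "len a < len w" "restr w (len a + 1) = e" "restr w (len a) = a"
proof -
  have a: "a \<in> CT" "e \<in> CT" "a \<sqsubseteq> e" "len e = len a + 1" using assms spl_CT by (auto simp: cone_def)
  show "a \<sqsubseteq> w" using a assms(3) below_trans by blast
  then show "restr w (len a) = a" using a assms(2) by (simp add: below_iff)
  show "len a < len w" using below_len[OF assms(3)] a by simp
  show "restr w (len a + 1) = e" using a assms by (simp add: below_iff)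
qed

lemma sim_below:
  assumes "similarity_map ar W M lo h S S'" "s \<in> S" "t \<in> S" "s \<sqsubseteq> t"
  shows "h s \<sqsubseteq> h t"
  using assms unfolding similarity_map_def by blast

text \<open>The subtree with the two nodes \<open>a\<close> and \<open>w\<close>, copied by the
  identity up to \<open>a\<close>, meets the conditions of \<open>extend_copy\<close>:
  \<open>e\<close> is the successor of \<open>a\<close> below \<open>w\<close> and so lies on the
  correct side.\<close>

lemma splitting_dense:
  assumes c: "cone a e" and w: "spl w" "e \<sqsubseteq> w" and r: "r \<in> T" "e \<sqsubseteq> r"
  shows "\<exists>s'. spl s' \<and> r \<sqsubseteq> s' \<and> \<psi> s' = \<psi> w"
proof -
  have wCT: "w \<in> CT" and wT: "w \<in> T" using w spl_CT spl_T by auto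
  note ca = cone_above[OF c wCT w(2)]
  have a: "spl a" "a \<in> CT" using c spl_CT by (auto simp: cone_def)
  interpret G: generators ar \<K> M W lo T "{w}" "{len a, len w}"
  proof unfold_locales
    show "{len a, len w} \<subseteq> levels" using a w unfolding levels_def by blast
    show "\<exists>c \<in> {w}. l \<le> len c" if "l \<in> {len a, len w}" for l using that ca(2) by auto
  qed (use wT in auto)
  have aA: "a \<in> G.A" using generatedI[of w "{w}" "len a" "{len a, len w}"] ca by simp
  have wA: "w \<in> G.A" using generatedI[of w "{w}" "len w" "{len a, len w}"] restr_len[OF wCT] by simp
  let ?A0 = "{t \<in> G.A. len t \<le> len a}"
  show ?thesis
  proof (rule G.extend_copy(1)[OF copies, of "len a" "len w" a w ?A0 id ?A0 e r])
    show "len a < len w" by (rule ca(2))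
    show "l \<le> len a" if "l \<in> {len a, len w}" "l < len w" for l using that by auto
    show "similarity_map ar W M lo id ?A0 ?A0" using similarity_map_id G.meet_closed_le by blast
    show "?A0 \<subseteq> T" using G.A_T by blast
    have "restr w (len a + 1) \<in> imm_succ T a" using succ_mem[OF wT a(2) ca(1,2)] .
    then show "e \<in> imm_succ T (id a)" using ca(3) by simp
    show "position a (restr w (len a + 1)) = position (id a) e" using ca(3) by simp
  qed (use a w aA wA ca r in simp_all)
qed

text \<open>The subtree now consists of \<open>a\<close>, \<open>v\<close> and \<open>cn i\<close>.
  The image of \<open>v\<close> can be placed above \<open>r\<close>, and the copy of the whole
  subtree takes the coding node along with its unary type.\<close>

lemma coding_dense:
  assumes c: "cone a e" and v: "spl v" "e \<sqsubseteq> v" and i: "i \<in> N" "v \<sqsubseteq> cn i" and r: "r \<in> T" "e \<sqsubseteq> r"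
  shows "\<exists>i' \<in> N. r \<sqsubseteq> cn i' \<and> un i' = un i"
proof -
  have vCT: "v \<in> CT" and vT: "v \<in> T" using v spl_CT spl_T by auto
  have iT: "cn i \<in> T" and iCT: "cn i \<in> CT" using i(1) cn_CT by (simp_all add: N_iff)
  note ca = cone_above[OF c vCT v(2)]
  have a: "spl a" "a \<in> CT" using c spl_CT by (auto simp: cone_def)
  have lv: "len v < i + 1" using below_len[OF i(2)] spl_not_coding[OF v(1) i(1)] by simp
  have rv: "restr (cn i) (len v) = v" using i(2) vCT iCT by (simp add: below_iff)
  have ra: "restr (cn i) (len a) = a" using restr_restr[of "len a" "len v" "cn i"] rv ca by simp
  let ?Ls = "{len a, len v, i + 1}"
  interpret G: generators ar \<K> M W lo T "{cn i}" ?Ls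
  proof unfold_locales
    show "?Ls \<subseteq> levels" using a v i unfolding levels_def by auto
    show "\<exists>c \<in> {cn i}. l \<le> len c" if "l \<in> ?Ls" for l using that ca(2) lv by auto
  qed (use iT in auto)
  have aA: "a \<in> G.A" using generatedI[of "cn i" "{cn i}" "len a" ?Ls] ra ca(2) lv by simp
  have vA: "v \<in> G.A" using generatedI[of "cn i" "{cn i}" "len v" ?Ls] rv lv by simp
  have iA: "cn i \<in> G.A" using generatedI[of "cn i" "{cn i}" "i + 1" ?Ls] restr_len[OF iCT] by simp
  let ?A0 = "{t \<in> G.A. len t \<le> len a}"
  obtain s' where s': "spl s'" "r \<sqsubseteq> s'" "\<psi> s' = \<psi> v" using splitting_dense[OF c v r] by blast
  have "\<exists>A' h. A' \<subseteq> T \<and> similarity_map ar W M lo h G.A A' \<and> (\<forall>t \<in> ?A0. h t = id t) \<and> h v = s'"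
  proof (rule G.extend_copy(2)[OF copies, of "len a" "len v" a v ?A0 id ?A0 e s'])
    show "l \<le> len a" if "l \<in> ?Ls" "l < len v" for l using that lv by auto
    show "similarity_map ar W M lo id ?A0 ?A0" using similarity_map_id G.meet_closed_le by blast
    show "?A0 \<subseteq> T" using G.A_T by blast
    have "restr v (len a + 1) \<in> imm_succ T a" using succ_mem[OF vT a(2) ca(1,2)] .
    then show "e \<in> imm_succ T (id a)" using ca(3) by simp
    show "position a (restr v (len a + 1)) = position (id a) e" using ca(3) by simp
    show "e \<sqsubseteq> s'" using r(2) s'(2) below_trans by blast
  qed (use a v aA vA ca s' in simp_all)
  then obtain A' h where h: "A' \<subseteq> T" "similarity_map ar W M lo h G.A A'" "h v = s'" by blast
  have iA': "i \<in> cidx G.A" using iA by (simp add: coding_idx_def)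
  have CT': "G.A \<subseteq> CT" "A' \<subseteq> CT" using G.A_T h(1) T_CT by auto
  obtain i' where i': "i' \<in> cidx A'" "h (cn i) = cn i'" "un i' = un i"
    by (rule sim_coding[OF h(2) iA' CT'], rule that)
  have "s' \<sqsubseteq> cn i'" using sim_below[OF h(2) vA iA i(2)] h(3) i'(2) by simp
  then have "r \<sqsubseteq> cn i'" using s'(2) below_trans by blast
  moreover have "i' \<in> N" using i'(1) h(1) by (auto simp: coding_idx_def)
  ultimately show ?thesis using i'(3) by blast
qed

lemma meet_of_below:
  assumes "s \<in> CT" "t \<in> CT" "s \<sqsubseteq> t"
  shows "meet s t = s" "meet t s = s"
proof -
  have "len s \<le> ml s t" using restr_eq_iff[of "len s" s t] assms by (auto simp: below_iff restr_len)
  then have "ml s t = len s" using ml_le[of s t] by simp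
  then show "meet s t = s" using meet_restr(1)[of s t] restr_len[OF assms(1)] by metis
  then show "meet t s = s" using meet_commute by metis
qed

lemma triple_table:
  assumes xy: "x \<in> T" "y \<in> T" "len x = len y" "incomparable x y" and m: "meet x y = m"
  shows "x \<noteq> y" "m \<noteq> x" "m \<noteq> y" "len m < len x" "len m < len y"
    "meet x x = x" "meet y y = y" "meet y x = m" "\<not> x \<sqsubseteq> y" "\<not> y \<sqsubseteq> x" "\<not> x \<sqsubseteq> m" "\<not> y \<sqsubseteq> m"
    "\<not> pr x x" "\<not> pr y y" "\<not> pr m m" "pr y x \<longleftrightarrow> \<not> pr x y"
    "0 < len m \<Longrightarrow> spl m \<and> m \<sqsubseteq> x \<and> m \<sqsubseteq> y \<and> meet m m = m \<and> meet x m = m \<and> meet m x = m \<and> meet y m = m \<and>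
       meet m y = m \<and> pr m x \<and> pr m y \<and> \<not> pr x m \<and> \<not> pr y m"
    "len m = 0 \<Longrightarrow> m = (0, {})"
proof -
  have CT: "x \<in> CT" "y \<in> CT" using xy T_CT by auto
  show ne: "x \<noteq> y" using xy(4) by (auto simp: incomparable_def)
  show lm: "len m < len x" "len m < len y" using incomparable_iff[OF CT] xy(4) m by auto
  show "m \<noteq> x" "m \<noteq> y" using lm by auto
  show "meet x x = x" "meet y y = y" using meet_of_below CT by auto
  show "meet y x = m" using meet_commute m by metis
  show "\<not> x \<sqsubseteq> y" "\<not> y \<sqsubseteq> x" using xy(4) by (auto simp: incomparable_def)
  show xm: "\<not> x \<sqsubseteq> m" "\<not> y \<sqsubseteq> m" using lm below_len by fastforce+
  have irr: "\<not> pr z z" for z by (simp add: prec_def incomparable_def)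
  show "\<not> pr x x" "\<not> pr y y" "\<not> pr m m" using irr by auto
  show "pr y x \<longleftrightarrow> \<not> pr x y" using prec_asym CT xy(4) by blast
  show "m = (0, {})" if "len m = 0" using meet_restr(1)[of x y] m that restr_0 by metis
  assume pos: "0 < len m"
  have mm: "m \<in> CT" "m \<sqsubseteq> x" "m \<sqsubseteq> y" using meet_below[OF CT] m pos by auto
  have "spl m" using meet_spl[OF xy(1,2,4)] m pos by simp
  moreover have "pr m x" "pr m y" using mm lm by (auto simp: prec_def)
  moreover have "\<not> pr x m" "\<not> pr y m" using mm xm by (auto simp: prec_def incomparable_def)
  ultimately show "spl m \<and> m \<sqsubseteq> x \<and> m \<sqsubseteq> y \<and> meet m m = m \<and> meet x m = m \<and> meet m x = m \<and> meet y m = m \<and>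
       meet m y = m \<and> pr m x \<and> pr m y \<and> \<not> pr x m \<and> \<not> pr y m"
    using mm meet_of_below CT by auto
qed

text \<open>Without coding nodes there are no passing types to compare, and the relations among two
  nodes of equal length and their meet are all listed in \<open>triple_table\<close>. A meet of
  length 0 is the virtual root and does not belong to the subtree.\<close>

lemma triple_similarity:
  assumes xy: "x \<in> T" "y \<in> T" "len x = len y" "incomparable x y" "spl x"
    and xy': "x' \<in> T" "y' \<in> T" "len x' = len y'" "incomparable x' y'" "spl x'"
    and m: "meet x y = m" "meet x' y' = m'" "len m = 0 \<longleftrightarrow> len m' = 0" and o: "pr x y \<longleftrightarrow> pr x' y'"
    and S: "S = (if len m = 0 then {x, y} else {x, y, m})"
    and S': "S' = (if len m' = 0 then {x', y'} else {x', y', m'})"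
    and f: "f x = x'" "f y = y'" "len m \<noteq> 0 \<Longrightarrow> f m = m'"
  shows "similarity_map ar W M lo f S S'"
proof -
  note tb = triple_table[OF xy(1-4) m(1)]
  note tb' = triple_table[OF xy'(1-4) m(2)]
  have mc: "meet_closed S" "meet_closed S'"
    unfolding meet_closed_def S S'
    using tb tb' m(1,2) by (cases "len m = 0"; cases "len m' = 0"; simp)+
  have bij: "bij_betw f S S'"
    unfolding bij_betw_def S S' using tb(1-3) tb'(1-3) f m(3) by (cases "len m = 0") auto
  \<comment> \<open>Every length in these sets is the length of a splitting node: \<open>y\<close>
    has the length of \<open>x\<close>, and the meet splits. Coding nodes of \<open>T\<close> have
    other lengths.\<close>
  have empty: "cidx S = {}" "cidx S' = {}"
  proof -
    have gen: "S \<subseteq> T \<and> len ` S \<subseteq> len ` {b. spl b}" if h: "x \<in> T" "y \<in> T" "len x = len y" "spl x" "incomparable x y" "meet x y = m"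
      "S = (if len m = 0 then {x, y} else {x, y, m})" for x y m S
    proof -
      have L: "len x \<in> len ` {b. spl b}" using h(4) by blast
      then have L': "len y \<in> len ` {b. spl b}" using h(3) by metis
      show ?thesis
      proof (cases "len m = 0")
        case True
        then have "S = {x, y}" using h(7) by simp
        then show ?thesis using L L' h(1,2) by blast
      next
        case False
        then have "S = {x, y, m}" using h(7) by simp
        moreover have "spl m" using triple_table(17)[OF h(1,2,3,5,6)] False by blast
        ultimately show ?thesis using L L' h(1,2) spl_T[of m] by blast
      qed
    qed
    note * = gen[OF xy(1-3,5,4) m(1) S] gen[OF xy'(1-3,5,4) m(2) S']
    have "cidx X = {}" if X: "X \<subseteq> T \<and> len ` X \<subseteq> len ` {b. spl b}" for X
    proof (rule ccontr)
      assume "cidx X \<noteq> {}"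
      then obtain i where "cn i \<in> X" by (auto simp: coding_idx_def)
      then have "i \<in> N" "len (cn i) \<in> len ` {b. spl b}" using X N_iff by blast+
      then obtain b where "spl b" "len b = i + 1" by (metis imageE len_cn mem_Collect_eq)
      then show False using spl_not_coding \<open>i \<in> N\<close> by blast
    qed
    then show "cidx S = {}" "cidx S' = {}" using * by auto
  qed
  have nth: "\<not> has_nth ar W M S n" "\<not> has_nth ar W M S' n" for n
    using empty by (simp_all add: has_nth_def)
  have main: "(pr s t \<longleftrightarrow> pr (f s) (f t)) \<and> (if ml s t = 0 then meet s t else f (meet s t)) = meet (f s) (f t) \<and>
      (len s < len t \<longleftrightarrow> len (f s) < len (f t)) \<and> (s \<sqsubseteq> t \<longleftrightarrow> f s \<sqsubseteq> f t)" if st: "s \<in> S" "t \<in> S" for s t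
  proof (cases "len m = 0")
    case True
    have lx: "len x \<noteq> 0" "len y \<noteq> 0" using CT_len T_CT xy by fastforce+
    have m0: "m' = m" using True tb(18) tb'(18) m(3) by simp
    consider "s = x \<and> t = x" | "s = x \<and> t = y" | "s = y \<and> t = x" | "s = y \<and> t = y" using st True S by auto
    then show ?thesis
      by cases (use True lx m0 tb(1-16) tb'(1-16) m(1,2) f(1,2) o xy(3) xy'(3) in simp_all)
  next
    case False
    have lx: "len x \<noteq> 0" "len y \<noteq> 0" using CT_len T_CT xy by fastforce+
    have p: "0 < len m" "0 < len m'" using False m(3) by auto
    consider "s = x \<and> t = x" | "s = x \<and> t = y" | "s = y \<and> t = x" | "s = y \<and> t = y" |
      "s = m \<and> t = x" | "s = m \<and> t = y" | "s = x \<and> t = m" | "s = y \<and> t = m" | "s = m \<and> t = m" using st False S by auto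
    then show ?thesis
      by cases (use False lx f tb(1-16) tb'(1-16) tb(17)[OF p(1)] tb'(17)[OF p(2)] m(1,2) o xy(3) xy'(3) in simp_all)
  qed
  show ?thesis
    unfolding similarity_map_def using mc bij main nth by blast
qed

text \<open>The levels up to \<open>u1\<close> are copied by hand with
  \<open>triple_similarity\<close>. The Extension Property is then applied at \<open>u2\<close>, and
  its conclusion copies the rest, including the two coding nodes. Two splitting nodes are needed on
  the branch: \<open>u1\<close> as the splitting node on the last level copied by hand,
  \<open>u2\<close> as the one to be extended next.\<close>

lemma transport:
  assumes pq: "p \<in> N" "q' \<in> N" "incomparable (cn p) (cn q')"
    and u: "spl u1" "spl u2" "u1 \<sqsubseteq> u2" "u2 \<sqsubseteq> cn p" "ml (cn p) (cn q') < len u1" "len u1 < len u2" "len u2 < len (cn q')"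
    and b: "spl b1" "\<psi> b1 = \<psi> u1" "t1 \<in> T" "len t1 = len b1" "incomparable b1 t1"
    and m: "ml (cn p) (cn q') = 0 \<longleftrightarrow> ml b1 t1 = 0" "0 < ml b1 t1 \<Longrightarrow> \<psi> (meet (cn p) (cn q')) = \<psi> (meet b1 t1)"
    and o: "pr (cn p) (cn q') \<longleftrightarrow> pr b1 t1"
  shows "\<exists>p' \<in> N. \<exists>r' \<in> N. b1 \<sqsubseteq> cn p' \<and> t1 \<sqsubseteq> cn r' \<and> un p' = un p \<and> un r' = un q' \<and> q p' r' = q p q'"
proof -
  let ?c = "cn p" and ?d = "cn q'"
  have CT: "?c \<in> CT" "?d \<in> CT" "u1 \<in> CT" "u2 \<in> CT" "b1 \<in> CT" "t1 \<in> CT" using cn_CT u b spl_CT T_CT by auto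
  have TT: "?c \<in> T" "?d \<in> T" "u1 \<in> T" "u2 \<in> T" "b1 \<in> T" using pq N_iff u b spl_T by auto
  define m0 where "m0 = meet ?c ?d"
  define t0 where "t0 = restr ?d (len u1)"
  have lu2: "len u2 < len ?c" using below_len[OF u(4)] spl_not_coding[OF u(2) pq(1)] by simp
  have u1c: "u1 \<sqsubseteq> ?c" using u(3,4) below_trans by blast
  have ru1: "restr ?c (len u1) = u1" and ru2: "restr ?c (len u2) = u2" using u1c u(4) CT by (auto simp: below_iff)
  have t0: "t0 \<in> T" "len t0 = len u1" "t0 \<sqsubseteq> ?d"
    using spl_level[OF u(1) TT(2)] u CT restr_below[of ?d "len u1"] CT_len[OF CT(3)] by (auto simp: t0_def)
  have "ml u1 t0 = ml ?c ?d"
    using ml_restr[of "len u1" ?c "len u1" ?d] ru1 u lu2 by (simp add: t0_def)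
  then have inc: "incomparable u1 t0" using incomparable_iff[OF CT(3) T_CT[OF t0(1)]] u(5) t0(2) by simp
  note above = meet_above[OF CT(3) T_CT[OF t0(1)] CT(1,2) u1c t0(3) inc] prec_above[OF CT(3) T_CT[OF t0(1)] CT(1,2) u1c t0(3) inc]
  have mm: "meet u1 t0 = m0" using above(1) by (simp add: m0_def)
  note tb = triple_table[OF TT(3) t0(1) t0(2)[symmetric] inc mm]
  define m1 where "m1 = meet b1 t1"
  note tb' = triple_table[OF TT(5) b(3) b(4)[symmetric] b(5) m1_def[symmetric]]
  let ?Ls = "(if len m0 = 0 then {} else {len m0}) \<union> {len u1, len u2, p + 1, q' + 1}"
  have m0lev: "len m0 \<noteq> 0 \<Longrightarrow> len m0 \<in> levels" using tb(17) unfolding levels_def by blast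
  interpret G: generators ar \<K> M W lo T "{?c, ?d}" ?Ls
  proof unfold_locales
    show "{?c, ?d} \<subseteq> T" using TT by simp
    show "?Ls \<subseteq> levels" using u(1,2) pq(1,2) m0lev unfolding levels_def by auto
    show "\<exists>c \<in> {?c, ?d}. l \<le> len c" if "l \<in> ?Ls" for l
      using that ml_le[of ?c ?d] lu2 u(6) unfolding m0_def by (auto split: if_splits)
    show "ml c c' \<in> ?Ls" if "c \<in> {?c, ?d}" "c' \<in> {?c, ?d}" "0 < ml c c'" "c \<noteq> c'" for c c'
      using that ml_commute[of ?c ?d] unfolding m0_def by auto
  qed (auto)
  have cA: "restr ?c l \<in> G.A" if "l \<in> ?Ls" "l \<le> len ?c" for l using generatedI[OF _ that] by simp
  have dA: "restr ?d l \<in> G.A" if "l \<in> ?Ls" "l \<le> len ?d" for l using generatedI[OF _ that] by simp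
  have mem: "u1 \<in> G.A" "u2 \<in> G.A" "?c \<in> G.A" "?d \<in> G.A" "t0 \<in> G.A"
    using cA[of "len u1"] cA[of "len u2"] cA[of "p + 1"] dA[of "q' + 1"] dA[of "len u1"] ru1 ru2 lu2 u(6,7) restr_len[OF CT(1)] restr_len[OF CT(2)]
    by (simp_all add: t0_def)
  have m0A: "len m0 \<noteq> 0 \<Longrightarrow> m0 \<in> G.A"
    using cA[of "len m0"] meet_restr(1)[of ?c ?d] ml_le(1)[of ?c ?d] unfolding m0_def by simp
  define A0 where "A0 = {t \<in> G.A. len t \<le> len u1}"
  have A0: "A0 = (if len m0 = 0 then {u1, t0} else {u1, t0, m0})"
  proof
    show "A0 \<subseteq> (if len m0 = 0 then {u1, t0} else {u1, t0, m0})"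
    proof
      fix t assume "t \<in> A0"
      then have t: "t \<in> G.A" "len t \<le> len u1" by (auto simp: A0_def)
      obtain c l where c: "c \<in> {?c, ?d}" "l \<in> ?Ls" "l \<le> len c" "t = restr c l" using t(1) by (rule generatedE)
      have "l = len u1 \<or> (len m0 \<noteq> 0 \<and> l = len m0)"
        using c(2,4) t(2) u(6,7) lu2 by (auto split: if_splits)
      then show "t \<in> (if len m0 = 0 then {u1, t0} else {u1, t0, m0})"
        using c(1,4) ru1 meet_restr[of ?c ?d] unfolding t0_def m0_def by auto
    qed
    show "(if len m0 = 0 then {u1, t0} else {u1, t0, m0}) \<subseteq> A0"
      using mem m0A t0(2) tb(4) unfolding A0_def by auto
  qed
  define f where "f t = (if t = u1 then b1 else if t = t0 then t1 else m1)" for t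
  have ff: "f u1 = b1" "f t0 = t1" "f m0 = m1" using tb(1-3) by (auto simp: f_def)
  define B where "B = (if len m1 = 0 then {b1, t1} else {b1, t1, m1})"
  have l01: "len m0 = 0 \<longleftrightarrow> len m1 = 0" using m(1) by (simp add: m0_def m1_def)
  have sim: "similarity_map ar W M lo f A0 B"
    by (rule triple_similarity[OF TT(3) t0(1) t0(2)[symmetric] inc u(1) TT(5) b(3) b(4)[symmetric] b(5,1) mm m1_def[symmetric] l01 _ A0 B_def ff])
       (use above(3) o in simp)
  have BT: "B \<subseteq> T" using TT(5) b(3) tb'(17) spl_T by (auto simp: B_def)
  \<comment> \<open>Labels matter only at \<open>u1\<close> and at the meet: \<open>t0\<close> lies
    on the top level of \<open>A0\<close>, above which \<open>A0\<close> has no nodes.\<close>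
  have lab: "\<psi> (f t) = \<psi> t" if t: "t \<in> A0" "splitting A0 t \<or> t = u1" for t
  proof (cases "t = u1")
    case True
    then show ?thesis using ff b(2) by simp
  next
    case False
    then obtain x where "x \<in> imm_succ A0 t" using t(2) unfolding splitting_def by blast
    then have "x \<in> hat A0" "len x = len t + 1" unfolding imm_succ_def by auto
    then obtain z n where z: "z \<in> A0" "n \<le> len z" "x = restr z n" unfolding hat_def by blast
    have "len x \<le> len u1" using z unfolding A0_def by simp
    then have "t \<noteq> t0" using \<open>len x = len t + 1\<close> t0(2) by auto
    then have tm: "t = m0" "len m0 \<noteq> 0" using t(1) False A0 by (auto split: if_splits)
    then show ?thesis using ff(3) m(2) l01 by (simp add: m0_def m1_def)
  qed
  have su2: "restr u2 (len u1 + 1) \<in> imm_succ T u1" using succ_mem[OF TT(4) CT(3) u(3,6)] .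
  \<comment> \<open>The successor of \<open>b1\<close> on the side that \<open>u2\<close> takes at
    \<open>u1\<close>.\<close>
  obtain s where s: "s \<in> imm_succ T b1" "position u1 (restr u2 (len u1 + 1)) = position b1 s"
    using position_cases[OF u(1) b(1) su2] by blast
  obtain r where r: "r \<in> T" "len b1 < len r" "b1 \<sqsubseteq> r" "s = restr r (len b1 + 1)" "s \<in> CT" using succE[OF s(1) CT(5)] by metis
  have sr: "s \<sqsubseteq> r" using restr_below[OF T_CT[OF r(1)], of "len b1 + 1"] r by simp
  note prems = copies _ _ u(6) _ mem(1) u(1) refl mem(2) u(2) refl u(3) A0_def sim BT
  have Lu: "l \<le> len u1" if "l \<in> ?Ls" "l < len u2" for l using that tb(4) lu2 u(7) by (auto split: if_splits)
  have fs: "s \<in> imm_succ T (f u1)" "position u1 (restr u2 (len u1 + 1)) = position (f u1) s" "spl (f u1)" using s ff b(1) by auto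
  have "\<exists>s'. spl s' \<and> r \<sqsubseteq> s' \<and> \<psi> s' = \<psi> u2"
    by (rule G.extend_copy(1)[OF prems fs(3) lab fs(1,2) r(1) sr]) (use Lu in auto)
  then obtain s' where s': "spl s'" "r \<sqsubseteq> s'" "\<psi> s' = \<psi> u2" by blast
  have "\<exists>A' h. A' \<subseteq> T \<and> similarity_map ar W M lo h G.A A' \<and> (\<forall>t \<in> A0. h t = f t) \<and> h u2 = s'"
    by (rule G.extend_copy(2)[OF prems fs(3) lab fs(1,2) s'(1) below_trans[OF sr s'(2)] s'(3)]) (use Lu in auto)
  then obtain A' h where h: "A' \<subseteq> T" "similarity_map ar W M lo h G.A A'" "\<forall>t \<in> A0. h t = f t" by blast
  have hu: "h u1 = b1" "h t0 = t1" using h(3) ff A0 by auto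
  have idx: "p \<in> cidx G.A" "q' \<in> cidx G.A" using mem by (auto simp: coding_idx_def)
  have CT': "G.A \<subseteq> CT" "A' \<subseteq> CT" using G.A_T h(1) T_CT by auto
  obtain p' where p': "p' \<in> cidx A'" "h ?c = cn p'" "un p' = un p"
      "\<And>j j'. j \<in> cidx G.A \<Longrightarrow> p < j \<Longrightarrow> h (cn j) = cn j' \<Longrightarrow> bn j' p' = bn j p"
    by (rule sim_coding[OF h(2) idx(1) CT']) (rule that, assumption, assumption, assumption, blast)
  obtain r' where r': "r' \<in> cidx A'" "h ?d = cn r'" "un r' = un q'"
      "\<And>j j'. j \<in> cidx G.A \<Longrightarrow> q' < j \<Longrightarrow> h (cn j) = cn j' \<Longrightarrow> bn j' r' = bn j q'"
    by (rule sim_coding[OF h(2) idx(2) CT']) (rule that, assumption, assumption, assumption, blast)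
  have NN: "p' \<in> N" "r' \<in> N" using p'(1) r'(1) h(1) by (auto simp: coding_idx_def)
  have ab: "b1 \<sqsubseteq> cn p'" "t1 \<sqsubseteq> cn r'"
    using sim_below[OF h(2) mem(1,3) u1c] sim_below[OF h(2) mem(5,4) t0(3)] hu p'(2) r'(2) by auto
  have "p \<noteq> q'" using pq(3) by (auto simp: incomparable_def)
  then consider "p < q'" | "q' < p" by linarith
  then have "bn p' r' = bn p q'"
  proof cases
    case 1
    then show ?thesis using p'(4)[OF idx(2) 1 r'(2)] bn_swap by metis
  next
    case 2
    then show ?thesis using r'(4)[OF idx(1) 2 p'(2)] by simp
  qed
  then have "q p' r' = q p q'" using p'(3) r'(3) by (simp add: q_def)
  then show ?thesis using NN ab p'(3) r'(3) by blast
qed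

text \<open>Provides the two splitting nodes that \<open>transport\<close> requires on a branch, in
  a range of lengths that is the same for all branches.\<close>

definition path :: "nat \<Rightarrow> nat \<Rightarrow> bool" where
  "path l L \<longleftrightarrow> (\<forall>t \<in> T. L \<le> len t \<longrightarrow>
     (\<exists>u1 u2. spl u1 \<and> spl u2 \<and> u1 \<sqsubseteq> u2 \<and> u2 \<sqsubseteq> t \<and> l \<le> len u1 \<and> len u1 < len u2 \<and> len u2 < L))"

lemma path_mono: "path l L \<Longrightarrow> L \<le> L' \<Longrightarrow> path l L'"
  unfolding path_def by (meson less_le_trans order_trans)

lemma path2:
  assumes "0 < l"
  shows "\<exists>L. path l L \<and> l \<le> L"
proof -
  obtain L1 where L1: "\<forall>t \<in> T. L1 \<le> len t \<longrightarrow> (\<exists>b. spl b \<and> b \<sqsubseteq> t \<and> l \<le> len b \<and> len b < L1)"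
    using path1[OF assms] by blast
  have "0 < max l L1" using assms by simp
  then obtain L2 where L2: "\<forall>t \<in> T. L2 \<le> len t \<longrightarrow> (\<exists>b. spl b \<and> b \<sqsubseteq> t \<and> max l L1 \<le> len b \<and> len b < L2)"
    using path1 by blast
  have "path l L2"
    unfolding path_def
  proof (intro ballI impI)
    fix t assume t: "t \<in> T" "L2 \<le> len t"
    obtain u2 where u2: "spl u2" "u2 \<sqsubseteq> t" "max l L1 \<le> len u2" "len u2 < L2" using L2 t by blast
    then have "L1 \<le> len t" using t by simp
    then obtain u1 where u1: "spl u1" "u1 \<sqsubseteq> t" "l \<le> len u1" "len u1 < L1" using L1 t by blast
    have "len u1 < len u2" using u1 u2 by simp
    then have "u1 \<sqsubseteq> u2" using below_linear[of u1 u2 t] spl_CT[OF u1(1)] spl_CT[OF u2(1)] T_CT[OF t(1)] u1 u2 by simp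
    then show "\<exists>u1 u2. spl u1 \<and> spl u2 \<and> u1 \<sqsubseteq> u2 \<and> u2 \<sqsubseteq> t \<and> l \<le> len u1 \<and> len u1 < len u2 \<and> len u2 < L2"
      using u1 u2 \<open>len u1 < len u2\<close> by blast
  qed
  then show ?thesis using path_mono[of l L2 "max l L2"] by (intro exI[of _ "max l L2"]) simp
qed

text \<open>The target of \<open>transport\<close> is found by density: a splitting node
  \<open>b1\<close> above \<open>r1\<close> with the label of \<open>u1\<close>, and an extension of
  \<open>r2\<close> cut off at the length of \<open>b1\<close>. Since \<open>r1\<close> and
  \<open>r2\<close> have split already, the label and the side of their split are
  unaffected.\<close>

lemma copy_pair:
  assumes c: "cone a e" and P: "path l L"
    and p: "p \<in> N" "q' \<in> N" "L \<le> p" "L \<le> q'" "incomparable (cn p) (cn q')" "ml (cn p) (cn q') < l" "len a < l" "e \<sqsubseteq> cn p"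
    and r: "r1 \<in> T" "r2 \<in> T" "e \<sqsubseteq> r1" "incomparable r1 r2"
    and m: "ml (cn p) (cn q') = 0 \<longleftrightarrow> ml r1 r2 = 0" "0 < ml r1 r2 \<Longrightarrow> \<psi> (meet (cn p) (cn q')) = \<psi> (meet r1 r2)"
    and o: "pr (cn p) (cn q') \<longleftrightarrow> pr r1 r2"
  shows "\<exists>p' \<in> N. \<exists>r' \<in> N. r1 \<sqsubseteq> cn p' \<and> r2 \<sqsubseteq> cn r' \<and> un p' = un p \<and> un r' = un q' \<and> q p' r' = q p q'"
proof -
  have "cn p \<in> T" "L \<le> len (cn p)" using p N_iff by auto
  then obtain u1 u2 where u: "spl u1" "spl u2" "u1 \<sqsubseteq> u2" "u2 \<sqsubseteq> cn p" "l \<le> len u1" "len u1 < len u2" "len u2 < L"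
    using P unfolding path_def by blast
  have e: "e \<in> CT" "len e = len a + 1" using c by (auto simp: cone_def)
  have u1: "u1 \<in> CT" "u1 \<sqsubseteq> cn p" using u spl_CT below_trans by blast+
  have eu: "e \<sqsubseteq> u1" using below_linear[OF e(1) u1(1) cn_CT p(8) u1(2)] e(2) u(5) p(7) by simp
  \<comment> \<open>\<open>b1\<close> will lie above \<open>r\<close>; a length of at least that of
    \<open>r2\<close> ensures that cutting at the length of \<open>b1\<close> does not cut below
    \<open>r2\<close>.\<close>
  obtain r where r': "r \<in> T" "r1 \<sqsubseteq> r" "len r2 \<le> len r" using long_above[OF r(1)] by blast
  obtain b1 where b1: "spl b1" "r \<sqsubseteq> b1" "\<psi> b1 = \<psi> u1"
    using splitting_dense[OF c u(1) eu r'(1)] r(3) r'(2) below_trans by blast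
  obtain t where t: "t \<in> T" "r2 \<sqsubseteq> t" "len b1 \<le> len t" using long_above[OF r(2)] by blast
  define t1 where "t1 = restr t (len b1)"
  have t1: "t1 \<in> T" "len t1 = len b1" using spl_level[OF b1(1) t(1,3)] by (auto simp: t1_def)
  have lb: "len r2 \<le> len b1" using r'(3) below_len[OF b1(2)] by simp
  have CT: "r1 \<in> CT" "r2 \<in> CT" "b1 \<in> CT" "t1 \<in> CT" "t \<in> CT" using r t t1 b1 T_CT spl_CT by auto
  have "t1 \<sqsubseteq> t" using restr_below[OF CT(5), of "len b1"] CT_len[OF CT(3)] t(3) by (simp add: t1_def)
  then have b2: "r2 \<sqsubseteq> t1" using below_linear[OF CT(2,4,5) t(2)] t1(2) lb by simp
  have b3: "r1 \<sqsubseteq> b1" using r'(2) b1(2) below_trans by blast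
  note above = meet_above[OF CT(1-4) b3 b2 r(4)] prec_above[OF CT(1-4) b3 b2 r(4)]
  have "\<exists>p' \<in> N. \<exists>r' \<in> N. b1 \<sqsubseteq> cn p' \<and> t1 \<sqsubseteq> cn r' \<and> un p' = un p \<and> un r' = un q' \<and> q p' r' = q p q'"
    by (rule transport[OF p(1,2,5) u(1,2,3,4) _ u(6) _ b1(1,3) t1 above(2)])
       (use above m o p u in simp_all)
  then show ?thesis using b2 b3 below_trans by blast
qed

lemma incomparable_agree:
  assumes "incomparable (cn i) (cn j)"
  shows "\<not> agree (min i j) i j"
proof
  assume "agree (min i j) i j"
  then have "restr (cn i) (min i j + 1) = restr (cn j) (min i j + 1)" by (subst cn_agree) auto
  then have "min i j + 1 \<le> ml (cn i) (cn j)" by (intro meet_aux(2)) auto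
  then show False using assms incomparable_iff[OF cn_CT cn_CT, of i j] by (auto simp: min_def split: if_splits)
qed

text \<open>If no third vertex separated \<open>x\<close> from \<open>y\<close>, then by homogeneity
  no pair of this type would be separated. Incomparable coding nodes above one long node can both
  form such a pair with an earlier vertex \<open>k\<close>. Both then agree with \<open>k\<close>,
  hence with each other, although incomparable coding nodes differ over an earlier vertex.\<close>

lemma separate:
  assumes xy: "x \<noteq> y" and G: "finite G"
  shows "\<exists>f. f \<notin> G \<and> f \<noteq> x \<and> f \<noteq> y \<and> bn x f \<noteq> bn y f"
proof -
  have "\<exists>f. f \<noteq> x \<and> f \<noteq> y \<and> bn x f \<noteq> bn y f"
  proof (rule ccontr)
    assume "\<not> ?thesis"
    then have tw: "bn x f = bn y f" if "f \<noteq> x" "f \<noteq> y" for f using that by blast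
    have tw': "bn p f = bn k f" if pk: "p \<noteq> k" "q p k = q x y" "f \<noteq> p" "f \<noteq> k" for p k f
    proof -
      obtain \<phi> where \<phi>: "pe \<phi> ({p, k} \<union> {f})" "\<forall>z \<in> {p, k}. \<phi> z = ((\<lambda>_. y)(p := x)) z"
        using extend[OF _ _ _ pe_pair[OF xy pk(1,2)], of "{f}" "{}"] by auto
      have "\<phi> p = x" "\<phi> k = y" using \<phi>(2) pk(1) by auto
      moreover have "\<phi> f \<noteq> \<phi> p" "\<phi> f \<noteq> \<phi> k" using pe_inj[OF \<phi>(1)] pk by (auto simp: inj_on_def)
      ultimately show ?thesis using pe_bn[OF \<phi>(1), of p f] pe_bn[OF \<phi>(1), of k f] pk tw[of "\<phi> f"] by auto
    qed
    obtain \<phi>0 where \<phi>0: "pe \<phi>0 {y}" "\<phi>0 ` {y} \<subseteq> N"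
      using extend_N[of "{}" "{y}" "{}" id] pe_id by auto
    define k where "k = \<phi>0 y"
    \<comment> \<open>Nodes beyond length \<open>k + 3\<close> settle the type over
      \<open>k\<close>, so all coding nodes above \<open>u2\<close> have the type of
      \<open>p\<close> over \<open>k\<close>.\<close>
    obtain L where L: "path (k + 3) L" using path2[of "k + 3"] by auto
    obtain \<phi> where \<phi>: "pe \<phi> ({y} \<union> {x})" "\<forall>z \<in> {y}. \<phi> z = \<phi>0 z" "\<phi> ` ({y} \<union> {x}) \<subseteq> N" "\<forall>z \<in> {x} - {y}. \<phi> z \<notin> {..L}"
      using extend_N[OF _ _ _ \<phi>0, of "{x}" "{..L}"] by auto
    define p where "p = \<phi> x"
    have p: "p \<in> N" "L < p" "\<phi> y = k" using \<phi> xy by (auto simp: p_def k_def)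
    have qpk: "q p k = q x y" using pe_q[OF \<phi>(1), of x y] xy p(3) by (simp add: p_def)
    have "cn p \<in> T" "L \<le> len (cn p)" using p N_iff by auto
    then obtain u1 u2 where u: "spl u1" "spl u2" "u1 \<sqsubseteq> u2" "u2 \<sqsubseteq> cn p" "k + 3 \<le> len u1" "len u1 < len u2"
      using L unfolding path_def by blast
    have uT: "u1 \<in> CT" "u2 \<in> CT" "u2 \<in> T" using u spl_CT spl_T by auto
    define e where "e = restr u2 (len u1 + 1)"
    have e: "e \<in> CT" "e \<sqsubseteq> u2" "len e = len u1 + 1"
      using restr_CT[OF uT(2), of "len u1 + 1"] restr_below[OF uT(2), of "len u1 + 1"] u(6) by (auto simp: e_def)
    have c: "cone u1 e" unfolding cone_def using u(1) e below_linear[OF uT(1) e(1) uT(2) u(3) e(2)] by simp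
    obtain t1 t2 where t: "t1 \<in> T" "t2 \<in> T" "u2 \<sqsubseteq> t1" "u2 \<sqsubseteq> t2" "incomparable t1 t2" using split_above[OF uT(3)] by metis
    obtain i1 where i1: "i1 \<in> N" "t1 \<sqsubseteq> cn i1" "un i1 = un p"
      using coding_dense[OF c u(2) e(2) p(1) u(4) t(1)] e(2) t(3) below_trans by blast
    obtain i2 where i2: "i2 \<in> N" "t2 \<sqsubseteq> cn i2" "un i2 = un p"
      using coding_dense[OF c u(2) e(2) p(1) u(4) t(2)] e(2) t(4) below_trans by blast
    have b: "u2 \<sqsubseteq> cn i1" "u2 \<sqsubseteq> cn i2" using t i1 i2 below_trans by blast+
    have k2: "k + 1 < len u2" using u(5,6) by simp
    have bk: "bn i1 k = bn p k" "bn i2 k = bn p k" using bn_below[OF uT(2) _ u(4) k2] b by auto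
    have ki: "k < i1" "k < i2" using below_len[OF b(1)] below_len[OF b(2)] k2 by auto
    have "incomparable (cn i1) (cn i2)"
      using meet_above(2)[OF T_CT[OF t(1)] T_CT[OF t(2)] cn_CT cn_CT i1(2) i2(2) t(5)] .
    then have "\<not> agree (min i1 i2) i1 i2" by (rule incomparable_agree)
    then obtain f where f: "f < min i1 i2" "bn i1 f \<noteq> bn i2 f"
      using i1(3) i2(3) unfolding agree_def uW_def by metis
    have "q i1 k = q x y" "q i2 k = q x y" using qpk bk i1 i2 by (auto simp: q_def)
    then have "f \<noteq> k \<Longrightarrow> bn i1 f = bn k f" "f \<noteq> k \<Longrightarrow> bn i2 f = bn k f"
      using tw'[of i1 k f] tw'[of i2 k f] ki f(1) by auto
    then show False using f(2) bk by (cases "f = k") auto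
  qed
  then obtain f where f: "f \<noteq> x" "f \<noteq> y" "bn x f \<noteq> bn y f" by blast
  \<comment> \<open>Homogeneity over \<open>x\<close> and \<open>y\<close> moves the separating
    vertex out of \<open>G\<close>.\<close>
  obtain f' where f': "f' \<notin> G \<union> {x, y}" "pe (id(f := f')) (insert f {x, y})"
    using ext1[OF _ _ pe_id[of "{x, y}"], of "G \<union> {x, y}" f] f G by auto
  have "bn x f' = bn x f" "bn y f' = bn y f" using pe_bn[OF f'(2), of x f] pe_bn[OF f'(2), of y f] f by auto
  then show ?thesis using f'(1) f(3) by auto
qed

text \<open>The version of \<open>decides\<close> that copying can use: the deciding vertices have
  become parameters of the two coding nodes, so being above these nodes replaces having the same
  type over the deciding set.\<close>

definition Dec :: "nat \<Rightarrow> nat \<Rightarrow> bool" where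
  "Dec x y \<longleftrightarrow> (\<forall>p \<in> N. \<forall>r \<in> N. cn x \<sqsubseteq> cn p \<longrightarrow> cn y \<sqsubseteq> cn r \<longrightarrow> un p = un x \<longrightarrow> un r = un y \<longrightarrow> q p r \<cong> q x y)"

lemma decides_pe:
  assumes d: "decides E x y" and E: "finite E" "x \<notin> E" "y \<notin> E" "x \<noteq> y" and \<phi>: "pe \<phi> ({x, y} \<union> E)"
  shows "decides (\<phi> ` E) (\<phi> x) (\<phi> y)"
  unfolding decides_def
proof (intro allI impI)
  fix p r assume p: "p \<noteq> r" "p \<notin> \<phi> ` E" "r \<notin> \<phi> ` E" "same p (\<phi> x) (\<phi> ` E)" "same r (\<phi> y) (\<phi> ` E)"
  have pE: "pe \<phi> E" using \<phi> by (rule pe_subset) auto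
  have f: "finite (\<phi> ` E)" using E by simp
  obtain \<iota> where \<iota>: "pe \<iota> (\<phi> ` E \<union> {p, r})" "\<forall>z \<in> \<phi> ` E. \<iota> z = the_inv_into E \<phi> z" "\<forall>z \<in> {p, r} - \<phi> ` E. \<iota> z \<notin> E"
    using extend[OF f _ E(1) pe_inv[OF pE], of "{p, r}"] by auto
  have i: "\<iota> (\<phi> z) = z" if "z \<in> E" for z using \<iota>(2) that the_inv_into_f_f[OF pe_inj[OF pE] that] by simp
  have sm: "same (\<iota> p') x' E" if "p' \<in> {p, r}" "x' \<in> {x, y}" "same p' (\<phi> x') (\<phi> ` E)" for p' x'
    unfolding same_def
  proof (intro conjI ballI)
    show "un (\<iota> p') = un x'" using that pe_un[OF \<iota>(1), of p'] pe_un[OF \<phi>, of x'] by (auto simp: same_def)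
    fix z assume z: "z \<in> E"
    have "p' \<noteq> \<phi> z" "x' \<noteq> z" using that p(2,3) z E by auto
    have "bn (\<iota> p') z = bn (\<iota> p') (\<iota> (\<phi> z))" using i[OF z] by simp
    also have "\<dots> = bn p' (\<phi> z)" using that(1) z \<open>p' \<noteq> \<phi> z\<close> by (intro pe_bn[OF \<iota>(1)]) auto
    also have "\<dots> = bn (\<phi> x') (\<phi> z)" using that(3) z by (simp add: same_def)
    also have "\<dots> = bn x' z" using that(2) z \<open>x' \<noteq> z\<close> by (intro pe_bn[OF \<phi>]) auto
    finally show "bn (\<iota> p') z = bn x' z" .
  qed
  have "\<iota> p \<noteq> \<iota> r" using pe_inj[OF \<iota>(1)] p(1) by (auto simp: inj_on_def)
  moreover have "\<iota> p \<notin> E" "\<iota> r \<notin> E" using \<iota>(3) p by auto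
  ultimately have "q (\<iota> p) (\<iota> r) \<cong> q x y"
    using d sm[of p x] sm[of r y] p(4,5) unfolding decides_def by auto
  moreover have "q (\<iota> p) (\<iota> r) = q p r" using pe_q[OF \<iota>(1), of p r] p(1) by simp
  moreover have "q (\<phi> x) (\<phi> y) = q x y" using pe_q[OF \<phi>, of x y] E(4) by simp
  ultimately show "q p r \<cong> q (\<phi> x) (\<phi> y)" by simp
qed

text \<open>Deciding and separating vertices for all pairs are placed in the tree first, and the
  copy of \<open>Z\<close> far above them. Its coding nodes then contain all types over the first
  part: they have split before \<open>l\<close> because of the separating vertices, and satisfy
  \<open>Dec\<close> because of the deciding ones.\<close>

lemma good_copy:
  assumes Z: "finite Z"
  shows "\<exists>\<phi> l L. pe \<phi> Z \<and> \<phi> ` Z \<subseteq> N \<and> path l L \<and> (\<forall>x \<in> Z. L \<le> \<phi> x) \<and>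
    (\<forall>x \<in> Z. \<forall>y \<in> Z. x \<noteq> y \<longrightarrow> incomparable (cn (\<phi> x)) (cn (\<phi> y)) \<and> ml (cn (\<phi> x)) (cn (\<phi> y)) < l \<and> Dec (\<phi> x) (\<phi> y))"
proof -
  have "\<exists>E f. x \<noteq> y \<longrightarrow> finite E \<and> E \<inter> Z = {} \<and> decides E x y \<and> f \<notin> Z \<and> bn x f \<noteq> bn y f" for x y
  proof (cases "x = y")
    case False
    obtain E where "finite E" "E \<inter> Z = {}" "decides E x y" using decide_pair[OF False Z] by metis
    then show ?thesis using separate[OF False Z] by blast
  qed simp
  then obtain E f where Ef: "\<And>x y. x \<noteq> y \<Longrightarrow> finite (E x y) \<and> E x y \<inter> Z = {} \<and> decides (E x y) x y \<and> f x y \<notin> Z \<and> bn x (f x y) \<noteq> bn y (f x y)"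
    by metis
  define H where "H = (\<Union>x \<in> Z. \<Union>y \<in> Z - {x}. insert (f x y) (E x y))"
  have fin: "finite (insert (f x y) (E x y))" if "y \<in> Z - {x}" for x y
    using Ef[of x y] that by auto
  have "finite H" unfolding H_def using Z fin by (metis (no_types, lifting) finite_Diff finite_UN)
  moreover have "z \<notin> H" if "z \<in> Z" for z
  proof
    assume "z \<in> H"
    then obtain x y where "y \<noteq> x" "z = f x y \<or> z \<in> E x y" unfolding H_def by blast
    then show False using Ef[of x y] that by auto
  qed
  ultimately have H: "finite H" "H \<inter> Z = {}" by auto
  have EH: "E x y \<subseteq> H" "f x y \<in> H" if "x \<in> Z" "y \<in> Z" "x \<noteq> y" for x y using that by (auto simp: H_def)
  obtain \<phi>0 where \<phi>0: "pe \<phi>0 H" "\<phi>0 ` H \<subseteq> N" using extend_N[OF _ H(1), of "{}" "{}" id] pe_id by auto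
  \<comment> \<open>The margin 3 leaves room for two shifts: nodes that differ over a vertex
    \<open>k\<close> split before length \<open>k + 2\<close>, and \<open>bn_below\<close> requires
    a length above \<open>k + 1\<close>.\<close>
  define l where "l = Max (insert 0 (\<phi>0 ` H)) + 3"
  have lH: "\<phi>0 h + 3 \<le> l" if "h \<in> H" for h using H(1) that by (simp add: l_def)
  obtain L where L: "path l L" "l \<le> L" using path2[of l] by (auto simp: l_def)
  obtain \<phi> where \<phi>: "pe \<phi> (H \<union> Z)" "\<forall>x \<in> H. \<phi> x = \<phi>0 x" "\<phi> ` (H \<union> Z) \<subseteq> N" "\<forall>y \<in> Z - H. \<phi> y \<notin> {..L}"
    using extend_N[OF H(1) Z _ \<phi>0, of "{..L}"] by auto
  have lZ: "L < \<phi> x" if "x \<in> Z" for x using \<phi>(4) that H(2) by force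
  have "incomparable (cn (\<phi> x)) (cn (\<phi> y)) \<and> ml (cn (\<phi> x)) (cn (\<phi> y)) < l \<and> Dec (\<phi> x) (\<phi> y)"
    if xy: "x \<in> Z" "y \<in> Z" "x \<noteq> y" for x y
  proof -
    note E = Ef[OF xy(3)]
    define k where "k = \<phi> (f x y)"
    have k: "k + 3 \<le> l" using lH[OF EH(2)[OF xy]] \<phi>(2) EH(2)[OF xy] by (simp add: k_def)
    have kxy: "k + 3 \<le> \<phi> x" "k + 3 \<le> \<phi> y" using k L(2) lZ[OF xy(1)] lZ[OF xy(2)] by auto
    have "x \<noteq> f x y" "y \<noteq> f x y" using E xy by metis+
    then have "bn (\<phi> x) k = bn x (f x y)" "bn (\<phi> y) k = bn y (f x y)"
      using pe_bn[OF \<phi>(1), of x "f x y"] pe_bn[OF \<phi>(1), of y "f x y"] xy E EH(2)[OF xy] by (auto simp: k_def)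
    then have "\<not> agree (k + 1) (\<phi> x) (\<phi> y)" using E by (auto simp: agree_def)
    then have "restr (cn (\<phi> x)) (k + 2) \<noteq> restr (cn (\<phi> y)) (k + 2)"
      using cn_agree[of "k + 1" "\<phi> x" "\<phi> y"] kxy by simp
    then have ml: "ml (cn (\<phi> x)) (cn (\<phi> y)) < k + 2"
      using restr_eq_iff[of "k + 2" "cn (\<phi> x)" "cn (\<phi> y)"] kxy by simp
    then have inc: "incomparable (cn (\<phi> x)) (cn (\<phi> y))" using incomparable_iff[OF cn_CT cn_CT] kxy by simp
    have "{x, y} \<union> E x y \<subseteq> H \<union> Z" using xy EH(1)[OF xy] by auto
    then have "pe \<phi> ({x, y} \<union> E x y)" using \<phi>(1) pe_subset by blast
    then have dec: "decides (\<phi> ` E x y) (\<phi> x) (\<phi> y)"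
      using E xy by (intro decides_pe) auto
    have small: "\<phi> z + 3 \<le> \<phi> x'" if "z \<in> E x y" "x' \<in> Z" for z x'
      using lH[of z] \<phi>(2) EH(1)[OF xy] that lZ[of x'] L(2) by fastforce
    have sm: "same p (\<phi> x') (\<phi> ` E x y) \<and> p \<notin> \<phi> ` E x y" if p: "cn (\<phi> x') \<sqsubseteq> cn p" "un p = un (\<phi> x')" "x' \<in> Z" for p x'
    proof
      show "same p (\<phi> x') (\<phi> ` E x y)"
        unfolding same_def using p(2) bn_below[OF cn_CT p(1), of "\<phi> x'"] small[OF _ p(3)] by fastforce
      show "p \<notin> \<phi> ` E x y" using small[OF _ p(3)] below_len[OF p(1)] by fastforce
    qed
    have "Dec (\<phi> x) (\<phi> y)"
      unfolding Dec_def
    proof (intro ballI impI)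
      fix p r assume p: "p \<in> N" "r \<in> N" "cn (\<phi> x) \<sqsubseteq> cn p" "cn (\<phi> y) \<sqsubseteq> cn r" "un p = un (\<phi> x)" "un r = un (\<phi> y)"
      have "incomparable (cn p) (cn r)" using meet_above(2)[OF cn_CT cn_CT cn_CT cn_CT p(3,4) inc] .
      then have "p \<noteq> r" by (auto simp: incomparable_def)
      then show "q p r \<cong> q (\<phi> x) (\<phi> y)"
        using dec sm[OF p(3,5) xy(1)] sm[OF p(4,6) xy(2)] unfolding decides_def by blast
    qed
    then show ?thesis using inc ml k by simp
  qed
  moreover have "pe \<phi> Z" using \<phi>(1) by (rule pe_subset) auto
  moreover have "\<phi> ` Z \<subseteq> N" using \<phi>(3) by auto
  moreover have "\<forall>x \<in> Z. L \<le> \<phi> x" using lZ by (auto intro: less_imp_le)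
  ultimately show ?thesis using L(1) by blast
qed

text \<open>The pair \<open>p, q'\<close> has an exact copy above the coding nodes of
  \<open>x\<close> and \<open>y\<close>, where \<open>Dec\<close> determines the class. Hence the
  class depends only on the unary types and on the label and side of the split.\<close>

lemma forced:
  assumes c: "cone a e" and P: "path l L"
    and p: "p \<in> N" "q' \<in> N" "L \<le> p" "L \<le> q'" "incomparable (cn p) (cn q')" "ml (cn p) (cn q') < l" "len a < l" "e \<sqsubseteq> cn p"
    and r: "x \<in> N" "y \<in> N" "e \<sqsubseteq> cn x" "incomparable (cn x) (cn y)" "Dec x y" "un p = un x" "un q' = un y"
    and m: "ml (cn p) (cn q') = 0 \<longleftrightarrow> ml (cn x) (cn y) = 0"
      "0 < ml (cn x) (cn y) \<Longrightarrow> \<psi> (meet (cn p) (cn q')) = \<psi> (meet (cn x) (cn y))"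
    and o: "pr (cn p) (cn q') \<longleftrightarrow> pr (cn x) (cn y)"
  shows "q p q' \<cong> q x y"
proof -
  have "cn x \<in> T" "cn y \<in> T" using r N_iff by auto
  from copy_pair[OF c P p this r(3,4) m o]
  obtain p' r' where "p' \<in> N" "r' \<in> N" "cn x \<sqsubseteq> cn p'" "cn y \<sqsubseteq> cn r'" "un p' = un p" "un r' = un q'" "q p' r' = q p q'" by blast
  then show ?thesis using r(5-7) unfolding Dec_def by metis
qed

end

section \<open>Vertices that separate three vertices of one unary type\<close>

context homog_sdap
begin

text \<open>Pairs are corrected one at a time. A change affects a single pair, so corrected pairs
  stay correct and the others keep their class.\<close>

lemma cong_realise:
  assumes V: "finite V" "inj_on f V"
    and c: "\<And>x y. x \<in> V \<Longrightarrow> y \<in> V \<Longrightarrow> x \<noteq> y \<Longrightarrow> cong (q (f x) (f y)) (\<tau> x y)"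
    and \<tau>: "\<And>x y. x \<in> V \<Longrightarrow> y \<in> V \<Longrightarrow> x \<noteq> y \<Longrightarrow> \<exists>a b. a \<noteq> b \<and> \<tau> x y = q a b \<and> \<tau> y x = q b a"
  shows "\<exists>g. inj_on g V \<and> (\<forall>x \<in> V. un (g x) = un (f x)) \<and> (\<forall>x \<in> V. \<forall>y \<in> V. x \<noteq> y \<longrightarrow> q (g x) (g y) = \<tau> x y)"
proof -
  have step: "\<exists>g. inj_on g V \<and> (\<forall>x \<in> V. un (g x) = un (f x)) \<and>
      (\<forall>x \<in> V. \<forall>y \<in> V. x \<noteq> y \<longrightarrow> cong (q (g x) (g y)) (\<tau> x y) \<and> ((x, y) \<in> D \<longrightarrow> q (g x) (g y) = \<tau> x y))"
    if "finite D" "D \<subseteq> {(x, y). x \<in> V \<and> y \<in> V \<and> x \<noteq> y}" for D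
    using that
  proof (induction D rule: finite_induct)
    case empty
    then show ?case using V c by (intro exI[of _ f]) blast
  next
    case (insert d D)
    have "D \<subseteq> {(x, y). x \<in> V \<and> y \<in> V \<and> x \<noteq> y}" using insert.prems by simp
    from insert.IH[OF this]
    obtain g where g: "inj_on g V" "\<forall>x \<in> V. un (g x) = un (f x)"
      "\<forall>x \<in> V. \<forall>y \<in> V. x \<noteq> y \<longrightarrow> cong (q (g x) (g y)) (\<tau> x y) \<and> ((x, y) \<in> D \<longrightarrow> q (g x) (g y) = \<tau> x y)"
      by (elim exE conjE)
    obtain x y where d: "d = (x, y)" "x \<in> V" "y \<in> V" "x \<noteq> y" using insert.prems by blast
    obtain a b where ab: "a \<noteq> b" "\<tau> x y = q a b" "\<tau> y x = q b a" using \<tau>[OF d(2-4)] by blast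
    have gne: "g x' \<noteq> g y'" if "x' \<in> V" "y' \<in> V" "x' \<noteq> y'" for x' y' using g(1) that by (meson inj_onD)
    have "cong (q (g x) (g y)) (q a b)" using g(3) d ab by metis
    then obtain \<phi> where \<phi>: "change_map \<phi> (g ` V) (g x) (g y) (q a b)"
      using change_pair[of "g x" "g y" a b "g ` V"] V(1) d gne by blast
    note \<phi>D = change_mapD[OF \<phi>]
    have "cong (q ((\<phi> \<circ> g) x') ((\<phi> \<circ> g) y')) (\<tau> x' y') \<and>
        ((x', y') \<in> insert d D \<longrightarrow> q ((\<phi> \<circ> g) x') ((\<phi> \<circ> g) y') = \<tau> x' y')"
      if xy: "x' \<in> V" "y' \<in> V" "x' \<noteq> y'" for x' y'
    proof -
      consider "x' = x \<and> y' = y" | "x' = y \<and> y' = x" | "{x', y'} \<noteq> {x, y}" by (auto simp: doubleton_eq_iff)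
      then show ?thesis
      proof cases
        case 1
        then show ?thesis using \<phi>D(3) ab cong_refl by simp
      next
        case 2
        then show ?thesis using q_swap[OF \<phi>D(3)] ab cong_refl by simp
      next
        case 3
        have "{g x', g y'} \<noteq> {g x, g y}"
          using 3 inj_onD[OF g(1)] xy d by (metis doubleton_eq_iff)
        then have "q (\<phi> (g x')) (\<phi> (g y')) = q (g x') (g y')"
          using xy gne by (intro change_map_q[OF \<phi>]) auto
        moreover have "(x', y') \<noteq> (x, y)" using 3 by auto
        ultimately show ?thesis using g(3) xy d(1) by auto
      qed
    qed
    moreover have "inj_on (\<phi> \<circ> g) V" using g(1) \<phi>D(1) comp_inj_on by blast
    moreover have "\<forall>x \<in> V. un ((\<phi> \<circ> g) x) = un (f x)" using g(2) \<phi>D(2) by simp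
    ultimately show ?case by blast
  qed
  let ?D = "{(x, y). x \<in> V \<and> y \<in> V \<and> x \<noteq> y}"
  have "finite ?D" by (rule finite_subset[of _ "V \<times> V"]) (use V(1) in auto)
  then obtain g where g: "inj_on g V" "\<forall>x \<in> V. un (g x) = un (f x)"
      "\<forall>x \<in> V. \<forall>y \<in> V. x \<noteq> y \<longrightarrow> cong (q (g x) (g y)) (\<tau> x y) \<and> ((x, y) \<in> ?D \<longrightarrow> q (g x) (g y) = \<tau> x y)"
    using step[of ?D] by blast
  have "\<forall>x \<in> V. \<forall>y \<in> V. x \<noteq> y \<longrightarrow> q (g x) (g y) = \<tau> x y" using g(3) by simp
  then show ?thesis using g(1,2) by blast
qed

lemma extend_triple:
  assumes d: "distinct [a, b, c]" "distinct [a', b', c']" and y: "y \<notin> {a, b, c}" and G: "finite G"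
    and t: "q a b = q a' b'" "q a c = q a' c'" "q b c = q b' c'"
  shows "\<exists>y'. y' \<notin> G \<and> y' \<notin> {a', b', c'} \<and> un y' = un y \<and> q y' a' = q y a \<and> q y' b' = q y b \<and> q y' c' = q y c"
proof -
  define \<phi> where "\<phi> = (\<lambda>_. c')(b := b', a := a')"
  have \<phi>: "\<phi> a = a'" "\<phi> b = b'" "\<phi> c = c'" using d by (auto simp: \<phi>_def)
  have t': "q b a = q b' a'" "q c a = q c' a'" "q c b = q c' b'" using q_swap t by metis+
  have "pe \<phi> {a, b, c}"
    unfolding pe_def using \<phi> d t t' by (simp add: q_def inj_on_def)
  then obtain y' where y': "y' \<notin> G \<union> {a', b', c'}" "pe (\<phi>(y := y')) (insert y {a, b, c})"
    using ext1[of "{a, b, c}" "G \<union> {a', b', c'}" \<phi> y] G y by auto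
  have Q: "q y' (\<phi> z) = q y z" if "z \<in> {a, b, c}" for z
    using pe_q[OF y'(2), of y z] that y by auto
  have "un y' = un y" using pe_un[OF y'(2), of y] by simp
  then show ?thesis using \<phi> y'(1) Q[of a] Q[of b] Q[of c] by (intro exI[of _ y']) simp
qed

end

context copying_tree
begin

text \<open>All that \<open>forced\<close> has to know about a pair. The condition
  \<open>0 < ml r s\<close> excludes the virtual root, which carries no label.\<close>

definition pos :: "'r node \<Rightarrow> 'r node \<Rightarrow> nat \<Rightarrow> bool \<Rightarrow> bool" where
  "pos r s m o' \<longleftrightarrow> incomparable r s \<and> 0 < ml r s \<and> \<psi> (meet r s) = m \<and> (pr r s \<longleftrightarrow> o')"

lemma pos_above:
  assumes "pos r s m o'" "r \<in> CT" "s \<in> CT" "r' \<in> CT" "s' \<in> CT" "r \<sqsubseteq> r'" "s \<sqsubseteq> s'"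
  shows "pos r' s' m o'"
  using assms meet_above[of r s r' s'] prec_above[of r s r' s'] unfolding pos_def by simp

lemma pos_sym: "pos r s m o' \<Longrightarrow> r \<in> CT \<Longrightarrow> s \<in> CT \<Longrightarrow> pos s r m (\<not> o')"
  using prec_asym[of r s] meet_commute[of r s] unfolding pos_def incomparable_def by simp

text \<open>Either of the two branches may be named first, so both sides are available.\<close>

lemma split_pos:
  assumes "cone a e" "spl w" "e \<sqsubseteq> w" "r \<in> T" "e \<sqsubseteq> r"
  shows "\<exists>t1 \<in> T. \<exists>t2 \<in> T. r \<sqsubseteq> t1 \<and> r \<sqsubseteq> t2 \<and> pos t1 t2 (\<psi> w) o'"
proof -
  obtain s where s: "spl s" "r \<sqsubseteq> s" "\<psi> s = \<psi> w" using splitting_dense[OF assms] by blast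
  obtain t1 t2 where t: "t1 \<in> T" "t2 \<in> T" "s \<sqsubseteq> t1" "s \<sqsubseteq> t2" "incomparable t1 t2" "meet t1 t2 = s"
    using splE[OF s(1)] by metis
  have r: "r \<sqsubseteq> t1" "r \<sqsubseteq> t2" using s(2) t(3,4) below_trans by blast+
  have "0 < len s" using CT_len[OF spl_CT[OF s(1)]] by simp
  then have "pos t1 t2 (\<psi> w) (pr t1 t2)" using t s(3) by (simp add: pos_def)
  then have "pos t1 t2 (\<psi> w) o' \<or> pos t2 t1 (\<psi> w) o'"
    using pos_sym[of t1 t2 "\<psi> w" "pr t1 t2"] T_CT[OF t(1)] T_CT[OF t(2)] by (cases "pr t1 t2 \<longleftrightarrow> o'") auto
  then show ?thesis using t(1,2) r by blast
qed

definition good :: "nat \<Rightarrow> nat \<Rightarrow> nat set \<Rightarrow> bool" where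
  "good l L X \<longleftrightarrow> X \<subseteq> N \<and> path l L \<and> (\<forall>x \<in> X. L \<le> x) \<and>
    (\<forall>x \<in> X. \<forall>y \<in> X. x \<noteq> y \<longrightarrow> incomparable (cn x) (cn y) \<and> ml (cn x) (cn y) < l \<and> Dec x y)"

lemma goodD:
  assumes "good l L X"
  shows "x \<in> X \<Longrightarrow> x \<in> N" "x \<in> X \<Longrightarrow> L \<le> x" "path l L"
    "x \<in> X \<Longrightarrow> y \<in> X \<Longrightarrow> x \<noteq> y \<Longrightarrow> incomparable (cn x) (cn y)"
    "x \<in> X \<Longrightarrow> y \<in> X \<Longrightarrow> x \<noteq> y \<Longrightarrow> ml (cn x) (cn y) < l"
    "x \<in> X \<Longrightarrow> y \<in> X \<Longrightarrow> x \<noteq> y \<Longrightarrow> Dec x y"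
  using assms unfolding good_def by blast+

lemma good_copy':
  assumes "finite Z"
  obtains \<phi> l L where "pe \<phi> Z" "good l L (\<phi> ` Z)"
proof -
  obtain \<phi> l L where \<phi>: "pe \<phi> Z" "\<phi> ` Z \<subseteq> N" "path l L" "\<forall>x \<in> Z. L \<le> \<phi> x"
    "\<forall>x \<in> Z. \<forall>y \<in> Z. x \<noteq> y \<longrightarrow> incomparable (cn (\<phi> x)) (cn (\<phi> y)) \<and> ml (cn (\<phi> x)) (cn (\<phi> y)) < l \<and> Dec (\<phi> x) (\<phi> y)"
    using good_copy[OF assms] by blast
  have "\<forall>x \<in> \<phi> ` Z. \<forall>y \<in> \<phi> ` Z. x \<noteq> y \<longrightarrow> incomparable (cn x) (cn y) \<and> ml (cn x) (cn y) < l \<and> Dec x y"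
  proof (intro ballI impI)
    fix x y assume "x \<in> \<phi> ` Z" "y \<in> \<phi> ` Z" "x \<noteq> y"
    then obtain x' y' where xy: "x = \<phi> x'" "y = \<phi> y'" "x' \<in> Z" "y' \<in> Z" "x' \<noteq> y'" by blast
    show "incomparable (cn x) (cn y) \<and> ml (cn x) (cn y) < l \<and> Dec x y"
      unfolding xy(1,2) by (rule \<phi>(5)[rule_format, OF xy(3-5)])
  qed
  then show ?thesis using that[OF \<phi>(1)] \<phi>(2-4) unfolding good_def by blast
qed

definition closer :: "'r node \<Rightarrow> 'r node \<Rightarrow> 'r node \<Rightarrow> bool" where
  "closer x y z \<longleftrightarrow> ml x z < ml x y"

text \<open>A splitting node has only two successors, so three branches never separate at one
  node.\<close>

lemma shape:
  assumes t: "t1 \<in> T" "t2 \<in> T" "t3 \<in> T" "incomparable t1 t2" "incomparable t1 t3" "incomparable t2 t3" "0 < ml t1 t2"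
  shows "closer t1 t2 t3 \<or> closer t1 t3 t2 \<or> closer t2 t3 t1"
proof (rule ccontr)
  assume n: "\<not> ?thesis"
  then have eq: "ml t1 t2 = ml t1 t3" unfolding closer_def by simp
  define b where "b = meet t1 t2"
  have b: "spl b" unfolding b_def using meet_spl t by blast
  have CT: "t1 \<in> CT" "t2 \<in> CT" "t3 \<in> CT" using t T_CT by auto
  have "meet t1 t3 = b" using meet_restr(1)[of t1 t2] meet_restr(1)[of t1 t3] eq by (simp add: b_def)
  moreover have "0 < ml t1 t3" using t(7) eq by simp
  ultimately have bb: "b \<sqsubseteq> t1" "b \<sqsubseteq> t2" "b \<sqsubseteq> t3"
    using meet_below[OF CT(1,2) t(7)] meet_below[OF CT(1,3)] unfolding b_def by metis+
  have len: "len b < len t1" "len b < len t2" "len b < len t3"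
    using incomparable_iff[OF CT(1,2)] incomparable_iff[OF CT(1,3)] t(4,5) eq unfolding b_def by simp_all
  have "restr t1 (len b + 1) \<noteq> restr t2 (len b + 1)" "restr t1 (len b + 1) \<noteq> restr t3 (len b + 1)"
    using restr_eq_iff[of "len b + 1" t1 t2] restr_eq_iff[of "len b + 1" t1 t3] len eq unfolding b_def by simp_all
  then have "restr t2 (len b + 1) = restr t3 (len b + 1)" using succ_cases[OF b t(1-3) bb len] by blast
  then have "len b + 1 \<le> ml t2 t3" using restr_eq_iff[of "len b + 1" t2 t3] len by simp
  then have "closer t2 t3 t1" unfolding closer_def b_def using ml_commute[of t1 t2] by simp
  then show False using n by blast
qed

text \<open>The standing situation of the following lemmas. The cone below the meet \<open>v\<close>
  makes copies of splitting and coding nodes above \<open>e\<close> available; \<open>good\<close>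
  makes classes readable from positions.\<close>

definition split_at :: "'r node \<Rightarrow> 'r node \<Rightarrow> 'r node \<Rightarrow> nat \<Rightarrow> nat \<Rightarrow> nat set \<Rightarrow> nat \<Rightarrow> nat \<Rightarrow> bool" where
  "split_at a e v l L X i j \<longleftrightarrow> cone a e \<and> spl v \<and> e \<sqsubseteq> v \<and> meet (cn i) (cn j) = v \<and> good l L X \<and> len a < l \<and>
     i \<in> X \<and> j \<in> X \<and> i \<noteq> j \<and> un i = un j"

lemma split_at_sym: "split_at a e v l L X i j \<Longrightarrow> split_at a e v l L X j i"
  using meet_commute[of "cn i" "cn j"] unfolding split_at_def by auto

lemma split_atD:
  assumes "split_at a e v l L X i j"
  shows "v \<in> CT" "v \<sqsubseteq> cn i" "v \<sqsubseteq> cn j" "e \<sqsubseteq> cn i" "e \<sqsubseteq> cn j" "i \<in> N" "j \<in> N" "0 < len v"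
    "len v < len (cn i)" "len v < len (cn j)" "cone a e" "spl v" "e \<sqsubseteq> v" "good l L X" "len a < l"
    "i \<in> X" "j \<in> X" "i \<noteq> j" "un i = un j" "meet (cn i) (cn j) = v"
    "pos (cn i) (cn j) (\<psi> v) (pr (cn i) (cn j))"
proof -
  have s: "cone a e" "spl v" "e \<sqsubseteq> v" "meet (cn i) (cn j) = v" "good l L X" "len a < l"
    "i \<in> X" "j \<in> X" "i \<noteq> j" "un i = un j" using assms unfolding split_at_def by blast+
  then show "cone a e" "spl v" "e \<sqsubseteq> v" "meet (cn i) (cn j) = v" "good l L X" "len a < l"
    "i \<in> X" "j \<in> X" "i \<noteq> j" "un i = un j" by blast+
  show v: "v \<in> CT" using s spl_CT by blast
  show pos: "0 < len v" using CT_len[OF v] by simp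
  show b: "v \<sqsubseteq> cn i" "v \<sqsubseteq> cn j" using meet_below[OF cn_CT cn_CT, of i j] s(4) pos by auto
  show "e \<sqsubseteq> cn i" "e \<sqsubseteq> cn j" using b s(3) below_trans by blast+
  show "i \<in> N" "j \<in> N" using goodD(1)[OF s(5)] s by auto
  have inc: "incomparable (cn i) (cn j)" using goodD(4)[OF s(5,7,8,9)] .
  then show "len v < len (cn i)" "len v < len (cn j)" using incomparable_iff[OF cn_CT cn_CT] s(4) by auto
  show "pos (cn i) (cn j) (\<psi> v) (pr (cn i) (cn j))" unfolding pos_def using inc s(4) pos by simp
qed

lemma forced_pos:
  assumes c: "cone a e" and P: "path l L" and p: "p \<in> N" "q' \<in> N" "L \<le> p" "L \<le> q'" "ml (cn p) (cn q') < l" "len a < l" "e \<sqsubseteq> cn p"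
    and r: "x \<in> N" "y \<in> N" "e \<sqsubseteq> cn x" "Dec x y" "un p = un x" "un q' = un y"
    and pos: "pos (cn p) (cn q') m o'" "pos (cn x) (cn y) m o'"
  shows "q p q' \<cong> q x y"
  by (rule forced[OF c P p(1-4) _ p(5-7) r(1-3) _ r(4-6)]) (use pos in \<open>simp_all add: pos_def\<close>)

text \<open>If \<open>v\<close> is not below \<open>cn y\<close>, then \<open>y\<close> splits from
  \<open>v\<close>, so it has the same position relative to \<open>i\<close> and to
  \<open>j\<close>, and \<open>forced\<close> identifies the two classes.\<close>

lemma branch:
  assumes s: "split_at a e v l L X i j" and y: "y \<in> X" "y \<noteq> i" "y \<noteq> j" and d: "\<not> q y i \<cong> q y j"
  shows "v \<sqsubseteq> cn y"
proof (rule ccontr)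
  note S = split_atD[OF s]
  assume n: "\<not> v \<sqsubseteq> cn y"
  note g = goodD[OF S(14)]
  have inc: "incomparable (cn i) (cn y)" "incomparable (cn j) (cn y)" using g(4) S y by auto
  have "\<not> cn y \<sqsubseteq> v" using inc S(2) below_trans unfolding incomparable_def by blast
  then have iv: "incomparable v (cn y)" using n by (simp add: incomparable_def)
  note i = meet_above(1)[OF S(1) cn_CT cn_CT cn_CT S(2) below_refl iv] prec_above[OF S(1) cn_CT cn_CT cn_CT S(2) below_refl iv]
  note j = meet_above(1)[OF S(1) cn_CT cn_CT cn_CT S(3) below_refl iv] prec_above[OF S(1) cn_CT cn_CT cn_CT S(3) below_refl iv]
  have "q i y \<cong> q j y"
    by (rule forced[OF S(11) g(3) S(6) g(1)[OF y(1)] g(2)[OF S(16)] g(2)[OF y(1)] inc(1) g(5)[OF S(16) y(1)] S(15) S(4)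
        S(7) g(1)[OF y(1)] S(5) inc(2) g(6)[OF S(17) y(1)] S(19) refl])
       (use i j y in simp_all)
  then have "q y i \<cong> q y j" by (rule cong_swap) (use y in auto)
  then show False using d by blast
qed

lemma side:
  assumes s: "split_at a e v l L X i j" and y: "y \<in> X" "y \<noteq> i" "y \<noteq> j" "v \<sqsubseteq> cn y"
  shows "restr (cn y) (len v + 1) = restr (cn i) (len v + 1) \<or> restr (cn y) (len v + 1) = restr (cn j) (len v + 1)"
proof -
  note S = split_atD[OF s]
  note g = goodD[OF S(14)]
  have T: "cn i \<in> T" "cn j \<in> T" "cn y \<in> T" using S(6,7) g(1)[OF y(1)] N_iff by auto
  have "len v \<le> len (cn y)" using below_len y(4) by blast
  moreover have "len v \<noteq> y + 1" using spl_not_coding[OF S(12) g(1)[OF y(1)]] .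
  ultimately have "len v < len (cn y)" by simp
  from succ_cases[OF S(12) T S(2,3) y(4) S(9,10) this]
  have "restr (cn i) (len v + 1) = restr (cn j) (len v + 1) \<or> restr (cn y) (len v + 1) = restr (cn i) (len v + 1) \<or>
      restr (cn y) (len v + 1) = restr (cn j) (len v + 1)" by metis
  moreover have "restr (cn i) (len v + 1) \<noteq> restr (cn j) (len v + 1)"
    using restr_eq_iff[of "len v + 1" "cn i" "cn j"] S(9,10,20) by simp
  ultimately show ?thesis by blast
qed

lemma side_pos:
  assumes s: "split_at a e v l L X i j" and y: "y \<in> X" "y \<noteq> i" "y \<noteq> j"
    and on: "restr (cn y) (len v + 1) = restr (cn i) (len v + 1)"
  shows "pos (cn y) (cn j) (\<psi> v) (pr (cn i) (cn j))" "spl (meet (cn y) (cn i))" "e \<sqsubseteq> meet (cn y) (cn i)"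
    "pos (cn y) (cn i) (\<psi> (meet (cn y) (cn i))) (pr (cn y) (cn i))" "v \<sqsubseteq> cn y"
proof -
  note S = split_atD[OF s]
  note g = goodD[OF S(14)]
  have T: "cn i \<in> T" "cn j \<in> T" "cn y \<in> T" using S(6,7) g(1)[OF y(1)] N_iff by auto
  have inc: "incomparable (cn y) (cn i)" "incomparable (cn y) (cn j)" using g(4) S y by auto
  define x where "x = restr (cn i) (len v + 1)"
  define z where "z = restr (cn j) (len v + 1)"
  have CT: "x \<in> CT" "z \<in> CT" using restr_CT[OF cn_CT, of "len v + 1"] S(9,10) by (auto simp: x_def z_def)
  have b: "x \<sqsubseteq> cn i" "z \<sqsubseteq> cn j" using restr_below[OF cn_CT, of "len v + 1"] S(9,10) by (auto simp: x_def z_def)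
  have "x \<noteq> z" using restr_eq_iff[of "len v + 1" "cn i" "cn j"] S(9,10,20) by (simp add: x_def z_def)
  then have "incomparable x z" using below_antisym CT by (auto simp: incomparable_def x_def z_def) (metis below_antisym len_restr)+
  have ly: "len v + 1 \<le> len (cn y)"
  proof (rule ccontr)
    assume "\<not> ?thesis"
    then have "y + 1 \<le> len v" by simp
    then have "restr (cn y) (y + 1) = restr (cn i) (y + 1)"
      using on restr_restr[of "y + 1" "len v + 1" "cn y"] restr_restr[of "y + 1" "len v + 1" "cn i"] by simp
    then have "cn y \<sqsubseteq> cn i" using below_iff[OF cn_CT cn_CT, of y i] restr_len[OF cn_CT, of y] \<open>y + 1 \<le> len v\<close> S(9) by simp
    then show False using inc by (simp add: incomparable_def)
  qed
  have xy: "x \<sqsubseteq> cn y" using restr_below[OF cn_CT, of "len v + 1" y] ly on by (simp add: x_def)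
  note A = meet_above(1)[OF CT cn_CT cn_CT xy b(2) \<open>incomparable x z\<close>] prec_above[OF CT cn_CT cn_CT xy b(2) \<open>incomparable x z\<close>]
  note B = meet_above(1)[OF CT cn_CT cn_CT b(1,2) \<open>incomparable x z\<close>] prec_above[OF CT cn_CT cn_CT b(1,2) \<open>incomparable x z\<close>]
  have "meet (cn y) (cn j) = v" "pr (cn y) (cn j) \<longleftrightarrow> pr (cn i) (cn j)" using A B S(20) by auto
  then show "pos (cn y) (cn j) (\<psi> v) (pr (cn i) (cn j))" using inc S(8) by (simp add: pos_def)
  have le: "len v + 1 \<le> ml (cn y) (cn i)" using restr_eq_iff[of "len v + 1" "cn y" "cn i"] ly S(9) on by simp
  then have p0: "0 < ml (cn y) (cn i)" by simp
  show w: "spl (meet (cn y) (cn i))" using meet_spl[OF T(3,1) inc(1) p0] .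
  have e: "e \<in> CT" using S(11) by (simp add: cone_def)
  have "len e \<le> len v" using below_len S(13) by blast
  then show "e \<sqsubseteq> meet (cn y) (cn i)"
    using below_linear[OF e spl_CT[OF w] cn_CT S(4)] meet_below[OF cn_CT cn_CT p0] le by simp
  show "pos (cn y) (cn i) (\<psi> (meet (cn y) (cn i))) (pr (cn y) (cn i))" using inc p0 by (simp add: pos_def)
  have "v \<sqsubseteq> x" using below_linear[OF S(1) CT(1) cn_CT S(2) b(1)] by (simp add: x_def)
  then show "v \<sqsubseteq> cn y" using xy below_trans by blast
qed

text \<open>\<open>k\<close> splits from \<open>v\<close> itself, so relative to \<open>k\<close>
  all coding nodes above \<open>v\<close> have one position.\<close>

lemma third:
  assumes s: "split_at a e v l L X i j" and k: "k \<in> X" "k \<noteq> i" "k \<noteq> j" "closer (cn i) (cn j) (cn k)" "0 < ml (cn i) (cn k)"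
    and y: "y \<in> X" "y \<noteq> k" "v \<sqsubseteq> cn y" and y': "y' \<in> X" "y' \<noteq> k" "v \<sqsubseteq> cn y'" and un: "un y = un y'"
  shows "q y k \<cong> q y' k"
proof -
  note S = split_atD[OF s]
  note g = goodD[OF S(14)]
  have inc: "incomparable (cn i) (cn k)" using g(4) S k by auto
  have lt: "ml (cn i) (cn k) < len v" using k(4) S(20) by (simp add: closer_def)
  have nv: "restr (cn k) (len v) \<noteq> v" if "len v \<le> len (cn k)"
  proof
    assume "restr (cn k) (len v) = v"
    moreover have "restr (cn i) (len v) = v" using S(1,2) cn_CT by (simp add: below_iff)
    ultimately show False using restr_eq_iff[of "len v" "cn i" "cn k"] that lt S(9) by simp
  qed
  have "\<not> v \<sqsubseteq> cn k" using nv S(1) cn_CT by (auto simp: below_iff)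
  moreover have "\<not> cn k \<sqsubseteq> v" using inc S(2) below_trans unfolding incomparable_def by blast
  ultimately have iv: "incomparable v (cn k)" by (simp add: incomparable_def)
  note A = meet_above[OF S(1) cn_CT cn_CT cn_CT _ below_refl iv] prec_above[OF S(1) cn_CT cn_CT cn_CT _ below_refl iv]
  have m0: "0 < ml v (cn k)" using A(1)[OF S(2)] k(5) by simp
  have pos: "pos (cn z) (cn k) (\<psi> (meet v (cn k))) (pr v (cn k))" if "v \<sqsubseteq> cn z" for z
    unfolding pos_def using A[OF that] m0 by simp
  have ey: "e \<sqsubseteq> cn y" "e \<sqsubseteq> cn y'" using S(13) y(3) y'(3) below_trans by blast+
  show ?thesis
    by (rule forced_pos[OF S(11) g(3) g(1)[OF y(1)] g(1)[OF k(1)] g(2)[OF y(1)] g(2)[OF k(1)] g(5)[OF y(1) k(1) y(2)] S(15) ey(1)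
       g(1)[OF y'(1)] g(1)[OF k(1)] ey(2) g(6)[OF y'(1) k(1) y'(2)] un refl pos[OF y(3)] pos[OF y'(3)]])
qed

text \<open>Equal unary types put the three coding nodes above a common node of length 1, so their
  meets are genuine splitting nodes. The later meet is \<open>v\<close>, and the earlier one is the
  splitting node of the cone.\<close>

lemma triple_shape:
  assumes Z: "finite Z" "a \<in> Z" "b \<in> Z" "c \<in> Z" "distinct [a, b, c]" "un a = un b" "un a = un c"
  obtains \<phi> l L i j k a' e v where "pe \<phi> Z" "(i, j, k) \<in> {(a, b, c), (a, c, b), (b, c, a)}"
    "split_at a' e v l L (\<phi> ` Z) (\<phi> i) (\<phi> j)" "closer (cn (\<phi> i)) (cn (\<phi> j)) (cn (\<phi> k))" "0 < ml (cn (\<phi> i)) (cn (\<phi> k))"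
proof -
  obtain \<phi> l L where \<phi>: "pe \<phi> Z" and gd: "good l L (\<phi> ` Z)" using good_copy'[OF Z(1)] .
  note g = goodD[OF gd]
  have T: "cn (\<phi> x) \<in> T" if "x \<in> Z" for x using g(1)[of "\<phi> x"] that N_iff by auto
  have ne: "\<phi> x \<noteq> \<phi> y" if "x \<in> Z" "y \<in> Z" "x \<noteq> y" for x y using pe_inj[OF \<phi>] that by (auto simp: inj_on_def)
  have inc: "incomparable (cn (\<phi> x)) (cn (\<phi> y))" if "x \<in> Z" "y \<in> Z" "x \<noteq> y" for x y
    using g(4)[of "\<phi> x" "\<phi> y"] ne[OF that] that by auto
  have m0: "0 < ml (cn (\<phi> x)) (cn (\<phi> y))" if "x \<in> Z" "y \<in> Z" "un x = un y" for x y
  proof -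
    have "un (\<phi> x) = un (\<phi> y)" using pe_un[OF \<phi>] that by simp
    then have "agree 0 (\<phi> x) (\<phi> y)" by (simp add: agree_def uW_def)
    then have "restr (cn (\<phi> x)) 1 = restr (cn (\<phi> y)) 1" using cn_agree[of 0 "\<phi> x" "\<phi> y"] by simp
    then have "1 \<le> ml (cn (\<phi> x)) (cn (\<phi> y))" by (subst restr_eq_iff[symmetric]) auto
    then show ?thesis by simp
  qed
  have d: "a \<noteq> b" "a \<noteq> c" "b \<noteq> c" using Z by auto
  have un: "un b = un c" using Z by simp
  from shape[OF T[OF Z(2)] T[OF Z(3)] T[OF Z(4)] inc[OF Z(2,3) d(1)] inc[OF Z(2,4) d(2)] inc[OF Z(3,4) d(3)] m0[OF Z(2,3,6)]]
  obtain i j k where ijk: "(i, j, k) \<in> {(a, b, c), (a, c, b), (b, c, a)}" "closer (cn (\<phi> i)) (cn (\<phi> j)) (cn (\<phi> k))" by blast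
  then have i: "i \<in> Z" "j \<in> Z" "k \<in> Z" "i \<noteq> j" "i \<noteq> k" "j \<noteq> k" "un i = un j" "un i = un k" using Z d by auto
  define v where "v = meet (cn (\<phi> i)) (cn (\<phi> j))"
  define a' where "a' = meet (cn (\<phi> i)) (cn (\<phi> k))"
  have lt: "len a' < len v" using ijk(2) by (simp add: closer_def v_def a'_def)
  have sp: "spl v" "spl a'"
    unfolding v_def a'_def using meet_spl[OF T[OF i(1)] T[OF i(2)] inc[OF i(1,2,4)] m0[OF i(1,2,7)]]
      meet_spl[OF T[OF i(1)] T[OF i(3)] inc[OF i(1,3,5)] m0[OF i(1,3,8)]] by blast+
  have CT: "v \<in> CT" "a' \<in> CT" using sp spl_CT by auto
  have b: "v \<sqsubseteq> cn (\<phi> i)" "a' \<sqsubseteq> cn (\<phi> i)"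
    using meet_below[OF cn_CT cn_CT m0[OF i(1,2,7)]] meet_below[OF cn_CT cn_CT m0[OF i(1,3,8)]] unfolding v_def a'_def by blast+
  define e where "e = restr v (len a' + 1)"
  have e: "e \<in> CT" "e \<sqsubseteq> v" "len e = len a' + 1"
    using restr_CT[OF CT(1), of "len a' + 1"] restr_below[OF CT(1), of "len a' + 1"] lt by (auto simp: e_def)
  have "a' \<sqsubseteq> v" using below_linear[OF CT(2,1) cn_CT b(2,1)] lt by simp
  then have "a' \<sqsubseteq> e" using below_linear[OF CT(2) e(1) CT(1) _ e(2)] e(3) by simp
  then have cn: "cone a' e" using sp(2) e by (simp add: cone_def)
  have "len a' < l" using g(5)[OF imageI[OF i(1)] imageI[OF i(3)] ne[OF i(1,3,5)]] unfolding a'_def .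
  moreover have unij: "un (\<phi> i) = un (\<phi> j)" using pe_un[OF \<phi> i(1)] pe_un[OF \<phi> i(2)] i(7) by simp
  ultimately have "split_at a' e v l L (\<phi> ` Z) (\<phi> i) (\<phi> j)"
    unfolding split_at_def using cn sp(1) e(2) gd imageI[OF i(1), of \<phi>] imageI[OF i(2), of \<phi>] ne[OF i(1,2,4)] unij v_def by blast
  then show ?thesis using that[OF \<phi> ijk(1) _ ijk(2) m0[OF i(1,3,8)]] by blast
qed

text \<open>By \<open>branch\<close> both separating vertices pass through the later meet; from
  there \<open>third\<close> applies to the vertex that split off earlier.\<close>

lemma triple_third:
  assumes Z: "finite Z" "a \<in> Z" "b \<in> Z" "c \<in> Z" "distinct [a, b, c]" "un a = un b" "un a = un c"
  obtains i j k where "(i, j, k) \<in> {(a, b, c), (a, c, b), (b, c, a)}"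
    "\<And>y y'. y \<in> Z - {i, j, k} \<Longrightarrow> y' \<in> Z - {i, j, k} \<Longrightarrow> un y = un y' \<Longrightarrow> \<not> q y i \<cong> q y j \<Longrightarrow> \<not> q y' i \<cong> q y' j \<Longrightarrow> q y k \<cong> q y' k"
proof -
  obtain \<phi> l L i j k a' e v where \<phi>: "pe \<phi> Z" and ijk: "(i, j, k) \<in> {(a, b, c), (a, c, b), (b, c, a)}"
    and s: "split_at a' e v l L (\<phi> ` Z) (\<phi> i) (\<phi> j)" and cl: "closer (cn (\<phi> i)) (cn (\<phi> j)) (cn (\<phi> k))" "0 < ml (cn (\<phi> i)) (cn (\<phi> k))"
    by (rule triple_shape[OF Z])
  have i: "i \<in> Z" "j \<in> Z" "k \<in> Z" "i \<noteq> j" "i \<noteq> k" "j \<noteq> k" using ijk Z by auto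
  have ne: "\<phi> x \<noteq> \<phi> y" if "x \<in> Z" "y \<in> Z" "x \<noteq> y" for x y using pe_inj[OF \<phi>] that by (auto simp: inj_on_def)
  have ab: "v \<sqsubseteq> cn (\<phi> y)" if "y \<in> Z - {i, j, k}" "\<not> q y i \<cong> q y j" for y
    using branch[OF s, of "\<phi> y"] that i ne pe_q[OF \<phi>, of y i] pe_q[OF \<phi>, of y j] by auto
  have "q y k \<cong> q y' k" if "y \<in> Z - {i, j, k}" "y' \<in> Z - {i, j, k}" "un y = un y'" "\<not> q y i \<cong> q y j" "\<not> q y' i \<cong> q y' j" for y y'
  proof -
    have "q (\<phi> y) (\<phi> k) \<cong> q (\<phi> y') (\<phi> k)"
      by (rule third[OF s _ _ _ cl _ _ ab[OF that(1,4)] _ _ ab[OF that(2,5)]]) (use that i ne pe_un[OF \<phi>] in auto)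
    moreover have "q (\<phi> y) (\<phi> k) = q y k" "q (\<phi> y') (\<phi> k) = q y' k"
      using pe_q[OF \<phi>] that i by auto
    ultimately show ?thesis by simp
  qed
  then show ?thesis using that ijk by blast
qed

text \<open>The vertices are coding nodes above long extensions of the nodes \<open>R k\<close>. A
  pair whose position also occurs in \<open>X\<close> inherits its class from there by
  \<open>forced\<close>. The pair with indices 0 and 3 is obtained by \<open>copy_pair\<close>
  instead if its position is that of \<open>p, r\<close>, and then has exactly their type.\<close>

lemma config:
  assumes s: "split_at a e v l L X i j" and y: "y \<in> X" "v \<sqsubseteq> cn y"
    and p: "p \<in> N" "r \<in> N" "path l' L'" "L' \<le> p" "L' \<le> r" "ml (cn p) (cn r) < l'" "len a < l'" "e \<sqsubseteq> cn p" "un p = un i" "un r = un y"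
      "pos (cn p) (cn r) m0 o0"
    and R: "\<And>k. k < (4::nat) \<Longrightarrow> R k \<in> T \<and> e \<sqsubseteq> R k" "\<And>k k'. k < 4 \<Longrightarrow> k' < 4 \<Longrightarrow> k \<noteq> k' \<Longrightarrow> incomparable (R k) (R k')"
  obtains x where "inj_on x {..<4}" "\<And>k. k < 4 \<Longrightarrow> un (x k) = (if k = 3 then un y else un i)"
    "pos (R 0) (R 3) m0 o0 \<Longrightarrow> q (x 0) (x 3) = q p r"
    "\<And>k k' s t m o'. k < 4 \<Longrightarrow> k' < 4 \<Longrightarrow> k \<noteq> k' \<Longrightarrow> pos (R k) (R k') m o' \<Longrightarrow> s \<in> X \<Longrightarrow> t \<in> X \<Longrightarrow> s \<noteq> t \<Longrightarrow>
       e \<sqsubseteq> cn s \<Longrightarrow> un s = (if k = 3 then un y else un i) \<Longrightarrow> un t = (if k' = 3 then un y else un i) \<Longrightarrow>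
       pos (cn s) (cn t) m o' \<Longrightarrow> q (x k) (x k') \<cong> q s t"
proof -
  note S = split_atD[OF s]
  note g = goodD[OF S(14)]
  \<comment> \<open>The meets of the four coding nodes are meets of the nodes \<open>R k\<close>,
    hence shorter than \<open>l2\<close>.\<close>
  define l2 where "l2 = len a + (\<Sum>k<4. len (R k)) + 1"
  have l2: "len a < l2" by (simp add: l2_def)
  have lR: "len (R k) < l2" if "k < 4" for k
    using member_le_sum[of k "{..<4}" "\<lambda>k. len (R k)"] that by (simp add: l2_def)
  obtain L2 where L2: "path l2 L2" using path2[of l2] by (auto simp: l2_def)
  have "\<exists>r'. k < 4 \<longrightarrow> r' \<in> T \<and> R k \<sqsubseteq> r' \<and> L2 + 1 \<le> len r'" for k using long_above[of "R k" "L2 + 1"] R(1) by blast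
  then obtain R' where R': "\<And>k. k < 4 \<Longrightarrow> R' k \<in> T \<and> R k \<sqsubseteq> R' k \<and> L2 + 1 \<le> len (R' k)" by metis
  have CT: "R k \<in> CT" "R' k \<in> CT" if "k < 4" for k using R(1) R' T_CT that by auto
  have eR: "e \<sqsubseteq> R' k" if "k < 4" for k using R(1) R' below_trans that by blast
  have inc': "incomparable (R' k) (R' k')" if "k < 4" "k' < 4" "k \<noteq> k'" for k k'
    using meet_above(2)[of "R k" "R k'" "R' k" "R' k'"] CT R(2) R' that by blast
  let ?u = "\<lambda>k. if k = 3 then un y else un i"
  have ex: "\<exists>x \<in> N. R' k \<sqsubseteq> cn x \<and> un x = ?u k" if "k < 4" for k
  proof (cases "k = 3")
    case True
    then show ?thesis using coding_dense[OF S(11,12,13) g(1)[OF y(1)] y(2), of "R' k"] R' eR that by auto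
  next
    case False
    then show ?thesis using coding_dense[OF S(11,12,13,6,2), of "R' k"] R' eR that by auto
  qed
  have "\<exists>x0 \<in> N. \<exists>x3 \<in> N. R' 0 \<sqsubseteq> cn x0 \<and> R' 3 \<sqsubseteq> cn x3 \<and> un x0 = un i \<and> un x3 = un y \<and> (pos (R 0) (R 3) m0 o0 \<longrightarrow> q x0 x3 = q p r)"
  proof (cases "pos (R 0) (R 3) m0 o0")
    case True
    have "pos (R' 0) (R' 3) m0 o0" by (rule pos_above[OF True]) (use CT R' in auto)
    then have *: "incomparable (R' 0) (R' 3)" "ml (cn p) (cn r) = 0 \<longleftrightarrow> ml (R' 0) (R' 3) = 0"
      "\<psi> (meet (cn p) (cn r)) = \<psi> (meet (R' 0) (R' 3))" "pr (cn p) (cn r) \<longleftrightarrow> pr (R' 0) (R' 3)" "incomparable (cn p) (cn r)"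
      using p(11) by (auto simp: pos_def)
    have "\<exists>p' \<in> N. \<exists>r' \<in> N. R' 0 \<sqsubseteq> cn p' \<and> R' 3 \<sqsubseteq> cn r' \<and> un p' = un p \<and> un r' = un r \<and> q p' r' = q p r"
      by (rule copy_pair[OF S(11) p(3) p(1,2,4,5) *(5) p(6,7,8) _ _ _ *(1,2,3,4)]) (use R' eR in auto)
    then show ?thesis using p(9,10) by metis
  next
    case False
    then show ?thesis using ex[of 0] ex[of 3] by auto
  qed
  then obtain x0 x3 where x03: "x0 \<in> N" "x3 \<in> N" "R' 0 \<sqsubseteq> cn x0" "R' 3 \<sqsubseteq> cn x3" "un x0 = un i" "un x3 = un y"
    "pos (R 0) (R 3) m0 o0 \<longrightarrow> q x0 x3 = q p r" by blast
  obtain x' where x': "\<And>k. k < 4 \<Longrightarrow> x' k \<in> N \<and> R' k \<sqsubseteq> cn (x' k) \<and> un (x' k) = ?u k" using ex by metis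
  define x where "x = x'(0 := x0, 3 := x3)"
  have x: "x k \<in> N" "R' k \<sqsubseteq> cn (x k)" "un (x k) = ?u k" if "k < 4" for k
    using x'[OF that] x03 by (auto simp: x_def)
  have Rx: "R k \<sqsubseteq> cn (x k)" if "k < 4" for k using x(2) R' below_trans that by blast
  have ex': "e \<sqsubseteq> cn (x k)" if "k < 4" for k using x(2) eR below_trans that by blast
  have Lx: "L2 \<le> x k" if "k < 4" for k using R' x(2) below_len[of "R' k" "cn (x k)"] that by fastforce
  have inc: "incomparable (cn (x k)) (cn (x k'))" "ml (cn (x k)) (cn (x k')) < l2" if "k < 4" "k' < 4" "k \<noteq> k'" for k k'
  proof -
    note m = meet_above[OF CT(1)[OF that(1)] CT(1)[OF that(2)] cn_CT cn_CT Rx[OF that(1)] Rx[OF that(2)] R(2)[OF that]]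
    show "incomparable (cn (x k)) (cn (x k'))" by (rule m(2))
    show "ml (cn (x k)) (cn (x k')) < l2" using m(1) ml_le(1)[of "R k" "R k'"] lR[OF that(1)] by simp
  qed
  have A1: "inj_on x {..<4}" using inc(1) unfolding inj_on_def incomparable_def by (metis below_refl lessThan_iff)
  have A3: "q (x 0) (x 3) = q p r" if "pos (R 0) (R 3) m0 o0" using x03(7) that by (simp add: x_def)
  have A4: "q (x k) (x k') \<cong> q s t" if k: "k < 4" "k' < 4" "k \<noteq> k'" "pos (R k) (R k') m o'" and st: "s \<in> X" "t \<in> X" "s \<noteq> t"
      "e \<sqsubseteq> cn s" "un s = ?u k" "un t = ?u k'" "pos (cn s) (cn t) m o'" for k k' s t m o'
  proof -
    have "pos (cn (x k)) (cn (x k')) m o'" by (rule pos_above[OF k(4) CT(1)[OF k(1)] CT(1)[OF k(2)] cn_CT cn_CT Rx[OF k(1)] Rx[OF k(2)]])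
    then show ?thesis
      using x(3)[OF k(1)] x(3)[OF k(2)] st
      by (intro forced_pos[OF S(11) L2 x(1)[OF k(1)] x(1)[OF k(2)] Lx[OF k(1)] Lx[OF k(2)] inc(2)[OF k(1-3)] l2 ex'[OF k(1)]
         g(1)[OF st(1)] g(1)[OF st(2)] st(4) g(6)[OF st(1-3)]]) auto
  qed
  show ?thesis by (rule that[OF A1 x(3) A3 A4])
qed

text \<open>The three pairs of the triple have exactly the type of \<open>i, j\<close>. Exactness is
  what later lets homogeneity identify the triples of different configurations; the pairs with
  \<open>y\<close> matter only up to \<open>\<cong>\<close>.\<close>

definition quad :: "nat \<Rightarrow> nat \<Rightarrow> 'r set \<Rightarrow> 'r set \<times> 'r set \<times> 'r set \<times> 'r set \<Rightarrow> 'r set \<times> 'r set \<times> 'r set \<times> 'r set \<Rightarrow> 'r set \<times> 'r set \<times> 'r set \<times> 'r set \<Rightarrow> bool" where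
  "quad i j u t0 t1 t2 \<longleftrightarrow> (\<exists>a b c y. distinct [a, b, c, y] \<and> q a b = q i j \<and> q a c = q i j \<and> q b c = q i j \<and> un y = u \<and>
     q y a \<cong> t0 \<and> q y b \<cong> t1 \<and> q y c \<cong> t2)"

text \<open>\<open>cong_realise\<close> makes the pairs inside the triple exact and leaves the types
  of the pairs with the fourth vertex as they are.\<close>

lemma quadI:
  assumes x: "inj_on x {..<(4::nat)}" and ij: "i \<noteq> j" and u: "un (x 3) = u"
    and b: "q (x 0) (x 1) \<cong> q i j" "q (x 0) (x 2) \<cong> q i j" "q (x 1) (x 2) \<cong> q i j"
    and y: "q (x 3) (x 0) \<cong> t0" "q (x 3) (x 1) \<cong> t1" "q (x 3) (x 2) \<cong> t2"
  shows "quad i j u t0 t1 t2"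
proof -
  have ne: "x k \<noteq> x k'" if "k < 4" "k' < 4" "k \<noteq> k'" for k k' using x that by (auto simp: inj_on_def)
  define \<tau> where "\<tau> k k' = (if k < 3 \<and> k' < 3 then (if k < k' then q i j else q j i) else q (x k) (x k'))" for k k' :: nat
  have b': "q (x k) (x k') \<cong> q i j" if "k < k'" "k' < 3" for k k'
  proof -
    have "k = 0 \<and> k' = 1 \<or> k = 0 \<and> k' = 2 \<or> k = 1 \<and> k' = 2" using that by linarith
    then show ?thesis using b by auto
  qed
  have "\<exists>g. inj_on g {..<4} \<and> (\<forall>k \<in> {..<4}. un (g k) = un (x k)) \<and> (\<forall>k \<in> {..<4}. \<forall>k' \<in> {..<4}. k \<noteq> k' \<longrightarrow> q (g k) (g k') = \<tau> k k')"
  proof (rule cong_realise)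
    show "q (x k) (x k') \<cong> \<tau> k k'" if k: "k \<in> {..<4}" "k' \<in> {..<4}" "k \<noteq> k'" for k k'
    proof (cases "k < 3 \<and> k' < 3")
      case True
      then consider "k < k'" | "k' < k" using k by linarith
      then show ?thesis
      proof cases
        case 1
        then show ?thesis using b'[OF 1] True by (simp add: \<tau>_def)
      next
        case 2
        then have "q (x k) (x k') \<cong> q j i" using True ne[of k' k] k ij 2 by (intro cong_swap[OF b'[OF 2]]) auto
        then show ?thesis using 2 True by (simp add: \<tau>_def)
      qed
    next
      case False
      then show ?thesis using cong_refl by (auto simp: \<tau>_def)
    qed
    show "\<exists>a b. a \<noteq> b \<and> \<tau> k k' = q a b \<and> \<tau> k' k = q b a" if k: "k \<in> {..<4}" "k' \<in> {..<4}" "k \<noteq> k'" for k k'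
    proof (cases "k < 3 \<and> k' < 3")
      case True
      then consider "k < k'" | "k' < k" using k by linarith
      then show ?thesis
      proof cases
        case 1
        then show ?thesis using True ij by (intro exI[of _ i] exI[of _ j]) (simp add: \<tau>_def)
      next
        case 2
        then show ?thesis using True ij by (intro exI[of _ j] exI[of _ i]) (simp add: \<tau>_def)
      qed
    next
      case False
      then show ?thesis using ne[of k k'] k by (intro exI[of _ "x k"] exI[of _ "x k'"]) (auto simp: \<tau>_def)
    qed
  qed (use x in auto)
  then obtain g where g: "inj_on g {..<4}" "\<And>k. k < 4 \<Longrightarrow> un (g k) = un (x k)"
    "\<And>k k'. k < 4 \<Longrightarrow> k' < 4 \<Longrightarrow> k \<noteq> k' \<Longrightarrow> q (g k) (g k') = \<tau> k k'" by auto
  have gne: "g k \<noteq> g k'" if "k < 4" "k' < 4" "k \<noteq> k'" for k k' using g(1) that by (auto simp: inj_on_def)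
  have "distinct [g 0, g 1, g 2, g 3]" using gne by auto
  moreover have "q (g 0) (g 1) = q i j" "q (g 0) (g 2) = q i j" "q (g 1) (g 2) = q i j"
    "q (g 3) (g 0) = q (x 3) (x 0)" "q (g 3) (g 1) = q (x 3) (x 1)" "q (g 3) (g 2) = q (x 3) (x 2)"
    using g(3)[of 0 1] g(3)[of 0 2] g(3)[of 1 2] g(3)[of 3 0] g(3)[of 3 1] g(3)[of 3 2] by (simp_all add: \<tau>_def)
  moreover have "un (g 3) = u" using g(2)[of 3] u by simp
  ultimately show ?thesis unfolding quad_def using y by (intro exI[of _ "g 0"] exI[of _ "g 1"] exI[of _ "g 2"] exI[of _ "g 3"]) simp
qed

text \<open>Over common \<open>a, b, c\<close>, the four configurations cannot live in one tree: whichever two of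
  the three vertices split last, two of the four \<open>y\<close> separate them and yet differ over the third.\<close>

lemma no_quads:
  assumes un: "un i = un j" and A: "quad i j u lam lam mu" and B: "quad i j u lam mu mu" and C: "quad i j u gam lam lam" and D: "quad i j u gam lam mu"
    and ne: "\<not> lam \<cong> mu" "\<not> gam \<cong> lam"
  shows False
proof -
  obtain a b c yA where A: "distinct [a, b, c, yA]" "q a b = q i j" "q a c = q i j" "q b c = q i j" "un yA = u"
    "q yA a \<cong> lam" "q yA b \<cong> lam" "q yA c \<cong> mu" using A unfolding quad_def by blast
  \<comment> \<open>The triples of all four configurations are isomorphic, so each fourth vertex can
    be transferred to the triple \<open>a, b, c\<close> of the first one.\<close>
  have tr: "\<exists>y. y \<notin> {a, b, c} \<and> un y = u \<and> q y a \<cong> t0 \<and> q y b \<cong> t1 \<and> q y c \<cong> t2" if q: "quad i j u t0 t1 t2" for t0 t1 t2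
  proof -
    obtain a' b' c' y' where Q: "distinct [a', b', c', y']" "q a' b' = q i j" "q a' c' = q i j" "q b' c' = q i j" "un y' = u"
      "q y' a' \<cong> t0" "q y' b' \<cong> t1" "q y' c' \<cong> t2" using q unfolding quad_def by blast
    have "\<exists>y. y \<notin> {} \<and> y \<notin> {a, b, c} \<and> un y = un y' \<and> q y a = q y' a' \<and> q y b = q y' b' \<and> q y c = q y' c'"
      by (rule extend_triple) (use A Q in auto)
    then show ?thesis using Q by metis
  qed
  obtain yB where yB: "yB \<notin> {a, b, c}" "un yB = u" "q yB a \<cong> lam" "q yB b \<cong> mu" "q yB c \<cong> mu" using tr[OF B] by blast
  obtain yC where yC: "yC \<notin> {a, b, c}" "un yC = u" "q yC a \<cong> gam" "q yC b \<cong> lam" "q yC c \<cong> lam" using tr[OF C] by blast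
  obtain yD where yD: "yD \<notin> {a, b, c}" "un yD = u" "q yD a \<cong> gam" "q yD b \<cong> lam" "q yD c \<cong> mu" using tr[OF D] by blast
  define Z where "Z = {a, b, c, yA, yB, yC, yD}"
  have uabc: "un a = un b" "un a = un c" using A(2,3) un by (auto simp: q_def)
  have rel: "s \<cong> s' \<Longrightarrow> s \<cong> t \<Longrightarrow> s' \<cong> t' \<Longrightarrow> t \<cong> t'" for s s' t t' using cong_trans cong_sym by blast
  have nn: "\<not> s \<cong> s'" if "s \<cong> t" "s' \<cong> t'" "\<not> t \<cong> t'" for s s' t t' using rel that by blast
  obtain x y z where xyz: "(x, y, z) \<in> {(a, b, c), (a, c, b), (b, c, a)}"
    "\<And>w w'. w \<in> Z - {x, y, z} \<Longrightarrow> w' \<in> Z - {x, y, z} \<Longrightarrow> un w = un w' \<Longrightarrow> \<not> q w x \<cong> q w y \<Longrightarrow> \<not> q w' x \<cong> q w' y \<Longrightarrow> q w z \<cong> q w' z"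
    by (rule triple_third[of Z a b c]) (use A(1) uabc in \<open>auto simp: Z_def\<close>)
  have mem: "yA \<in> Z - {x, y, z}" "yB \<in> Z - {x, y, z}" "yC \<in> Z - {x, y, z}" "yD \<in> Z - {x, y, z}"
    using xyz(1) A(1) yB(1) yC(1) yD(1) by (auto simp: Z_def)
  consider "x = a" "y = b" "z = c" | "x = a" "y = c" "z = b" | "x = b" "y = c" "z = a" using xyz(1) by auto
  then show False
  proof cases
    case 1
    have "q yB c \<cong> q yC c"
      using xyz(2)[OF mem(2,3)] nn[OF yB(3,4) ne(1)] nn[OF yC(3,4) ne(2)] yB(2) yC(2) 1 by simp
    then show False using rel[OF _ yB(5) yC(5)] ne(1) cong_sym by blast
  next
    case 2
    have "q yA b \<cong> q yB b"
      using xyz(2)[OF mem(1,2)] nn[OF A(6,8) ne(1)] nn[OF yB(3,5) ne(1)] A(5) yB(2) 2 by simp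
    then show False using rel[OF _ A(7) yB(4)] ne(1) by blast
  next
    case 3
    have "q yA a \<cong> q yD a"
      using xyz(2)[OF mem(1,4)] nn[OF A(7,8) ne(1)] nn[OF yD(4,5) ne(1)] A(5) yD(2) 3 by simp
    then show False using rel[OF _ A(6) yD(3)] ne(2) cong_sym by blast
  qed
qed

text \<open>If this fails, the four configurations above are all realised: the positions of the coding
  nodes prescribe every pair up to \<open>\<cong>\<close>, except that \<open>(a, y)\<close> is a copy of \<open>(p, r)\<close> in two of them.\<close>

lemma opposite_value:
  assumes s: "split_at a e v l L X i j" and y: "y \<in> X" "y \<noteq> i" "y \<noteq> j"
    and on: "restr (cn y) (len v + 1) = restr (cn i) (len v + 1)" and d: "\<not> q y i \<cong> q y j"
    and p: "p \<in> N" "r \<in> N" "path l' L'" "L' \<le> p" "L' \<le> r" "ml (cn p) (cn r) < l'" "len a < l'" "e \<sqsubseteq> cn p" "un p = un i" "un r = un y"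
      "pos (cn p) (cn r) (\<psi> v) (pr (cn i) (cn j))"
  shows "q r p \<cong> q y i"
proof (rule ccontr)
  assume n: "\<not> q r p \<cong> q y i"
  note S = split_atD[OF s]
  note sp = side_pos[OF s y on]
  define w where "w = meet (cn y) (cn i)"
  define o1 where "o1 = pr (cn i) (cn j)"
  define o2 where "o2 = pr (cn y) (cn i)"
  have pij: "pos (cn i) (cn j) (\<psi> v) o1" using S(21) by (simp add: o1_def)
  have pyj: "pos (cn y) (cn j) (\<psi> v) o1" using sp(1) by (simp add: o1_def)
  have pyi: "pos (cn y) (cn i) (\<psi> w) o2" using sp(4) by (simp add: w_def o2_def)
  have ew: "spl w" "e \<sqsubseteq> w" using sp(2,3) by (auto simp: w_def)
  have ey: "e \<sqsubseteq> cn y" using sp(5) S(13) below_trans by blast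
  have p0: "pos (cn p) (cn r) (\<psi> v) o1" using p(11) by (simp add: o1_def)
  have vT: "v \<in> T" using S(12) spl_T by blast
  note sv = split_pos[OF S(11,12,13)] and sw = split_pos[OF S(11) ew]
  have up: "e \<sqsubseteq> t" if "e \<sqsubseteq> r" "r \<sqsubseteq> t" for r t using that below_trans by blast
  have P2: "pos r' s' m o'" if "pos r s m o'" "r \<in> T" "s \<in> T" "r' \<in> T" "s' \<in> T" "r \<sqsubseteq> r'" "s \<sqsubseteq> s'" for r s r' s' m o'
    using pos_above[OF that(1)] that T_CT by blast
  \<comment> \<open>\<open>ra, rb, rc\<close> are the positions of the triple and \<open>ry\<close>
    that of the fourth vertex. Each class is conditional on a position, so that one statement covers
    the four trees below.\<close>
  have build: "\<exists>x. inj_on x {..<4} \<and> un (x 3) = un y \<and>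
      (\<forall>k < 3. \<forall>k' < 3. k \<noteq> k' \<longrightarrow> pos (R k) (R k') (\<psi> v) o1 \<longrightarrow> q (x k) (x k') \<cong> q i j) \<and>
      (\<forall>k < 3. (pos (R 3) (R k) (\<psi> w) o2 \<longrightarrow> q (x 3) (x k) \<cong> q y i) \<and> (pos (R 3) (R k) (\<psi> v) o1 \<longrightarrow> q (x 3) (x k) \<cong> q y j)) \<and>
      (pos (R 0) (R 3) (\<psi> v) o1 \<longrightarrow> q (x 3) (x 0) \<cong> q r p)"
    if R: "R = (\<lambda>k. if k = 0 then ra else if k = 1 then rb else if k = 2 then rc else ry)"
      and T4: "ra \<in> T" "rb \<in> T" "rc \<in> T" "ry \<in> T" "e \<sqsubseteq> ra" "e \<sqsubseteq> rb" "e \<sqsubseteq> rc" "e \<sqsubseteq> ry"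
      and inc: "incomparable ra rb" "incomparable ra rc" "incomparable rb rc" "incomparable ry ra" "incomparable ry rb" "incomparable ry rc"
    for R :: "nat \<Rightarrow> 'r node" and ra rb rc ry
  proof -
    have R4: "R k \<in> T \<and> e \<sqsubseteq> R k" if "k < 4" for k using T4 by (simp add: R)
    have inc': "incomparable (R k) (R k')" if "k < 4" "k' < 4" "k \<noteq> k'" for k k'
    proof -
      have "k = 0 \<or> k = 1 \<or> k = 2 \<or> k = 3" "k' = 0 \<or> k' = 1 \<or> k' = 2 \<or> k' = 3" using that by linarith+
      then show ?thesis using inc that(3) unfolding R incomparable_def by (elim disjE) simp_all
    qed
    obtain x where x: "inj_on x {..<4}" "\<And>k. k < 4 \<Longrightarrow> un (x k) = (if k = 3 then un y else un i)"
      "pos (R 0) (R 3) (\<psi> v) o1 \<Longrightarrow> q (x 0) (x 3) = q p r"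
      "\<And>k k' s t m o'. k < 4 \<Longrightarrow> k' < 4 \<Longrightarrow> k \<noteq> k' \<Longrightarrow> pos (R k) (R k') m o' \<Longrightarrow> s \<in> X \<Longrightarrow> t \<in> X \<Longrightarrow> s \<noteq> t \<Longrightarrow>
       e \<sqsubseteq> cn s \<Longrightarrow> un s = (if k = 3 then un y else un i) \<Longrightarrow> un t = (if k' = 3 then un y else un i) \<Longrightarrow>
       pos (cn s) (cn t) m o' \<Longrightarrow> q (x k) (x k') \<cong> q s t"
    proof (rule config[where R = R, OF s y(1) sp(5) p(1-10) p0 R4 inc'], goal_cases)
      case prems: (5 x)
      show ?case by (rule prems(1)[OF prems(2-5)])
    qed simp_all
    have lt: "k < 3 \<Longrightarrow> k < 4" "k < 3 \<Longrightarrow> k \<noteq> 3" "(3::nat) < 4" for k :: nat by simp_all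
    have 1: "q (x k) (x k') \<cong> q i j" if k: "k < 3" "k' < 3" "k \<noteq> k'" "pos (R k) (R k') (\<psi> v) o1" for k k'
      by (rule x(4)[OF lt(1)[OF k(1)] lt(1)[OF k(2)] k(3,4) S(16,17,18,4) _ _ pij]) (use lt(2)[OF k(1)] lt(2)[OF k(2)] S(19) in simp_all)
    have 2: "q (x 3) (x k) \<cong> q y i" if k: "k < 3" "pos (R 3) (R k) (\<psi> w) o2" for k
      by (rule x(4)[OF lt(3) lt(1)[OF k(1)] lt(2)[OF k(1), symmetric] k(2) y(1) S(16) y(2) ey _ _ pyi]) (use lt(2)[OF k(1)] in simp_all)
    have 3: "q (x 3) (x k) \<cong> q y j" if k: "k < 3" "pos (R 3) (R k) (\<psi> v) o1" for k
      by (rule x(4)[OF lt(3) lt(1)[OF k(1)] lt(2)[OF k(1), symmetric] k(2) y(1) S(17) y(3) ey _ _ pyj]) (use lt(2)[OF k(1)] S(19) in simp_all)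
    have 4: "q (x 3) (x 0) \<cong> q r p" if "pos (R 0) (R 3) (\<psi> v) o1"
      unfolding q_swap[OF x(3)[OF that]] by (rule cong_refl)
    show ?thesis using x(1) x(2)[of 3] 1 2 3 4 by (intro exI[of _ x]) simp
  qed
  have ij: "i \<noteq> j" by (rule S(18))
  have inc: "pos r s m o' \<Longrightarrow> incomparable r s" "pos r s m o' \<Longrightarrow> incomparable s r" for r s m o' by (auto simp: pos_def incomparable_def)
  \<comment> \<open>Each of the four trees starts from this split, which has the label and side of
    \<open>v\<close>. In the first two the fourth vertex lies over \<open>t1\<close>. In the last
    two it lies over \<open>t2\<close> and the first vertex of the triple over \<open>t1\<close>, so
    that these two have the position of \<open>p, r\<close>.\<close>
  obtain t1 t2 where t: "t1 \<in> T" "t2 \<in> T" "e \<sqsubseteq> t1" "e \<sqsubseteq> t2" "pos t1 t2 (\<psi> v) o1"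
    using sv[OF vT S(13), of o1] up[OF S(13)] by blast
  have A: "quad i j (un y) (q y i) (q y i) (q y j)"
  proof -
    obtain ry t12 where 1: "ry \<in> T" "t12 \<in> T" "t1 \<sqsubseteq> ry" "t1 \<sqsubseteq> t12" "pos ry t12 (\<psi> w) o2" using sw[OF t(1,3), of o2] by blast
    obtain ra rb where 2: "ra \<in> T" "rb \<in> T" "t12 \<sqsubseteq> ra" "t12 \<sqsubseteq> rb" "pos ra rb (\<psi> v) o1" using sv[OF 1(2) up[OF t(3) 1(4)], of o1] by blast
    have b: "t1 \<sqsubseteq> ra" "t1 \<sqsubseteq> rb" using 1 2 below_trans by blast+
    have P: "pos ra t2 (\<psi> v) o1" "pos rb t2 (\<psi> v) o1" "pos ry t2 (\<psi> v) o1" "pos ry ra (\<psi> w) o2" "pos ry rb (\<psi> w) o2"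
      using P2[OF t(5) t(1,2) 2(1) t(2) b(1) below_refl] P2[OF t(5) t(1,2) 2(2) t(2) b(2) below_refl]
        P2[OF t(5) t(1,2) 1(1) t(2) 1(3) below_refl] P2[OF 1(5) 1(1,2) 1(1) 2(1) below_refl 2(3)] P2[OF 1(5) 1(1,2) 1(1) 2(2) below_refl 2(4)] by blast+
    obtain x where x: "inj_on x {..<(4::nat)}" "un (x 3) = un y" "q (x 0) (x 1) \<cong> q i j" "q (x 0) (x 2) \<cong> q i j" "q (x 1) (x 2) \<cong> q i j"
        "q (x 3) (x 0) \<cong> q y i" "q (x 3) (x 1) \<cong> q y i" "q (x 3) (x 2) \<cong> q y j"
      using build[OF refl 2(1,2) t(2) 1(1) up[OF t(3) b(1)] up[OF t(3) b(2)] t(4) up[OF t(3) 1(3)]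
          inc(1)[OF 2(5)] inc(1)[OF P(1)] inc(1)[OF P(2)] inc(1)[OF P(4)] inc(1)[OF P(5)] inc(1)[OF P(3)]] 2(5) P by auto
    then show ?thesis by (intro quadI[OF x(1) ij]) auto
  qed
  have B: "quad i j (un y) (q y i) (q y j) (q y j)"
  proof -
    obtain ry ra where 1: "ry \<in> T" "ra \<in> T" "t1 \<sqsubseteq> ry" "t1 \<sqsubseteq> ra" "pos ry ra (\<psi> w) o2" using sw[OF t(1,3), of o2] by blast
    obtain rb rc where 2: "rb \<in> T" "rc \<in> T" "t2 \<sqsubseteq> rb" "t2 \<sqsubseteq> rc" "pos rb rc (\<psi> v) o1" using sv[OF t(2,4), of o1] by blast
    have P: "pos ra rb (\<psi> v) o1" "pos ra rc (\<psi> v) o1" "pos ry rb (\<psi> v) o1" "pos ry rc (\<psi> v) o1"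
      using P2[OF t(5) t(1,2) 1(2) 2(1) 1(4) 2(3)] P2[OF t(5) t(1,2) 1(2) 2(2) 1(4) 2(4)]
        P2[OF t(5) t(1,2) 1(1) 2(1) 1(3) 2(3)] P2[OF t(5) t(1,2) 1(1) 2(2) 1(3) 2(4)] by blast+
    obtain x where x: "inj_on x {..<(4::nat)}" "un (x 3) = un y" "q (x 0) (x 1) \<cong> q i j" "q (x 0) (x 2) \<cong> q i j" "q (x 1) (x 2) \<cong> q i j"
        "q (x 3) (x 0) \<cong> q y i" "q (x 3) (x 1) \<cong> q y j" "q (x 3) (x 2) \<cong> q y j"
      using build[OF refl 1(2) 2(1,2) 1(1) up[OF t(3) 1(4)] up[OF t(4) 2(3)] up[OF t(4) 2(4)] up[OF t(3) 1(3)]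
          inc(1)[OF P(1)] inc(1)[OF P(2)] inc(1)[OF 2(5)] inc(1)[OF 1(5)] inc(1)[OF P(3)] inc(1)[OF P(4)]] 1(5) 2(5) P by auto
    then show ?thesis by (intro quadI[OF x(1) ij]) auto
  qed
  have C: "quad i j (un y) (q r p) (q y i) (q y i)"
  proof -
    obtain ry t22 where 1: "ry \<in> T" "t22 \<in> T" "t2 \<sqsubseteq> ry" "t2 \<sqsubseteq> t22" "pos ry t22 (\<psi> w) o2" using sw[OF t(2,4), of o2] by blast
    obtain rb rc where 2: "rb \<in> T" "rc \<in> T" "t22 \<sqsubseteq> rb" "t22 \<sqsubseteq> rc" "pos rb rc (\<psi> v) o1" using sv[OF 1(2) up[OF t(4) 1(4)], of o1] by blast
    have b: "t2 \<sqsubseteq> rb" "t2 \<sqsubseteq> rc" using 1 2 below_trans by blast+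
    have P: "pos t1 rb (\<psi> v) o1" "pos t1 rc (\<psi> v) o1" "pos t1 ry (\<psi> v) o1" "pos ry rb (\<psi> w) o2" "pos ry rc (\<psi> w) o2"
      using P2[OF t(5) t(1,2) t(1) 2(1) below_refl b(1)] P2[OF t(5) t(1,2) t(1) 2(2) below_refl b(2)]
        P2[OF t(5) t(1,2) t(1) 1(1) below_refl 1(3)] P2[OF 1(5) 1(1,2) 1(1) 2(1) below_refl 2(3)] P2[OF 1(5) 1(1,2) 1(1) 2(2) below_refl 2(4)] by blast+
    obtain x where x: "inj_on x {..<(4::nat)}" "un (x 3) = un y" "q (x 0) (x 1) \<cong> q i j" "q (x 0) (x 2) \<cong> q i j" "q (x 1) (x 2) \<cong> q i j"
        "q (x 3) (x 0) \<cong> q r p" "q (x 3) (x 1) \<cong> q y i" "q (x 3) (x 2) \<cong> q y i"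
      using build[OF refl t(1) 2(1,2) 1(1) t(3) up[OF t(4) b(1)] up[OF t(4) b(2)] up[OF t(4) 1(3)]
          inc(1)[OF P(1)] inc(1)[OF P(2)] inc(1)[OF 2(5)] inc(2)[OF P(3)] inc(1)[OF P(4)] inc(1)[OF P(5)]] 2(5) P by auto
    then show ?thesis by (intro quadI[OF x(1) ij]) auto
  qed
  have D: "quad i j (un y) (q r p) (q y i) (q y j)"
  proof -
    obtain t21 rc where 1: "t21 \<in> T" "rc \<in> T" "t2 \<sqsubseteq> t21" "t2 \<sqsubseteq> rc" "pos t21 rc (\<psi> v) o1" using sv[OF t(2,4), of o1] by blast
    obtain ry rb where 2: "ry \<in> T" "rb \<in> T" "t21 \<sqsubseteq> ry" "t21 \<sqsubseteq> rb" "pos ry rb (\<psi> w) o2" using sw[OF 1(1) up[OF t(4) 1(3)], of o2] by blast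
    have b: "t2 \<sqsubseteq> ry" "t2 \<sqsubseteq> rb" using 1 2 below_trans by blast+
    have P: "pos t1 rb (\<psi> v) o1" "pos t1 rc (\<psi> v) o1" "pos t1 ry (\<psi> v) o1" "pos rb rc (\<psi> v) o1" "pos ry rc (\<psi> v) o1"
      using P2[OF t(5) t(1,2) t(1) 2(2) below_refl b(2)] P2[OF t(5) t(1,2) t(1) 1(2) below_refl 1(4)]
        P2[OF t(5) t(1,2) t(1) 2(1) below_refl b(1)] P2[OF 1(5) 1(1,2) 2(2) 1(2) 2(4) below_refl] P2[OF 1(5) 1(1,2) 2(1) 1(2) 2(3) below_refl] by blast+
    obtain x where x: "inj_on x {..<(4::nat)}" "un (x 3) = un y" "q (x 0) (x 1) \<cong> q i j" "q (x 0) (x 2) \<cong> q i j" "q (x 1) (x 2) \<cong> q i j"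
        "q (x 3) (x 0) \<cong> q r p" "q (x 3) (x 1) \<cong> q y i" "q (x 3) (x 2) \<cong> q y j"
      using build[OF refl t(1) 2(2) 1(2) 2(1) t(3) up[OF t(4) b(2)] up[OF t(4) 1(4)] up[OF t(4) b(1)]
          inc(1)[OF P(1)] inc(1)[OF P(2)] inc(1)[OF P(4)] inc(2)[OF P(3)] inc(1)[OF 2(5)] inc(1)[OF P(5)]] 2(5) P by auto
    then show ?thesis by (intro quadI[OF x(1) ij]) auto
  qed
  show False by (rule no_quads[OF S(19) A B C D d n])
qed

text \<open>If \<open>y'\<close> lies on the side of \<open>i\<close> too, the values over
  \<open>j\<close> agree by position, and both values over \<open>i\<close> equal, by
  \<open>opposite_value\<close>, that of a vertex on the other side. If \<open>y'\<close> lies on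
  the side of \<open>j\<close>, it is itself such a vertex for \<open>i\<close>, and
  \<open>y\<close> is one for \<open>j\<close>.\<close>

lemma separation_pattern:
  assumes s: "split_at a e v l L X i j"
    and y: "y \<in> X" "y \<noteq> i" "y \<noteq> j" "\<not> q y i \<cong> q y j" and y': "y' \<in> X" "y' \<noteq> i" "y' \<noteq> j" "\<not> q y' i \<cong> q y' j" and un: "un y = un y'"
    and on: "restr (cn y) (len v + 1) = restr (cn i) (len v + 1)"
  shows "q y i \<cong> q y' i \<and> q y j \<cong> q y' j"
proof -
  note S = split_atD[OF s]
  note g = goodD[OF S(14)]
  note sp = side_pos[OF s y(1-3) on]
  have ey: "e \<sqsubseteq> cn y" using sp(5) S(13) below_trans by blast
  have by': "v \<sqsubseteq> cn y'" using branch[OF s y'] .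
  from side[OF s y'(1-3) by'] show ?thesis
  proof
    assume on': "restr (cn y') (len v + 1) = restr (cn i) (len v + 1)"
    note sp' = side_pos[OF s y'(1-3) on']
    have ey': "e \<sqsubseteq> cn y'" using sp'(5) S(13) below_trans by blast
    have 1: "q y j \<cong> q y' j"
      by (rule forced_pos[OF S(11) g(3) g(1)[OF y(1)] S(7) g(2)[OF y(1)] g(2)[OF S(17)] g(5)[OF y(1) S(17) y(3)] S(15) ey
         g(1)[OF y'(1)] S(7) ey' g(6)[OF y'(1) S(17) y'(3)] un refl sp(1) sp'(1)])
    \<comment> \<open>A vertex of the unary type of \<open>y\<close> beyond \<open>j\<close>. It
      serves as the common term of comparison for \<open>y\<close> and \<open>y'\<close> over
      \<open>i\<close>.\<close>
    obtain r where r: "r \<in> N" "cn j \<sqsubseteq> cn r" "un r = un y"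
      using coding_dense[OF S(11,12,13) g(1)[OF y(1)] sp(5), of "cn j"] S(5,7) N_iff by auto
    have Lr: "L \<le> r" using below_len[OF r(2)] g(2)[OF S(17)] by simp
    have inc: "incomparable (cn i) (cn j)" using S(21) by (simp add: pos_def)
    have m: "meet (cn i) (cn r) = v" using meet_above(1)[OF cn_CT cn_CT cn_CT cn_CT below_refl r(2) inc] S(20) by simp
    have lt: "ml (cn i) (cn r) < l" using m g(5)[OF S(16,17,18)] S(20) by simp
    have pos: "pos (cn i) (cn r) (\<psi> v) (pr (cn i) (cn j))" by (rule pos_above[OF S(21) cn_CT cn_CT cn_CT cn_CT below_refl r(2)])
    have "q r i \<cong> q y i"
      by (rule opposite_value[OF s y(1-3) on y(4) S(6) r(1) g(3) g(2)[OF S(16)] Lr lt S(15,4) refl r(3) pos])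
    moreover have "q r i \<cong> q y' i"
      by (rule opposite_value[OF s y'(1-3) on' y'(4) S(6) r(1) g(3) g(2)[OF S(16)] Lr lt S(15,4) refl _ pos]) (use r un in simp)
    ultimately show ?thesis using 1 cong_trans cong_sym by blast
  next
    assume on': "restr (cn y') (len v + 1) = restr (cn j) (len v + 1)"
    note s' = split_at_sym[OF s]
    note sp' = side_pos[OF s' y'(1,3,2) on']
    have p1: "pos (cn i) (cn y') (\<psi> v) (pr (cn i) (cn j))"
      using pos_sym[OF sp'(1) cn_CT cn_CT] prec_asym[OF cn_CT cn_CT, of i j] S(21) unfolding pos_def by simp
    have p2: "pos (cn j) (cn y) (\<psi> v) (pr (cn j) (cn i))"
      using pos_sym[OF sp(1) cn_CT cn_CT] prec_asym[OF cn_CT cn_CT, of i j] S(21) unfolding pos_def by simp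
    have "q y' i \<cong> q y i"
      by (rule opposite_value[OF s y(1-3) on y(4) S(6) g(1)[OF y'(1)] g(3) g(2)[OF S(16)] g(2)[OF y'(1)] g(5)[OF S(16) y'(1) y'(2)[symmetric]] S(15,4) refl un[symmetric] p1])
    moreover have "\<not> q y' j \<cong> q y' i" using y'(4) cong_sym by blast
    then have "q y j \<cong> q y' j"
      using opposite_value[OF s' y'(1,3,2) on' _ S(7) g(1)[OF y(1)] g(3) g(2)[OF S(17)] g(2)[OF y(1)] g(5)[OF S(17) y(1) y(3)[symmetric]] S(15,5) refl un p2] by blast
    ultimately show ?thesis using cong_sym by blast
  qed
qed

definition one_pattern :: "nat set \<Rightarrow> nat \<Rightarrow> nat \<Rightarrow> bool" where
  "one_pattern Z i j \<longleftrightarrow> (\<forall>y \<in> Z - {i, j}. \<forall>y' \<in> Z - {i, j}. un y = un y' \<longrightarrow> \<not> q y i \<cong> q y j \<longrightarrow> \<not> q y' i \<cong> q y' j \<longrightarrow>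
     q y i \<cong> q y' i \<and> q y j \<cong> q y' j)"

text \<open>\<open>separation_pattern\<close> presupposes that one vertex lies on the side of
  \<open>i\<close>. On the other side it is applied with \<open>i\<close> and \<open>j\<close>
  exchanged.\<close>

lemma master:
  assumes Z: "finite Z" "a \<in> Z" "b \<in> Z" "c \<in> Z" "distinct [a, b, c]" "un a = un b" "un a = un c"
  shows "one_pattern Z a b \<or> one_pattern Z a c \<or> one_pattern Z b c"
proof -
  obtain \<phi> l L i j k a' e v where \<phi>: "pe \<phi> Z" and ijk: "(i, j, k) \<in> {(a, b, c), (a, c, b), (b, c, a)}"
    and s: "split_at a' e v l L (\<phi> ` Z) (\<phi> i) (\<phi> j)"
    by (rule triple_shape[OF Z])
  have i: "i \<in> Z" "j \<in> Z" using ijk Z by auto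
  have ne: "\<phi> x \<noteq> \<phi> y" if "x \<in> Z" "y \<in> Z" "x \<noteq> y" for x y using pe_inj[OF \<phi>] that by (auto simp: inj_on_def)
  have "one_pattern Z i j"
    unfolding one_pattern_def
  proof (intro ballI impI)
    fix y y' assume y: "y \<in> Z - {i, j}" "y' \<in> Z - {i, j}" "un y = un y'" "\<not> q y i \<cong> q y j" "\<not> q y' i \<cong> q y' j"
    have Q: "q (\<phi> z) (\<phi> i) = q z i" "q (\<phi> z) (\<phi> j) = q z j" if "z \<in> Z - {i, j}" for z
      using pe_q[OF \<phi>, of z i] pe_q[OF \<phi>, of z j] that i by auto
    have Y: "\<phi> y \<in> \<phi> ` Z" "\<phi> y \<noteq> \<phi> i" "\<phi> y \<noteq> \<phi> j" "\<not> q (\<phi> y) (\<phi> i) \<cong> q (\<phi> y) (\<phi> j)" using y Q ne i by auto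
    have Y': "\<phi> y' \<in> \<phi> ` Z" "\<phi> y' \<noteq> \<phi> i" "\<phi> y' \<noteq> \<phi> j" "\<not> q (\<phi> y') (\<phi> i) \<cong> q (\<phi> y') (\<phi> j)" using y Q ne i by auto
    have un: "un (\<phi> y) = un (\<phi> y')" using pe_un[OF \<phi>] y by simp
    have Z1: "\<not> q (\<phi> y) (\<phi> j) \<cong> q (\<phi> y) (\<phi> i)" "\<not> q (\<phi> y') (\<phi> j) \<cong> q (\<phi> y') (\<phi> i)" using Y Y' cong_sym by blast+
    from side[OF s Y(1-3) branch[OF s Y]]
    have "q (\<phi> y) (\<phi> i) \<cong> q (\<phi> y') (\<phi> i) \<and> q (\<phi> y) (\<phi> j) \<cong> q (\<phi> y') (\<phi> j)"
    proof
      assume "restr (cn (\<phi> y)) (len v + 1) = restr (cn (\<phi> i)) (len v + 1)"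
      then show ?thesis using separation_pattern[OF s Y Y' un] by blast
    next
      assume "restr (cn (\<phi> y)) (len v + 1) = restr (cn (\<phi> j)) (len v + 1)"
      then show ?thesis using separation_pattern[OF split_at_sym[OF s] Y(1,3,2) Z1(1) Y'(1,3,2) Z1(2) un] by blast
    qed
    then show "q y i \<cong> q y' i \<and> q y j \<cong> q y' j" using Q y(1,2) by simp
  qed
  then show ?thesis using ijk by auto
qed

end

section \<open>A vertex with a constant type over copies of all finite sets\<close>

context diagonal_tree
begin

text \<open>The node \<open>c\<^sub>0\<close> cannot split, since it would be a coding node of \<open>T\<close>.\<close>

lemma constant_over_first:
  assumes i: "i \<in> N" "j \<in> N" "i \<noteq> 0" "j \<noteq> 0" "un i = un 0" "un j = un 0"
  shows "bn i 0 = bn j 0"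
proof (rule ccontr)
  assume ne: "bn i 0 \<noteq> bn j 0"
  have T: "cn i \<in> T" "cn j \<in> T" using i N_iff by auto
  have "\<not> cn i \<sqsubseteq> cn j"
  proof
    assume "cn i \<sqsubseteq> cn j"
    then have "bn i 0 = bn j 0" by (rule bn_below[OF cn_CT below_refl]) (use i in simp)
    then show False using ne by simp
  qed
  moreover have "\<not> cn j \<sqsubseteq> cn i"
  proof
    assume "cn j \<sqsubseteq> cn i"
    then have "bn i 0 = bn j 0" by (rule bn_below[OF cn_CT _ below_refl]) (use i in simp)
    then show False using ne by simp
  qed
  ultimately have inc: "incomparable (cn i) (cn j)" by (simp add: incomparable_def)
  have ag: "agree 0 i 0" "agree 0 i j" using i by (auto simp: agree_def uW_def)
  have "restr (cn i) 1 = restr (cn j) 1" using cn_agree[of 0 i j] ag by simp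
  then have 1: "1 \<le> ml (cn i) (cn j)" by (subst restr_eq_iff[symmetric]) auto
  have "\<not> agree 1 i j" using ne by (auto simp: agree_def)
  then have "restr (cn i) 2 \<noteq> restr (cn j) 2" using cn_agree[of 1 i j] i by (simp add: numeral_2_eq_2)
  then have "\<not> 2 \<le> ml (cn i) (cn j)" using restr_eq_iff[of 2 "cn i" "cn j"] i by simp
  then have ml: "ml (cn i) (cn j) = 1" using 1 by simp
  have sp: "spl (meet (cn i) (cn j))" using meet_spl[OF T inc] ml by simp
  have "meet (cn i) (cn j) = restr (cn i) 1" using meet_restr(1)[of "cn i" "cn j"] ml by simp
  also have "\<dots> = restr (cn 0) 1" using cn_agree[of 0 i 0] ag by simp
  also have "\<dots> = cn 0" using restr_len[OF cn_CT, of 0] by simp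
  finally have "spl (cn 0)" using sp by simp
  then show False using spl_not_coding[of "cn 0" 0] spl_T N_iff by auto
qed

text \<open>A copy of \<open>F\<close> inside \<open>N\<close> that avoids the vertex 0 sees it
  constantly by \<open>constant_over_first\<close>. The common type is read off a copy in
  \<open>N\<close> of the vertex 0 itself.\<close>

lemma copies_over_first:
  "\<exists>\<gamma>. \<forall>F. finite F \<and> (\<forall>x \<in> F. un x = un 0) \<longrightarrow> (\<exists>\<phi>. pe \<phi> F \<and> 0 \<notin> \<phi> ` F \<and> (\<forall>x \<in> F. q 0 (\<phi> x) = \<gamma>))"
proof -
  have ex: "\<exists>\<phi>. pe \<phi> F \<and> \<phi> ` F \<subseteq> N \<and> 0 \<notin> \<phi> ` F" if F: "finite F" for F
  proof -
    obtain \<phi> where "pe \<phi> ({} \<union> F)" "\<phi> ` ({} \<union> F) \<subseteq> N" "\<forall>y \<in> F - {}. \<phi> y \<notin> {0}"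
      using extend_N[OF finite.emptyI F _ pe_id[of "{}"], of "{0}"] by auto
    then show ?thesis by (intro exI[of _ \<phi>]) force
  qed
  obtain \<phi>0 where p0: "pe \<phi>0 {0}" "\<phi>0 ` {0} \<subseteq> N" "0 \<notin> \<phi>0 ` {0}" using ex[of "{0}"] by auto
  define i where "i = \<phi>0 0"
  have i: "i \<in> N" "i \<noteq> 0" "un i = un 0" using p0 pe_un[OF p0(1), of 0] by (auto simp: i_def)
  have "\<exists>\<phi>. pe \<phi> F \<and> 0 \<notin> \<phi> ` F \<and> (\<forall>x \<in> F. q 0 (\<phi> x) = q 0 i)" if F: "finite F" "\<forall>x \<in> F. un x = un 0" for F
  proof -
    obtain \<phi> where \<phi>: "pe \<phi> F" "\<phi> ` F \<subseteq> N" "0 \<notin> \<phi> ` F" using ex[OF F(1)] by blast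
    have "q 0 (\<phi> x) = q 0 i" if x: "x \<in> F" for x
    proof -
      have u: "un (\<phi> x) = un 0" using pe_un[OF \<phi>(1) x] F(2) x by simp
      have "\<phi> x \<in> N" "\<phi> x \<noteq> 0" using \<phi> x by force+
      then have "bn (\<phi> x) 0 = bn i 0" using constant_over_first i u by blast
      then have "bn 0 (\<phi> x) = bn 0 i" by (rule bn_swap)
      then show ?thesis using u i(3) by (simp add: q_def)
    qed
    then show ?thesis using \<phi> by blast
  qed
  then show ?thesis by blast
qed

end

context fraisse_limit
begin

text \<open>The Diagonal Coding Tree Property holds for every enumeration, so any vertex can be made
  the first one.\<close>

lemma permuted_limit:
  assumes \<pi>: "bij \<pi>"
  shows "enumerated_fraisse_limit ar \<K> (pull \<pi> M UNIV)"
proof -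
  let ?M = "pull \<pi> M UNIV" and ?i = "inv \<pi>"
  have inv: "\<pi> (?i x) = x" "?i (\<pi> x) = x" for x using \<pi> by (simp_all add: bij_def surj_f_inv_f)
  have inj: "inj \<pi>" "inj ?i" using \<pi> bij_imp_bij_inv bij_is_inj by blast+
  have e1: "embedding \<pi> ?M M" using embedding_pull[of \<pi> UNIV M] inj by simp
  have r: "xs \<in> rels M R \<longleftrightarrow> map ?i xs \<in> rels ?M R" for xs R
  proof -
    have "map \<pi> (map ?i xs) = xs" using inv(1) by (simp add: comp_def)
    then show ?thesis by simp
  qed
  have e2: "embedding ?i M ?M"
    unfolding embedding_def using inj(2) r by simp
  have age: "age ar ?M = \<K>"
  proof -
    have "embeds A ?M \<longleftrightarrow> embeds A M" for A
      using embedding_comp e1 e2 unfolding embeds_def by blast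
    then show ?thesis using limit unfolding enumerated_fraisse_limit_def age_def by simp
  qed
  have "ultrahomogeneous ?M"
    unfolding ultrahomogeneous_def
  proof (intro allI impI)
    fix F G f assume fg: "F \<subseteq> univ ?M \<and> G \<subseteq> univ ?M \<and> finite F \<and> is_iso f (induced ?M F) (induced ?M G)"
    let ?f = "\<pi> \<circ> f \<circ> ?i"
    have f: "inj_on f F" "f ` F = G" "\<And>R xs. set xs \<subseteq> F \<Longrightarrow> xs \<in> rels (induced ?M F) R \<longleftrightarrow> map f xs \<in> rels (induced ?M G) R"
      using fg by (auto simp: is_iso_def embedding_def simp del: induced_simps(2))
    have im: "?f ` (\<pi> ` F) = \<pi> ` G" using f(2) inv by (force simp: image_iff)
    have "is_iso ?f (induced M (\<pi> ` F)) (induced M (\<pi> ` G))"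
      unfolding is_iso_def embedding_def
    proof (intro conjI allI impI)
      show "inj_on ?f (univ (induced M (\<pi> ` F)))"
      proof (rule inj_onI)
        fix x y assume xy: "x \<in> univ (induced M (\<pi> ` F))" "y \<in> univ (induced M (\<pi> ` F))" "?f x = ?f y"
        obtain a b where ab: "x = \<pi> a" "a \<in> F" "y = \<pi> b" "b \<in> F" using xy(1,2) by auto
        have "\<pi> (f a) = \<pi> (f b)" using xy(3) ab inv(2) by simp
        then have "f a = f b" by (rule injD[OF inj(1)])
        then have "a = b" using inj_onD[OF f(1)] ab by blast
        then show "x = y" using ab by simp
      qed
      show "?f ` univ (induced M (\<pi> ` F)) \<subseteq> univ (induced M (\<pi> ` G))" "?f ` univ (induced M (\<pi> ` F)) = univ (induced M (\<pi> ` G))"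
        using im by simp_all
      fix R xs assume "set xs \<subseteq> univ (induced M (\<pi> ` F))"
      then have xs: "set xs \<subseteq> \<pi> ` F" by simp
      then have s1: "set (map ?i xs) \<subseteq> F" using inv by auto
      then have s2: "set (map f (map ?i xs)) \<subseteq> G" using f(2) by auto
      have s3: "set (map ?f xs) \<subseteq> \<pi> ` G" using image_mono[OF xs, of ?f] im by simp
      have "xs \<in> rels (induced M (\<pi> ` F)) R \<longleftrightarrow> map ?i xs \<in> rels (induced ?M F) R" using xs s1 r by auto
      also have "\<dots> \<longleftrightarrow> map f (map ?i xs) \<in> rels (induced ?M G) R" by (rule f(3)[OF s1])
      also have "\<dots> \<longleftrightarrow> map ?f xs \<in> rels (induced M (\<pi> ` G)) R" using s2 s3 by (simp add: comp_assoc)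
      finally show "xs \<in> rels (induced M (\<pi> ` F)) R \<longleftrightarrow> map ?f xs \<in> rels (induced M (\<pi> ` G)) R" .
    qed
    moreover have "ultrahomogeneous M" using limit by (simp add: enumerated_fraisse_limit_def)
    ultimately obtain h where h: "is_iso h M M" "\<forall>a \<in> \<pi> ` F. h a = ?f a"
      using fg unfolding ultrahomogeneous_def by (metis finite_imageI subset_UNIV univ_M)
    have "embedding (?i \<circ> (h \<circ> \<pi>)) ?M ?M"
      using h(1) embedding_comp[OF embedding_comp[OF e1] e2] unfolding is_iso_def by (simp add: comp_assoc)
    moreover have "(?i \<circ> (h \<circ> \<pi>)) ` univ ?M = univ ?M"
    proof -
      have A: "\<pi> ` UNIV = UNIV" "h ` UNIV = UNIV" "?i ` UNIV = UNIV"
        using \<pi> h(1) bij_imp_bij_inv[OF \<pi>] by (simp_all add: bij_def is_iso_def)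
      show ?thesis unfolding pull_simps(1) image_comp[symmetric] A by (rule refl)
    qed
    ultimately have "is_iso (?i \<circ> (h \<circ> \<pi>)) ?M ?M" by (simp add: is_iso_def)
    moreover have "\<forall>a \<in> F. (?i \<circ> (h \<circ> \<pi>)) a = f a" using h(2) inv by simp
    ultimately show "\<exists>h. is_iso h ?M ?M \<and> (\<forall>a \<in> F. h a = f a)" by blast
  qed
  then show ?thesis
    unfolding enumerated_fraisse_limit_def using is_struct_pull[OF struct_M] age by simp
qed

lemma bottom_vertex:
  assumes dct: "diagonal_coding_tree_property ar \<K>" and lo: "literal_order (lo :: ('r lit \<times> 'r lit) set)"
  shows "\<exists>\<gamma>. \<forall>F. finite F \<and> (\<forall>x \<in> F. un x = un x0) \<longrightarrow>
    (\<exists>\<phi> v. pe \<phi> F \<and> v \<notin> \<phi> ` F \<and> un v = un x0 \<and> (\<forall>x \<in> F. q v (\<phi> x) = \<gamma>))"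
proof -
  \<comment> \<open>A transposition that makes \<open>x0\<close> the first vertex; being its own
    inverse, it also translates the result back.\<close>
  define \<pi> where "\<pi> = id(0 := x0, x0 := 0)"
  have \<pi>\<pi>: "\<pi> (\<pi> x) = x" for x by (simp add: \<pi>_def)
  then have "bij \<pi>" by (metis bijI')
  let ?M = "pull \<pi> M UNIV"
  have lim: "enumerated_fraisse_limit ar \<K> ?M" by (rule permuted_limit[OF \<open>bij \<pi>\<close>])
  then obtain W T where WT: "W \<in> tree_symbols ar" "perfect T" "diagonal_coding_subtree ar W ?M T"
    using dct unfolding diagonal_coding_tree_property_def by blast
  interpret P: diagonal_tree ar \<K> ?M W lo T
    using ar lim dap distinct_tuples WT lo
    by unfold_locales (auto simp: diagonal_coding_subtree_def simp del: bnS_induced unS_induced)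
  have un: "unS ar ?M x = un (\<pi> x)" for x by (simp add: unS_def)
  have bn: "bnS ar ?M x y = bn (\<pi> x) (\<pi> y)" for x y by (simp add: bnS_def)
  have \<pi>0: "\<pi> 0 = x0" by (auto simp: \<pi>_def)
  obtain \<gamma> where \<gamma>: "\<forall>F. finite F \<and> (\<forall>x \<in> F. unS ar ?M x = unS ar ?M 0) \<longrightarrow>
      (\<exists>\<phi>. P.pe \<phi> F \<and> 0 \<notin> \<phi> ` F \<and> (\<forall>x \<in> F. P.q 0 (\<phi> x) = \<gamma>))"
    using P.copies_over_first by (rule exE)
  have "\<exists>\<phi> v. pe \<phi> F \<and> v \<notin> \<phi> ` F \<and> un v = un x0 \<and> (\<forall>x \<in> F. q v (\<phi> x) = \<gamma>)"
    if F: "finite F" "\<forall>x \<in> F. un x = un x0" for F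
  proof -
    have fF: "finite (\<pi> ` F) \<and> (\<forall>x \<in> \<pi> ` F. unS ar ?M x = unS ar ?M 0)" using F \<pi>\<pi> \<pi>0 by (simp add: un)
    obtain \<phi> where \<phi>: "P.pe \<phi> (\<pi> ` F)" "0 \<notin> \<phi> ` \<pi> ` F" "\<forall>x \<in> \<pi> ` F. P.q 0 (\<phi> x) = \<gamma>"
      using mp[OF spec[OF \<gamma>, of "\<pi> ` F"] fF] by blast
    define \<rho> where "\<rho> x = \<pi> (\<phi> (\<pi> x))" for x
    have inj: "\<pi> x = \<pi> y \<longleftrightarrow> x = y" for x y using \<pi>\<pi> by metis
    have "pe \<rho> F"
      unfolding pe_def
    proof (intro conjI ballI impI)
      show "inj_on \<rho> F"
        using P.pe_inj[OF \<phi>(1)] by (auto simp: inj_on_def \<rho>_def inj)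
      show "un (\<rho> x) = un x" if "x \<in> F" for x
        using P.pe_un[OF \<phi>(1), of "\<pi> x"] that by (simp add: un \<pi>\<pi> \<rho>_def)
      show "bn (\<rho> x) (\<rho> y) = bn x y" if "x \<in> F" "y \<in> F" "x \<noteq> y" for x y
        using P.pe_bn[OF \<phi>(1), of "\<pi> x" "\<pi> y"] that by (simp add: bn \<pi>\<pi> \<rho>_def inj)
    qed
    moreover have "x0 \<notin> \<rho> ` F"
    proof
      assume "x0 \<in> \<rho> ` F"
      then obtain x where "x \<in> F" "\<pi> (\<phi> (\<pi> x)) = \<pi> 0" using \<pi>0 by (auto simp: \<rho>_def)
      then show False using \<phi>(2) by (auto simp: inj)
    qed
    moreover have "q x0 (\<rho> x) = \<gamma>" if "x \<in> F" for x
    proof -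
      have "P.q 0 (\<phi> (\<pi> x)) = \<gamma>" using \<phi>(3) that by blast
      then show ?thesis by (simp add: P.q_def q_def un bn \<rho>_def \<pi>0)
    qed
    ultimately show ?thesis by blast
  qed
  then show ?thesis by blast
qed

end

section \<open>Linear orders on blocks of unary types\<close>

text \<open>The two facts that the trees yield. From here on the orders are derived from
  \<open>un\<close> and \<open>bn\<close> alone.\<close>

locale structured = homog_sdap un bn for un :: "nat \<Rightarrow> 'u" and bn :: "nat \<Rightarrow> nat \<Rightarrow> 'b" +
  assumes one_pattern: "finite Z \<Longrightarrow> a \<in> Z \<Longrightarrow> b \<in> Z \<Longrightarrow> c \<in> Z \<Longrightarrow> distinct [a, b, c] \<Longrightarrow> un a = un b \<Longrightarrow> un a = un c \<Longrightarrow>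
      \<exists>(i, j) \<in> {(a, b), (a, c), (b, c)}. \<forall>y \<in> Z - {i, j}. \<forall>y' \<in> Z - {i, j}. un y = un y' \<longrightarrow>
        \<not> cong (q y i) (q y j) \<longrightarrow> \<not> cong (q y' i) (q y' j) \<longrightarrow> cong (q y i) (q y' i) \<and> cong (q y j) (q y' j)"
    and bottom: "\<exists>\<gamma>. \<forall>F. finite F \<and> (\<forall>x \<in> F. un x = un x0) \<longrightarrow>
      (\<exists>\<phi> v. pe \<phi> F \<and> v \<notin> \<phi> ` F \<and> un v = un x0 \<and> (\<forall>x \<in> F. q v (\<phi> x) = \<gamma>))"
begin

notation cong (infix "\<cong>" 50)

definition bottom_type :: "'u \<Rightarrow> 'u \<times> 'u \<times> 'b" where
  "bottom_type u = (SOME \<gamma>. \<forall>F. finite F \<and> (\<forall>x \<in> F. un x = u) \<longrightarrow>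
      (\<exists>\<phi> v. pe \<phi> F \<and> v \<notin> \<phi> ` F \<and> un v = u \<and> (\<forall>x \<in> F. q v (\<phi> x) = \<gamma>)))"

text \<open>\<open>bottom\<close> provides the vertex only over a copy of the relevant part of
  \<open>F\<close>. Extending the inverse of the copying map brings it back, outside
  \<open>F\<close>.\<close>

lemma bottom_in:
  assumes F: "finite F"
  shows "\<exists>v. v \<notin> F \<and> un v = un x0 \<and> (\<forall>x \<in> F. un x = un x0 \<longrightarrow> q v x = bottom_type (un x0))"
proof -
  let ?F = "{x \<in> F. un x = un x0}"
  have all: "\<forall>F. finite F \<and> (\<forall>x \<in> F. un x = un x0) \<longrightarrow>
      (\<exists>\<phi> v. pe \<phi> F \<and> v \<notin> \<phi> ` F \<and> un v = un x0 \<and> (\<forall>x \<in> F. q v (\<phi> x) = bottom_type (un x0)))"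
    unfolding bottom_type_def by (rule someI_ex[OF bottom])
  have fF: "finite ?F \<and> (\<forall>x \<in> ?F. un x = un x0)" using F by simp
  obtain \<phi> v where \<phi>: "pe \<phi> ?F" "v \<notin> \<phi> ` ?F" "un v = un x0" "\<forall>x \<in> ?F. q v (\<phi> x) = bottom_type (un x0)"
    using mp[OF spec[OF all, of ?F] fF] by blast
  note inj = pe_inj[OF \<phi>(1)]
  have fin: "finite (\<phi> ` ?F)" using F by simp
  obtain v' where v': "v' \<notin> F" "pe ((the_inv_into ?F \<phi>)(v := v')) (insert v (\<phi> ` ?F))"
    using ext1[OF fin F pe_inv[OF \<phi>(1)] \<phi>(2)] by blast
  have "q v' x = bottom_type (un x0)" if x: "x \<in> F" "un x = un x0" for x
  proof -
    have 1: "\<phi> x \<in> \<phi> ` ?F" "\<phi> x \<noteq> v" using x \<phi>(2) by auto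
    have "q (((the_inv_into ?F \<phi>)(v := v')) v) (((the_inv_into ?F \<phi>)(v := v')) (\<phi> x)) = q v (\<phi> x)"
      by (rule pe_q[OF v'(2)]) (use 1 in auto)
    then show ?thesis using 1 the_inv_into_f_f[OF inj, of x] x \<phi>(4) by simp
  qed
  moreover have "un v' = un x0" using pe_un[OF v'(2), of v] \<phi>(3) by simp
  ultimately show ?thesis using v'(1) by blast
qed

lemma ext_pair:
  assumes "un x = un p" "p \<noteq> r" "finite G"
  obtains z where "z \<notin> G" "z \<noteq> x" "q x z = q p r" "q z x = q r p" "un z = un r"
proof -
  have "pe (\<lambda>_. x) {p}" using assms(1) by (simp add: pe_def)
  then obtain z where z: "z \<notin> insert x G" "pe ((\<lambda>_. x)(r := z)) (insert r {p})"
    using ext1[of "{p}" "insert x G" "\<lambda>_. x" r] assms by auto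
  have "q x z = q p r" using pe_q[OF z(2), of p r] assms(2) by simp
  moreover have "un z = un r" using pe_un[OF z(2), of r] by simp
  ultimately show ?thesis using that z(1) q_swap by (metis insertCI)
qed

lemma extend_pair:
  assumes "c \<noteq> d" "c' \<noteq> d'" "q c d = q c' d'" "y \<notin> {c, d}" "finite G"
  obtains y' where "y' \<notin> G" "y' \<notin> {c', d'}" "q y' c' = q y c" "q y' d' = q y d" "un y' = un y"
proof -
  have p: "pe ((\<lambda>_. d')(c := c')) {c, d}" by (rule pe_pair) (use assms in auto)
  obtain z where z: "z \<notin> G \<union> {c', d'}" "pe (((\<lambda>_. d')(c := c'))(y := z)) (insert y {c, d})"
    using ext1[OF _ _ p assms(4), of "G \<union> {c', d'}"] assms(5) by auto
  have "q z c' = q y c" "q z d' = q y d"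
    using pe_q[OF z(2), of y c] pe_q[OF z(2), of y d] assms by auto
  moreover have "un z = un y" using pe_un[OF z(2), of y] by simp
  ultimately show ?thesis using that z(1) by blast
qed

lemma change_third:
  assumes "q c d \<cong> q c' d'" "distinct [c, d, y]"
  obtains c1 d1 y1 where "distinct [c1, d1, y1]" "q c1 d1 = q c' d'" "q y1 c1 = q y c" "q y1 d1 = q y d" "un y1 = un y"
proof -
  obtain \<phi> where \<phi>: "change_map \<phi> {c, d, y} c d (q c' d')"
    by (rule change_pair[OF assms(1), of "{c, d, y}"]) (use assms(2) in auto)
  have "{y, c} \<noteq> {c, d}" "{y, d} \<noteq> {c, d}" using assms(2) by (auto simp: doubleton_eq_iff)
  then have "q (\<phi> y) (\<phi> c) = q y c" "q (\<phi> y) (\<phi> d) = q y d"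
    using change_map_q[OF \<phi>, of y c] change_map_q[OF \<phi>, of y d] assms(2) by auto
  moreover have "distinct [\<phi> c, \<phi> d, \<phi> y]" using change_mapD(1)[OF \<phi>] assms(2) by (auto simp: inj_on_def)
  ultimately show ?thesis using that change_mapD(2,3)[OF \<phi>] by blast
qed

section \<open>Cuts, and at most two classes for a pair of unary types\<close>

definition lower :: "'u \<Rightarrow> nat \<Rightarrow> nat \<Rightarrow> bool" where
  "lower u c d \<longleftrightarrow> un c = u \<and> un d = u \<and> c \<noteq> d \<and> q c d \<cong> bottom_type u"

text \<open>A pair oriented by the bottom type and separated by \<open>y\<close>; it plays the role
  of two points of a line on different sides of \<open>y\<close>.\<close>

definition cuts :: "'u \<Rightarrow> nat \<Rightarrow> nat \<Rightarrow> nat \<Rightarrow> bool" where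
  "cuts u y c d \<longleftrightarrow> lower u c d \<and> y \<notin> {c, d} \<and> \<not> q y c \<cong> q y d"

lemma chain:
  obtains c1 c2 c3 where "distinct [c1, c2, c3]" "un c1 = un x0" "un c2 = un x0" "un c3 = un x0"
    "q c1 c2 = bottom_type (un x0)" "q c1 c3 = bottom_type (un x0)" "q c2 c3 = bottom_type (un x0)"
proof -
  obtain c2 where c2: "c2 \<noteq> x0" "un c2 = un x0" "q c2 x0 = bottom_type (un x0)" using bottom_in[of "{x0}" x0] by auto
  obtain c1 where c1: "c1 \<notin> {c2, x0}" "un c1 = un x0" "\<forall>x \<in> {c2, x0}. un x = un x0 \<longrightarrow> q c1 x = bottom_type (un x0)"
    using bottom_in[of "{c2, x0}" x0] by auto
  show ?thesis by (rule that[of c1 c2 x0]) (use c1 c2 in auto)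
qed

text \<open>Over a chain of three vertices, realise the cut by \<open>y\<close> and the cut by
  \<open>y'\<close> at each of the three pairs. Whichever pair \<open>one_pattern\<close> selects,
  both cuts are present there and must have the same classes.\<close>

lemma cuts_unique_exact:
  assumes c: "cuts u y c d" "q c d = bottom_type u" and c': "cuts u y' c' d'" "q c' d' = bottom_type u" and un: "un y = un y'"
  shows "q y c \<cong> q y' c' \<and> q y d \<cong> q y' d'"
proof -
  have u: "un c = u" "c \<noteq> d" "c' \<noteq> d'" "y \<notin> {c, d}" "y' \<notin> {c', d'}" using c c' by (auto simp: cuts_def lower_def)
  obtain c1 c2 c3 where ch: "distinct [c1, c2, c3]" "un c1 = u" "un c2 = u" "un c3 = u"
    "q c1 c2 = bottom_type u" "q c1 c3 = bottom_type u" "q c2 c3 = bottom_type u" using chain[of c] u by auto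
  let ?C = "{c1, c2, c3}"
  have ex: "\<exists>z. z \<notin> ?C \<and> q z i = q y c \<and> q z j = q y d \<and> un z = un y" if "i \<noteq> j" "q i j = bottom_type u" for i j
    by (rule extend_pair[OF u(2) that(1) _ u(4), of ?C]) (use that c in auto)
  have ex': "\<exists>z. z \<notin> ?C \<and> q z i = q y' c' \<and> q z j = q y' d' \<and> un z = un y'" if "i \<noteq> j" "q i j = bottom_type u" for i j
    by (rule extend_pair[OF u(3) that(1) _ u(5), of ?C]) (use that c' in auto)
  have d: "c1 \<noteq> c2" "c1 \<noteq> c3" "c2 \<noteq> c3" using ch by auto
  obtain z12 z13 z23 where z: "z12 \<notin> ?C" "q z12 c1 = q y c" "q z12 c2 = q y d" "un z12 = un y"
     "z13 \<notin> ?C" "q z13 c1 = q y c" "q z13 c3 = q y d" "un z13 = un y"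
     "z23 \<notin> ?C" "q z23 c2 = q y c" "q z23 c3 = q y d" "un z23 = un y"
    using ex[OF d(1) ch(5)] ex[OF d(2) ch(6)] ex[OF d(3) ch(7)] by blast
  obtain w12 w13 w23 where w: "w12 \<notin> ?C" "q w12 c1 = q y' c'" "q w12 c2 = q y' d'" "un w12 = un y'"
     "w13 \<notin> ?C" "q w13 c1 = q y' c'" "q w13 c3 = q y' d'" "un w13 = un y'"
     "w23 \<notin> ?C" "q w23 c2 = q y' c'" "q w23 c3 = q y' d'" "un w23 = un y'"
    using ex'[OF d(1) ch(5)] ex'[OF d(2) ch(6)] ex'[OF d(3) ch(7)] by blast
  let ?Z = "{c1, c2, c3, z12, z13, z23, w12, w13, w23}"
  have n: "\<not> q y c \<cong> q y d" "\<not> q y' c' \<cong> q y' d'" using c c' by (auto simp: cuts_def)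
  have "\<exists>(i, j) \<in> {(c1, c2), (c1, c3), (c2, c3)}. \<forall>y \<in> ?Z - {i, j}. \<forall>y' \<in> ?Z - {i, j}. un y = un y' \<longrightarrow>
        \<not> q y i \<cong> q y j \<longrightarrow> \<not> q y' i \<cong> q y' j \<longrightarrow> q y i \<cong> q y' i \<and> q y j \<cong> q y' j"
    by (rule one_pattern) (use ch in auto)
  then obtain i j where ij: "(i, j) \<in> {(c1, c2), (c1, c3), (c2, c3)}" and
    P': "\<forall>y \<in> ?Z - {i, j}. \<forall>y' \<in> ?Z - {i, j}. un y = un y' \<longrightarrow>
        \<not> q y i \<cong> q y j \<longrightarrow> \<not> q y' i \<cong> q y' j \<longrightarrow> q y i \<cong> q y' i \<and> q y j \<cong> q y' j" by (elim bexE case_prodE) simp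
  note P = P'[rule_format]
  from ij consider "i = c1" "j = c2" | "i = c1" "j = c3" | "i = c2" "j = c3" by blast
  then show ?thesis
  proof cases
    case 1
    then show ?thesis using P[of z12 w12] z(1-4) w(1-4) n un by simp
  next
    case 2
    then show ?thesis using P[of z13 w13] z(5-8) w(5-8) n un by simp
  next
    case 3
    then show ?thesis using P[of z23 w23] z(9-12) w(9-12) n un by simp
  qed
qed

lemma bottom_pair: "\<exists>a b. a \<noteq> b \<and> un a = un x0 \<and> un b = un x0 \<and> bottom_type (un x0) = q a b"
  using chain[of x0] by (metis distinct_length_2_or_more)

lemma cuts_exact:
  assumes "cuts u y c d"
  obtains y1 c1 d1 where "cuts u y1 c1 d1" "q c1 d1 = bottom_type u" "q y1 c1 = q y c" "q y1 d1 = q y d" "un y1 = un y"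
proof -
  have c: "un c = u" "un d = u" "distinct [c, d, y]" "q c d \<cong> bottom_type u" "\<not> q y c \<cong> q y d"
    using assms by (auto simp: cuts_def lower_def)
  obtain a b where ab: "a \<noteq> b" "un a = u" "un b = u" "bottom_type u = q a b" using bottom_pair[of c] c(1) by auto
  have "q c d \<cong> q a b" using c(4) ab(4) by simp
  then obtain c1 d1 y1 where *: "distinct [c1, d1, y1]" "q c1 d1 = q a b" "q y1 c1 = q y c" "q y1 d1 = q y d" "un y1 = un y"
    using change_third[OF _ c(3)] by blast
  have "un c1 = u" "un d1 = u" using *(2) ab by (auto simp: q_def)
  then have "cuts u y1 c1 d1" using * ab(4) c(5) cong_refl by (auto simp: cuts_def lower_def)
  then show ?thesis using that * ab(4) by simp
qed

lemma cuts_unique: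
  assumes "cuts u y c d" "cuts u y' c' d'" "un y = un y'"
  shows "q y c \<cong> q y' c'" "q y d \<cong> q y' d'"
proof -
  obtain y1 c1 d1 where 1: "cuts u y1 c1 d1" "q c1 d1 = bottom_type u" "q y1 c1 = q y c" "q y1 d1 = q y d" "un y1 = un y"
    using cuts_exact[OF assms(1)] .
  obtain y2 c2 d2 where 2: "cuts u y2 c2 d2" "q c2 d2 = bottom_type u" "q y2 c2 = q y' c'" "q y2 d2 = q y' d'" "un y2 = un y'"
    using cuts_exact[OF assms(2)] .
  show "q y c \<cong> q y' c'" "q y d \<cong> q y' d'"
    using cuts_unique_exact[OF 1(1,2) 2(1,2)] 1 2 assms(3) by auto
qed

text \<open>Otherwise add bottom vertices \<open>v\<close> and \<open>w\<close>. If the reversed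
  bottom type is not congruent to the bottom type, then \<open>v\<close> cuts \<open>w, a\<close>;
  either \<open>a\<close> cuts \<open>v, b\<close> with values that contradict uniqueness, or
  reversing a congruence gives a contradiction. If it is congruent to it, \<open>a\<close> cuts both
  \<open>v, b\<close> and \<open>b, v\<close>, with the two values exchanged.\<close>

lemma lower_total:
  assumes ab: "a \<noteq> b" "un a = u" "un b = u"
  shows "lower u a b \<or> lower u b a"
proof (rule ccontr)
  assume "\<not> ?thesis"
  then have n: "\<not> q a b \<cong> bottom_type u" "\<not> q b a \<cong> bottom_type u" using ab by (auto simp: lower_def)
  obtain v where v: "v \<notin> {a, b}" "un v = u" "q v a = bottom_type u" "q v b = bottom_type u"
    using bottom_in[of "{a, b}" a] ab by auto
  obtain w where w: "w \<notin> {v, a}" "un w = u" "q w v = bottom_type u" "q w a = bottom_type u"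
    using bottom_in[of "{v, a}" a] ab v by auto
  have \<rho>: "q b v = q a v" "q v w = q a v" using q_swap v w by metis+
  have lw: "lower u v b" "lower u w a" using v w ab cong_refl by (auto simp: lower_def)
  show False
  proof (cases "q a v \<cong> bottom_type u")
    case False
    have 1: "cuts u v w a" using lw(2) v w \<rho>(2) False by (auto simp: cuts_def)
    show False
    proof (cases "q a v \<cong> q a b")
      case True
      then have "q v a \<cong> q b a" using v ab by (intro cong_swap[of a v a b]) auto
      then show False using n(2) v(3) cong_sym by simp
    next
      case False
      have "cuts u a v b" using lw(1) v ab False by (auto simp: cuts_def)
      then have "q a b \<cong> q v a" using cuts_unique(2)[OF _ 1] ab v(2) by simp
      then show False using n(1) v(3) by simp
    qed
  next
    case True
    have nn: "\<not> q a v \<cong> q a b" using True n(1) cong_sym cong_trans by blast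
    have 1: "cuts u a v b" using lw(1) v ab nn by (auto simp: cuts_def)
    have "lower u b v" using v ab True \<rho>(1) by (auto simp: lower_def)
    moreover have "\<not> q a b \<cong> q a v" using nn cong_sym by blast
    ultimately have "cuts u a b v" using v ab by (auto simp: cuts_def)
    then show False using cuts_unique(1)[OF 1] nn by blast
  qed
qed

text \<open>Both types are realised by the one vertex \<open>x\<close> over \<open>z\<close> and a
  new \<open>w\<close>; \<open>lower_total\<close> orients these two, and \<open>x\<close> separates
  them.\<close>

lemma cut_exists:
  assumes x: "un x = un x'" "un z = un z'" "x \<noteq> z" "x' \<noteq> z'" "\<not> q x z \<cong> q x' z'"
  obtains y c d where "cuts (un z) y c d" "un y = un x" "(q y c = q x z \<and> q y d = q x' z') \<or> (q y c = q x' z' \<and> q y d = q x z)"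
proof -
  obtain w where w: "w \<notin> {z}" "w \<noteq> x" "q x w = q x' z'" "un w = un z'" using ext_pair[OF x(1,4), of "{z}"] by auto
  have "lower (un z) z w \<or> lower (un z) w z" using w x by (intro lower_total) auto
  moreover have "\<not> q x z \<cong> q x w" "\<not> q x w \<cong> q x z" using w x(5) cong_sym by metis+
  ultimately have "cuts (un z) x z w \<or> cuts (un z) x w z" using w x(3) by (auto simp: cuts_def)
  then show ?thesis using that w(3) by metis
qed

text \<open>Two distinct classes are the values of some cut. A third class would yield a cut with
  another pair of values, against \<open>cuts_unique\<close>.\<close>

lemma two_classes:
  assumes un: "un x1 = un x2" "un x2 = un x3" "un z1 = un z2" "un z2 = un z3" and ne: "x1 \<noteq> z1" "x2 \<noteq> z2" "x3 \<noteq> z3"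
  shows "q x1 z1 \<cong> q x2 z2 \<or> q x1 z1 \<cong> q x3 z3 \<or> q x2 z2 \<cong> q x3 z3"
proof (rule ccontr)
  assume n: "\<not> ?thesis"
  obtain y c d where 1: "cuts (un z1) y c d" "un y = un x1" "(q y c = q x1 z1 \<and> q y d = q x2 z2) \<or> (q y c = q x2 z2 \<and> q y d = q x1 z1)"
    by (rule cut_exists[of x1 x2 z1 z2]) (use un ne n in auto)
  obtain y' c' d' where 2: "cuts (un z1) y' c' d'" "un y' = un x1" "(q y' c' = q x1 z1 \<and> q y' d' = q x3 z3) \<or> (q y' c' = q x3 z3 \<and> q y' d' = q x1 z1)"
    by (rule cut_exists[of x1 x3 z1 z3]) (use un ne n in auto)
  have "q y c \<cong> q y' c'" "q y d \<cong> q y' d'" using cuts_unique[OF 1(1) 2(1)] 1(2) 2(2) by auto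
  then show False using 1(3) 2(3) n cong_sym by metis
qed

section \<open>The linear order on the vertices of a block\<close>

definition two :: "'u \<Rightarrow> 'u \<Rightarrow> bool" where
  "two u' u \<longleftrightarrow> (\<exists>x z x' z'. un x = u' \<and> un x' = u' \<and> un z = u \<and> un z' = u \<and> x \<noteq> z \<and> x' \<noteq> z' \<and> \<not> q x z \<cong> q x' z')"

lemma two_sym: "two u u' \<Longrightarrow> two u' u"
  unfolding two_def using cong_swap by metis

lemma not_two: "\<not> two (un x) (un z) \<Longrightarrow> un x' = un x \<Longrightarrow> un z' = un z \<Longrightarrow> x \<noteq> z \<Longrightarrow> x' \<noteq> z' \<Longrightarrow> q x z \<cong> q x' z'"
  unfolding two_def by blast

lemma two_cut:
  assumes "two u' u"
  obtains y c d where "cuts u y c d" "un y = u'"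
proof -
  obtain x z x' z' where x: "un x = u'" "un x' = u'" "un z = u" "un z' = u" "x \<noteq> z" "x' \<noteq> z'" "\<not> q x z \<cong> q x' z'"
    using assms unfolding two_def by blast
  obtain y c d where "cuts (un z) y c d" "un y = un x" by (rule cut_exists[of x x' z z']) (use x in auto)
  then show ?thesis using that x by simp
qed

text \<open>All pairs oriented by \<open>lower\<close> are congruent, so one pair oriented in both
  directions would make all of them so. A cut could then be turned round, which exchanges its two
  classes.\<close>

lemma lower_asym:
  assumes t: "two u' u" and l: "lower u a b"
  shows "\<not> lower u b a"
proof
  assume l': "lower u b a"
  obtain y c d where c: "cuts u y c d" using two_cut[OF t] .
  have cd: "un c = u" "un d = u" "c \<noteq> d" "q c d \<cong> bottom_type u" "y \<notin> {c, d}" "\<not> q y c \<cong> q y d"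
    using c by (auto simp: cuts_def lower_def)
  have ab: "q a b \<cong> bottom_type u" "q b a \<cong> bottom_type u" "a \<noteq> b" using l l' by (auto simp: lower_def)
  have "q c d \<cong> q a b" using cd ab cong_trans cong_sym by blast
  then have "q d c \<cong> q b a" using cd ab by (intro cong_swap[of c d a b]) auto
  then have "q d c \<cong> bottom_type u" using ab cong_trans by blast
  then have "lower u d c" using cd by (auto simp: lower_def)
  moreover have "\<not> q y d \<cong> q y c" using cd cong_sym by blast
  ultimately have "cuts u y d c" using cd by (auto simp: cuts_def)
  then have "q y c \<cong> q y d" using cuts_unique(1)[OF c] by blast
  then show False using cd by blast
qed

text \<open>The class of a cutting vertex over the lower vertex of its cut, so \<open>x\<close>
  counts as lying after \<open>a\<close>. The class over the upper vertex defines
  \<open>bef\<close>. By \<open>cuts_unique\<close> the choice of the cut is immaterial.\<close>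

definition aft :: "'u \<Rightarrow> nat \<Rightarrow> nat \<Rightarrow> bool" where
  "aft u x a \<longleftrightarrow> un a = u \<and> x \<noteq> a \<and> (\<exists>y c d. un y = un x \<and> cuts u y c d \<and> q x a \<cong> q y c)"

definition bef :: "'u \<Rightarrow> nat \<Rightarrow> nat \<Rightarrow> bool" where
  "bef u x a \<longleftrightarrow> un a = u \<and> x \<noteq> a \<and> (\<exists>y c d. un y = un x \<and> cuts u y c d \<and> q x a \<cong> q y d)"

lemma aft_cong: "aft u x a \<Longrightarrow> q x' a' \<cong> q x a \<Longrightarrow> x' \<noteq> a' \<Longrightarrow> aft u x' a'"
  unfolding aft_def using cong_un cong_trans by metis

lemma bef_cong: "bef u x a \<Longrightarrow> q x' a' \<cong> q x a \<Longrightarrow> x' \<noteq> a' \<Longrightarrow> bef u x' a'"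
  unfolding bef_def using cong_un cong_trans by metis

lemma aft_bef: "aft u x a \<Longrightarrow> \<not> bef u x a"
proof
  assume "aft u x a" "bef u x a"
  then obtain y c d y' c' d' where 1: "un y = un x" "cuts u y c d" "q x a \<cong> q y c"
    and 2: "un y' = un x" "cuts u y' c' d'" "q x a \<cong> q y' d'" unfolding aft_def bef_def by blast
  have "q y d \<cong> q y' d'" using cuts_unique(2)[OF 1(2) 2(2)] 1(1) 2(1) by simp
  then have "q y c \<cong> q y d" using 1(3) 2(3) cong_trans cong_sym by blast
  then show False using 1(2) by (simp add: cuts_def)
qed

lemma aft_down:
  assumes "lower u c d" "x \<notin> {c, d}" "aft u x d"
  shows "aft u x c"
proof (cases "q x c \<cong> q x d")
  case True
  then show ?thesis using aft_cong assms by blast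
next
  case False
  then have "cuts u x c d" using assms by (simp add: cuts_def)
  then show ?thesis using assms cong_refl unfolding aft_def lower_def by blast
qed

lemma bef_up:
  assumes "lower u c d" "x \<notin> {c, d}" "bef u x c"
  shows "bef u x d"
proof (cases "q x d \<cong> q x c")
  case True
  then show ?thesis using bef_cong assms by blast
next
  case False
  then have "\<not> q x c \<cong> q x d" using cong_sym by blast
  then have "cuts u x c d" using assms by (simp add: cuts_def)
  then show ?thesis using assms cong_refl unfolding bef_def lower_def by blast
qed

lemma aft_bef_lower:
  assumes "aft u y a" "bef u y b"
  shows "lower u a b"
proof -
  have ab: "un a = u" "un b = u" "y \<noteq> a" "y \<noteq> b" using assms by (auto simp: aft_def bef_def)
  have "a \<noteq> b" using assms aft_bef by blast
  then consider "lower u a b" | "lower u b a" using lower_total ab by blast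
  then show ?thesis
  proof cases
    case 2
    then have "aft u y b" using aft_down[OF 2] ab assms by blast
    then show ?thesis using assms aft_bef by blast
  qed
qed

text \<open>A vertex that is lower than another one separates it from a common bottom vertex and so
  lies before it. Being before is inherited upwards, whence \<open>a\<close> lies before
  \<open>c\<close>; the class of this relation is again the bottom class, so \<open>a\<close> is
  lower than \<open>c\<close>.\<close>

lemma no_cycle:
  assumes t: "two u' u" and l: "lower u a b" "lower u b c" "lower u c a"
  shows False
proof -
  have d: "un a = u" "un b = u" "un c = u" "a \<noteq> b" "b \<noteq> c" "c \<noteq> a" using l by (auto simp: lower_def)
  have cut: "\<exists>w. cuts u x w z" if "lower u x z" for x z
  proof -
    have x: "un x = u" "un z = u" "x \<noteq> z" "q x z \<cong> bottom_type u" using that by (auto simp: lower_def)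
    obtain w where w: "w \<notin> {x, z}" "un w = u" "q w x = bottom_type u" "q w z = bottom_type u" using bottom_in[of "{x, z}" x] x by auto
    have lw: "lower u w x" "lower u w z" using w x cong_refl by (auto simp: lower_def)
    have "\<not> q x w \<cong> q x z"
    proof
      assume "q x w \<cong> q x z"
      then have "q x w \<cong> bottom_type u" using x(4) cong_trans by blast
      then have "lower u x w" using x w by (auto simp: lower_def)
      then show False using lower_asym[OF t lw(1)] by blast
    qed
    then have "cuts u x w z" using lw(2) w x by (auto simp: cuts_def)
    then show ?thesis by blast
  qed
  obtain w where w: "cuts u a w b" using cut[OF l(1)] by blast
  have ab: "q a b \<cong> bottom_type u" using l(1) by (simp add: lower_def)
  have "bef u a b" using w d cong_refl unfolding bef_def by blast
  then have "bef u a c" by (rule bef_up[OF l(2), rotated]) (use d in auto)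
  then obtain y c' d' where y: "un y = un a" "cuts u y c' d'" "q a c \<cong> q y d'" unfolding bef_def by blast
  have "q y d' \<cong> q a b" by (rule cuts_unique(2)[OF y(2) w y(1)])
  then have "q a c \<cong> bottom_type u" using y(3) ab cong_trans by blast
  then have "lower u a c" using d by (auto simp: lower_def)
  then show False using lower_asym[OF t l(3)] by blast
qed

text \<open>\<open>LT u x y\<close>: a vertex of unary type \<open>u\<close> can be inserted between \<open>x\<close> and \<open>y\<close>.\<close>

definition LT :: "'u \<Rightarrow> nat \<Rightarrow> nat \<Rightarrow> bool" where
  "LT u x y \<longleftrightarrow> x \<noteq> y \<and> (\<exists>x' y' a. x' \<noteq> y' \<and> q x' y' \<cong> q x y \<and> bef u x' a \<and> aft u y' a)"

text \<open>Changing the witnessing pair to the type of \<open>x, y\<close> leaves the types over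
  the inserted vertex alone; homogeneity then moves the pair onto \<open>x, y\<close>.\<close>

lemma LT_insert:
  assumes "LT u x y" "finite F"
  obtains a where "a \<notin> F" "bef u x a" "aft u y a"
proof -
  obtain x' y' a where 1: "x \<noteq> y" "x' \<noteq> y'" "q x' y' \<cong> q x y" "bef u x' a" "aft u y' a" using assms unfolding LT_def by blast
  have d: "distinct [x', y', a]" using 1 by (auto simp: aft_def bef_def)
  obtain x1 y1 a1 where 2: "distinct [x1, y1, a1]" "q x1 y1 = q x y" "q a1 x1 = q a x'" "q a1 y1 = q a y'"
    using change_third[OF 1(3) d] by metis
  obtain b where b: "b \<notin> F" "b \<notin> {x, y}" "q b x = q a1 x1" "q b y = q a1 y1"
    by (rule extend_pair[of x1 y1 x y a1 F]) (use 1 2 assms in auto)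
  have "q x b = q x' a" "q y b = q y' a" using b 2 q_swap by metis+
  then have "bef u x b" "aft u y b" using bef_cong[OF 1(4)] aft_cong[OF 1(5)] b(2) cong_refl by auto
  then show ?thesis using that b(1) by blast
qed

text \<open>Vertices inserted for the two directions would be lower than each other.\<close>

lemma LT_asym:
  assumes "two u' u" "LT u x y"
  shows "\<not> LT u y x"
proof
  assume "LT u y x"
  then obtain a where a: "bef u y a" "aft u x a" using LT_insert[of u y x "{}"] by auto
  obtain b where b: "bef u x b" "aft u y b" using LT_insert[OF assms(2), of "{}"] by auto
  have "lower u a b" "lower u b a" using aft_bef_lower a b by blast+
  then show False using lower_asym[OF assms(1)] by blast
qed

lemma bef_ex:
  assumes t: "two u' u" and a: "un a = u" and G: "finite G"
  obtains x where "x \<notin> G" "un x = u'" "bef u x a"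
proof -
  obtain y c d where y: "cuts u y c d" "un y = u'" using two_cut[OF t] .
  have d: "un d = u" "y \<noteq> d" using y(1) by (auto simp: cuts_def lower_def)
  then have "bef u y d" using y cong_refl unfolding bef_def by blast
  obtain x where x: "x \<notin> G" "x \<noteq> a" "q x a = q y d" "un x = un y" using ext_pair[of a d y G] a d G by metis
  then have "bef u x a" using bef_cong[OF \<open>bef u y d\<close>, of x a] cong_refl by simp
  then show ?thesis using that x y by simp
qed

lemma aft_ex:
  assumes t: "two u' u" and a: "un a = u" and G: "finite G"
  obtains x where "x \<notin> G" "un x = u'" "aft u x a"
proof -
  obtain y c d where y: "cuts u y c d" "un y = u'" using two_cut[OF t] .
  have d: "un c = u" "y \<noteq> c" using y(1) by (auto simp: cuts_def lower_def)
  then have "aft u y c" using y cong_refl unfolding aft_def by blast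
  obtain x where x: "x \<notin> G" "x \<noteq> a" "q x a = q y c" "un x = un y" using ext_pair[of a c y G] a d G by metis
  then have "aft u x a" using aft_cong[OF \<open>aft u y c\<close>, of x a] cong_refl by simp
  then show ?thesis using that x y by simp
qed

lemma aft_ex':
  assumes t: "two (un x) u" and G: "finite G"
  obtains a where "a \<notin> G" "aft u x a"
proof -
  obtain y c d where y: "cuts u y c d" "un y = un x" using two_cut[OF t] .
  have d: "un c = u" "y \<noteq> c" using y(1) by (auto simp: cuts_def lower_def)
  then have "aft u y c" using y cong_refl unfolding aft_def by blast
  obtain a where a: "a \<notin> G" "a \<noteq> x" "q x a = q y c" using ext_pair[of x y c G] y d G by metis
  then have "aft u x a" using aft_cong[OF \<open>aft u y c\<close>, of x a] cong_refl by simp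
  then show ?thesis using that a by simp
qed

lemma LT_I: "bef u x a \<Longrightarrow> aft u y a \<Longrightarrow> x \<noteq> y \<Longrightarrow> LT u x y"
  unfolding LT_def using cong_refl by blast

lemma LT_cong: "LT u x y \<Longrightarrow> q x' y' \<cong> q x y \<Longrightarrow> x' \<noteq> y' \<Longrightarrow> LT u x' y'"
  unfolding LT_def using cong_trans cong_sym by blast

lemma LT_both:
  assumes "two u1 u" "two u2 u"
  obtains x y x' y' where "un x = u1" "un y = u2" "LT u x y" "un x' = u1" "un y' = u2" "LT u y' x'"
proof -
  obtain a where a: "un a = u" using assms(1) unfolding two_def by blast
  obtain x where x: "un x = u1" "bef u x a" using bef_ex[OF assms(1) a, of "{}"] by auto
  obtain y where y: "y \<notin> {x}" "un y = u2" "aft u y a" using aft_ex[OF assms(2) a, of "{x}"] by auto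
  obtain x' where x': "un x' = u1" "aft u x' a" using aft_ex[OF assms(1) a, of "{}"] by auto
  obtain y' where y': "y' \<notin> {x'}" "un y' = u2" "bef u y' a" using bef_ex[OF assms(2) a, of "{x'}"] by auto
  show ?thesis by (rule that[of x y x' y']) (use x y x' y' LT_I in auto)
qed

text \<open>There are at most two classes, and one of them is taken by pairs in the opposite
  order.\<close>

lemma LT_same_class:
  assumes t: "two (un x) u" "two (un y) u" and l: "LT u x y" "LT u x' y'" and un: "un x = un x'" "un y = un y'"
  shows "q x y \<cong> q x' y'"
proof -
  obtain z w where z: "un z = un x" "un w = un y" "LT u w z" using LT_both[OF t] by metis
  have ne: "x \<noteq> y" "x' \<noteq> y'" "z \<noteq> w" using l z by (auto simp: LT_def)
  have n: "\<not> q s r \<cong> q z w" if "LT u s r" for s r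
  proof
    assume "q s r \<cong> q z w"
    then have "LT u z w" using LT_cong[OF that] cong_sym ne by blast
    then show False using LT_asym[OF t(1) z(3)] by blast
  qed
  have "un x' = un z" "un y' = un w" using un z(1,2) by metis+
  then show ?thesis using two_classes[OF un(1) _ un(2) _ ne] n[OF l(1)] n[OF l(2)] by blast
qed

lemma LT_total:
  assumes t: "two (un x) u" "two (un y) u" and ne: "x \<noteq> y"
  shows "LT u x y \<or> LT u y x"
proof -
  obtain z w z' w' where z: "un z = un x" "un w = un y" "LT u z w" "un z' = un x" "un w' = un y" "LT u w' z'" using LT_both[OF t] by metis
  have ne': "z \<noteq> w" "z' \<noteq> w'" using z by (auto simp: LT_def)
  have "\<not> q z w \<cong> q z' w'"
  proof
    assume "q z w \<cong> q z' w'"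
    then have "LT u z' w'" using LT_cong[OF z(3)] cong_sym ne' by blast
    then show False using LT_asym[OF t(1) z(6)] by blast
  qed
  moreover have "un x = un z" "un z = un z'" "un y = un w" "un w = un w'" using z by metis+
  ultimately have "q x y \<cong> q z w \<or> q x y \<cong> q z' w'" using two_classes[OF _ _ _ _ ne ne'] by blast
  then show ?thesis
  proof
    assume "q x y \<cong> q z w"
    then show ?thesis using LT_cong[OF z(3)] ne by blast
  next
    assume "q x y \<cong> q z' w'"
    then have "q y x \<cong> q w' z'" using ne ne' by (intro cong_swap[of x y z' w']) auto
    then show ?thesis using LT_cong[OF z(6)] ne by blast
  qed
qed

text \<open>Insert \<open>a\<close> between \<open>x\<close> and \<open>y\<close>, and
  \<open>b\<close> between \<open>y\<close> and \<open>z\<close>; then \<open>a\<close> is lower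
  than \<open>b\<close>. A vertex inserted between \<open>z\<close> and \<open>x\<close> would close
  a cycle with them.\<close>

lemma LT_trans:
  assumes t: "two (un x) u" "two (un z) u" and l: "LT u x y" "LT u y z"
  shows "LT u x z"
proof -
  obtain a where a: "bef u x a" "aft u y a" using LT_insert[OF l(1), of "{}"] by auto
  obtain b where b: "bef u y b" "aft u z b" using LT_insert[OF l(2), of "{}"] by auto
  have ab: "lower u a b" using aft_bef_lower a b by blast
  have "x \<noteq> z"
  proof
    assume "x = z"
    then have "lower u b a" using aft_bef_lower a b by blast
    then show False using lower_asym[OF t(1) ab] by blast
  qed
  moreover have "\<not> LT u z x"
  proof
    assume "LT u z x"
    then obtain c where c: "bef u z c" "aft u x c" using LT_insert[of u z x "{}"] by auto
    have "lower u b c" "lower u c a" using aft_bef_lower a b c by blast+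
    then show False using no_cycle[OF t(1) ab] by blast
  qed
  ultimately show ?thesis using LT_total[OF t] by blast
qed

text \<open>Each \<open>x\<close> in question lies after some vertex of unary type \<open>u\<close>.
  A bottom vertex \<open>b\<close> below all of these still has every such \<open>x\<close> after
  it, and a \<open>v\<close> before \<open>b\<close> is as required.\<close>

lemma LT_bottom:
  assumes F: "finite F" and t: "two u' u"
  obtains v where "v \<notin> F" "un v = u'" "\<And>x. x \<in> F \<Longrightarrow> two (un x) u \<Longrightarrow> LT u v x"
proof -
  obtain x0 where x0: "un x0 = u" using t unfolding two_def by blast
  have "\<exists>a. two (un x) u \<longrightarrow> aft u x a" for x using aft_ex'[of x u "{}"] by auto
  then obtain a where a: "\<And>x. two (un x) u \<Longrightarrow> aft u x (a x)" by metis
  obtain b where b: "b \<notin> F \<union> a ` F" "un b = u" "\<forall>x \<in> F \<union> a ` F. un x = u \<longrightarrow> q b x = bottom_type u"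
    using bottom_in[of "F \<union> a ` F" x0] F x0 by auto
  obtain v where v: "v \<notin> F" "un v = u'" "bef u v b" using bef_ex[OF t b(2) F] .
  have "LT u v x" if x: "x \<in> F" "two (un x) u" for x
  proof -
    have ax: "un (a x) = u" using a[OF x(2)] by (simp add: aft_def)
    then have "lower u b (a x)" using b x cong_refl by (auto simp: lower_def)
    moreover have "x \<notin> {b, a x}" using a[OF x(2)] b(1) x(1) by (auto simp: aft_def)
    ultimately have "aft u x b" using aft_down a[OF x(2)] by blast
    moreover have "v \<noteq> x" using v(1) x(1) by auto
    ultimately show ?thesis using LT_I v(3) by blast
  qed
  then show ?thesis using that v by blast
qed

text \<open>Both orders occur between the unary types \<open>u1\<close> and \<open>u2\<close>, and
  the order of a pair depends only on its class.\<close>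

lemma two_trans:
  assumes "two u1 u" "two u2 u"
  shows "two u1 u2"
proof -
  obtain x y x' y' where l: "un x = u1" "un y = u2" "LT u x y" "un x' = u1" "un y' = u2" "LT u y' x'"
    using LT_both[OF assms] .
  have ne: "x \<noteq> y" "x' \<noteq> y'" using l by (auto simp: LT_def)
  have "\<not> q x y \<cong> q x' y'"
  proof
    assume "q x y \<cong> q x' y'"
    then have "LT u x' y'" using LT_cong[OF l(3)] cong_sym ne by blast
    then show False using LT_asym[OF assms(1) l(6)] by blast
  qed
  then show ?thesis unfolding two_def using l ne by blast
qed

text \<open>Blocks of unary types, numbered from 1; block 0 collects the types that form no block.\<close>

definition blk :: "'u \<Rightarrow> nat" where
  "blk u = (if \<exists>n. two (un n) u then Suc (LEAST n. two (un n) u) else 0)"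

definition rep :: "'u \<Rightarrow> 'u" where
  "rep u = un (LEAST n. two (un n) u)"

text \<open>Inserting vertices of one fixed unary type per block yields a single order for all
  vertices of the block.\<close>

definition lt :: "nat \<Rightarrow> nat \<Rightarrow> bool" where
  "lt x y \<longleftrightarrow> LT (rep (un x)) x y"

lemma blk_rep:
  assumes "blk u \<noteq> 0"
  shows "two (rep u) u" "two u (rep u)" "blk u = Suc (LEAST n. two (un n) u)"
proof -
  have "\<exists>n. two (un n) u" using assms by (auto simp: blk_def split: if_splits)
  then show "two (rep u) u" unfolding rep_def by (rule LeastI_ex)
  then show "two u (rep u)" by (rule two_sym)
  show "blk u = Suc (LEAST n. two (un n) u)" using \<open>\<exists>n. two (un n) u\<close> by (simp add: blk_def)
qed

lemma two_blk:
  assumes "two u u'"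
  shows "blk u = blk u'" "blk u \<noteq> 0" "rep u = rep u'"
proof -
  have eq: "two (un n) u \<longleftrightarrow> two (un n) u'" for n using assms two_trans two_sym by blast
  then show "blk u = blk u'" "rep u = rep u'" by (simp_all add: blk_def rep_def)
  obtain n where "un n = u'" using assms unfolding two_def by blast
  then have "two (un n) u" using two_sym[OF assms] by simp
  then show "blk u \<noteq> 0" by (auto simp: blk_def)
qed

lemma blk_two:
  assumes "blk u = blk u'" "blk u \<noteq> 0"
  shows "two u u'" "rep u = rep u'"
proof -
  have "rep u = rep u'" using blk_rep(3)[of u] blk_rep(3)[of u'] assms by (simp add: rep_def)
  then show "two u u'" using blk_rep(1,2)[of u] blk_rep(1,2)[of u'] assms two_trans two_sym by metis
  then show "rep u = rep u'" by (rule two_blk(3))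
qed

lemma lt_facts:
  assumes b: "blk (un x) = blk (un y)" "blk (un x) \<noteq> 0"
  shows "x \<noteq> y \<Longrightarrow> lt x y \<or> lt y x" "lt x y \<Longrightarrow> \<not> lt y x" "lt x y \<Longrightarrow> x \<noteq> y"
    "blk (un z) = blk (un x) \<Longrightarrow> lt x y \<Longrightarrow> lt y z \<Longrightarrow> lt x z"
    "q x' y' \<cong> q x y \<Longrightarrow> x' \<noteq> y' \<Longrightarrow> lt x y \<Longrightarrow> lt x' y'"
    "un x' = un x \<Longrightarrow> un y' = un y \<Longrightarrow> lt x y \<Longrightarrow> lt x' y' \<Longrightarrow> q x y \<cong> q x' y'"
proof -
  have r: "rep (un x) = rep (un y)" using blk_two(2)[OF b] .
  have t: "two (un x) (rep (un x))" "two (un y) (rep (un x))" using blk_rep(2)[of "un x"] blk_rep(2)[of "un y"] b r by auto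
  show "x \<noteq> y \<Longrightarrow> lt x y \<or> lt y x" using LT_total[OF t] r by (simp add: lt_def)
  show "lt x y \<Longrightarrow> \<not> lt y x" using LT_asym[OF t(1)] r by (simp add: lt_def)
  show "lt x y \<Longrightarrow> x \<noteq> y" by (auto simp: lt_def LT_def)
  show "lt x z" if "blk (un z) = blk (un x)" "lt x y" "lt y z"
  proof -
    have "rep (un z) = rep (un x)" using blk_two(2)[of "un z" "un x"] that b by simp
    then have "two (un z) (rep (un x))" using blk_rep(2)[of "un z"] that b by simp
    then show ?thesis using LT_trans[OF t(1)] that r by (simp add: lt_def)
  qed
  show "lt x' y'" if "q x' y' \<cong> q x y" "x' \<noteq> y'" "lt x y"
  proof -
    have "un x' = un x" using cong_un that by blast
    then show ?thesis using LT_cong that by (simp add: lt_def)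
  qed
  show "un x' = un x \<Longrightarrow> un y' = un y \<Longrightarrow> lt x y \<Longrightarrow> lt x' y' \<Longrightarrow> q x y \<cong> q x' y'"
    using LT_same_class[OF t] by (simp add: lt_def)
qed

text \<open>At first only the block orders are realised. They already determine the class of every
  pair, whereupon \<open>cong_realise\<close> makes all types exact at once.\<close>

lemma realise:
  fixes r :: "'v \<Rightarrow> nat"
  assumes V: "finite V" and r: "inj_on r V" and c: "\<And>x. x \<in> V \<Longrightarrow> c x \<in> range un"
    and \<tau>: "\<And>x y. x \<in> V \<Longrightarrow> y \<in> V \<Longrightarrow> r x < r y \<Longrightarrow> \<exists>p s. p \<noteq> s \<and> un p = c x \<and> un s = c y \<and>
      (blk (c x) = blk (c y) \<longrightarrow> blk (c x) \<noteq> 0 \<longrightarrow> lt p s) \<and> \<tau> x y = q p s \<and> \<tau> y x = q s p"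
  shows "\<exists>f. inj_on f V \<and> (\<forall>x \<in> V. un (f x) = c x) \<and> (\<forall>x \<in> V. \<forall>y \<in> V. x \<noteq> y \<longrightarrow> q (f x) (f y) = \<tau> x y)"
proof -
  \<comment> \<open>The ranks are negated because this induction adds an element of largest value,
    whereas \<open>LT_bottom\<close> can place new vertices only at the bottom.\<close>
  have "\<exists>f. inj_on f V \<and> (\<forall>x \<in> V. un (f x) = c x) \<and>
      (\<forall>x \<in> V. \<forall>y \<in> V. r x < r y \<longrightarrow> blk (c x) = blk (c y) \<longrightarrow> blk (c x) \<noteq> 0 \<longrightarrow> lt (f x) (f y))"
    using V r c
  proof (induction V rule: finite_ranking_induct[where f = "\<lambda>x. - int (r x)"])
    case empty
    then show ?case by simp
  next
    case (insert m S)
    show ?case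
    proof (cases "m \<in> S")
      case True
      then show ?thesis using insert by (simp add: insert_absorb)
    next
      case m: False
      obtain f where f: "inj_on f S" "\<forall>x \<in> S. un (f x) = c x"
        "\<forall>x \<in> S. \<forall>y \<in> S. r x < r y \<longrightarrow> blk (c x) = blk (c y) \<longrightarrow> blk (c x) \<noteq> 0 \<longrightarrow> lt (f x) (f y)"
        using insert.IH insert.prems by (auto simp: inj_on_def)
      have min: "r m \<le> r y" if "y \<in> S" for y using insert.hyps(2)[OF that] by simp
      have fin: "finite (f ` S)" using insert.hyps by simp
      obtain p where p: "un p = c m" using insert.prems(2)[of m] by auto
      have "\<exists>v. v \<notin> f ` S \<and> un v = c m \<and> (\<forall>y \<in> S. blk (c m) = blk (c y) \<longrightarrow> blk (c m) \<noteq> 0 \<longrightarrow> lt v (f y))"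
      proof (cases "blk (c m) = 0")
        case True
        then show ?thesis using bottom_in[OF fin, of p] p by auto
      next
        case False
        obtain v where v: "v \<notin> f ` S" "un v = c m" "\<And>x. x \<in> f ` S \<Longrightarrow> two (un x) (rep (c m)) \<Longrightarrow> LT (rep (c m)) v x"
          using LT_bottom[OF fin blk_rep(2)[OF False]] by blast
        have "lt v (f y)" if "y \<in> S" "blk (c m) = blk (c y)" for y
        proof -
          have "two (c y) (rep (c m))" using blk_two(2)[of "c m" "c y"] blk_rep(2)[of "c y"] that False by simp
          then show ?thesis using v(2,3) f(2) that(1) by (simp add: lt_def)
        qed
        then show ?thesis using v by blast
      qed
      then obtain v where v: "v \<notin> f ` S" "un v = c m" "\<forall>y \<in> S. blk (c m) = blk (c y) \<longrightarrow> blk (c m) \<noteq> 0 \<longrightarrow> lt v (f y)" by blast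
      let ?f = "f(m := v)"
      have e: "?f y = f y" if "y \<in> S" for y using that m by auto
      have "inj_on ?f (insert m S)"
      proof -
        have "inj_on ?f S" using f(1) m by (simp add: inj_on_fun_updI v(1))
        moreover have "?f m \<notin> ?f ` (S - {m})" using v(1) e by force
        ultimately show ?thesis by simp
      qed
      moreover have "\<forall>x \<in> insert m S. un (?f x) = c x" using f(2) v(2) e by auto
      moreover have "lt (?f x) (?f y)" if "x \<in> insert m S" "y \<in> insert m S" "r x < r y" "blk (c x) = blk (c y)" "blk (c x) \<noteq> 0" for x y
      proof -
        have y: "y \<in> S" using that min[of x] by (cases "x = m") auto
        show ?thesis
        proof (cases "x = m")
          case True
          then show ?thesis using v(3) y e[OF y] that by simp
        next
          case False
          then have "x \<in> S" using that by simp
          then show ?thesis using f(3) y e that by simp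
        qed
      qed
      ultimately show ?thesis by blast
    qed
  qed
  then obtain f where f: "inj_on f V" "\<forall>x \<in> V. un (f x) = c x"
    "\<And>x y. x \<in> V \<Longrightarrow> y \<in> V \<Longrightarrow> r x < r y \<Longrightarrow> blk (c x) = blk (c y) \<Longrightarrow> blk (c x) \<noteq> 0 \<Longrightarrow> lt (f x) (f y)" by blast
  have fne: "f x \<noteq> f y" if "x \<in> V" "y \<in> V" "x \<noteq> y" for x y using f(1) that by (auto simp: inj_on_def)
  have cl: "q (f x) (f y) \<cong> \<tau> x y \<and> (\<exists>a b. a \<noteq> b \<and> \<tau> x y = q a b \<and> \<tau> y x = q b a)" if xy: "x \<in> V" "y \<in> V" "r x < r y" for x y
  proof -
    obtain p s where p: "p \<noteq> s" "un p = c x" "un s = c y" "blk (c x) = blk (c y) \<longrightarrow> blk (c x) \<noteq> 0 \<longrightarrow> lt p s"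
      "\<tau> x y = q p s" "\<tau> y x = q s p" using \<tau>[OF xy] by blast
    have ne: "f x \<noteq> f y" using fne[OF xy(1,2)] xy(3) by auto
    \<comment> \<open>Where there are two classes, both unary types lie in one block and the order
      fixes the class; otherwise there is only one class.\<close>
    have "q (f x) (f y) \<cong> q p s"
    proof (cases "two (c x) (c y)")
      case True
      note tb = two_blk[OF True]
      show ?thesis
        by (rule lt_facts(6)) (use tb f(2) xy p f(3)[OF xy tb(1,2)] in simp_all)
    next
      case False
      then show ?thesis using not_two[of "f x" "f y" p s] f(2) xy p ne by simp
    qed
    then show ?thesis using p by auto
  qed
  have rr: "r x < r y \<or> r y < r x" if "x \<in> V" "y \<in> V" "x \<noteq> y" for x y
    using r that by (metis inj_onD linorder_neqE_nat)
  have tau: "\<exists>a b. a \<noteq> b \<and> \<tau> x y = q a b \<and> \<tau> y x = q b a" if "x \<in> V" "y \<in> V" "x \<noteq> y" for x y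
    using rr[OF that] cl[of x y] cl[of y x] that by metis
  have "q (f x) (f y) \<cong> \<tau> x y" if xy: "x \<in> V" "y \<in> V" "x \<noteq> y" for x y
    using rr[OF xy]
  proof
    assume "r x < r y"
    then show ?thesis using cl xy by blast
  next
    assume l: "r y < r x"
    obtain a b where ab: "a \<noteq> b" "\<tau> x y = q a b" "\<tau> y x = q b a" using tau[OF xy] by blast
    have "q (f y) (f x) \<cong> q b a" using cl[OF xy(2,1) l] ab by simp
    then have "q (f x) (f y) \<cong> q a b" using ab fne[of y x] xy by (intro cong_swap[of "f y" "f x" b a]) auto
    then show ?thesis using ab by simp
  qed
  from cong_realise[OF V f(1) this tau]
  obtain g where "inj_on g V" "\<forall>x \<in> V. un (g x) = un (f x)" "\<forall>x \<in> V. \<forall>y \<in> V. x \<noteq> y \<longrightarrow> q (g x) (g y) = \<tau> x y" by blast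
  then show ?thesis using f(2) by metis
qed

end

section \<open>The Hales-Jewett theorem and the product Ramsey theorem\<close>

text \<open>\<open>None\<close> marks the variable coordinates of a combinatorial line.\<close>

definition inst :: "'a option list \<Rightarrow> 'a \<Rightarrow> 'a list" where
  "inst p a = map (case_option a id) p"

definition line :: "'a set \<Rightarrow> nat \<Rightarrow> 'a option list \<Rightarrow> bool" where
  "line \<Sigma> n p \<longleftrightarrow> length p = n \<and> None \<in> set p \<and> set p \<subseteq> insert None (Some ` \<Sigma>)"

definition mono_line :: "'a set \<Rightarrow> nat \<Rightarrow> ('a list \<Rightarrow> nat) \<Rightarrow> bool" where
  "mono_line \<Sigma> n \<chi> \<longleftrightarrow> (\<exists>p c. line \<Sigma> n p \<and> (\<forall>a \<in> \<Sigma>. \<chi> (inst p a) = c))"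

lemma inst_append: "inst (p @ p') a = inst p a @ inst p' a"
  by (simp add: inst_def)

lemma inst_Some: "inst (map Some w) a = w"
  by (induction w) (auto simp: inst_def)

lemma inst_in_lists: "line \<Sigma> n p \<Longrightarrow> a \<in> \<Sigma>' \<Longrightarrow> \<Sigma> \<subseteq> \<Sigma>' \<Longrightarrow> set (inst p a) \<subseteq> \<Sigma>' \<and> length (inst p a) = n"
  unfolding inst_def line_def by (fastforce split: option.splits)

lemma line_append_const:
  "line \<Sigma> n p \<Longrightarrow> length w = m \<Longrightarrow> set w \<subseteq> \<Sigma> \<Longrightarrow> line \<Sigma> (n + m) (p @ map Some w)"
  "line \<Sigma> n p \<Longrightarrow> length w = m \<Longrightarrow> set w \<subseteq> \<Sigma> \<Longrightarrow> line \<Sigma> (m + n) (map Some w @ p)"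
  by (auto simp: line_def)

lemma line_append: "line \<Sigma> n p \<Longrightarrow> line \<Sigma> m p' \<Longrightarrow> line \<Sigma> (n + m) (p @ p')"
  by (auto simp: line_def)

lemma line_mono: "line \<Sigma> n p \<Longrightarrow> \<Sigma> \<subseteq> \<Sigma>' \<Longrightarrow> line \<Sigma>' n p"
  unfolding line_def by blast

text \<open>Colourings of a finite set are used as the colours of another colouring; this numbers
  them.\<close>

lemma finite_fun_code:
  assumes "finite W"
  shows "\<exists>m e. (\<forall>f. (\<forall>w. f w < l) \<longrightarrow> e f < (m::nat)) \<and>
    (\<forall>f g. (\<forall>w. f w < l) \<longrightarrow> (\<forall>w. g w < (l::nat)) \<longrightarrow> e f = e g \<longrightarrow> (\<forall>w \<in> W. f w = g w))"
proof -
  have fin: "finite (W \<rightarrow>\<^sub>E {..<l})"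
    using assms by (intro finite_PiE) auto
  obtain h n where h: "h ` (W \<rightarrow>\<^sub>E {..<l}) = {i. i < (n::nat)}" "inj_on h (W \<rightarrow>\<^sub>E {..<l})"
    using finite_imp_inj_to_nat_seg[OF fin] by metis
  have "h (restrict f W) < n" if "\<forall>w. f w < l" for f
  proof -
    have "restrict f W \<in> W \<rightarrow>\<^sub>E {..<l}" using that by auto
    then show ?thesis using h by blast
  qed
  moreover have "f w = g w" if fg: "\<forall>w. f w < l" "\<forall>w. g w < l" "h (restrict f W) = h (restrict g W)" "w \<in> W" for f g w
  proof -
    have "restrict f W \<in> W \<rightarrow>\<^sub>E {..<l}" "restrict g W \<in> W \<rightarrow>\<^sub>E {..<l}" using fg by auto
    with fg h have "restrict f W = restrict g W" by (meson inj_onD)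
    with fg(4) show "f w = g w" by (metis restrict_apply')
  qed
  ultimately show ?thesis by (intro exI[of _ n] exI[of _ "\<lambda>f. h (restrict f W)"]) blast
qed

text \<open>Colour focusing, by induction on the alphabet. Unless a monochromatic line exists
  already, one finds more and more lines that are monochromatic over the smaller alphabet, have
  distinct colours, and meet in one word at the new letter \<open>z\<close>.\<close>

theorem hales_jewett:
  fixes \<Sigma> :: "'a set"
  assumes "finite \<Sigma>"
  shows "\<exists>n. \<forall>\<chi>. (\<forall>w. \<chi> w < l) \<longrightarrow> mono_line \<Sigma> n \<chi>"
  using assms
proof (induction \<Sigma> arbitrary: l rule: finite_induct)
  case empty
  have "mono_line {} 1 \<chi>" for \<chi> :: "'a list \<Rightarrow> nat"
    by (auto simp: mono_line_def line_def intro!: exI[of _ "[None]"])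
  then show ?case by blast
next
  case (insert z \<Sigma>')
  let ?\<Sigma> = "insert z \<Sigma>'"
  show ?case
  proof (cases "\<Sigma>' = {}")
    case True
    have "mono_line ?\<Sigma> 1 \<chi>" for \<chi> :: "'a list \<Rightarrow> nat"
      using True by (auto simp: mono_line_def line_def intro!: exI[of _ "[None]"])
    then show ?thesis by blast
  next
    case False
    then obtain a0 where a0: "a0 \<in> \<Sigma>'" by auto
    define foc where "foc n \<chi> s \<longleftrightarrow> (\<exists>p c w. length w = n \<and> set w \<subseteq> ?\<Sigma> \<and> inj_on c {..<s} \<and>
      (\<forall>i<s. line ?\<Sigma> n (p i) \<and> inst (p i) z = w \<and> (\<forall>a \<in> \<Sigma>'. \<chi> (inst (p i) a) = c i)))"
      for n :: nat and \<chi> :: "'a list \<Rightarrow> nat" and s :: nat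
    have foc: "\<exists>n. \<forall>\<chi>. (\<forall>w. \<chi> w < l) \<longrightarrow> mono_line ?\<Sigma> n \<chi> \<or> foc n \<chi> s" for s
    proof (induction s)
      case 0
      show ?case by (intro exI[of _ 0]) (auto simp: foc_def)
    next
      case (Suc s)
      then obtain n1 where n1: "\<And>\<chi>. (\<forall>w. \<chi> w < l) \<Longrightarrow> mono_line ?\<Sigma> n1 \<chi> \<or> foc n1 \<chi> s"
        by blast
      define W where "W = {w. set w \<subseteq> ?\<Sigma> \<and> length w = n1}"
      have "finite W" unfolding W_def using insert.hyps(1) by (intro finite_lists_length_eq) auto
      then obtain m :: nat and e where e: "\<forall>f. (\<forall>w. f w < l) \<longrightarrow> e f < m"
        "\<forall>f g. (\<forall>w. f w < l) \<longrightarrow> (\<forall>w. g w < l) \<longrightarrow> e f = e g \<longrightarrow> (\<forall>w \<in> W. f w = g w)"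
        using finite_fun_code[of W l] by auto
      \<comment> \<open>A tail of length \<open>n2\<close> is coloured by the colouring it induces
        on the heads of length \<open>n1\<close>. A monochromatic line of tails makes the colours of
        the heads independent of the letter from \<open>\<Sigma>'\<close>.\<close>
      obtain n2 where n2: "\<And>\<chi>. (\<forall>w. \<chi> w < m) \<Longrightarrow> mono_line \<Sigma>' n2 \<chi>"
        using insert.IH[of m] by blast
      have "mono_line ?\<Sigma> (n1 + n2) \<chi> \<or> foc (n1 + n2) \<chi> (Suc s)" if \<chi>: "\<And>w. \<chi> w < l" for \<chi>
      proof -
        have "mono_line \<Sigma>' n2 (\<lambda>u. e (\<lambda>w. \<chi> (w @ u)))"
          using e(1) \<chi> by (intro n2) simp
        then obtain p2 c2 where p2: "line \<Sigma>' n2 p2" "\<And>a. a \<in> \<Sigma>' \<Longrightarrow> e (\<lambda>w. \<chi> (w @ inst p2 a)) = c2"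
          by (auto simp: mono_line_def)
        define \<chi>1 where "\<chi>1 w = \<chi> (w @ inst p2 a0)" for w
        have \<chi>1: "\<chi> (w @ inst p2 a) = \<chi>1 w" if "w \<in> W" "a \<in> \<Sigma>'" for w a
          unfolding \<chi>1_def
          using e(2)[rule_format, of "\<lambda>w. \<chi> (w @ inst p2 a)" "\<lambda>w. \<chi> (w @ inst p2 a0)" w] p2(2) a0 that \<chi> by simp
        have p2': "line ?\<Sigma> n2 p2" using p2(1) by (rule line_mono) auto
        have mono: "mono_line ?\<Sigma> (n1 + n2) \<chi>" if "line ?\<Sigma> n1 p" "\<And>a. a \<in> ?\<Sigma> \<Longrightarrow> \<chi>1 (inst p a) = c" for p c
        proof -
          have "set (inst p2 a0) \<subseteq> ?\<Sigma>" "length (inst p2 a0) = n2"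
            using inst_in_lists[OF p2', of a0 ?\<Sigma>] a0 by auto
          then have "line ?\<Sigma> (n1 + n2) (p @ map Some (inst p2 a0))"
            using that(1) by (intro line_append_const) auto
          moreover have "\<chi> (inst (p @ map Some (inst p2 a0)) a) = c" if "a \<in> ?\<Sigma>" for a
            using \<open>\<And>a. a \<in> ?\<Sigma> \<Longrightarrow> \<chi>1 (inst p a) = c\<close>[OF that]
            by (simp add: inst_append inst_Some \<chi>1_def)
          ultimately show ?thesis unfolding mono_line_def by blast
        qed
        consider "mono_line ?\<Sigma> n1 \<chi>1" | "foc n1 \<chi>1 s"
          using n1[of \<chi>1] \<chi> by (auto simp: \<chi>1_def)
        then show ?thesis
        proof cases
          case 1
          then show ?thesis using mono by (auto simp: mono_line_def)
        next
          case 2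
          then obtain p c w where p: "length w = n1" "set w \<subseteq> ?\<Sigma>" "inj_on c {..<s}"
            "\<And>i. i < s \<Longrightarrow> line ?\<Sigma> n1 (p i)" "\<And>i. i < s \<Longrightarrow> inst (p i) z = w"
            "\<And>i a. i < s \<Longrightarrow> a \<in> \<Sigma>' \<Longrightarrow> \<chi>1 (inst (p i) a) = c i"
            unfolding foc_def by blast
          show ?thesis
          proof (cases "\<exists>i<s. c i = \<chi>1 w")
            case True
            then obtain i where "i < s" "c i = \<chi>1 w" by blast
            then have "mono_line ?\<Sigma> (n1 + n2) \<chi>"
              by (intro mono[of "p i" "c i"]) (use p in auto)
            then show ?thesis by simp
          next
            case False
            \<comment> \<open>The old lines now move together with the tail; the new line keeps its
              head at the old focus and takes the colour of that focus, which differs from the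
              others.\<close>
            define p' where "p' i = (if i < s then p i @ p2 else map Some w @ p2)" for i
            define c' where "c' i = (if i < s then c i else \<chi>1 w)" for i
            have wW: "w \<in> W" using p by (auto simp: W_def)
            have "inj_on c' {..<Suc s}"
              using False p(3) by (auto simp: inj_on_def c'_def less_Suc_eq)
            moreover have "line ?\<Sigma> (n1 + n2) (p' i)" if "i < Suc s" for i
              using p(1,2,4) p2' that unfolding p'_def
              by (auto intro: line_append line_append_const)
            moreover have "inst (p' i) z = w @ inst p2 z" if "i < Suc s" for i
              using p(5) that by (auto simp: p'_def inst_append inst_Some)
            moreover have "\<chi> (inst (p' i) a) = c' i" if "i < Suc s" "a \<in> \<Sigma>'" for i a
            proof (cases "i < s")
              case True
              have "inst (p i) a \<in> W"
                using inst_in_lists[OF p(4)[OF True], of a ?\<Sigma>] that by (auto simp: W_def)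
              then show ?thesis using True p(6) that \<chi>1 by (auto simp: p'_def c'_def inst_append)
            next
              case False
              then show ?thesis using \<chi>1[OF wW] that by (auto simp: p'_def c'_def inst_append inst_Some)
            qed
            moreover have "length (w @ inst p2 z) = n1 + n2" "set (w @ inst p2 z) \<subseteq> ?\<Sigma>"
              using inst_in_lists[OF p2', of z ?\<Sigma>] p by auto
            ultimately have "foc (n1 + n2) \<chi> (Suc s)"
              unfolding foc_def by blast
            then show ?thesis by simp
          qed
        qed
      qed
      then show ?case by blast
    qed
    obtain n where n: "\<And>\<chi>. (\<forall>w. \<chi> w < l) \<Longrightarrow> mono_line ?\<Sigma> n \<chi> \<or> foc n \<chi> l"
      using foc[of l] by blast
    have "mono_line ?\<Sigma> n \<chi>" if \<chi>: "\<And>w. \<chi> w < l" for \<chi>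
    proof (rule ccontr)
      assume no: "\<not> mono_line ?\<Sigma> n \<chi>"
      with n \<chi> have "foc n \<chi> l" by blast
      then obtain p c w where p: "inj_on c {..<l}"
        "\<And>i. i < l \<Longrightarrow> line ?\<Sigma> n (p i)" "\<And>i. i < l \<Longrightarrow> inst (p i) z = w"
        "\<And>i a. i < l \<Longrightarrow> a \<in> \<Sigma>' \<Longrightarrow> \<chi> (inst (p i) a) = c i"
        unfolding foc_def by blast
      \<comment> \<open>With \<open>l\<close> distinct colours on the lines, the colour of the focus
        is among them, and that line is monochromatic over the whole alphabet.\<close>
      have "c ` {..<l} \<subseteq> {..<l}" using p(4) a0 \<chi> by (metis image_subsetI lessThan_iff)
      then have "c ` {..<l} = {..<l}"
        using p(1) by (simp add: card_image card_subset_eq)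
      moreover have "\<chi> w < l" using \<chi> .
      ultimately obtain i where i: "i < l" "c i = \<chi> w" by (metis imageE lessThan_iff)
      then have "\<forall>a\<in>?\<Sigma>. \<chi> (inst (p i) a) = c i" using p(3,4) by auto
      then show False using no p(2)[OF i(1)] by (auto simp: mono_line_def)
    qed
    then show ?thesis by blast
  qed
qed

section \<open>The finite Ramsey theorem and its product form\<close>

lemma ramsey_colours:
  "\<exists>N::nat. \<forall>f. (\<forall>S. f S < l) \<longrightarrow> (\<exists>H \<in> nsets {..<N} n. \<exists>c. \<forall>S \<in> nsets H k. f S = (c::nat))"
proof -
  obtain N :: nat where N: "partn_lst {..<N} (replicate l n) k" using ramsey_full by blast
  have "\<exists>H \<in> nsets {..<N} n. \<exists>c. \<forall>S \<in> nsets H k. f S = c" if "\<And>S. f S < l" for f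
  proof -
    have "f \<in> nsets {..<N} k \<rightarrow> {..<length (replicate l n)}" using that by auto
    then obtain i where i: "i < l" "monochromatic {..<N} (replicate l n ! i) k f i"
      using N by (auto simp: partn_lst_def)
    then obtain H where H: "H \<in> nsets {..<N} n" "f ` nsets H k \<subseteq> {i}"
      by (auto simp: monochromatic_def)
    then have "\<forall>S \<in> nsets H k. f S = i" by blast
    with H(1) show ?thesis by blast
  qed
  then show ?thesis by (intro exI[of _ N]) simp
qed

text \<open>Ramsey's theorem is applied in the second coordinate with the whole function of the
  first coordinate as colour; what remains is a colouring in the first coordinate alone.\<close>

lemma product_ramsey:
  "\<exists>N::nat. \<forall>f. (\<forall>S S'. f S S' < l) \<longrightarrow>
     (\<exists>H \<in> nsets {..<N} n. \<exists>H' \<in> nsets {..<N} n. \<exists>c. \<forall>S \<in> nsets H k. \<forall>S' \<in> nsets H' k. f S S' = (c::nat))"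
proof -
  obtain N1 :: nat where N1: "\<And>f. (\<forall>S. f S < l) \<Longrightarrow> \<exists>H \<in> nsets {..<N1} n. \<exists>c. \<forall>S \<in> nsets H k. f S = c"
    using ramsey_colours[of l n k] by blast
  have "finite (nsets {..<N1} k)" by (rule finite_imp_finite_nsets) simp
  then obtain m :: nat and e where e: "\<forall>f. (\<forall>w. f w < l) \<longrightarrow> e f < m"
    "\<forall>f g. (\<forall>w. f w < l) \<longrightarrow> (\<forall>w. g w < l) \<longrightarrow> e f = e g \<longrightarrow> (\<forall>w \<in> nsets {..<N1} k. f w = g w)"
    using finite_fun_code[of "nsets {..<N1} k" l] by auto
  obtain N2 :: nat where N2: "\<And>f. (\<forall>S. f S < m) \<Longrightarrow> \<exists>H \<in> nsets {..<N2} n. \<exists>c. \<forall>S \<in> nsets H k. f S = c"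
    using ramsey_colours[of m n k] by blast
  let ?N = "max N1 N2"
  have "\<exists>H \<in> nsets {..<?N} n. \<exists>H' \<in> nsets {..<?N} n. \<exists>c. \<forall>S \<in> nsets H k. \<forall>S' \<in> nsets H' k. f S S' = c"
    if f: "\<And>S S'. f S S' < l" for f
  proof -
    have "\<forall>S'. e (\<lambda>S. f S S') < m" using e(1) f by simp
    then obtain H' c' where H': "H' \<in> nsets {..<N2} n" "\<And>S'. S' \<in> nsets H' k \<Longrightarrow> e (\<lambda>S. f S S') = c'"
      using N2[of "\<lambda>S'. e (\<lambda>S. f S S')"] by metis
    \<comment> \<open>Without \<open>k\<close>-subsets of \<open>H'\<close> the value is arbitrary,
      but it must be a colour below \<open>l\<close>.\<close>
    define g where "g S = (if nsets H' k = {} then f S {} else f S (SOME S'. S' \<in> nsets H' k))" for S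
    have g: "f S S' = g S" if "S \<in> nsets {..<N1} k" "S' \<in> nsets H' k" for S S'
    proof -
      let ?S = "SOME S'. S' \<in> nsets H' k"
      have "?S \<in> nsets H' k" using that(2) by (rule someI)
      then have "f S S' = f S ?S"
        using e(2)[rule_format, of "\<lambda>S. f S S'" "\<lambda>S. f S ?S" S] f H'(2) that by simp
      then show ?thesis using that by (auto simp: g_def)
    qed
    have "\<forall>S. g S < l" using f by (simp add: g_def)
    then obtain H c where H: "H \<in> nsets {..<N1} n" "\<And>S. S \<in> nsets H k \<Longrightarrow> g S = c"
      using N1[of g] by blast
    have "H \<subseteq> {..<N1}" using H(1) by (auto simp: nsets_def)
    then have "\<forall>S \<in> nsets H k. \<forall>S' \<in> nsets H' k. f S S' = c"
      using g H(2) nsets_mono by (metis subsetD)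
    moreover have "H \<in> nsets {..<?N} n" "H' \<in> nsets {..<?N} n"
      using H(1) H'(1) by (auto simp: nsets_def)
    ultimately show ?thesis by blast
  qed
  then show ?thesis by blast
qed

section \<open>The partite construction\<close>

record ('o, 't) psys =
  vs :: "nat set"
  so :: "nat \<Rightarrow> 'o"
  ed :: "nat \<Rightarrow> nat \<Rightarrow> 't"

text \<open>\<open>k\<close> and \<open>\<alpha>\<close> describe the structure whose copies are
  coloured. Edges count only from a smaller to a larger sort, and then have to be admissible for the
  two sorts.\<close>

locale partite =
  fixes Srt :: "'o set" and lt :: "'o \<Rightarrow> 'o \<Rightarrow> bool" and adm :: "'o \<Rightarrow> 'o \<Rightarrow> 't set"
    and k :: nat and \<alpha> :: "nat \<Rightarrow> nat \<Rightarrow> 't"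
  assumes irrefl: "\<not> lt a a"
    and adm_ne: "a \<in> Srt \<Longrightarrow> b \<in> Srt \<Longrightarrow> lt a b \<Longrightarrow> adm a b \<noteq> {}"
begin

definition system :: "('o, 't) psys \<Rightarrow> bool" where
  "system P \<longleftrightarrow> finite (vs P) \<and> so P ` vs P \<subseteq> Srt \<and>
     (\<forall>x \<in> vs P. \<forall>y \<in> vs P. lt (so P x) (so P y) \<longrightarrow> ed P x y \<in> adm (so P x) (so P y))"

definition emb :: "(nat \<Rightarrow> nat) \<Rightarrow> ('o, 't) psys \<Rightarrow> ('o, 't) psys \<Rightarrow> bool" where
  "emb g P P' \<longleftrightarrow> inj_on g (vs P) \<and> g ` vs P \<subseteq> vs P' \<and> (\<forall>x \<in> vs P. so P' (g x) = so P x) \<and>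
     (\<forall>x \<in> vs P. \<forall>y \<in> vs P. lt (so P x) (so P y) \<longrightarrow> ed P' (g x) (g y) = ed P x y)"

definition copies_along :: "('o, 't) psys \<Rightarrow> (nat \<Rightarrow> 'o) \<Rightarrow> nat list set" where
  "copies_along P s = {xs. length xs = k \<and> set xs \<subseteq> vs P \<and> (\<forall>r<k. so P (xs ! r) = s r) \<and>
     (\<forall>r<k. \<forall>r'<k. lt (s r) (s r') \<longrightarrow> ed P (xs ! r) (xs ! r') = \<alpha> r r')}"

definition dflt :: "'o \<Rightarrow> 'o \<Rightarrow> 't" where
  "dflt a b = (SOME t. t \<in> adm a b)"

lemma dflt: "a \<in> Srt \<Longrightarrow> b \<in> Srt \<Longrightarrow> lt a b \<Longrightarrow> dflt a b \<in> adm a b"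
  using adm_ne unfolding dflt_def by (metis ex_in_conv someI)

lemma emb_comp: "emb g P P' \<Longrightarrow> emb g' P' P'' \<Longrightarrow> emb (g' \<circ> g) P P''"
  unfolding emb_def
  by (auto simp: image_subset_iff intro: comp_inj_on inj_on_subset)

lemma copies_along_emb:
  assumes "emb g P P'" "xs \<in> copies_along P s"
  shows "map g xs \<in> copies_along P' s"
proof -
  have "xs ! r \<in> vs P" if "r < k" for r
    using assms(2) that by (auto simp: copies_along_def subset_iff)
  then show ?thesis
    using assms by (auto simp: copies_along_def emb_def)
qed

lemma finite_copies: "finite (vs P) \<Longrightarrow> finite (copies_along P s)"
  by (rule finite_subset[OF _ finite_lists_length_eq[of "vs P" k]]) (auto simp: copies_along_def)

text \<open>The partite lemma: the letters are the copies along \<open>s\<close>, and a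
  combinatorial line embeds the part of \<open>P\<close> in the sorts of \<open>s\<close> so that
  its copies are the instances of the line. The rest of \<open>P\<close> is added separately over
  every line.\<close>

lemma partite_step:
  assumes P: "system P" and s: "inj_on s {..<k}" and l: "0 < (l::nat)"
  shows "\<exists>P'. system P' \<and> (\<forall>\<chi>. (\<forall>xs. \<chi> xs < l) \<longrightarrow>
    (\<exists>g. emb g P P' \<and> (\<exists>c. \<forall>xs \<in> copies_along P s. \<chi> (map g xs) = c)))"
proof (cases "copies_along P s = {}")
  case True
  have "emb id P P" by (auto simp: emb_def)
  then show ?thesis using P True by (intro exI[of _ P]) auto
next
  case False
  define \<Sigma> where "\<Sigma> = copies_along P s"
  define Ps where "Ps = {v \<in> vs P. so P v \<in> s ` {..<k}}"
  define ix where "ix o' = the_inv_into {..<k} s o'" for o'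
  have ix: "ix (s r) = r" if "r < k" for r
    unfolding ix_def using s that by (intro the_inv_into_f_f) auto
  have finS: "finite \<Sigma>" using P by (auto simp: \<Sigma>_def system_def intro: finite_copies)
  obtain n where n: "\<And>\<chi>. (\<forall>w. \<chi> w < l) \<Longrightarrow> mono_line \<Sigma> n \<chi>"
    using hales_jewett[OF finS, of l] by blast
  define L where "L = {p. line \<Sigma> n p}"
  \<comment> \<open>The word of a vertex \<open>v\<close> along the line \<open>p\<close>: a
    constant coordinate gives the vertex of that letter in the sort of \<open>v\<close>, a variable
    coordinate gives \<open>v\<close>. Hence \<open>unlin\<close> recovers \<open>v\<close> from any
    variable coordinate.\<close>
  define lin where "lin p v = map (case_option v (\<lambda>a. a ! ix (so P v))) p"
    for p :: "nat list option list" and v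
  define unlin where "unlin p ws = (ws :: nat list) ! (SOME i. i < length p \<and> p ! i = None)"
    for p :: "nat list option list" and ws
  define D where "D = {ws. length ws = n \<and> ws \<noteq> [] \<and> (\<exists>r<k. \<forall>w \<in> set ws. w \<in> vs P \<and> so P w = s r)}"
  \<comment> \<open>Along a line the constant coordinates show \<open>\<alpha>\<close>, so a
    coordinate with a different edge is a variable one and shows the edge of the original pair. If
    there is none, the original edge is \<open>\<alpha>\<close> as well.\<close>
  define edD where "edD ws ws' = (let a = \<alpha> (ix (so P (hd ws))) (ix (so P (hd ws'))) in
      case find (\<lambda>(x, y). ed P x y \<noteq> a) (zip ws ws') of Some (x, y) \<Rightarrow> ed P x y | None \<Rightarrow> a)"
    for ws ws' :: "nat list"
  define ent :: "nat list + nat list option list \<times> nat \<Rightarrow> nat" where "ent = to_nat"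
  have ent: "inj ent" by (simp add: ent_def)
  define dec where "dec = inv ent"
  have dec[simp]: "dec (ent x) = x" for x using ent by (simp add: dec_def)
  \<comment> \<open>Words inside a single sort of \<open>s\<close>, shared by all lines, and for
    each line its own copy of the vertices in other sorts.\<close>
  define V where "V = Inl ` D \<union> Inr ` (L \<times> (vs P - Ps))"
  define so' where "so' v = (case v of Inl ws \<Rightarrow> so P (hd ws) | Inr (p, x) \<Rightarrow> so P x)"
    for v :: "nat list + nat list option list \<times> nat"
  define ed' where "ed' v v' = (case v of
       Inl ws \<Rightarrow> (case v' of Inl ws' \<Rightarrow> edD ws ws'
          | Inr (p, x) \<Rightarrow> if unlin p ws \<in> Ps \<and> lin p (unlin p ws) = ws then ed P (unlin p ws) x
                        else dflt (so P (hd ws)) (so P x))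
     | Inr (p, x) \<Rightarrow> (case v' of Inl ws \<Rightarrow> if unlin p ws \<in> Ps \<and> lin p (unlin p ws) = ws then ed P x (unlin p ws)
                        else dflt (so P x) (so P (hd ws))
          | Inr (p', x') \<Rightarrow> if p = p' then ed P x x' else dflt (so P x) (so P x')))"
    for v v' :: "nat list + nat list option list \<times> nat"
  define P' where "P' = \<lparr>vs = ent ` V, so = so' \<circ> dec, ed = (\<lambda>v v'. ed' (dec v) (dec v'))\<rparr>"
  have letter: "a ! r \<in> vs P" "so P (a ! r) = s r" if "a \<in> \<Sigma>" "r < k" for a r
    using that by (auto simp: \<Sigma>_def copies_along_def subset_iff)
  have letter_ed: "ed P (a ! r) (a ! r') = \<alpha> r r'" if "a \<in> \<Sigma>" "r < k" "r' < k" "lt (s r) (s r')" for a r r'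
    using that by (auto simp: \<Sigma>_def copies_along_def)
  have Lp: "None \<in> set p" "length p = n" "\<And>a. Some a \<in> set p \<Longrightarrow> a \<in> \<Sigma>" if "p \<in> L" for p
    using that unfolding L_def line_def by auto
  have lin_mem: "lin p v \<in> D \<and> hd (lin p v) \<in> vs P \<and> so P (hd (lin p v)) = so P v" if pv: "p \<in> L" "v \<in> Ps" for p v
  proof -
    obtain r where r: "r < k" "so P v = s r" "v \<in> vs P" using pv by (auto simp: Ps_def)
    have "w \<in> vs P \<and> so P w = s r" if w: "w \<in> set (lin p v)" for w
    proof -
      obtain z where z: "z \<in> set p" "w = case_option v (\<lambda>a. a ! ix (so P v)) z"
        using w by (auto simp: lin_def)
      show ?thesis
      proof (cases z)
        case None
        then show ?thesis using z r by simp
      next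
        case (Some a)
        then have "a \<in> \<Sigma>" using z Lp(3)[OF pv(1)] by simp
        then show ?thesis using Some z r letter ix by simp
      qed
    qed
    moreover have "lin p v \<noteq> []" using Lp(1)[OF pv(1)] by (auto simp: lin_def)
    moreover have "length (lin p v) = n" using Lp(2)[OF pv(1)] by (simp add: lin_def)
    ultimately show ?thesis using r by (auto simp: D_def)
  qed
  have unlin: "unlin p (lin p v) = v" if "p \<in> L" for p v
  proof -
    have "\<exists>i. i < length p \<and> p ! i = None" using Lp(1)[OF that] by (metis in_set_conv_nth)
    then have "(SOME i. i < length p \<and> p ! i = None) < length p \<and> p ! (SOME i. i < length p \<and> p ! i = None) = None"
      by (rule someI_ex)
    then show ?thesis by (simp add: unlin_def lin_def)
  qed
  have lin_ed: "edD (lin p x) (lin p y) = ed P x y"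
    if pxy: "p \<in> L" "x \<in> Ps" "y \<in> Ps" "lt (so P x) (so P y)" for p x y
  proof -
    obtain r r' where r: "r < k" "so P x = s r" "r' < k" "so P y = s r'" using pxy by (auto simp: Ps_def)
    have hd: "so P (hd (lin p x)) = s r" "so P (hd (lin p y)) = s r'"
      using lin_mem[OF pxy(1,2)] lin_mem[OF pxy(1,3)] r by auto
    have pairs: "(u, v) = (x, y) \<or> ed P u v = \<alpha> r r'" if uv: "(u, v) \<in> set (zip (lin p x) (lin p y))" for u v
    proof -
      obtain i where i: "i < n" "u = lin p x ! i" "v = lin p y ! i"
        using uv Lp(2)[OF \<open>p \<in> L\<close>] by (auto simp: in_set_zip lin_def)
      show ?thesis
      proof (cases "p ! i")
        case None
        then show ?thesis using i Lp(2)[OF \<open>p \<in> L\<close>] by (simp add: lin_def)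
      next
        case (Some a)
        then have "a \<in> \<Sigma>" using i Lp[OF \<open>p \<in> L\<close>] by (metis nth_mem)
        then have "ed P (a ! r) (a ! r') = \<alpha> r r'" using letter_ed r pxy by auto
        then show ?thesis using i Lp(2)[OF \<open>p \<in> L\<close>] Some r ix by (simp add: lin_def)
      qed
    qed
    have mem: "(x, y) \<in> set (zip (lin p x) (lin p y))"
    proof -
      obtain i where "i < n" "p ! i = None" using Lp[OF \<open>p \<in> L\<close>] by (metis in_set_conv_nth)
      then show ?thesis using Lp(2)[OF \<open>p \<in> L\<close>] by (auto simp: in_set_zip lin_def intro!: exI[of _ i])
    qed
    show ?thesis
    proof (cases "find (\<lambda>(u, v). ed P u v \<noteq> \<alpha> r r') (zip (lin p x) (lin p y))")
      case None
      then have "ed P x y = \<alpha> r r'" using mem by (auto simp: find_None_iff)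
      then show ?thesis using None hd r ix by (simp add: edD_def Let_def)
    next
      case (Some uv)
      then obtain u v where uv: "uv = (u, v)" by fastforce
      then have "(u, v) \<in> set (zip (lin p x) (lin p y))" "ed P u v \<noteq> \<alpha> r r'"
        using Some by (auto simp: find_Some_iff set_zip)
      then have "(u, v) = (x, y)" using pairs by blast
      then show ?thesis using Some hd r ix uv by (simp add: edD_def Let_def)
    qed
  qed
  have adP: "ed P x y \<in> adm (so P x) (so P y)" if "x \<in> vs P" "y \<in> vs P" "lt (so P x) (so P y)" for x y
    using P that by (auto simp: system_def)
  have D_hd: "hd ws \<in> vs P \<and> so P (hd ws) \<in> s ` {..<k} \<and> (\<forall>w \<in> set ws. w \<in> vs P \<and> so P w = so P (hd ws))"
    if "ws \<in> D" for ws
    using that by (cases ws) (auto simp: D_def)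
  have edD_adm: "edD ws ws' \<in> adm (so P (hd ws)) (so P (hd ws'))"
    if D: "ws \<in> D" "ws' \<in> D" "lt (so P (hd ws)) (so P (hd ws'))" for ws ws'
  proof -
    obtain r r' where r: "r < k" "so P (hd ws) = s r" "r' < k" "so P (hd ws') = s r'"
      using D_hd[OF D(1)] D_hd[OF D(2)] by auto
    obtain a where a: "a \<in> \<Sigma>" using False by (auto simp: \<Sigma>_def)
    have "\<alpha> r r' \<in> adm (s r) (s r')"
      using adP[of "a ! r" "a ! r'"] letter[OF a r(1)] letter[OF a r(3)] letter_ed[OF a r(1,3)] D(3) r by simp
    moreover have "ed P u v \<in> adm (s r) (s r')" if "(u, v) \<in> set (zip ws ws')" for u v
    proof -
      have "u \<in> set ws" "v \<in> set ws'" using that by (auto dest: set_zip_leftD set_zip_rightD)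
      then have "u \<in> vs P" "v \<in> vs P" "so P u = s r" "so P v = s r'"
        using D_hd[OF D(1)] D_hd[OF D(2)] r by auto
      then show ?thesis using adP[of u v] D(3) r by simp
    qed
    moreover have "uv \<in> set (zip ws ws')" if "find Q (zip ws ws') = Some uv" for Q uv
      using that by (auto simp: find_Some_iff) (metis length_zip min_less_iff_conj nth_mem nth_zip)
    ultimately show ?thesis
      using r ix by (auto simp: edD_def Let_def split: option.splits prod.splits)
  qed
  have sys: "system P'"
  proof -
    have "finite D"
      by (rule finite_subset[OF _ finite_lists_length_eq[of "vs P" n]])
         (use P in \<open>auto simp: D_def system_def\<close>)
    moreover have "finite L"
      by (rule finite_subset[OF _ finite_lists_length_eq[of "insert None (Some ` \<Sigma>)" n]])
         (use finS in \<open>auto simp: L_def line_def\<close>)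
    ultimately have "finite V" using P by (auto simp: V_def system_def)
    moreover have sO: "so' v \<in> Srt" if "v \<in> V" for v
      using that P D_hd by (auto simp: V_def so'_def system_def)
    moreover have "ed' v v' \<in> adm (so' v) (so' v')" if v: "v \<in> V" "v' \<in> V" "lt (so' v) (so' v')" for v v'
    proof -
      have df: "dflt (so' v) (so' v') \<in> adm (so' v) (so' v')" using sO v by (auto intro: dflt)
      have un: "unlin p ws \<in> vs P \<and> so P (hd ws) = so P (unlin p ws)"
        if "p \<in> L" "unlin p ws \<in> Ps" "lin p (unlin p ws) = ws" for p ws
        using lin_mem[OF that(1,2)] that by (auto simp: Ps_def)
      show ?thesis
      proof (cases v)
        case (Inl ws)
        show ?thesis
        proof (cases v')
          case (Inl ws')
          then show ?thesis using \<open>v = Inl ws\<close> v edD_adm by (auto simp: V_def so'_def ed'_def)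
        next
          case (Inr px)
          then obtain p x where px: "v' = Inr (p, x)" by (cases px) auto
          then have "p \<in> L" "x \<in> vs P" using v by (auto simp: V_def)
          then show ?thesis using \<open>v = Inl ws\<close> px v un[of p ws] df adP by (auto simp: so'_def ed'_def)
        qed
      next
        case (Inr px)
        then obtain p x where px: "v = Inr (p, x)" by (cases px) auto
        then have pL: "p \<in> L" "x \<in> vs P" using v by (auto simp: V_def)
        show ?thesis
        proof (cases v')
          case (Inl ws)
          then show ?thesis using px pL v un[of p ws] df adP by (auto simp: so'_def ed'_def)
        next
          case (Inr px')
          then obtain p' x' where px': "v' = Inr (p', x')" by (cases px') auto
          then have "x' \<in> vs P" using v by (auto simp: V_def)
          then show ?thesis using px px' pL v df adP by (auto simp: so'_def ed'_def)
        qed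
      qed
    qed
    ultimately show ?thesis by (auto simp: system_def P'_def)
  qed
  have "\<exists>g. emb g P P' \<and> (\<exists>c. \<forall>xs \<in> copies_along P s. \<chi> (map g xs) = c)"
    if \<chi>: "\<forall>xs. \<chi> xs < l" for \<chi>
  proof -
    define col where "col w r = map (\<lambda>b. b ! r) w" for w :: "nat list list" and r :: nat
    have "mono_line \<Sigma> n (\<lambda>w. \<chi> (map (\<lambda>r. ent (Inl (col w r))) [0..<k]))"
      using \<chi> by (intro n) auto
    then obtain p c where p: "p \<in> L"
      "\<And>a. a \<in> \<Sigma> \<Longrightarrow> \<chi> (map (\<lambda>r. ent (Inl (col (inst p a) r))) [0..<k]) = c"
      by (auto simp: mono_line_def L_def)
    define g where "g v = ent (if v \<in> Ps then Inl (lin p v) else Inr (p, v))" for v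
    have so_g: "so P' (g v) = so P v" if "v \<in> vs P" for v
      using lin_mem[OF p(1), of v] by (auto simp: g_def P'_def so'_def)
    have "inj_on g (vs P)"
    proof (rule inj_onI)
      fix x y assume "g x = g y"
      then have "dec (g x) = dec (g y)" by simp
      then have "(if x \<in> Ps then Inl (lin p x) else Inr (p, x)) = (if y \<in> Ps then Inl (lin p y) else Inr (p, y))"
        by (simp only: g_def dec)
      then have "lin p x = lin p y \<or> x = y" by (simp split: if_splits)
      then show "x = y" using unlin[OF p(1)] by metis
    qed
    moreover have "g ` vs P \<subseteq> vs P'"
      using lin_mem[OF p(1)] p(1) by (auto simp: g_def P'_def V_def)
    moreover have "ed P' (g x) (g y) = ed P x y" if "x \<in> vs P" "y \<in> vs P" "lt (so P x) (so P y)" for x y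
      using that lin_ed[OF p(1), of x y] unlin[OF p(1)] by (auto simp: g_def P'_def ed'_def)
    ultimately have "emb g P P'" using so_g by (auto simp: emb_def)
    moreover have "\<chi> (map g xs) = c" if xs: "xs \<in> copies_along P s" for xs
    proof -
      have xk: "length xs = k" using xs by (auto simp: copies_along_def)
      have "g (xs ! r) = ent (Inl (col (inst p xs) r))" if "r < k" for r
      proof -
        have r: "xs ! r \<in> vs P" "so P (xs ! r) = s r" using letter xs that by (auto simp: \<Sigma>_def)
        then have "xs ! r \<in> Ps" using that by (auto simp: Ps_def)
        moreover have "lin p (xs ! r) = col (inst p xs) r"
          using r ix that by (auto simp: lin_def col_def inst_def split: option.splits)
        ultimately show ?thesis by (simp add: g_def)
      qed
      then have "map g xs = map (\<lambda>r. ent (Inl (col (inst p xs) r))) [0..<k]"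
        using xk by (auto intro!: nth_equalityI)
      then show ?thesis using p(2) xs by (simp add: \<Sigma>_def)
    qed
    ultimately show ?thesis by blast
  qed
  with sys show ?thesis by blast
qed

text \<open>Each step makes the colour constant along one further sort pattern. Copies go to copies
  along the same pattern under embeddings, so pulling the colouring back preserves what the other
  steps provide.\<close>

lemma partite_construction:
  assumes "system P" and "\<forall>s \<in> set ss. inj_on s {..<k}" and "0 < (l::nat)"
  shows "\<exists>P'. system P' \<and> (\<forall>\<chi>. (\<forall>xs. \<chi> xs < l) \<longrightarrow>
    (\<exists>g. emb g P P' \<and> (\<forall>s \<in> set ss. \<exists>c. \<forall>xs \<in> copies_along P s. \<chi> (map g xs) = c)))"
  using assms(2)
proof (induction ss)
  case Nil
  have "emb id P P" by (auto simp: emb_def)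
  then show ?case using assms(1) by auto
next
  case (Cons s ss)
  then obtain P1 where P1: "system P1" "\<And>\<chi>. (\<forall>xs. \<chi> xs < l) \<Longrightarrow>
    \<exists>g. emb g P P1 \<and> (\<forall>s \<in> set ss. \<exists>c. \<forall>xs \<in> copies_along P s. \<chi> (map g xs) = c)"
    by auto
  obtain P2 where P2: "system P2" "\<And>\<chi>. (\<forall>xs. \<chi> xs < l) \<Longrightarrow>
    \<exists>g. emb g P1 P2 \<and> (\<exists>c. \<forall>xs \<in> copies_along P1 s. \<chi> (map g xs) = c)"
    using partite_step[OF P1(1) _ assms(3), of s] Cons.prems by auto
  have "\<exists>g. emb g P P2 \<and> (\<forall>s \<in> set (s # ss). \<exists>c. \<forall>xs \<in> copies_along P s. \<chi> (map g xs) = c)"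
    if \<chi>: "\<forall>xs. \<chi> xs < l" for \<chi>
  proof -
    obtain g2 c2 where g2: "emb g2 P1 P2" "\<And>xs. xs \<in> copies_along P1 s \<Longrightarrow> \<chi> (map g2 xs) = c2"
      using P2(2)[OF \<chi>] by auto
    have "\<forall>xs. \<chi> (map g2 xs) < l" using \<chi> by blast
    then obtain g1 where g1: "emb g1 P P1"
      "\<And>s. s \<in> set ss \<Longrightarrow> \<exists>c. \<forall>xs \<in> copies_along P s. \<chi> (map g2 (map g1 xs)) = c"
      using P1(2)[of "\<lambda>xs. \<chi> (map g2 xs)"] by blast
    have "\<forall>xs \<in> copies_along P s. \<chi> (map (g2 \<circ> g1) xs) = c2"
      using g2(2) copies_along_emb[OF g1(1)] by (metis map_map)
    then show ?thesis
      using emb_comp[OF g1(1) g2(1)] g1(2) by (intro exI[of _ "g2 \<circ> g1"]) auto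
  qed
  with P2(1) show ?case by blast
qed

end

lemma sorted_list_of_set_image:
  fixes f :: "nat \<Rightarrow> nat"
  assumes "strict_mono_on {..<k} f"
  shows "sorted_list_of_set (f ` {..<k}) = map f [0..<k]"
proof -
  have "sorted_wrt (<) (map f [0..<k])"
    using assms by (auto simp: sorted_wrt_iff_nth_less strict_mono_on_def)
  then have "sorted (map f [0..<k])" "distinct (map f [0..<k])"
    by (auto simp: strict_sorted_iff)
  then have "sorted_list_of_set (set (map f [0..<k])) = map f [0..<k]"
    by (rule sorted_list_of_set.idem_if_sorted_distinct)
  then show ?thesis by (simp add: atLeast0LessThan)
qed

text \<open>An embedding of structures with two linear orders: the first order is that of the
  indices, the second is given by the ranks \<open>rA\<close> and \<open>rB\<close>.\<close>

definition occurrence where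
  "occurrence k n uA rA \<alpha>A uB rB \<alpha>B \<rho> \<longleftrightarrow> strict_mono_on {..<k} \<rho> \<and> \<rho> ` {..<k} \<subseteq> {..<n} \<and>
     (\<forall>i<k. uB (\<rho> i) = uA i) \<and>
     (\<forall>i<k. \<forall>j<k. rA i < rA j \<longrightarrow> rB (\<rho> i) < rB (\<rho> j) \<and> \<alpha>B (\<rho> i) (\<rho> j) = \<alpha>A i j)"
  for k n :: nat and rA rB \<rho> :: "nat \<Rightarrow> nat"

text \<open>\<open>fst (so x)\<close> is a grid point: the edges follow the order of the first coordinates, while the
  enumeration of \<open>A\<close> and \<open>B\<close> follows the second.\<close>

lemma structural_ramsey:
  fixes uA uB :: "nat \<Rightarrow> 'u" and rA rB :: "nat \<Rightarrow> nat" and \<alpha>A \<alpha>B :: "nat \<Rightarrow> nat \<Rightarrow> 't"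
    and adm :: "'u \<Rightarrow> 'u \<Rightarrow> 't set" and l :: nat
  assumes l: "0 < l" and ne: "\<And>a b. a \<in> U \<Longrightarrow> b \<in> U \<Longrightarrow> adm a b \<noteq> {}"
    and uB: "\<And>r. r < n \<Longrightarrow> uB r \<in> U" and rB: "bij_betw rB {..<n} {..<n}" and rA: "bij_betw rA {..<k} {..<k}"
    and \<alpha>B: "\<And>r r'. r < n \<Longrightarrow> r' < n \<Longrightarrow> rB r < rB r' \<Longrightarrow> \<alpha>B r r' \<in> adm (uB r) (uB r')"
  shows "\<exists>(V :: nat set) (so :: nat \<Rightarrow> (nat \<times> nat) \<times> 'u) ed. finite V \<and> (\<forall>x \<in> V. snd (so x) \<in> U) \<and>
     (\<forall>x \<in> V. \<forall>y \<in> V. fst (fst (so x)) < fst (fst (so y)) \<longrightarrow> ed x y \<in> adm (snd (so x)) (snd (so y))) \<and>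
     (\<forall>\<chi>. (\<forall>xs. \<chi> xs < l) \<longrightarrow> (\<exists>y::nat \<Rightarrow> nat. inj_on y {..<n} \<and> y ` {..<n} \<subseteq> V \<and>
        (\<forall>r<n. snd (so (y r)) = uB r) \<and>
        (\<forall>r<n. \<forall>r'<n. (r < r' \<longrightarrow> snd (fst (so (y r))) < snd (fst (so (y r')))) \<and>
           (rB r < rB r' \<longrightarrow> fst (fst (so (y r))) < fst (fst (so (y r'))) \<and> ed (y r) (y r') = \<alpha>B r r')) \<and>
        (\<exists>c. \<forall>\<rho>. occurrence k n uA rA \<alpha>A uB rB \<alpha>B \<rho> \<longrightarrow> \<chi> (map (\<lambda>i. y (\<rho> i)) [0..<k]) = c)))"
proof -
  obtain N :: nat where N: "\<And>f. (\<forall>S S'. f S S' < l) \<Longrightarrow>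
     \<exists>H \<in> nsets {..<N} n. \<exists>H' \<in> nsets {..<N} n. \<exists>c. \<forall>S \<in> nsets H k. \<forall>S' \<in> nsets H' k. f S S' = (c::nat)"
    using product_ramsey[of l n k] by blast
  define lt where "lt a b \<longleftrightarrow> fst (fst a) < fst (fst b)" for a b :: "(nat \<times> nat) \<times> 'u"
  interpret partite "UNIV \<times> U" lt "\<lambda>a b. adm (snd a) (snd b)" k \<alpha>A
    by unfold_locales (auto simp: lt_def ne)
  define sl where "sl = (sorted_list_of_set :: nat set \<Rightarrow> nat list)"
  define Hs where "Hs = sl ` nsets {..<N} n"
  have Hs: "length h = n" "\<And>i j. i < j \<Longrightarrow> j < n \<Longrightarrow> h ! i < h ! j" if "h \<in> Hs" for h
  proof -
    obtain H where "H \<in> nsets {..<N} n" "h = sl H" using \<open>h \<in> Hs\<close> by (auto simp: Hs_def)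
    then have H: "card H = n" "finite H" by (auto simp: nsets_def)
    then show "length h = n" using \<open>h = sl H\<close> by (simp add: sl_def)
    show "h ! i < h ! j" if "i < j" "j < n" for i j
      using \<open>h = sl H\<close> that H strict_sorted_list_of_set[of H]
      by (simp add: sl_def sorted_wrt_iff_nth_less)
  qed
  have Hs_iff: "h ! i < h ! j \<longleftrightarrow> i < j" if "h \<in> Hs" "i < n" "j < n" for h i j
    using Hs(2)[OF that(1)] that by (metis linorder_neqE_nat order_less_asym less_irrefl_nat)
  define bs where "bs h h' r = ((h ! rB r, h' ! r), uB r)" for h h' :: "nat list" and r
  \<comment> \<open>The disjoint union of one copy of \<open>B\<close> for each pair of
    \<open>n\<close>-subsets of the two axes. The rank of a vertex chooses its first coordinate, its
    index the second.\<close>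
  define P where "P = \<lparr>vs = to_nat ` (Hs \<times> Hs \<times> {..<n}),
     so = (\<lambda>v. case from_nat v of (h, h', r) \<Rightarrow> bs h h' r),
     ed = (\<lambda>v w. case from_nat v of (h, h', r) \<Rightarrow> case from_nat w of (g, g', r') \<Rightarrow>
        if h = g \<and> h' = g' then \<alpha>B r r' else dflt (bs h h' r) (bs g g' r'))\<rparr>"
  have fin_ns: "finite (nsets {..<N} m)" for m by (rule finite_imp_finite_nsets) simp
  have rB_lt: "rB r < n" if "r < n" for r using rB that by (auto simp: bij_betw_def)
  have "system P"
  proof -
    have "finite (vs P)" using fin_ns by (auto simp: P_def Hs_def)
    moreover have "so P ` vs P \<subseteq> UNIV \<times> U" using uB by (auto simp: P_def bs_def)
    moreover have "ed P x y \<in> adm (snd (so P x)) (snd (so P y))"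
      if xy: "x \<in> vs P" "y \<in> vs P" "lt (so P x) (so P y)" for x y
    proof -
      obtain h h' r where x: "h \<in> Hs" "h' \<in> Hs" "r < n" "x = to_nat (h, h', r)" using xy by (auto simp: P_def)
      obtain g g' r' where y: "g \<in> Hs" "g' \<in> Hs" "r' < n" "y = to_nat (g, g', r')" using xy by (auto simp: P_def)
      show ?thesis
      proof (cases "h = g \<and> h' = g'")
        case True
        have "h ! rB r < h ! rB r'" using xy(3) x(4) y(4) True by (simp add: P_def lt_def bs_def)
        then have "rB r < rB r'" using Hs_iff[OF x(1) rB_lt[OF x(3)] rB_lt[OF y(3)]] by simp
        then show ?thesis using True x(3,4) y(3,4) \<alpha>B by (simp add: P_def bs_def)
      next
        case False
        have "dflt (bs h h' r) (bs g g' r') \<in> adm (snd (bs h h' r)) (snd (bs g g' r'))"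
          using dflt[of "bs h h' r" "bs g g' r'"] xy(3) x(3,4) y(3,4) uB by (simp add: P_def bs_def)
        then show ?thesis using False x(4) y(4) by (auto simp: P_def)
      qed
    qed
    ultimately show ?thesis unfolding system_def by blast
  qed
  \<comment> \<open>The sort patterns that copies of \<open>A\<close> can have, one for each pair of
    \<open>k\<close>-subsets of the axes.\<close>
  define ssf where "ssf S S' i = ((sl S ! rA i, sl S' ! i), uA i)" for S S' i
  have fin_ss: "finite ((\<lambda>(S, S'). ssf S S') ` (nsets {..<N} k \<times> nsets {..<N} k))"
    by (intro finite_imageI finite_cartesian_product fin_ns)
  obtain ss where ss: "set ss = (\<lambda>(S, S'). ssf S S') ` (nsets {..<N} k \<times> nsets {..<N} k)"
    by (rule exE[OF finite_list[OF fin_ss]])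
  have "inj_on s {..<k}" if s: "s \<in> set ss" for s
  proof -
    obtain S S' where S: "s = ssf S S'" "S' \<in> nsets {..<N} k" using s unfolding ss by auto
    then have "distinct (sl S')" "length (sl S') = k" by (auto simp: sl_def nsets_def)
    then show ?thesis using S by (auto simp: inj_on_def ssf_def nth_eq_iff_index_eq)
  qed
  then obtain P' where P': "system P'" "\<And>\<chi>. (\<forall>xs. \<chi> xs < l) \<Longrightarrow>
    (\<exists>g. emb g P P' \<and> (\<forall>s \<in> set ss. \<exists>c. \<forall>xs \<in> copies_along P s. \<chi> (map g xs) = c))"
    using partite_construction[OF \<open>system P\<close> _ l, of ss] by blast
  have "\<exists>y::nat \<Rightarrow> nat. inj_on y {..<n} \<and> y ` {..<n} \<subseteq> vs P' \<and>
        (\<forall>r<n. snd (so P' (y r)) = uB r) \<and>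
        (\<forall>r<n. \<forall>r'<n. (r < r' \<longrightarrow> snd (fst (so P' (y r))) < snd (fst (so P' (y r')))) \<and>
           (rB r < rB r' \<longrightarrow> fst (fst (so P' (y r))) < fst (fst (so P' (y r'))) \<and> ed P' (y r) (y r') = \<alpha>B r r')) \<and>
        (\<exists>c. \<forall>\<rho>. occurrence k n uA rA \<alpha>A uB rB \<alpha>B \<rho> \<longrightarrow> \<chi> (map (\<lambda>i. y (\<rho> i)) [0..<k]) = c)"
    if \<chi>: "\<forall>xs. \<chi> xs < l" for \<chi> :: "nat list \<Rightarrow> nat"
  proof -
    obtain g where g: "emb g P P'"
      "\<And>s. s \<in> set ss \<Longrightarrow> \<exists>c. \<forall>xs \<in> copies_along P s. \<chi> (map g xs) = c"
      using P'(2)[OF \<chi>] by blast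
    \<comment> \<open>All copies along one pattern now have one colour, so it induces a colouring of
      pairs of \<open>k\<close>-subsets; a pair without copies gets the colour 0.\<close>
    define f where "f S S' = (if copies_along P (ssf S S') = {} then 0
       else \<chi> (map g (SOME xs. xs \<in> copies_along P (ssf S S'))))" for S S'
    have "\<forall>S S'. f S S' < l" using \<chi> l by (auto simp: f_def)
    then obtain H H' c where H: "H \<in> nsets {..<N} n" "H' \<in> nsets {..<N} n"
      "\<And>S S'. S \<in> nsets H k \<Longrightarrow> S' \<in> nsets H' k \<Longrightarrow> f S S' = c"
      using N[of f] by blast
    have f: "\<chi> (map g xs) = f S S'"
      if S: "xs \<in> copies_along P (ssf S S')" "S \<in> nsets {..<N} k" "S' \<in> nsets {..<N} k" for xs S S'
    proof -
      have "ssf S S' \<in> set ss" using S unfolding ss by auto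
      then obtain d where d: "\<And>xs. xs \<in> copies_along P (ssf S S') \<Longrightarrow> \<chi> (map g xs) = d"
        using g(2) by blast
      have "(SOME xs. xs \<in> copies_along P (ssf S S')) \<in> copies_along P (ssf S S')"
        using S(1) by (rule someI)
      then show ?thesis using d S(1) by (auto simp: f_def)
    qed
    have slH: "sl H \<in> Hs" "sl H' \<in> Hs" using H by (auto simp: Hs_def)
    define b where "b r = to_nat (sl H, sl H', r)" for r :: nat
    have bP: "b r \<in> vs P" "so P (b r) = bs (sl H) (sl H') r" if "r < n" for r
      using that slH by (auto simp: b_def P_def)
    have edb: "ed P (b r) (b r') = \<alpha>B r r'" for r r' by (simp add: b_def P_def)
    have so_g: "so P' (g (b r)) = bs (sl H) (sl H') r" if "r < n" for r
      using g(1) bP that by (auto simp: emb_def)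
    have "inj_on (\<lambda>r. g (b r)) {..<n}"
    proof (rule inj_onI)
      fix r r' assume r: "r \<in> {..<n}" "r' \<in> {..<n}" "g (b r) = g (b r')"
      then have "b r = b r'" using g(1) bP by (auto simp: emb_def dest: inj_onD)
      then show "r = r'" by (simp add: b_def)
    qed
    moreover have "(\<lambda>r. g (b r)) ` {..<n} \<subseteq> vs P'" using g(1) bP by (auto simp: emb_def)
    moreover have "ed P' (g (b r)) (g (b r')) = \<alpha>B r r'" if "r < n" "r' < n" "rB r < rB r'" for r r'
    proof -
      have "lt (so P (b r)) (so P (b r'))"
        using that bP Hs_iff[OF slH(1) rB_lt[OF that(1)] rB_lt[OF that(2)]] by (simp add: lt_def bs_def)
      then show ?thesis using g(1) bP that edb by (auto simp: emb_def)
    qed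
    moreover have "\<chi> (map (\<lambda>i. g (b (\<rho> i))) [0..<k]) = c"
      if "occurrence k n uA rA \<alpha>A uB rB \<alpha>B \<rho>" for \<rho>
    proof -
      have \<rho>: "strict_mono_on {..<k} \<rho>" "\<And>i. i < k \<Longrightarrow> \<rho> i < n" "\<And>i. i < k \<Longrightarrow> uB (\<rho> i) = uA i"
        "\<And>i j. i < k \<Longrightarrow> j < k \<Longrightarrow> rA i < rA j \<Longrightarrow> rB (\<rho> i) < rB (\<rho> j) \<and> \<alpha>B (\<rho> i) (\<rho> j) = \<alpha>A i j"
        using that by (auto simp: occurrence_def)
      define iA where "iA = the_inv_into {..<k} rA"
      have iA: "iA j < k" "rA (iA j) = j" if "j < k" for j
        using rA that the_inv_into_into[of rA "{..<k}" j "{..<k}"] f_the_inv_into_f[of rA "{..<k}" j]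
        by (auto simp: iA_def bij_betw_def)
      have iA': "iA (rA i) = i" "rA i < k" if "i < k" for i
        using rA that the_inv_into_f_f[of rA "{..<k}" i] by (auto simp: iA_def bij_betw_def)
      \<comment> \<open>The coordinates of the occurrence, listed by rank on the first axis and by
        index on the second, so that both lists increase and name the two
        \<open>k\<close>-subsets.\<close>
      define fs where "fs j = sl H ! rB (\<rho> (iA j))" for j
      define fs' where "fs' i = sl H' ! \<rho> i" for i
      have mono: "strict_mono_on {..<k} fs" "strict_mono_on {..<k} fs'"
        using Hs_iff[OF slH(1)] Hs_iff[OF slH(2)] \<rho> iA rB_lt
        by (auto simp: strict_mono_on_def fs_def fs'_def)
      have slS: "sl (fs ` {..<k}) ! j = fs j" "sl (fs' ` {..<k}) ! j = fs' j" if "j < k" for j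
        using sorted_list_of_set_image[OF mono(1)] sorted_list_of_set_image[OF mono(2)] that by (auto simp: sl_def)
      have set_sl: "set (sl H) = H" "length (sl H) = n" "set (sl H') = H'" "length (sl H') = n"
        using H by (auto simp: sl_def nsets_def)
      have S: "fs ` {..<k} \<in> nsets H k" "fs' ` {..<k} \<in> nsets H' k"
      proof -
        have "fs j \<in> H" "fs' j \<in> H'" if "j < k" for j
          using set_sl nth_mem[of "rB (\<rho> (iA j))" "sl H"] nth_mem[of "\<rho> j" "sl H'"] \<rho>(2) iA rB_lt that
          by (auto simp: fs_def fs'_def)
        moreover have "card (fs ` {..<k}) = k" "card (fs' ` {..<k}) = k"
          using strict_mono_on_imp_inj_on[OF mono(1)] strict_mono_on_imp_inj_on[OF mono(2)]
          by (simp_all add: card_image)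
        ultimately show "fs ` {..<k} \<in> nsets H k" "fs' ` {..<k} \<in> nsets H' k"
          by (auto simp: nsets_def)
      qed
      have "H \<subseteq> {..<N}" "H' \<subseteq> {..<N}" using H by (auto simp: nsets_def)
      then have S': "fs ` {..<k} \<in> nsets {..<N} k" "fs' ` {..<k} \<in> nsets {..<N} k"
        using S nsets_mono by blast+
      have "so P (b (\<rho> i)) = ssf (fs ` {..<k}) (fs' ` {..<k}) i" if "i < k" for i
        using that slS iA' \<rho> bP by (simp add: bs_def ssf_def fs_def fs'_def)
      moreover have "\<alpha>B (\<rho> i) (\<rho> j) = \<alpha>A i j"
        if ij: "i < k" "j < k" "lt (ssf (fs ` {..<k}) (fs' ` {..<k}) i) (ssf (fs ` {..<k}) (fs' ` {..<k}) j)" for i j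
      proof -
        have "fs (rA i) < fs (rA j)" using ij slS iA' by (simp add: lt_def ssf_def)
        then have "rA i < rA j"
          using mono(1) iA'(2)[OF ij(1)] iA'(2)[OF ij(2)]
          by (metis lessThan_iff linorder_neqE_nat order_less_asym strict_mono_onD)
        then show ?thesis using \<rho>(4) ij by blast
      qed
      ultimately have "map (\<lambda>i. b (\<rho> i)) [0..<k] \<in> copies_along P (ssf (fs ` {..<k}) (fs' ` {..<k}))"
        using bP \<rho>(2) edb by (auto simp: copies_along_def)
      from f[OF this S'] H(3)[OF S] show ?thesis by (simp add: comp_def)
    qed
    ultimately show ?thesis
      using so_g Hs_iff[OF slH(1)] Hs_iff[OF slH(2)] rB_lt
      by (intro exI[of _ "\<lambda>r. g (b r)"]) (auto simp: bs_def)
  qed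
  then show ?thesis
    using P'(1) by (intro exI[of _ "vs P'"] exI[of _ "so P'"] exI[of _ "ed P'"]) (auto simp: system_def lt_def)
qed

section \<open>The ordered expansion\<close>

lemma bnS_swap: "bnS ar X b a = (snd (bnS ar X a b), fst (bnS ar X a b))"
  by (simp add: bnS_def)

lemma rank_bij:
  assumes X: "finite X" and irr: "\<And>x. x \<in> X \<Longrightarrow> \<not> S x x"
    and tot: "\<And>x y. x \<in> X \<Longrightarrow> y \<in> X \<Longrightarrow> x \<noteq> y \<Longrightarrow> S x y \<or> S y x"
    and tr: "\<And>x y z. x \<in> X \<Longrightarrow> y \<in> X \<Longrightarrow> z \<in> X \<Longrightarrow> S x y \<Longrightarrow> S y z \<Longrightarrow> S x z"
  shows "\<exists>r :: 'a \<Rightarrow> nat. bij_betw r X {..<card X} \<and> (\<forall>x \<in> X. \<forall>y \<in> X. r x < r y \<longleftrightarrow> S x y)"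
proof -
  define r where "r x = card {y \<in> X. S y x}" for x
  have mono: "r x < r y" if "x \<in> X" "y \<in> X" "S x y" for x y
    unfolding r_def
  proof (rule psubset_card_mono)
    show "finite {z \<in> X. S z y}" using X by simp
    have "{z \<in> X. S z x} \<subseteq> {z \<in> X. S z y}" using tr that by blast
    moreover have "x \<in> {z \<in> X. S z y}" "x \<notin> {z \<in> X. S z x}" using irr that by auto
    ultimately show "{z \<in> X. S z x} \<subset> {z \<in> X. S z y}" by blast
  qed
  have iff: "r x < r y \<longleftrightarrow> S x y" if "x \<in> X" "y \<in> X" for x y
    using mono that tot by (metis less_asym less_irrefl)
  have inj: "inj_on r X" using iff tot by (metis inj_onI less_irrefl)
  have "r x < card X" if "x \<in> X" for x
    unfolding r_def by (rule psubset_card_mono[OF X]) (use irr that in auto)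
  then have "r ` X \<subseteq> {..<card X}" by auto
  moreover have "card (r ` X) = card {..<card X}" using card_image[OF inj] by simp
  ultimately have "r ` X = {..<card X}" by (intro card_subset_eq) auto
  then show ?thesis using inj iff by (intro exI[of _ r]) (auto simp: bij_betw_def)
qed

abbreviation less_in :: "'r option struct \<Rightarrow> nat \<Rightarrow> nat \<Rightarrow> bool" where
  "less_in X a b \<equiv> [a, b] \<in> rels X None"

abbreviation unR :: "('r \<Rightarrow> nat) \<Rightarrow> 'r option struct \<Rightarrow> nat \<Rightarrow> 'r set" where
  "unR ar X \<equiv> unS ar (reduct X)"

abbreviation bnR :: "('r \<Rightarrow> nat) \<Rightarrow> 'r option struct \<Rightarrow> nat \<Rightarrow> nat \<Rightarrow> 'r set \<times> 'r set" where
  "bnR ar X \<equiv> bnS ar (reduct X)"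

lemma reduct_simps [simp]: "univ (reduct X) = univ X" "rels (reduct X) R = rels X (Some R)"
  by (simp_all add: reduct_def)

locale structured_limit = fraisse_sdap ar \<K> M + structured "unS ar M" "bnS ar M"
  for ar :: "'r::finite \<Rightarrow> nat" and \<K> and M
begin

abbreviation "\<K>' \<equiv> ordered_expansion ar \<K>"

lemma less_order:
  assumes "X \<in> \<K>'"
  shows "a \<in> univ X \<Longrightarrow> \<not> less_in X a a"
    "a \<in> univ X \<Longrightarrow> b \<in> univ X \<Longrightarrow> a \<noteq> b \<Longrightarrow> less_in X a b \<or> less_in X b a"
    "less_in X a b \<Longrightarrow> less_in X b c \<Longrightarrow> less_in X a c"
proof -
  have o: "strict_linear_order_on (univ X) {(a, b). less_in X a b}" using assms by (simp add: ordered_expansion_def)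
  show "a \<in> univ X \<Longrightarrow> \<not> less_in X a a" using o by (auto simp: strict_linear_order_on_def irrefl_def)
  show "a \<in> univ X \<Longrightarrow> b \<in> univ X \<Longrightarrow> a \<noteq> b \<Longrightarrow> less_in X a b \<or> less_in X b a"
    using o by (auto simp: strict_linear_order_on_def total_on_def)
  show "less_in X a b \<Longrightarrow> less_in X b c \<Longrightarrow> less_in X a c"
    using o unfolding strict_linear_order_on_def trans_def by blast
qed

lemma reduct_K: "X \<in> \<K>' \<Longrightarrow> reduct X \<in> \<K>"
  by (simp add: ordered_expansion_def)

lemma finite_univ: "X \<in> \<K>' \<Longrightarrow> finite (univ X)"
  using reduct_K K_iff by force

lemma less_asym_in:
  assumes "X \<in> \<K>'" "a \<in> univ X" "less_in X a b"
  shows "\<not> less_in X b a"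
  using less_order(1)[OF assms(1,2)] less_order(3)[OF assms(1) assms(3)] by blast

lemma ordered_embeddingI:
  assumes X: "X \<in> \<K>'" and Y: "Y \<in> \<K>'" and g: "inj_on g (univ X)" "g ` univ X \<subseteq> univ Y"
    and un: "\<And>a. a \<in> univ X \<Longrightarrow> unR ar Y (g a) = unR ar X a"
    and bn: "\<And>a b. a \<in> univ X \<Longrightarrow> b \<in> univ X \<Longrightarrow> a \<noteq> b \<Longrightarrow> bnR ar Y (g a) (g b) = bnR ar X a b"
    and less: "\<And>a b. a \<in> univ X \<Longrightarrow> b \<in> univ X \<Longrightarrow> a \<noteq> b \<Longrightarrow> less_in Y (g a) (g b) \<longleftrightarrow> less_in X a b"
  shows "embedding g X Y"
proof -
  have e: "embedding g (reduct X) (reduct Y)"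
    by (rule embeddingI[OF ar proper_K[OF reduct_K[OF X]] proper_K[OF reduct_K[OF Y]]]) (use g un bn in auto)
  have "xs \<in> rels X R \<longleftrightarrow> map g xs \<in> rels Y R" if xs: "set xs \<subseteq> univ X" for R xs
  proof (cases R)
    case (Some R')
    then show ?thesis using e xs by (simp add: embedding_def)
  next
    case None
    have len: "length zs = 2" if "zs \<in> rels Z None" "Z \<in> \<K>'" for zs Z
      using that by (fastforce simp: ordered_expansion_def is_struct_def)
    show ?thesis
    proof (cases "length xs = 2")
      case True
      then obtain a b where ab: "xs = [a, b]" by (auto simp: length_Suc_conv numeral_2_eq_2)
      show ?thesis
      proof (cases "a = b")
        case True
        have "a \<in> univ X" "g a \<in> univ Y" using xs ab g by auto
        then show ?thesis using True ab None less_order(1)[OF X] less_order(1)[OF Y] by simp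
      next
        case False
        then show ?thesis using less[of a b] xs ab None by simp
      qed
    next
      case False
      then show ?thesis using len[of xs X] len[of "map g xs" Y] X Y None by auto
    qed
  qed
  then show ?thesis using g by (simp add: embedding_def)
qed

lemma ordered_embeddingD:
  assumes "embedding g X Y" "a \<in> univ X" "b \<in> univ X"
  shows "unR ar Y (g a) = unR ar X a" "bnR ar Y (g a) (g b) = bnR ar X a b" "less_in Y (g a) (g b) \<longleftrightarrow> less_in X a b"
    "g a = g b \<longleftrightarrow> a = b" "g a \<in> univ Y"
proof -
  have e: "embedding g (reduct X) (reduct Y)" using assms(1) by (simp add: embedding_def)
  show "unR ar Y (g a) = unR ar X a" "bnR ar Y (g a) (g b) = bnR ar X a b"
    using embedding_unS[OF e] embedding_bnS[OF e] assms by auto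
  have "[a, b] \<in> rels X None \<longleftrightarrow> map g [a, b] \<in> rels Y None"
    using assms unfolding embedding_def by (metis empty_set empty_subsetI insert_subset list.simps(15))
  then show "less_in Y (g a) (g b) \<longleftrightarrow> less_in X a b" by simp
  show "g a = g b \<longleftrightarrow> a = b" "g a \<in> univ Y" using assms by (auto simp: embedding_def inj_on_def)
qed

text \<open>The order \<open>lt\<close> depends only on the type of the pair, so it can be read off
  inside any structure of the class.\<close>

definition lt_type :: "'r set \<times> 'r set \<times> 'r set \<times> 'r set \<Rightarrow> bool" where
  "lt_type t \<longleftrightarrow> (\<exists>p s. q p s = t \<and> lt p s)"

lemma lt_type_q: "p \<noteq> s \<Longrightarrow> lt_type (q p s) \<longleftrightarrow> lt p s"
proof
  assume ne: "p \<noteq> s" and "lt_type (q p s)"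
  then obtain p' s' where *: "q p' s' = q p s" "lt p' s'" by (auto simp: lt_type_def)
  then have "un p = un p'" by (simp add: q_def)
  then show "lt p s" using LT_cong[of _ p' s' p s] * ne cong_refl by (simp add: lt_def)
qed (auto simp: lt_type_def)

text \<open>The canonical linear order of an ordered structure, the first of the two orders that the
  Ramsey theorem for partite systems requires; the second one is the given order.\<close>

definition before :: "'r option struct \<Rightarrow> nat \<Rightarrow> nat \<Rightarrow> bool" where
  "before X a b \<longleftrightarrow> a \<noteq> b \<and> (blk (unR ar X a) < blk (unR ar X b) \<or>
     (blk (unR ar X a) = blk (unR ar X b) \<and>
       (if blk (unR ar X a) = 0 then less_in X a b else lt_type (unR ar X a, unR ar X b, bnR ar X a b))))"

lemma embed_M:
  assumes "X \<in> \<K>'"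
  shows "\<exists>e. inj_on e (univ X) \<and> (\<forall>a \<in> univ X. un (e a) = unR ar X a) \<and>
    (\<forall>a \<in> univ X. \<forall>b \<in> univ X. bn (e a) (e b) = bnR ar X a b)"
proof -
  obtain e where e: "embedding e (reduct X) M" using reduct_K[OF assms] by (auto simp: K_iff embeds_def)
  have "inj_on e (univ X)" using e by (simp add: embedding_def)
  then show ?thesis using embedding_unS[OF e] embedding_bnS[OF e] by (intro exI[of _ e]) simp
qed

text \<open>An embedding of the reduct into the limit turns the comparison by pair types into
  \<open>lt\<close>, which is a linear order on each block; the given order is used where there is
  no block.\<close>

lemma before_order:
  assumes X: "X \<in> \<K>'"
  shows "\<not> before X a a"
    "a \<in> univ X \<Longrightarrow> b \<in> univ X \<Longrightarrow> a \<noteq> b \<Longrightarrow> before X a b \<or> before X b a"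
    "a \<in> univ X \<Longrightarrow> b \<in> univ X \<Longrightarrow> c \<in> univ X \<Longrightarrow> before X a b \<Longrightarrow> before X b c \<Longrightarrow> before X a c"
proof -
  obtain e where "inj_on e (univ X) \<and> (\<forall>a \<in> univ X. un (e a) = unR ar X a) \<and>
    (\<forall>a \<in> univ X. \<forall>b \<in> univ X. bn (e a) (e b) = bnR ar X a b)" using embed_M[OF X] by (elim exE)
  then have e: "inj_on e (univ X)" "\<And>a. a \<in> univ X \<Longrightarrow> un (e a) = unR ar X a"
    "\<And>a b. a \<in> univ X \<Longrightarrow> b \<in> univ X \<Longrightarrow> bn (e a) (e b) = bnR ar X a b" by blast+
  have ne: "e a \<noteq> e b" if "a \<in> univ X" "b \<in> univ X" "a \<noteq> b" for a b using e(1) that by (auto simp: inj_on_def)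
  define B where "B a = blk (unR ar X a)" for a
  have B: "B a = blk (un (e a))" if "a \<in> univ X" for a using e(2) that by (simp add: B_def)
  have lt: "lt_type (unR ar X a, unR ar X b, bnR ar X a b) \<longleftrightarrow> lt (e a) (e b)" if "a \<in> univ X" "b \<in> univ X" "a \<noteq> b" for a b
    using lt_type_q[OF ne[OF that]] e(2,3) that by (simp add: q_def)
  have bf: "before X a b \<longleftrightarrow> B a < B b \<or> (B a = B b \<and> (if B a = 0 then less_in X a b else lt (e a) (e b)))"
    if "a \<in> univ X" "b \<in> univ X" "a \<noteq> b" for a b
    using that lt[OF that] by (simp add: before_def B_def)
  show "\<not> before X a a" by (simp add: before_def)
  show "a \<in> univ X \<Longrightarrow> b \<in> univ X \<Longrightarrow> a \<noteq> b \<Longrightarrow> before X a b \<or> before X b a"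
  proof -
    assume ab: "a \<in> univ X" "b \<in> univ X" "a \<noteq> b"
    consider "B a \<noteq> B b" | "B a = B b" "B a = 0" | "B a = B b" "B a \<noteq> 0" by blast
    then show ?thesis
    proof cases
      case 1
      then show ?thesis using bf[OF ab] bf[OF ab(2,1) ab(3)[symmetric]] by linarith
    next
      case 2
      then show ?thesis using bf[OF ab] bf[OF ab(2,1) ab(3)[symmetric]] less_order(2)[OF X ab] by simp
    next
      case 3
      then show ?thesis
        using bf[OF ab] bf[OF ab(2,1) ab(3)[symmetric]] lt_facts(1)[of "e a" "e b"] B[OF ab(1)] B[OF ab(2)] ne[OF ab] by simp
    qed
  qed
  assume abc: "a \<in> univ X" "b \<in> univ X" "c \<in> univ X" and l: "before X a b" "before X b c"
  have d: "a \<noteq> b" "b \<noteq> c" using l by (auto simp: before_def)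
  note l1 = l(1)[unfolded bf[OF abc(1,2) d(1)]] and l2 = l(2)[unfolded bf[OF abc(2,3) d(2)]]
  have "a \<noteq> c"
  proof
    assume ac: "a = c"
    then have "B a = B b" using l1 l2 by auto
    then show False
      using l1 l2 ac less_asym_in[OF X abc(1), of b] lt_facts(2)[of "e a" "e b"] B[OF abc(1)] B[OF abc(2)]
      by (auto split: if_splits)
  qed
  moreover have "B a < B c \<or> (B a = B c \<and> (if B a = 0 then less_in X a c else lt (e a) (e c)))"
  proof (cases "B a = B b \<and> B b = B c")
    case True
    show ?thesis
    proof (cases "B a = 0")
      case True
      then show ?thesis using l1 l2 less_order(3)[OF X, of a b c] \<open>B a = B b \<and> B b = B c\<close> by simp
    next
      case False
      have bb: "blk (un (e a)) = blk (un (e b))" "blk (un (e a)) \<noteq> 0" "blk (un (e c)) = blk (un (e a))"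
        using B[OF abc(1)] B[OF abc(2)] B[OF abc(3)] True False by metis+
      have "lt (e a) (e b)" "lt (e b) (e c)" using l1 l2 True False by auto
      then have "lt (e a) (e c)" by (rule lt_facts(4)[OF bb])
      then show ?thesis using False True by simp
    qed
  next
    case False
    then show ?thesis using l1 l2 by (auto split: if_splits)
  qed
  ultimately show "before X a c" using bf[OF abc(1,3)] by simp
qed

lemma before_embedding:
  assumes "embedding g X Y" "a \<in> univ X" "b \<in> univ X"
  shows "before Y (g a) (g b) \<longleftrightarrow> before X a b"
  using ordered_embeddingD[OF assms] ordered_embeddingD(1)[OF assms(1,3,2)] by (simp add: before_def)

lemma enumeration:
  assumes X: "X \<in> \<K>'"
  shows "\<exists>h r. bij_betw h {..<card (univ X)} (univ X) \<and> bij_betw r {..<card (univ X)} {..<card (univ X)} \<and>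
    (\<forall>i<card (univ X). \<forall>j<card (univ X). (i < j \<longleftrightarrow> less_in X (h i) (h j)) \<and> (r i < (r j :: nat) \<longleftrightarrow> before X (h i) (h j)))"
proof -
  let ?n = "card (univ X)"
  obtain s :: "nat \<Rightarrow> nat" where s: "bij_betw s (univ X) {..<?n}" "\<forall>x \<in> univ X. \<forall>y \<in> univ X. s x < s y \<longleftrightarrow> less_in X x y"
    using rank_bij[OF finite_univ[OF X], of "less_in X"] less_order[OF X] by blast
  obtain t :: "nat \<Rightarrow> nat" where t: "bij_betw t (univ X) {..<?n}" "\<forall>x \<in> univ X. \<forall>y \<in> univ X. t x < t y \<longleftrightarrow> before X x y"
    using rank_bij[OF finite_univ[OF X], of "before X"] before_order[OF X] by blast
  define h where "h = the_inv_into (univ X) s"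
  have h: "bij_betw h {..<?n} (univ X)" unfolding h_def by (rule bij_betw_the_inv_into[OF s(1)])
  have hs: "h i \<in> univ X" "s (h i) = i" if "i < ?n" for i
    using bij_betwE[OF h] that s(1) f_the_inv_into_f[of s "univ X" i] by (auto simp: h_def bij_betw_def)
  have r: "bij_betw (t \<circ> h) {..<?n} {..<?n}" by (rule bij_betw_trans[OF h t(1)])
  show ?thesis
  proof (rule exI[of _ h], rule exI[of _ "t \<circ> h"], intro conjI allI impI h r)
    show "i < j \<longleftrightarrow> less_in X (h i) (h j)" if "i < ?n" "j < ?n" for i j
      using s(2) hs[OF that(1)] hs[OF that(2)] by metis
    show "(t \<circ> h) i < (t \<circ> h) j \<longleftrightarrow> before X (h i) (h j)" if "i < ?n" "j < ?n" for i j
      using t(2) hs(1)[OF that(1)] hs(1)[OF that(2)] by simp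
  qed
qed

text \<open>The edge types that an earlier vertex may have to a later one: inside a block the pair
  must be in its order, otherwise every realised type is allowed.\<close>

definition adm :: "'r set \<Rightarrow> 'r set \<Rightarrow> ('r set \<times> 'r set) set" where
  "adm a b = {t. \<exists>p s. p \<noteq> s \<and> un p = a \<and> un s = b \<and> bn p s = t \<and> (blk a = blk b \<longrightarrow> blk a \<noteq> 0 \<longrightarrow> lt p s)}"

lemma adm_nonempty:
  assumes "a \<in> range un" "b \<in> range un"
  shows "adm a b \<noteq> {}"
proof (cases "blk a = blk b \<and> blk a \<noteq> 0")
  case True
  then have t: "two a (rep a)" "two b (rep a)" using blk_rep(2) blk_two(2) by metis+
  obtain x y where "un x = a" "un y = b" "LT (rep a) x y" using LT_both[OF t] .
  then have "bn x y \<in> adm a b" unfolding adm_def lt_def LT_def by blast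
  then show ?thesis by blast
next
  case False
  obtain x y where xy: "a = un x" "b = un y" using assms by blast
  obtain v where "v \<noteq> x" "un v = un y" using bottom_in[of "{x}" y] by auto
  then have "x \<noteq> v \<and> un x = a \<and> un v = b \<and> bn x v = bn x v \<and> (blk a = blk b \<longrightarrow> blk a \<noteq> 0 \<longrightarrow> lt x v)"
    using False xy by metis
  then have "bn x v \<in> adm a b" unfolding adm_def by (intro CollectI exI)
  then show ?thesis by blast
qed

lemma lex_code:
  fixes a b x y K :: nat
  assumes "x < K" "a < b"
  shows "a * K + x < b * K + y"
proof -
  have "a * K + x < Suc a * K" using assms(1) by simp
  also have "\<dots> \<le> b * K" using assms(2) by (intro mult_le_mono1) simp
  finally show ?thesis by simp
qed

text \<open>Equal grid coordinates are ordered by the vertices themselves, and such pairs receive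
  some admissible type. Then every pair is prescribed and \<open>realise\<close> finds the reduct in
  the limit, while the second coordinates define \<open><\<close>.\<close>

lemma ordered_structure:
  fixes so :: "nat \<Rightarrow> (nat \<times> nat) \<times> 'r set" and ed :: "nat \<Rightarrow> nat \<Rightarrow> 'r set \<times> 'r set"
  assumes V: "finite V" "\<And>x. x \<in> V \<Longrightarrow> snd (so x) \<in> range un"
    and ed: "\<And>x y. x \<in> V \<Longrightarrow> y \<in> V \<Longrightarrow> fst (fst (so x)) < fst (fst (so y)) \<Longrightarrow> ed x y \<in> adm (snd (so x)) (snd (so y))"
  obtains C where "C \<in> \<K>'" "univ C = V" "\<And>x. x \<in> V \<Longrightarrow> unR ar C x = snd (so x)"
    "\<And>x y. x \<in> V \<Longrightarrow> y \<in> V \<Longrightarrow> fst (fst (so x)) < fst (fst (so y)) \<Longrightarrow> bnR ar C x y = ed x y"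
    "\<And>x y. x \<in> V \<Longrightarrow> y \<in> V \<Longrightarrow> snd (fst (so x)) < snd (fst (so y)) \<Longrightarrow> less_in C x y"
proof -
  \<comment> \<open>\<open>K\<close> exceeds every vertex, so multiplying a coordinate by
    \<open>K\<close> and adding the vertex gives a lexicographic order.\<close>
  define K where "K = Suc (Max (insert 0 V))"
  have K: "x < K" if "x \<in> V" for x using V(1) that by (simp add: K_def less_Suc_eq_le)
  define r where "r x = fst (fst (so x)) * K + x" for x
  define w where "w x = snd (fst (so x)) * K + x" for x
  have div: "(a * K + x) mod K = x" if "x \<in> V" for a x using K[OF that] by simp
  have rinj: "inj_on r V" unfolding r_def using div by (metis (no_types, lifting) inj_onI)
  have winj: "inj_on w V" unfolding w_def using div by (metis (no_types, lifting) inj_onI)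
  have rlt: "r x < r y" if "x \<in> V" "fst (fst (so x)) < fst (fst (so y))" for x y
    unfolding r_def by (rule lex_code[OF K[OF that(1)] that(2)])
  have wlt: "w x < w y" if "x \<in> V" "snd (fst (so x)) < snd (fst (so y))" for x y
    unfolding w_def by (rule lex_code[OF K[OF that(1)] that(2)])
  let ?c = "\<lambda>x. snd (so x)"
  have "\<exists>p s. x \<in> V \<and> y \<in> V \<longrightarrow> p \<noteq> s \<and> un p = ?c x \<and> un s = ?c y \<and> (blk (?c x) = blk (?c y) \<longrightarrow> blk (?c x) \<noteq> 0 \<longrightarrow> lt p s) \<and>
     (fst (fst (so x)) < fst (fst (so y)) \<longrightarrow> bn p s = ed x y)" for x y
  proof (cases "x \<in> V \<and> y \<in> V")
    case True
    then have "\<exists>t \<in> adm (?c x) (?c y). fst (fst (so x)) < fst (fst (so y)) \<longrightarrow> t = ed x y"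
      using ed[of x y] adm_nonempty[OF V(2) V(2)] by blast
    then show ?thesis unfolding adm_def by blast
  qed blast
  then obtain p s where ps: "\<And>x y. x \<in> V \<Longrightarrow> y \<in> V \<Longrightarrow> p x y \<noteq> s x y \<and> un (p x y) = ?c x \<and> un (s x y) = ?c y \<and>
     (blk (?c x) = blk (?c y) \<longrightarrow> blk (?c x) \<noteq> 0 \<longrightarrow> lt (p x y) (s x y)) \<and>
     (fst (fst (so x)) < fst (fst (so y)) \<longrightarrow> bn (p x y) (s x y) = ed x y)" by metis
  define \<tau> where "\<tau> x y = (if r x < r y then q (p x y) (s x y) else q (s y x) (p y x))" for x y
  have "\<exists>f. inj_on f V \<and> (\<forall>x \<in> V. un (f x) = ?c x) \<and> (\<forall>x \<in> V. \<forall>y \<in> V. x \<noteq> y \<longrightarrow> q (f x) (f y) = \<tau> x y)"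
  proof (rule realise[OF V(1) rinj V(2)])
    show "\<exists>a b. a \<noteq> b \<and> un a = ?c x \<and> un b = ?c y \<and> (blk (?c x) = blk (?c y) \<longrightarrow> blk (?c x) \<noteq> 0 \<longrightarrow> lt a b) \<and>
        \<tau> x y = q a b \<and> \<tau> y x = q b a" if "x \<in> V" "y \<in> V" "r x < r y" for x y
      using ps[OF that(1,2)] that(3) by (intro exI[of _ "p x y"] exI[of _ "s x y"]) (simp add: \<tau>_def)
  qed
  then obtain f where f: "inj_on f V" "\<forall>x \<in> V. un (f x) = ?c x" "\<forall>x \<in> V. \<forall>y \<in> V. x \<noteq> y \<longrightarrow> q (f x) (f y) = \<tau> x y" by blast
  define C :: "'r option struct" where "C = \<lparr>univ = V, rels = (\<lambda>R. case R of
      None \<Rightarrow> {xs. \<exists>x \<in> V. \<exists>y \<in> V. xs = [x, y] \<and> w x < w y} | Some R' \<Rightarrow> rels (pull f M V) R')\<rparr>"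
  have red: "reduct C = pull f M V" by (rule struct_eqI) (simp_all add: C_def reduct_def)
  have less: "less_in C x y \<longleftrightarrow> x \<in> V \<and> y \<in> V \<and> w x < w y" for x y by (auto simp: C_def)
  have un: "unR ar C x = un (f x)" if "x \<in> V" for x using that by (simp add: red unS_def)
  have bn: "bnR ar C x y = bn (f x) (f y)" if "x \<in> V" "y \<in> V" for x y using that by (simp add: red bnS_def)
  have "C \<in> \<K>'"
    unfolding ordered_expansion_def
  proof (intro CollectI conjI)
    show "reduct C \<in> \<K>" unfolding red by (rule pull_K[OF V(1) f(1)])
    have st: "is_struct ar (pull f M V)" by (rule is_struct_pull[OF struct_M])
    show "is_struct (case_option 2 ar) C"
      unfolding is_struct_def
    proof (intro allI ballI)
      fix R xs assume xs: "xs \<in> rels C R"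
      show "length xs = (case R of None \<Rightarrow> 2 | Some x \<Rightarrow> ar x) \<and> set xs \<subseteq> univ C"
      proof (cases R)
        case None
        then show ?thesis using xs by (auto simp: C_def)
      next
        case (Some R')
        then have "xs \<in> rels (pull f M V) R'" using xs by (simp add: C_def)
        then have "length xs = ar R' \<and> set xs \<subseteq> univ (pull f M V)" using st unfolding is_struct_def by blast
        then show ?thesis using Some by (simp add: C_def)
      qed
    qed
    have uC: "univ C = V" by (simp add: C_def)
    show "strict_linear_order_on (univ C) {(a, b). less_in C a b}"
      unfolding strict_linear_order_on_def uC less
    proof (intro conjI)
      show "trans {(a, b). a \<in> V \<and> b \<in> V \<and> w a < w b}" by (auto intro!: transI)
      show "irrefl {(a, b). a \<in> V \<and> b \<in> V \<and> w a < w b}" by (auto simp: irrefl_def)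
      show "total_on V {(a, b). a \<in> V \<and> b \<in> V \<and> w a < w b}"
      proof (rule total_onI)
        fix x y assume xy: "x \<in> V" "y \<in> V" "x \<noteq> y"
        then have "w x \<noteq> w y" using inj_onD[OF winj] by blast
        then show "(x, y) \<in> {(a, b). a \<in> V \<and> b \<in> V \<and> w a < w b} \<or> (y, x) \<in> {(a, b). a \<in> V \<and> b \<in> V \<and> w a < w b}"
          using xy by auto
      qed
    qed
  qed
  moreover have "univ C = V" by (simp add: C_def)
  moreover have "unR ar C x = ?c x" if "x \<in> V" for x using un f(2) that by simp
  moreover have "bnR ar C x y = ed x y" if xy: "x \<in> V" "y \<in> V" "fst (fst (so x)) < fst (fst (so y))" for x y
  proof -
    have "x \<noteq> y" using xy by auto
    then have "q (f x) (f y) = q (p x y) (s x y)" using f(3) xy rlt[OF xy(1,3)] by (simp add: \<tau>_def)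
    then show ?thesis using bn[OF xy(1,2)] ps[OF xy(1,2)] xy(3) by (simp add: q_def)
  qed
  moreover have "less_in C x y" if "x \<in> V" "y \<in> V" "snd (fst (so x)) < snd (fst (so y))" for x y
    unfolding less using wlt that by blast
  ultimately show ?thesis by (rule that)
qed

text \<open>The indices enumerate \<open>A\<close> and \<open>B\<close> along \<open><\<close>, and
  the ranks along \<open>before\<close>. Embeddings preserve both orders, so a copy of
  \<open>A\<close> inside the copy of \<open>B\<close> is an occurrence of \<open>A\<close> in
  \<open>B\<close>, and all occurrences have one colour.\<close>

lemma ordered_ramsey:
  assumes A: "A \<in> \<K>'" and B: "B \<in> \<K>'" and l: "2 \<le> (l::nat)"
  shows "\<exists>C \<in> \<K>'. \<forall>\<chi>. (\<forall>A' \<in> copies A C. \<chi> A' < l) \<longrightarrow>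
    (\<exists>g. embedding g B C \<and> (\<exists>c. \<forall>A' \<in> copies A (induced C (g ` univ B)). \<chi> A' = c))"
proof -
  define n where "n = card (univ B)"
  define k where "k = card (univ A)"
  obtain hA rA where hA0: "bij_betw hA {..<k} (univ A)" "bij_betw rA {..<k} {..<k}"
    and hA1: "\<forall>i<k. \<forall>j<k. (i < j \<longleftrightarrow> less_in A (hA i) (hA j)) \<and> (rA i < (rA j :: nat) \<longleftrightarrow> before A (hA i) (hA j))"
    using enumeration[OF A, folded k_def] by (elim exE conjE) (rule that)
  have hA: "bij_betw hA {..<k} (univ A)" "bij_betw rA {..<k} {..<k}"
    "\<And>i j. i < k \<Longrightarrow> j < k \<Longrightarrow> i < j \<longleftrightarrow> less_in A (hA i) (hA j)" "\<And>i j. i < k \<Longrightarrow> j < k \<Longrightarrow> rA i < rA j \<longleftrightarrow> before A (hA i) (hA j)"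
    using hA0 hA1 by blast+
  obtain hB rB where hB0: "bij_betw hB {..<n} (univ B)" "bij_betw rB {..<n} {..<n}"
    and hB1: "\<forall>i<n. \<forall>j<n. (i < j \<longleftrightarrow> less_in B (hB i) (hB j)) \<and> (rB i < (rB j :: nat) \<longleftrightarrow> before B (hB i) (hB j))"
    using enumeration[OF B, folded n_def] by (elim exE conjE) (rule that)
  have hB: "bij_betw hB {..<n} (univ B)" "bij_betw rB {..<n} {..<n}"
    "\<And>i j. i < n \<Longrightarrow> j < n \<Longrightarrow> i < j \<longleftrightarrow> less_in B (hB i) (hB j)" "\<And>i j. i < n \<Longrightarrow> j < n \<Longrightarrow> rB i < rB j \<longleftrightarrow> before B (hB i) (hB j)"
    using hB0 hB1 by blast+
  have hAU: "hA i \<in> univ A" if "i < k" for i using bij_betwE[OF hA(1)] that by blast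
  have hBU: "hB i \<in> univ B" if "i < n" for i using bij_betwE[OF hB(1)] that by blast
  obtain eB where "inj_on eB (univ B) \<and> (\<forall>a \<in> univ B. un (eB a) = unR ar B a) \<and>
    (\<forall>a \<in> univ B. \<forall>b \<in> univ B. bn (eB a) (eB b) = bnR ar B a b)" using embed_M[OF B] by (elim exE)
  then have eB: "inj_on eB (univ B)" "\<And>a. a \<in> univ B \<Longrightarrow> un (eB a) = unR ar B a"
    "\<And>a b. a \<in> univ B \<Longrightarrow> b \<in> univ B \<Longrightarrow> bn (eB a) (eB b) = bnR ar B a b" by blast+
  define uA where "uA i = unR ar A (hA i)" for i
  define uB where "uB i = unR ar B (hB i)" for i
  define \<alpha>A where "\<alpha>A i j = bnR ar A (hA i) (hA j)" for i j
  define \<alpha>B where "\<alpha>B i j = bnR ar B (hB i) (hB j)" for i j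
  have uBr: "uB i \<in> range un" if "i < n" for i
    using eB(2)[OF hBU[OF that]] unfolding uB_def by (metis rangeI)
  have \<alpha>Badm: "\<alpha>B i j \<in> adm (uB i) (uB j)" if ij: "i < n" "j < n" "rB i < rB j" for i j
  proof -
    have bf: "before B (hB i) (hB j)" using hB(4) ij by blast
    then have "hB i \<noteq> hB j" by (simp add: before_def)
    then have ne: "eB (hB i) \<noteq> eB (hB j)" using eB(1) hBU ij by (auto simp: inj_on_def)
    have "lt (eB (hB i)) (eB (hB j))" if "blk (uB i) = blk (uB j)" "blk (uB i) \<noteq> 0"
    proof -
      have "lt_type (uB i, uB j, \<alpha>B i j)" using bf that by (simp add: before_def uB_def \<alpha>B_def)
      moreover have "(uB i, uB j, \<alpha>B i j) = q (eB (hB i)) (eB (hB j))"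
        using eB(2,3) hBU ij by (simp add: q_def uB_def \<alpha>B_def)
      ultimately show ?thesis using lt_type_q[OF ne] by simp
    qed
    then show ?thesis
      unfolding adm_def using ne eB(2,3) hBU ij
      by (intro CollectI exI[of _ "eB (hB i)"] exI[of _ "eB (hB j)"]) (simp add: uB_def \<alpha>B_def)
  qed
  have ex: "\<exists>(V :: nat set) (so :: nat \<Rightarrow> (nat \<times> nat) \<times> 'r set) ed. finite V \<and> (\<forall>x \<in> V. snd (so x) \<in> range un) \<and>
     (\<forall>x \<in> V. \<forall>y \<in> V. fst (fst (so x)) < fst (fst (so y)) \<longrightarrow> ed x y \<in> adm (snd (so x)) (snd (so y))) \<and>
     (\<forall>\<chi>. (\<forall>xs. \<chi> xs < l) \<longrightarrow> (\<exists>y::nat \<Rightarrow> nat. inj_on y {..<n} \<and> y ` {..<n} \<subseteq> V \<and>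
        (\<forall>r<n. snd (so (y r)) = uB r) \<and>
        (\<forall>r<n. \<forall>r'<n. (r < r' \<longrightarrow> snd (fst (so (y r))) < snd (fst (so (y r')))) \<and>
           (rB r < rB r' \<longrightarrow> fst (fst (so (y r))) < fst (fst (so (y r'))) \<and> ed (y r) (y r') = \<alpha>B r r')) \<and>
        (\<exists>c. \<forall>\<rho>. occurrence k n uA rA \<alpha>A uB rB \<alpha>B \<rho> \<longrightarrow> \<chi> (map (\<lambda>i. y (\<rho> i)) [0..<k]) = c)))"
  proof (rule structural_ramsey[where adm = adm and U = "range un" and uA = uA and uB = uB and \<alpha>A = \<alpha>A and \<alpha>B = \<alpha>B
        and rA = rA and rB = rB and n = n and k = k and l = l])
    show "0 < l" using l by simp
    show "\<And>a b. a \<in> range un \<Longrightarrow> b \<in> range un \<Longrightarrow> adm a b \<noteq> {}" by (rule adm_nonempty)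
    show "\<And>r. r < n \<Longrightarrow> uB r \<in> range un" by (rule uBr)
    show "bij_betw rB {..<n} {..<n}" "bij_betw rA {..<k} {..<k}" by (rule hB(2), rule hA(2))
    show "\<And>r r'. r < n \<Longrightarrow> r' < n \<Longrightarrow> rB r < rB r' \<Longrightarrow> \<alpha>B r r' \<in> adm (uB r) (uB r')" by (rule \<alpha>Badm)
  qed
  from ex
  obtain V and so :: "nat \<Rightarrow> (nat \<times> nat) \<times> 'r set" and ed where V: "finite V" "\<forall>x \<in> V. snd (so x) \<in> range un"
     "\<forall>x \<in> V. \<forall>y \<in> V. fst (fst (so x)) < fst (fst (so y)) \<longrightarrow> ed x y \<in> adm (snd (so x)) (snd (so y))"
     and R: "\<forall>\<chi>. (\<forall>xs. \<chi> xs < l) \<longrightarrow> (\<exists>y::nat \<Rightarrow> nat. inj_on y {..<n} \<and> y ` {..<n} \<subseteq> V \<and>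
        (\<forall>r<n. snd (so (y r)) = uB r) \<and>
        (\<forall>r<n. \<forall>r'<n. (r < r' \<longrightarrow> snd (fst (so (y r))) < snd (fst (so (y r')))) \<and>
           (rB r < rB r' \<longrightarrow> fst (fst (so (y r))) < fst (fst (so (y r'))) \<and> ed (y r) (y r') = \<alpha>B r r')) \<and>
        (\<exists>c. \<forall>\<rho>. occurrence k n uA rA \<alpha>A uB rB \<alpha>B \<rho> \<longrightarrow> \<chi> (map (\<lambda>i. y (\<rho> i)) [0..<k]) = c))"
    by (elim exE conjE) (rule that, assumption, assumption, assumption, assumption)
  obtain C where C: "C \<in> \<K>'" "univ C = V" "\<And>x. x \<in> V \<Longrightarrow> unR ar C x = snd (so x)"
    "\<And>x y. x \<in> V \<Longrightarrow> y \<in> V \<Longrightarrow> fst (fst (so x)) < fst (fst (so y)) \<Longrightarrow> bnR ar C x y = ed x y"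
    "\<And>x y. x \<in> V \<Longrightarrow> y \<in> V \<Longrightarrow> snd (fst (so x)) < snd (fst (so y)) \<Longrightarrow> less_in C x y"
  proof (rule ordered_structure[OF V(1), of so ed])
    show "snd (so x) \<in> range un" if "x \<in> V" for x using V(2) that by blast
    show "ed x y \<in> adm (snd (so x)) (snd (so y))" if "x \<in> V" "y \<in> V" "fst (fst (so x)) < fst (fst (so y))" for x y
      using V(3) that by blast
  qed (rule that)
  have "\<exists>g. embedding g B C \<and> (\<exists>c. \<forall>A' \<in> copies A (induced C (g ` univ B)). \<chi> A' = c)"
    if \<chi>: "\<forall>A' \<in> copies A C. \<chi> A' < l" for \<chi> :: "'r option struct \<Rightarrow> nat"
  proof -
    \<comment> \<open>The partite theorem colours tuples. A tuple gets the colour of the copy that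
      it lists, and 0 if it lists none.\<close>
    define \<chi>' where "\<chi>' xs = (if induced C (set xs) \<in> copies A C then \<chi> (induced C (set xs)) else 0)" for xs
    have "\<forall>xs. \<chi>' xs < l" using \<chi> l by (simp add: \<chi>'_def)
    from mp[OF spec[OF R, of \<chi>'] this] obtain y c where y: "inj_on y {..<n}" "y ` {..<n} \<subseteq> V" "\<forall>r<n. snd (so (y r)) = uB r"
      "\<forall>r<n. \<forall>r'<n. (r < r' \<longrightarrow> snd (fst (so (y r))) < snd (fst (so (y r')))) \<and>
           (rB r < rB r' \<longrightarrow> fst (fst (so (y r))) < fst (fst (so (y r'))) \<and> ed (y r) (y r') = \<alpha>B r r')"
      "\<forall>\<rho>. occurrence k n uA rA \<alpha>A uB rB \<alpha>B \<rho> \<longrightarrow> \<chi>' (map (\<lambda>i. y (\<rho> i)) [0..<k]) = c"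
      by blast
    have yV: "y i \<in> V" if "i < n" for i using y(2) that by blast
    define iB where "iB = the_inv_into {..<n} hB"
    have iB: "iB b < n" "hB (iB b) = b" if "b \<in> univ B" for b
      using bij_betwE[OF bij_betw_the_inv_into[OF hB(1)]] that f_the_inv_into_f_bij_betw[OF hB(1)] by (auto simp: iB_def)
    have iBh: "iB (hB i) = i" if "i < n" for i
      using the_inv_into_f_f[of hB "{..<n}" i] hB(1) that by (auto simp: iB_def bij_betw_def)
    define g where "g b = y (iB b)" for b
    have ltC: "less_in C (y i) (y j) \<longleftrightarrow> i < j" if ij: "i < n" "j < n" for i j
    proof
      assume lc: "less_in C (y i) (y j)"
      show "i < j"
      proof (rule ccontr)
        assume "\<not> i < j"
        then consider "i = j" | "j < i" by linarith
        then show False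
        proof cases
          case 1
          then show ?thesis using lc less_order(1)[OF C(1)] yV[OF ij(1)] C(2) by simp
        next
          case 2
          then have "less_in C (y j) (y i)" using y(4) ij C(5)[OF yV[OF ij(2)] yV[OF ij(1)]] by blast
          then show ?thesis using less_asym_in[OF C(1) _ lc] yV[OF ij(1)] C(2) by simp
        qed
      qed
    next
      assume "i < j"
      then show "less_in C (y i) (y j)" using y(4) ij C(5)[OF yV[OF ij(1)] yV[OF ij(2)]] by blast
    qed
    have bnC: "bnR ar C (y i) (y j) = \<alpha>B i j" if ij: "i < n" "j < n" "i \<noteq> j" for i j
    proof -
      have "rB i \<noteq> rB j" using hB(2) ij by (auto simp: bij_betw_def inj_on_def)
      then consider "rB i < rB j" | "rB j < rB i" by linarith
      then show ?thesis
      proof cases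
        case 1
        then show ?thesis using y(4) ij C(4)[OF yV[OF ij(1)] yV[OF ij(2)]] by metis
      next
        case 2
        then have "bnR ar C (y j) (y i) = \<alpha>B j i" using y(4) ij C(4)[OF yV[OF ij(2)] yV[OF ij(1)]] by metis
        then show ?thesis unfolding \<alpha>B_def by (subst (1 2) bnS_swap) simp
      qed
    qed
    have g: "embedding g B C"
    proof (rule ordered_embeddingI[OF B C(1)])
      show "inj_on g (univ B)"
      proof (rule inj_onI)
        fix a b assume ab: "a \<in> univ B" "b \<in> univ B" "g a = g b"
        have "y (iB a) = y (iB b)" using ab(3) by (simp only: g_def)
        then have "iB a = iB b" by (rule inj_onD[OF y(1)]) (use iB(1)[OF ab(1)] iB(1)[OF ab(2)] in simp_all)
        have "hB (iB a) = a" "hB (iB b) = b" using iB(2) ab(1,2) by blast+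
        then show "a = b" using \<open>iB a = iB b\<close> by metis
      qed
      show "g ` univ B \<subseteq> univ C" unfolding C(2) using yV[OF iB(1)] by (simp add: g_def image_subset_iff)
      show "unR ar C (g a) = unR ar B a" if "a \<in> univ B" for a
        using y(3) iB[OF that] C(3)[OF yV[OF iB(1)[OF that]]] by (simp add: g_def uB_def)
      fix a b assume ab: "a \<in> univ B" "b \<in> univ B" "a \<noteq> b"
      then have "iB a \<noteq> iB b" using iB by metis
      then show "bnR ar C (g a) (g b) = bnR ar B a b"
        using bnC[OF iB(1)[OF ab(1)] iB(1)[OF ab(2)]] iB(2) ab by (simp add: g_def \<alpha>B_def)
      show "less_in C (g a) (g b) \<longleftrightarrow> less_in B a b"
        using ltC[OF iB(1)[OF ab(1)] iB(1)[OF ab(2)]] hB(3)[OF iB(1)[OF ab(1)] iB(1)[OF ab(2)]] iB(2)[OF ab(1)] iB(2)[OF ab(2)] by (simp add: g_def)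
    qed
    have "\<chi> A' = c" if A': "A' \<in> copies A (induced C (g ` univ B))" for A'
    proof -
      have sA: "univ A' \<subseteq> g ` univ B" "A' = induced (induced C (g ` univ B)) (univ A')" "isomorphic A A'"
        using A' by (auto simp: copies_def substructure_def)
      have gV: "g ` univ B \<subseteq> V" using g C(2) by (simp add: embedding_def)
      have AC: "A' = induced C (univ A')"
        by (subst sA(2), rule struct_eqI) (use sA(1) in auto)
      then have subC: "substructure A' C" using sA(1) gV C(2) unfolding substructure_def by blast
      then have copy: "A' \<in> copies A C" using sA(3) by (simp add: copies_def)
      obtain \<phi> where \<phi>: "embedding \<phi> A A'" "\<phi> ` univ A = univ A'" using sA(3) by (auto simp: isomorphic_def is_iso_def)
      have \<phi>C: "embedding \<phi> A C"
        using embedding_comp[OF \<phi>(1) substructure_embedding[OF subC]] by simp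
      have "\<forall>i<k. \<exists>j<n. \<phi> (hA i) = y j"
      proof (intro allI impI)
        fix i assume "i < k"
        then have "\<phi> (hA i) \<in> g ` univ B" using hAU \<phi>(2) sA(1) by blast
        then obtain b where "b \<in> univ B" "\<phi> (hA i) = y (iB b)" by (auto simp: g_def)
        then show "\<exists>j<n. \<phi> (hA i) = y j" using iB(1) by blast
      qed
      then obtain \<rho> where \<rho>: "\<And>i. i < k \<Longrightarrow> \<rho> i < n \<and> \<phi> (hA i) = y (\<rho> i)" by metis
      have yg: "y (\<rho> i) = g (hB (\<rho> i))" if "i < k" for i using iBh \<rho>[OF that] by (simp add: g_def)
      have D: "less_in C (y (\<rho> i)) (y (\<rho> j)) \<longleftrightarrow> less_in A (hA i) (hA j)" "bnR ar C (y (\<rho> i)) (y (\<rho> j)) = \<alpha>A i j"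
        "unR ar C (y (\<rho> i)) = uA i" "before C (y (\<rho> i)) (y (\<rho> j)) \<longleftrightarrow> before A (hA i) (hA j)" if "i < k" "j < k" for i j
        using ordered_embeddingD[OF \<phi>C hAU[OF that(1)] hAU[OF that(2)]] before_embedding[OF \<phi>C hAU[OF that(1)] hAU[OF that(2)]]
          \<rho>[OF that(1)] \<rho>[OF that(2)] by (simp_all add: uA_def \<alpha>A_def)
      have "occurrence k n uA rA \<alpha>A uB rB \<alpha>B \<rho>"
        unfolding occurrence_def
      proof (intro conjI allI impI)
        show "strict_mono_on {..<k} \<rho>"
        proof (rule strict_mono_onI)
          fix i j assume ij: "i \<in> {..<k}" "j \<in> {..<k}" "i < j"
          then have "less_in C (y (\<rho> i)) (y (\<rho> j))" using D(1)[of i j] hA(3)[of i j] by simp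
          then show "\<rho> i < \<rho> j" using ltC \<rho> ij by simp
        qed
        show "\<rho> ` {..<k} \<subseteq> {..<n}" using \<rho> by auto
        show "uB (\<rho> i) = uA i" if "i < k" for i
          using D(3)[OF that that] C(3)[OF yV] y(3) \<rho>[OF that] by simp
        fix i j assume ij: "i < k" "j < k" "rA i < rA j"
        have b: "before A (hA i) (hA j)" using hA(4)[OF ij(1,2)] ij(3) by simp
        have r: "\<rho> i < n" "\<rho> j < n" using \<rho> ij by auto
        have "before C (g (hB (\<rho> i))) (g (hB (\<rho> j)))" using b D(4)[OF ij(1,2)] yg ij by simp
        then have bB: "before B (hB (\<rho> i)) (hB (\<rho> j))" using before_embedding[OF g hBU[OF r(1)] hBU[OF r(2)]] by simp
        then show "rB (\<rho> i) < rB (\<rho> j)" using hB(4)[OF r] by simp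
        have "\<rho> i \<noteq> \<rho> j" using bB by (auto simp: before_def)
        then show "\<alpha>B (\<rho> i) (\<rho> j) = \<alpha>A i j" using bnC[OF r] D(2)[OF ij(1,2)] by simp
      qed
      then have "\<chi>' (map (\<lambda>i. y (\<rho> i)) [0..<k]) = c" using y(5) by blast
      moreover have "set (map (\<lambda>i. y (\<rho> i)) [0..<k]) = univ A'"
      proof -
        have "set (map (\<lambda>i. y (\<rho> i)) [0..<k]) = \<phi> ` hA ` {..<k}" using \<rho> by (force simp: image_iff)
        then show ?thesis using hA(1) \<phi>(2) by (simp add: bij_betw_def)
      qed
      ultimately show ?thesis using copy AC unfolding \<chi>'_def by metis
    qed
    then show ?thesis using g by blast
  qed
  then show ?thesis using C(1) by blast
qed

theorem ramsey_expansion: "ramsey_property \<K>'"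
  unfolding ramsey_property_def
proof (intro ballI impI allI)
  fix A B and l :: nat assume AB: "A \<in> \<K>'" "B \<in> \<K>'" "embeds A B" and l: "2 \<le> l"
  obtain C where C: "C \<in> \<K>'" "\<And>\<chi>. (\<forall>A' \<in> copies A C. \<chi> A' < l) \<Longrightarrow>
      \<exists>g. embedding g B C \<and> (\<exists>c. \<forall>A' \<in> copies A (induced C (g ` univ B)). \<chi> A' = c)"
    using ordered_ramsey[OF AB(1,2) l] by blast
  have "embeds B C" using C(2)[of "\<lambda>_. 0"] l by (auto simp: embeds_def)
  moreover have "\<exists>B' \<in> copies B C. \<exists>c. \<forall>A' \<in> copies A B'. \<chi> A' = c" if \<chi>: "\<forall>A' \<in> copies A C. \<chi> A' < l" for \<chi>
  proof -
    obtain g c where g: "embedding g B C" "\<forall>A' \<in> copies A (induced C (g ` univ B)). \<chi> A' = c" using C(2)[OF \<chi>] by blast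
    have im: "g ` univ B \<subseteq> univ C" using g(1) by (simp add: embedding_def)
    have "substructure (induced C (g ` univ B)) C" using im by (simp add: substructure_def)
    moreover have "is_iso g B (induced C (g ` univ B))"
      using g(1) by (fastforce simp: is_iso_def embedding_def)
    ultimately have "induced C (g ` univ B) \<in> copies B C" by (auto simp: copies_def isomorphic_def)
    then show ?thesis using g(2) by blast
  qed
  ultimately show "\<exists>C \<in> \<K>'. embeds B C \<and> (\<forall>\<chi>. (\<forall>A' \<in> copies A C. \<chi> A' < l) \<longrightarrow>
      (\<exists>B' \<in> copies B C. \<exists>c. \<forall>A' \<in> copies A B'. \<chi> A' = c))" using C(1) by blast
qed

end

theorem theorem6p14:
  fixes ar :: "'r::finite \<Rightarrow> nat" and \<K> :: "'r struct set" and M :: "'r struct"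
    and lo :: "('r lit \<times> 'r lit) set"
  assumes "fraisse_class ar \<K>"
    and "enumerated_fraisse_limit ar \<K> M"
    and "\<exists>R. ar R \<ge> 2"
    and "\<And>A R xs. A \<in> \<K> \<Longrightarrow> xs \<in> rels A R \<Longrightarrow> distinct xs"
    and "\<And>R. \<exists>xs. xs \<in> rels M R"
    and "\<And>R. \<exists>xs. length xs = ar R \<and> distinct xs \<and> xs \<notin> rels M R"
    and "(\<exists>R. ar R = 1) \<Longrightarrow> 2 \<le> card {R. ar R = 1}"
    and "\<And>A a. (\<exists>R. ar R = 1) \<Longrightarrow> A \<in> \<K> \<Longrightarrow> a \<in> univ A \<Longrightarrow> \<exists>!R. ar R = 1 \<and> [a] \<in> rels A R"
    and "literal_order lo"
    and "\<And>R. ar R \<le> 2"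
    and "SDAP_plus ar lo M"
  shows "ramsey_property (ordered_expansion ar \<K>)"
proof -
  have age: "age ar M = \<K>" and stM: "is_struct ar M" using assms(2) by (auto simp: enumerated_fraisse_limit_def)
  \<comment> \<open>A nullary symbol cannot both hold and fail of some tuple, as the empty tuple is
    its only one.\<close>
  have ar12: "ar R \<in> {1, 2}" for R
  proof -
    obtain xs ys where "xs \<in> rels M R" "length ys = ar R" "ys \<notin> rels M R" using assms(5,6) by metis
    moreover from this have "length xs = ar R" using stM by (auto simp: is_struct_def)
    ultimately have "ar R \<noteq> 0" by (metis length_0_conv)
    then show ?thesis using assms(10)[of R] by auto
  qed
  have sd: "SDAP ar \<K>" and dct: "diagonal_coding_tree_property ar \<K>" and ep: "extension_property ar lo M"
    using assms(11) age by (auto simp: SDAP_plus_def)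
  interpret L: fraisse_sdap ar \<K> M
    using ar12 assms(2,4) sd by unfold_locales (auto simp: SDAP_def)
  obtain W T where T: "W \<in> tree_symbols ar" "perfect T" "diagonal_coding_subtree ar W M T"
    "extension_property_1 ar W M lo T \<or> extension_property_2 ar W M lo T"
    using ep unfolding extension_property_def by blast
  interpret D: diagonal_tree ar \<K> M W lo T
    using T(1-3) assms(9) by unfold_locales (auto simp: diagonal_coding_subtree_def)
  obtain \<psi> where "D.extends_copies \<psi>" using D.extends_copies[OF T(4)] by blast
  then interpret P: copying_tree ar \<K> M W lo T \<psi> by unfold_locales
  interpret S: structured_limit ar \<K> M
  proof unfold_locales
    fix Z a b c assume Z: "finite Z" "a \<in> Z" "b \<in> Z" "c \<in> Z" "distinct [a, b, c]" "unS ar M a = unS ar M b" "unS ar M a = unS ar M c"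
    show "\<exists>(i, j) \<in> {(a, b), (a, c), (b, c)}. \<forall>y \<in> Z - {i, j}. \<forall>y' \<in> Z - {i, j}. unS ar M y = unS ar M y' \<longrightarrow>
        \<not> L.cong (L.q y i) (L.q y j) \<longrightarrow> \<not> L.cong (L.q y' i) (L.q y' j) \<longrightarrow> L.cong (L.q y i) (L.q y' i) \<and> L.cong (L.q y j) (L.q y' j)"
      using P.master[OF Z] unfolding P.one_pattern_def by blast
  next
    \<comment> \<open>Here the Diagonal Coding Tree Property enters for re-enumerations of
      \<open>M\<close>, independently of the tree \<open>T\<close> above.\<close>
    show "\<exists>\<gamma>. \<forall>F. finite F \<and> (\<forall>x \<in> F. unS ar M x = unS ar M x0) \<longrightarrow>
      (\<exists>\<phi> v. L.pe \<phi> F \<and> v \<notin> \<phi> ` F \<and> unS ar M v = unS ar M x0 \<and> (\<forall>x \<in> F. L.q v (\<phi> x) = \<gamma>))" for x0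
      by (rule L.bottom_vertex[OF dct assms(9)])
  qed
  show ?thesis by (rule S.ramsey_expansion)
qed

end
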